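(* Let $G$ be a finitely presented group with torsion-free abelianization. For each $i\ge1$, there is a natural epimorphism of graded $\mathbb{Z}$-Lie algebras $$\Psi_G^{(i)}\colon\mathfrak{H}(G)/\mathfrak{H}(G)^{(i)}\twoheadrightarrow\operatorname{gr}\big(G/G^{(i)}\big)$$ which fits into a commuting square with $\Psi_G\colon\mathfrak{H}(G)\twoheadrightarrow\operatorname{gr}(G)$ and the canonical projections $\mathfrak{H}(G)\twoheadrightarrow\mathfrak{H}(G)/\mathfrak{H}(G)^{(i)}$ and $\operatorname{gr}(G)\twoheadrightarrow\operatorname{gr}(G/G^{(i)})$; that is, the composite $\mathfrak{H}(G)\to\mathfrak{H}(G)/\mathfrak{H}(G)^{(i)}\xrightarrow{\Psi_G^{(i)}}\operatorname{gr}(G/G^{(i)})$ equals the composite $\mathfrak{H}(G)\xrightarrow{\Psi_G}\operatorname{gr}(G)\to\operatorname{gr}(G/G^{(i)})$.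
   Context: For a group $G$: $\Gamma_1G=G$, $\Gamma_{k+1}G=(\Gamma_kG,G)$; $G^{(0)}=G$, $G^{(i+1)}=(G^{(i)},G^{(i)})$; $\operatorname{gr}(G)=\bigoplus_{k\ge1}\Gamma_kG/\Gamma_{k+1}G$, a graded $\mathbb{Z}$-Lie algebra with bracket induced by the commutator. For a Lie algebra $E$, $E^{(0)}=E$, $E^{(i+1)}=[E^{(i)},E^{(i)}]$. "Natural" means functorial with respect to homomorphisms between such groups. Integral holonomy Lie algebra: let $X$ be a $K(G,1)$ with finite $2$-skeleton. $\mathfrak{H}(G)=\mathbf{L}^*(H_1X)/\text{ideal}(\operatorname{im}\overline\partial_X)$, where $\mathbf{L}^*(H_1X)$ is the free $\mathbb{Z}$-Lie algebra on $H_1X$ in degree $1$, and $\overline\partial_X\colon H_2X\to\operatorname{Hom}(H^2X,\mathbb{Z})\to\bigwedge^2H_1X=\mathbf{L}^2(H_1X)$ is the Kronecker surjection followed by the dual of the cup product $\bigwedge^2H^1X\to H^2X$. The map $\Psi_G$: the identification $H_1G=\operatorname{gr}_1(G)$ extends to a surjective map of graded Lie algebras $\mathbf{L}^*(H_1G)\to\operatorname{gr}(G)$; it is known (Markl–Papadima) that this map sends $\operatorname{im}\overline\partial_X$ to zero, so it induces a natural epimorphism $\Psi_G\colon\mathfrak{H}(G)\twoheadrightarrow\operatorname{gr}(G)$. *)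

theory Defs
  imports "HOL-Homology.Homology" "HOL-Algebra.Generated_Groups"
begin

section \<open>Graded Lie algebras over the integers\<close>

text \<open>The underlying abelian group of a Lie algebra is written multiplicatively, so that
  the group theory of HOL-Algebra (subgroups, cosets, \<open>Mod\<close>, \<open>finprod\<close>) applies to it directly;
  \<open>grade L k\<close> is the homogeneous part of degree \<open>k\<close>, which is relevant for \<open>k \<ge> 1\<close> only.\<close>

record 'a graded_lie = "'a monoid" +
  lbracket :: "'a \<Rightarrow> 'a \<Rightarrow> 'a"
  grade :: "nat \<Rightarrow> 'a set"

locale graded_lie_algebra = comm_group L for L :: "('a, 'm) graded_lie_scheme" (structure) +
  assumes lbracket_closed:
      "\<lbrakk>x \<in> carrier L; y \<in> carrier L\<rbrakk> \<Longrightarrow> lbracket L x y \<in> carrier L"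
    and lbracket_add_left:
      "\<lbrakk>x \<in> carrier L; y \<in> carrier L; z \<in> carrier L\<rbrakk>
        \<Longrightarrow> lbracket L (x \<otimes> y) z = lbracket L x z \<otimes> lbracket L y z"
    and lbracket_add_right:
      "\<lbrakk>x \<in> carrier L; y \<in> carrier L; z \<in> carrier L\<rbrakk>
        \<Longrightarrow> lbracket L x (y \<otimes> z) = lbracket L x y \<otimes> lbracket L x z"
    and lbracket_self: "x \<in> carrier L \<Longrightarrow> lbracket L x x = \<one>"
    and jacobi:
      "\<lbrakk>x \<in> carrier L; y \<in> carrier L; z \<in> carrier L\<rbrakk>
        \<Longrightarrow> lbracket L x (lbracket L y z) \<otimes> lbracket L y (lbracket L z x)
              \<otimes> lbracket L z (lbracket L x y) = \<one>"
    and grade_subgroup: "1 \<le> k \<Longrightarrow> subgroup (grade L k) L"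
    and grade_lbracket:
      "\<lbrakk>1 \<le> j; 1 \<le> k; x \<in> grade L j; y \<in> grade L k\<rbrakk> \<Longrightarrow> lbracket L x y \<in> grade L (j + k)"
    and grade_direct_sum:
      "x \<in> carrier L \<Longrightarrow>
        \<exists>!u. u \<in> (\<Pi>\<^sub>E k\<in>{1..}. grade L k) \<and> finite {k \<in> {1..}. u k \<noteq> \<one>}
             \<and> x = finprod L u {k \<in> {1..}. u k \<noteq> \<one>}"

definition graded_lie_hom ::
    "('a, 'm) graded_lie_scheme \<Rightarrow> ('b, 'n) graded_lie_scheme \<Rightarrow> ('a \<Rightarrow> 'b) set" where
  "graded_lie_hom L M = {f \<in> hom L M.
     (\<forall>x\<in>carrier L. \<forall>y\<in>carrier L. f (lbracket L x y) = lbracket M (f x) (f y)) \<and>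
     (\<forall>k\<ge>1. f ` grade L k \<subseteq> grade M k)}"

definition graded_lie_epi ::
    "('a, 'm) graded_lie_scheme \<Rightarrow> ('b, 'n) graded_lie_scheme \<Rightarrow> ('a \<Rightarrow> 'b) \<Rightarrow> bool" where
  "graded_lie_epi L M f \<longleftrightarrow> graded_lie_algebra L \<and> graded_lie_algebra M \<and>
     f \<in> graded_lie_hom L M \<and> f ` carrier L = carrier M"

definition lie_ideal :: "'a set \<Rightarrow> ('a, 'm) graded_lie_scheme \<Rightarrow> bool" where
  "lie_ideal I L \<longleftrightarrow> subgroup I L \<and>
     (\<forall>x\<in>carrier L. \<forall>a\<in>I. lbracket L x a \<in> I \<and> lbracket L a x \<in> I)"

definition lie_ideal_gen :: "('a, 'm) graded_lie_scheme \<Rightarrow> 'a set \<Rightarrow> 'a set" where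
  "lie_ideal_gen L S = \<Inter> {I. lie_ideal I L \<and> S \<subseteq> I}"

text \<open>For a Lie ideal \<open>I\<close>, the set \<open>I + {[a, b] | a \<in> A, b \<in> B}\<close> is a single coset of \<open>I\<close>.\<close>

definition lie_quot :: "('a, 'm) graded_lie_scheme \<Rightarrow> 'a set \<Rightarrow> 'a set graded_lie" where
  "lie_quot L I =
    \<lparr>carrier = carrier (L Mod I), monoid.mult = monoid.mult (L Mod I), one = one (L Mod I),
     lbracket = (\<lambda>A B. I <#>\<^bsub>L\<^esub> {lbracket L a b | a b. a \<in> A \<and> b \<in> B}),
     grade = (\<lambda>k. (\<lambda>x. I #>\<^bsub>L\<^esub> x) ` grade L k)\<rparr>"

primrec lie_derived :: "('a, 'm) graded_lie_scheme \<Rightarrow> nat \<Rightarrow> 'a set" where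
  "lie_derived L 0 = carrier L"
| "lie_derived L (Suc i) =
     generate L {lbracket L x y | x y. x \<in> lie_derived L i \<and> y \<in> lie_derived L i}"

text \<open>The map induced on a set of classes by a map that is constant on every class.\<close>

definition induced_map :: "('a \<Rightarrow> 'b) \<Rightarrow> 'a set \<Rightarrow> 'b" where
  "induced_map f C = the_elem (f ` C)"


section \<open>The free Lie algebra on an abelian group\<close>

datatype (atoms: 'a) lie_term =
  Atom 'a | Zero | Plus "'a lie_term" "'a lie_term" | Minus "'a lie_term"
  | Bracket "'a lie_term" "'a lie_term"

definition lie_terms :: "('a, 'm) monoid_scheme \<Rightarrow> 'a lie_term set" where
  "lie_terms A = {t. atoms t \<subseteq> carrier A}"

text \<open>The congruence generated by the axioms of Lie rings and by the additivity of
  \<open>Atom\<close> (the group \<open>A\<close> is abelian, but written multiplicatively).\<close>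

inductive lie_eq :: "('a, 'm) monoid_scheme \<Rightarrow> 'a lie_term \<Rightarrow> 'a lie_term \<Rightarrow> bool"
  for A where
  refl: "s \<in> lie_terms A \<Longrightarrow> lie_eq A s s"
| sym: "lie_eq A s t \<Longrightarrow> lie_eq A t s"
| trans: "lie_eq A r s \<Longrightarrow> lie_eq A s t \<Longrightarrow> lie_eq A r t"
| Plus_cong: "lie_eq A s s' \<Longrightarrow> lie_eq A t t' \<Longrightarrow> lie_eq A (Plus s t) (Plus s' t')"
| Minus_cong: "lie_eq A s s' \<Longrightarrow> lie_eq A (Minus s) (Minus s')"
| Bracket_cong: "lie_eq A s s' \<Longrightarrow> lie_eq A t t' \<Longrightarrow> lie_eq A (Bracket s t) (Bracket s' t')"
| assoc: "r \<in> lie_terms A \<Longrightarrow> s \<in> lie_terms A \<Longrightarrow> t \<in> lie_terms A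
    \<Longrightarrow> lie_eq A (Plus (Plus r s) t) (Plus r (Plus s t))"
| comm: "s \<in> lie_terms A \<Longrightarrow> t \<in> lie_terms A \<Longrightarrow> lie_eq A (Plus s t) (Plus t s)"
| zero: "s \<in> lie_terms A \<Longrightarrow> lie_eq A (Plus Zero s) s"
| minus: "s \<in> lie_terms A \<Longrightarrow> lie_eq A (Plus (Minus s) s) Zero"
| add_left: "r \<in> lie_terms A \<Longrightarrow> s \<in> lie_terms A \<Longrightarrow> t \<in> lie_terms A
    \<Longrightarrow> lie_eq A (Bracket (Plus r s) t) (Plus (Bracket r t) (Bracket s t))"
| add_right: "r \<in> lie_terms A \<Longrightarrow> s \<in> lie_terms A \<Longrightarrow> t \<in> lie_terms A
    \<Longrightarrow> lie_eq A (Bracket r (Plus s t)) (Plus (Bracket r s) (Bracket r t))"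
| self: "s \<in> lie_terms A \<Longrightarrow> lie_eq A (Bracket s s) Zero"
| jacobi: "r \<in> lie_terms A \<Longrightarrow> s \<in> lie_terms A \<Longrightarrow> t \<in> lie_terms A
    \<Longrightarrow> lie_eq A (Plus (Plus (Bracket r (Bracket s t)) (Bracket s (Bracket t r)))
                      (Bracket t (Bracket r s))) Zero"
| Atom_mult: "x \<in> carrier A \<Longrightarrow> y \<in> carrier A
    \<Longrightarrow> lie_eq A (Atom (x \<otimes>\<^bsub>A\<^esub> y)) (Plus (Atom x) (Atom y))"

inductive homogeneous :: "nat \<Rightarrow> 'a lie_term \<Rightarrow> bool" where
  "homogeneous 1 (Atom x)"
| "homogeneous k Zero"
| "homogeneous k s \<Longrightarrow> homogeneous k t \<Longrightarrow> homogeneous k (Plus s t)"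
| "homogeneous k s \<Longrightarrow> homogeneous k (Minus s)"
| "homogeneous j s \<Longrightarrow> homogeneous k t \<Longrightarrow> homogeneous (j + k) (Bracket s t)"

abbreviation lie_class :: "('a, 'm) monoid_scheme \<Rightarrow> 'a lie_term \<Rightarrow> 'a lie_term set" where
  "lie_class A t \<equiv> Collect (lie_eq A t)"

definition free_lie :: "('a, 'm) monoid_scheme \<Rightarrow> 'a lie_term set graded_lie" where
  "free_lie A =
    \<lparr>carrier = lie_class A ` lie_terms A,
     monoid.mult = (\<lambda>C D. {r. \<exists>s\<in>C. \<exists>t\<in>D. lie_eq A (Plus s t) r}),
     one = lie_class A Zero,
     lbracket = (\<lambda>C D. {r. \<exists>s\<in>C. \<exists>t\<in>D. lie_eq A (Bracket s t) r}),
     grade = (\<lambda>k. lie_class A ` {t \<in> lie_terms A. homogeneous k t})\<rparr>"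

primrec lie_eval :: "('b, 'm) graded_lie_scheme \<Rightarrow> ('a \<Rightarrow> 'b) \<Rightarrow> 'a lie_term \<Rightarrow> 'b" where
  "lie_eval M h (Atom x) = h x"
| "lie_eval M h Zero = \<one>\<^bsub>M\<^esub>"
| "lie_eval M h (Plus s t) = lie_eval M h s \<otimes>\<^bsub>M\<^esub> lie_eval M h t"
| "lie_eval M h (Minus s) = inv\<^bsub>M\<^esub> (lie_eval M h s)"
| "lie_eval M h (Bracket s t) = lbracket M (lie_eval M h s) (lie_eval M h t)"

text \<open>The extension of a homomorphism \<open>h\<close> from \<open>A\<close> into \<open>M\<close> to a Lie algebra homomorphism
  from \<open>free_lie A\<close> into \<open>M\<close>.\<close>

definition lie_extend ::
    "('b, 'm) graded_lie_scheme \<Rightarrow> ('a \<Rightarrow> 'b) \<Rightarrow> 'a lie_term set \<Rightarrow> 'b" where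
  "lie_extend M h = induced_map (lie_eval M h)"

text \<open>For homomorphisms \<open>a, b\<close> from \<open>A\<close> to the integers, \<open>wedge_pairing a b\<close> is the pairing of
  \<open>a \<and> b\<close> with the degree 2 part of the free Lie algebra, which is \<open>\<And>\<^sup>2 A\<close>:
  it sends \<open>[x, y]\<close>, that is \<open>x \<and> y\<close>, to \<open>a x * b y - a y * b x\<close>.\<close>

primrec term_lin :: "('a \<Rightarrow> int) \<Rightarrow> 'a lie_term \<Rightarrow> int" where
  "term_lin a (Atom x) = a x"
| "term_lin a Zero = 0"
| "term_lin a (Plus s t) = term_lin a s + term_lin a t"
| "term_lin a (Minus s) = - term_lin a s"
| "term_lin a (Bracket s t) = 0"

primrec term_wedge :: "('a \<Rightarrow> int) \<Rightarrow> ('a \<Rightarrow> int) \<Rightarrow> 'a lie_term \<Rightarrow> int" where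
  "term_wedge a b (Atom x) = 0"
| "term_wedge a b Zero = 0"
| "term_wedge a b (Plus s t) = term_wedge a b s + term_wedge a b t"
| "term_wedge a b (Minus s) = - term_wedge a b s"
| "term_wedge a b (Bracket s t) = term_lin a s * term_lin b t - term_lin a t * term_lin b s"

definition wedge_pairing :: "('a \<Rightarrow> int) \<Rightarrow> ('a \<Rightarrow> int) \<Rightarrow> 'a lie_term set \<Rightarrow> int" where
  "wedge_pairing a b = induced_map (term_wedge a b)"


section \<open>Lower central series and the associated graded Lie algebra\<close>

abbreviation commutator :: "('a, 'm) monoid_scheme \<Rightarrow> 'a \<Rightarrow> 'a \<Rightarrow> 'a" where
  "commutator G x y \<equiv> x \<otimes>\<^bsub>G\<^esub> y \<otimes>\<^bsub>G\<^esub> inv\<^bsub>G\<^esub> x \<otimes>\<^bsub>G\<^esub> inv\<^bsub>G\<^esub> y"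

text \<open>The series is indexed from 1; the value at 0 is a dummy.\<close>

primrec lower_central :: "('a, 'm) monoid_scheme \<Rightarrow> nat \<Rightarrow> 'a set" where
  "lower_central G 0 = carrier G"
| "lower_central G (Suc k) = (if k = 0 then carrier G
     else generate G {commutator G x y | x y. x \<in> lower_central G k \<and> y \<in> carrier G})"

definition gr_part :: "('a, 'm) monoid_scheme \<Rightarrow> nat \<Rightarrow> 'a set monoid" where
  "gr_part G k = G\<lparr>carrier := lower_central G k\<rparr> Mod lower_central G (Suc k)"

text \<open>For cosets \<open>A\<close>, \<open>B\<close> in degrees \<open>i\<close>, \<open>j\<close> this set is a single coset in degree \<open>i + j\<close>.\<close>

definition gr_commutator ::
    "('a, 'm) monoid_scheme \<Rightarrow> nat \<Rightarrow> nat \<Rightarrow> 'a set \<Rightarrow> 'a set \<Rightarrow> 'a set" where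
  "gr_commutator G i j A B =
     lower_central G (Suc (i + j)) <#>\<^bsub>G\<^esub> {commutator G a b | a b. a \<in> A \<and> b \<in> B}"

definition gr :: "('a, 'm) monoid_scheme \<Rightarrow> (nat \<Rightarrow> 'a set) graded_lie" where
  "gr G = (let S = sum_group {1..} (gr_part G) in
    \<lparr>carrier = carrier S, monoid.mult = monoid.mult S, one = one S,
     lbracket = (\<lambda>u v. \<lambda>k\<in>{1..}.
       finprod (gr_part G k) (\<lambda>i. gr_commutator G i (k - i) (u i) (v (k - i))) {1..<k}),
     grade = (\<lambda>k. {u \<in> carrier S. \<forall>j\<in>{1..}. j \<noteq> k \<longrightarrow> u j = \<one>\<^bsub>gr_part G j\<^esub>})\<rparr>)"

text \<open>The map from \<open>gr G\<close> to \<open>gr H\<close> induced by a homomorphism \<open>f\<close> from \<open>G\<close> to \<open>H\<close>.\<close>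

definition gr_map ::
    "('b, 'm) monoid_scheme \<Rightarrow> ('a \<Rightarrow> 'b) \<Rightarrow> (nat \<Rightarrow> 'a set) \<Rightarrow> nat \<Rightarrow> 'b set" where
  "gr_map H f u = (\<lambda>k\<in>{1..}. lower_central H (Suc k) <#>\<^bsub>H\<^esub> f ` u k)"

text \<open>The inclusion of the abelianization, as the degree 1 part of \<open>gr G\<close>.\<close>

definition gr_one :: "('a, 'm) monoid_scheme \<Rightarrow> 'a set \<Rightarrow> nat \<Rightarrow> 'a set" where
  "gr_one G C = (\<lambda>k\<in>{1..}. if k = 1 then C else \<one>\<^bsub>gr_part G k\<^esub>)"

definition derived_series :: "('a, 'm) monoid_scheme \<Rightarrow> nat \<Rightarrow> 'a set" where
  "derived_series G i = (derived G ^^ i) (carrier G)"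

text \<open>The map from \<open>G Mod derived_series G i\<close> to \<open>H Mod derived_series H i\<close> induced by \<open>f\<close>.\<close>

definition solv_quot_map ::
    "('b, 'm) monoid_scheme \<Rightarrow> nat \<Rightarrow> ('a \<Rightarrow> 'b) \<Rightarrow> 'a set \<Rightarrow> 'b set" where
  "solv_quot_map H i f = induced_map (\<lambda>g. derived_series H i #>\<^bsub>H\<^esub> f g)"


section \<open>Finitely presented groups with torsion-free abelianization\<close>

text \<open>Words in the letters \<open>x\<^sub>k\<close> = \<open>(k, True)\<close> and their inverses \<open>(k, False)\<close>, for \<open>k < n\<close>.\<close>

definition words :: "nat \<Rightarrow> (nat \<times> bool) list set" where
  "words n = lists ({..<n} \<times> UNIV)"

inductive word_eq ::
    "nat \<Rightarrow> (nat \<times> bool) list set \<Rightarrow> (nat \<times> bool) list \<Rightarrow> (nat \<times> bool) list \<Rightarrow> bool"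
  for n R where
  refl: "u \<in> words n \<Longrightarrow> word_eq n R u u"
| sym: "word_eq n R u v \<Longrightarrow> word_eq n R v u"
| trans: "word_eq n R u v \<Longrightarrow> word_eq n R v w \<Longrightarrow> word_eq n R u w"
| cancel: "u \<in> words n \<Longrightarrow> v \<in> words n \<Longrightarrow> k < n
    \<Longrightarrow> word_eq n R (u @ [(k, e), (k, \<not> e)] @ v) (u @ v)"
| relator: "u \<in> words n \<Longrightarrow> v \<in> words n \<Longrightarrow> r \<in> R \<Longrightarrow> word_eq n R (u @ r @ v) (u @ v)"

definition presented_group ::
    "nat \<Rightarrow> (nat \<times> bool) list set \<Rightarrow> (nat \<times> bool) list set monoid" where
  "presented_group n R =
    \<lparr>carrier = (\<lambda>u. Collect (word_eq n R u)) ` words n,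
     monoid.mult = (\<lambda>C D. {w. \<exists>u\<in>C. \<exists>v\<in>D. word_eq n R (u @ v) w}),
     one = Collect (word_eq n R [])\<rparr>"

definition finitely_presented :: "('a, 'm) monoid_scheme \<Rightarrow> bool" where
  "finitely_presented G \<longleftrightarrow> group G \<and>
     (\<exists>n R. finite R \<and> R \<subseteq> words n \<and> G \<cong> presented_group n R)"

definition torsion_free :: "('a, 'm) monoid_scheme \<Rightarrow> bool" where
  "torsion_free A \<longleftrightarrow> (\<forall>x\<in>carrier A. \<forall>n::nat. 0 < n \<and> x [^]\<^bsub>A\<^esub> n = \<one>\<^bsub>A\<^esub> \<longrightarrow> x = \<one>\<^bsub>A\<^esub>)"

abbreviation abelianization :: "('a, 'm) monoid_scheme \<Rightarrow> 'a set monoid" where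
  "abelianization G \<equiv> G Mod derived G (carrier G)"


section \<open>The fundamental group\<close>

definition loops :: "'x topology \<Rightarrow> 'x \<Rightarrow> (real \<Rightarrow> 'x) set" where
  "loops X x0 = {p. pathin X p \<and> p 0 = x0 \<and> p 1 = x0}"

definition loop_class :: "'x topology \<Rightarrow> 'x \<Rightarrow> (real \<Rightarrow> 'x) \<Rightarrow> (real \<Rightarrow> 'x) set" where
  "loop_class X x0 p = {q \<in> loops X x0.
     homotopic_with (\<lambda>r. r 0 = x0 \<and> r 1 = x0) (top_of_set {0..1}) X p q}"

definition concat_loops :: "(real \<Rightarrow> 'x) \<Rightarrow> (real \<Rightarrow> 'x) \<Rightarrow> real \<Rightarrow> 'x" where
  "concat_loops p q = (\<lambda>t. if t \<le> 1/2 then p (2 * t) else q (2 * t - 1))"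

definition fundamental_group :: "'x topology \<Rightarrow> 'x \<Rightarrow> (real \<Rightarrow> 'x) set monoid" where
  "fundamental_group X x0 =
    \<lparr>carrier = loop_class X x0 ` loops X x0,
     monoid.mult = (\<lambda>C D. \<Union>p\<in>C. \<Union>q\<in>D. loop_class X x0 (concat_loops p q)),
     one = loop_class X x0 (\<lambda>_. x0)\<rparr>"


section \<open>Eilenberg-MacLane complexes of type K(G,1)\<close>

abbreviation disk :: "nat \<Rightarrow> (nat \<Rightarrow> real) set" where
  "disk n \<equiv> {x \<in> topspace (Euclidean_space n). (\<Sum>i<n. x i ^ 2) \<le> 1}"

abbreviation open_disk :: "nat \<Rightarrow> (nat \<Rightarrow> real) set" where
  "open_disk n \<equiv> {x \<in> topspace (Euclidean_space n). (\<Sum>i<n. x i ^ 2) < 1}"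

text \<open>\<open>C n\<close> is the set of the characteristic maps of the cells of dimension \<open>n\<close>.  The conditions
  are those of the usual intrinsic description of CW complexes: the open cells partition \<open>X\<close>,
  each boundary lies in finitely many cells of lower dimension, and \<open>X\<close> carries the weak topology.\<close>

definition CW_structure :: "'x topology \<Rightarrow> (nat \<Rightarrow> ((nat \<Rightarrow> real) \<Rightarrow> 'x) set) \<Rightarrow> bool" where
  "CW_structure X C \<longleftrightarrow> Hausdorff_space X \<and>
     (\<forall>n. \<forall>\<Phi>\<in>C n.
        continuous_map (subtopology (Euclidean_space n) (disk n)) X \<Phi> \<and>
        embedding_map (subtopology (Euclidean_space n) (open_disk n)) X \<Phi>) \<and>
     (\<forall>x\<in>topspace X. \<exists>!(n, \<Phi>). \<Phi> \<in> C n \<and> x \<in> \<Phi> ` open_disk n) \<and>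
     (\<forall>n. \<forall>\<Phi>\<in>C n. \<exists>F. finite F \<and> F \<subseteq> (SIGMA m:{..<n}. C m) \<and>
        \<Phi> ` (disk n - open_disk n) \<subseteq> (\<Union>(m, \<Psi>)\<in>F. \<Psi> ` open_disk m)) \<and>
     (\<forall>S. S \<subseteq> topspace X \<and> (\<forall>n. \<forall>\<Phi>\<in>C n. closedin X (S \<inter> \<Phi> ` disk n)) \<longrightarrow> closedin X S)"

definition CW_finite_2_skeleton :: "'x topology \<Rightarrow> bool" where
  "CW_finite_2_skeleton X \<longleftrightarrow> (\<exists>C. CW_structure X C \<and> (\<forall>n\<le>2. finite (C n)))"

text \<open>\<open>X\<close> is a \<open>K(G,1)\<close> with finite 2-skeleton, and \<open>\<theta>\<close> is the identification of its fundamental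
  group with \<open>G\<close>.  On a path connected space, the \<open>n\<close>-th homotopy group is trivial if and
  only if every map from the \<open>n\<close>-sphere is freely homotopic to a constant.\<close>

definition K_G_1 ::
    "'g monoid \<Rightarrow> 'x topology \<Rightarrow> 'x \<Rightarrow> ((real \<Rightarrow> 'x) set \<Rightarrow> 'g) \<Rightarrow> bool" where
  "K_G_1 G X x0 \<theta> \<longleftrightarrow> CW_finite_2_skeleton X \<and> path_connected_space X \<and> x0 \<in> topspace X \<and>
     \<theta> \<in> iso (fundamental_group X x0) G \<and>
     (\<forall>n\<ge>2. \<forall>f. continuous_map (nsphere n) X f \<longrightarrow>
        (\<exists>c. homotopic_with (\<lambda>_. True) (nsphere n) X f (\<lambda>_. c)))"


section \<open>Singular cohomology and the cup product\<close>

definition cochain_group :: "nat \<Rightarrow> 'x topology \<Rightarrow> ('x chain \<Rightarrow> int) monoid" where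
  "cochain_group p X =
    \<lparr>carrier = hom (chain_group p X) integer_group \<inter> extensional (carrier (chain_group p X)),
     monoid.mult = (\<lambda>\<phi> \<psi>. \<lambda>c\<in>carrier (chain_group p X). \<phi> c + \<psi> c),
     one = (\<lambda>c\<in>carrier (chain_group p X). 0)\<rparr>"

definition coboundary :: "nat \<Rightarrow> 'x topology \<Rightarrow> ('x chain \<Rightarrow> int) \<Rightarrow> 'x chain \<Rightarrow> int" where
  "coboundary p X \<phi> = (\<lambda>c\<in>carrier (chain_group (Suc p) X). \<phi> (chain_boundary (Suc p) c))"

definition cocycles :: "nat \<Rightarrow> 'x topology \<Rightarrow> ('x chain \<Rightarrow> int) set" where
  "cocycles p X = {\<phi> \<in> carrier (cochain_group p X).
     coboundary p X \<phi> = \<one>\<^bsub>cochain_group (Suc p) X\<^esub>}"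

definition coboundaries :: "nat \<Rightarrow> 'x topology \<Rightarrow> ('x chain \<Rightarrow> int) set" where
  "coboundaries p X = (case p of 0 \<Rightarrow> {\<one>\<^bsub>cochain_group 0 X\<^esub>}
     | Suc q \<Rightarrow> coboundary q X ` carrier (cochain_group q X))"

definition cohomology_group :: "nat \<Rightarrow> 'x topology \<Rightarrow> ('x chain \<Rightarrow> int) set monoid" where
  "cohomology_group p X = (cochain_group p X)\<lparr>carrier := cocycles p X\<rparr> Mod coboundaries p X"

text \<open>Points of the standard simplex are sequences that vanish from some index on, so the front
  \<open>p\<close>-face is a restriction and the back \<open>q\<close>-face is a shift by \<open>p\<close>.\<close>

definition front_face :: "nat \<Rightarrow> ((nat \<Rightarrow> real) \<Rightarrow> 'x) \<Rightarrow> (nat \<Rightarrow> real) \<Rightarrow> 'x" where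
  "front_face p \<sigma> = restrict \<sigma> (standard_simplex p)"

definition back_face :: "nat \<Rightarrow> nat \<Rightarrow> ((nat \<Rightarrow> real) \<Rightarrow> 'x) \<Rightarrow> (nat \<Rightarrow> real) \<Rightarrow> 'x" where
  "back_face p q \<sigma> = restrict (\<lambda>x. \<sigma> (\<lambda>i. if i < p then 0 else x (i - p))) (standard_simplex q)"

definition cochain_cup :: "nat \<Rightarrow> nat \<Rightarrow> 'x topology
    \<Rightarrow> ('x chain \<Rightarrow> int) \<Rightarrow> ('x chain \<Rightarrow> int) \<Rightarrow> 'x chain \<Rightarrow> int" where
  "cochain_cup p q X \<phi> \<psi> = (\<lambda>c\<in>carrier (chain_group (p + q) X).
     \<Sum>\<sigma>\<in>Poly_Mapping.keys c. Poly_Mapping.lookup c \<sigma> *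
        (\<phi> (frag_of (front_face p \<sigma>)) * \<psi> (frag_of (back_face p q \<sigma>))))"

definition cup :: "nat \<Rightarrow> nat \<Rightarrow> 'x topology
    \<Rightarrow> ('x chain \<Rightarrow> int) set \<Rightarrow> ('x chain \<Rightarrow> int) set \<Rightarrow> ('x chain \<Rightarrow> int) set" where
  "cup p q X \<alpha> \<beta> = coboundaries (p + q) X <#>\<^bsub>cochain_group (p + q) X\<^esub>
     {cochain_cup p q X \<phi> \<psi> | \<phi> \<psi>. \<phi> \<in> \<alpha> \<and> \<psi> \<in> \<beta>}"

text \<open>Evaluation of a cohomology class on a homology class.\<close>

definition kronecker :: "'x chain set \<Rightarrow> ('x chain \<Rightarrow> int) set \<Rightarrow> int" where
  "kronecker z \<alpha> = the_elem {\<phi> c | \<phi> c. \<phi> \<in> \<alpha> \<and> c \<in> z}"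


section \<open>The holonomy Lie algebra\<close>

text \<open>The value at \<open>z\<close> of the Kronecker map followed by the dual of the cup product.  Since
  \<open>H\<^sub>1 X\<close> is free abelian of finite rank, a homomorphism from \<open>\<And>\<^sup>2 H\<^sup>1 X\<close> to the integers, here
  \<open>a \<and> b \<mapsto> \<langle>a \<union> b, z\<rangle>\<close>, is given by pairing with a unique element of \<open>\<And>\<^sup>2 H\<^sub>1 X\<close>,
  the degree 2 part of the free Lie algebra.\<close>

definition dual_cup :: "'x topology \<Rightarrow> 'x chain set \<Rightarrow> 'x chain set lie_term set" where
  "dual_cup X z = (THE w. w \<in> grade (free_lie (homology_group 1 X)) 2 \<and>
     (\<forall>a\<in>carrier (cohomology_group 1 X). \<forall>b\<in>carrier (cohomology_group 1 X).
        wedge_pairing (\<lambda>x. kronecker x a) (\<lambda>x. kronecker x b) w = kronecker z (cup 1 1 X a b)))"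

definition holonomy_ideal :: "'x topology \<Rightarrow> 'x chain set lie_term set set" where
  "holonomy_ideal X = lie_ideal_gen (free_lie (homology_group 1 X))
     (dual_cup X ` carrier (homology_group 2 X))"

definition holonomy :: "'x topology \<Rightarrow> 'x chain set lie_term set set graded_lie" where
  "holonomy X = lie_quot (free_lie (homology_group 1 X)) (holonomy_ideal X)"

abbreviation holonomy_solv ::
    "'x topology \<Rightarrow> nat \<Rightarrow> 'x chain set lie_term set set set graded_lie" where
  "holonomy_solv X i \<equiv> lie_quot (holonomy X) (lie_derived (holonomy X) i)"


section \<open>The epimorphism \<open>\<Psi>\<close> and the functoriality of the holonomy Lie algebra\<close>

definition loop_simplex :: "(real \<Rightarrow> 'x) \<Rightarrow> (nat \<Rightarrow> real) \<Rightarrow> 'x" where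
  "loop_simplex p = restrict (\<lambda>x. p (x 1)) (standard_simplex 1)"

text \<open>The identification of \<open>H\<^sub>1 X\<close> with the abelianization of \<open>G\<close>: by the Hurewicz theorem, every
  class is represented by a loop \<open>p\<close>, and is sent to the class of the element \<open>\<theta> [p]\<close>.\<close>

definition H1_to_ab :: "'g monoid \<Rightarrow> 'x topology \<Rightarrow> 'x \<Rightarrow> ((real \<Rightarrow> 'x) set \<Rightarrow> 'g)
    \<Rightarrow> 'x chain set \<Rightarrow> 'g set" where
  "H1_to_ab G X x0 \<theta> z = (THE C. \<exists>p\<in>loops X x0.
     z = homologous_rel_set 1 X {} (frag_of (loop_simplex p)) \<and>
     C = lower_central G 2 #>\<^bsub>G\<^esub> \<theta> (loop_class X x0 p))"

definition Psi :: "'g monoid \<Rightarrow> 'x topology \<Rightarrow> 'x \<Rightarrow> ((real \<Rightarrow> 'x) set \<Rightarrow> 'g)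
    \<Rightarrow> 'x chain set lie_term set set \<Rightarrow> nat \<Rightarrow> 'g set" where
  "Psi G X x0 \<theta> =
     induced_map (lie_extend (gr G) (\<lambda>z. gr_one G (H1_to_ab G X x0 \<theta> z)))"

text \<open>The map from \<open>H\<^sub>1 X\<close> to \<open>H\<^sub>1 Y\<close> given by a homomorphism \<open>f\<close> from \<open>G\<close> to \<open>H\<close>,
  where \<open>X\<close> is a \<open>K(G,1)\<close> and \<open>Y\<close> is a \<open>K(H,1)\<close>.\<close>

definition H1_map :: "'g monoid \<Rightarrow> 'x topology \<Rightarrow> 'x \<Rightarrow> ((real \<Rightarrow> 'x) set \<Rightarrow> 'g)
    \<Rightarrow> 'h monoid \<Rightarrow> 'y topology \<Rightarrow> 'y \<Rightarrow> ((real \<Rightarrow> 'y) set \<Rightarrow> 'h)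
    \<Rightarrow> ('g \<Rightarrow> 'h) \<Rightarrow> 'x chain set \<Rightarrow> 'y chain set" where
  "H1_map G X x0 \<theta> H Y y0 \<eta> f z =
     inv_into (carrier (homology_group 1 Y)) (H1_to_ab H Y y0 \<eta>)
       (lower_central H 2 <#>\<^bsub>H\<^esub> f ` H1_to_ab G X x0 \<theta> z)"

definition holonomy_map :: "'g monoid \<Rightarrow> 'x topology \<Rightarrow> 'x \<Rightarrow> ((real \<Rightarrow> 'x) set \<Rightarrow> 'g)
    \<Rightarrow> 'h monoid \<Rightarrow> 'y topology \<Rightarrow> 'y \<Rightarrow> ((real \<Rightarrow> 'y) set \<Rightarrow> 'h)
    \<Rightarrow> ('g \<Rightarrow> 'h) \<Rightarrow> 'x chain set lie_term set set \<Rightarrow> 'y chain set lie_term set set" where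
  "holonomy_map G X x0 \<theta> H Y y0 \<eta> f =
     induced_map (\<lambda>w. holonomy_ideal Y #>\<^bsub>free_lie (homology_group 1 Y)\<^esub>
       lie_extend (free_lie (homology_group 1 Y))
         (\<lambda>z. lie_class (homology_group 1 Y) (Atom (H1_map G X x0 \<theta> H Y y0 \<eta> f z))) w)"

definition holonomy_solv_map :: "'g monoid \<Rightarrow> 'x topology \<Rightarrow> 'x \<Rightarrow> ((real \<Rightarrow> 'x) set \<Rightarrow> 'g)
    \<Rightarrow> 'h monoid \<Rightarrow> 'y topology \<Rightarrow> 'y \<Rightarrow> ((real \<Rightarrow> 'y) set \<Rightarrow> 'h) \<Rightarrow> nat
    \<Rightarrow> ('g \<Rightarrow> 'h) \<Rightarrow> 'x chain set lie_term set set set \<Rightarrow> 'y chain set lie_term set set set" where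
  "holonomy_solv_map G X x0 \<theta> H Y y0 \<eta> i f =
     induced_map (\<lambda>u. lie_derived (holonomy Y) i #>\<^bsub>holonomy Y\<^esub>
       holonomy_map G X x0 \<theta> H Y y0 \<eta> f u)"

text \<open>\<open>\<psi>\<close> is an epimorphism of graded Lie algebras that fits into a commuting square with \<open>Psi\<close>
  and the canonical projections.  These conditions determine \<open>\<psi>\<close> on its domain.\<close>

definition solv_Psi :: "'g monoid \<Rightarrow> 'x topology \<Rightarrow> 'x \<Rightarrow> ((real \<Rightarrow> 'x) set \<Rightarrow> 'g) \<Rightarrow> nat
    \<Rightarrow> ('x chain set lie_term set set set \<Rightarrow> nat \<Rightarrow> 'g set set) \<Rightarrow> bool" where
  "solv_Psi G X x0 \<theta> i \<psi> \<longleftrightarrow>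
     graded_lie_epi (holonomy_solv X i) (gr (G Mod derived_series G i)) \<psi> \<and>
     (\<forall>u\<in>carrier (holonomy X).
        \<psi> (lie_derived (holonomy X) i #>\<^bsub>holonomy X\<^esub> u) =
        gr_map (G Mod derived_series G i) (\<lambda>g. derived_series G i #>\<^bsub>G\<^esub> g) (Psi G X x0 \<theta> u))"

end

theory Submission
  imports Defs
begin

text \<open>The epimorphism \<open>\<Psi>\<close> followed by \<open>gr G \<rightarrow> gr (G / G\<^sup>(\<^sup>i\<^sup>))\<close> kills the \<open>i\<close>-th derived ideal, because the
  components of an element of \<open>gr(K)\<^sup>(\<^sup>i\<^sup>)\<close> are represented in \<open>K\<^sup>(\<^sup>i\<^sup>)\<close>; this gives \<open>\<psi>\<close>.

  Both the existence of \<open>\<Psi>\<close> and the functoriality of the holonomy Lie algebra follow from the identity: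
  the image of the dual of the cup product is the kernel of \<open>\<And>\<^sup>2 H\<^sub>1 \<rightarrow> \<Gamma>\<^sub>2 / \<Gamma>\<^sub>3\<close>.  It holds for every path
  connected space whose fundamental group \<open>G\<close> is finitely generated with torsion-free abelianization.
  Choose \<open>g\<^sub>1, ..., g\<^sub>n\<close> in \<open>G\<close> over a basis of \<open>H\<^sub>1\<close>, with dual basis \<open>\<alpha>\<^sub>1, ..., \<alpha>\<^sub>n\<close>.
  Modulo \<open>\<Gamma>\<^sub>3\<close>, every \<open>x\<close> is \<open>g\<^sub>1\<close> to the \<open>\<alpha>\<^sub>1(x)\<close> times \<open>...\<close> times \<open>g\<^sub>n\<close> to the \<open>\<alpha>\<^sub>n(x)\<close> times a
  central remainder \<open>\<beta>(x)\<close>, and collection shows that \<open>\<beta>(xy) - \<beta>(x) - \<beta>(y)\<close> is the sum over \<open>j < i\<close> of the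
  \<open>\<alpha>\<^sub>i(x) \<alpha>\<^sub>j(y) [g\<^sub>i, g\<^sub>j]\<close>.  So the cup products, paired with the commutators, form a coboundary with
  values in \<open>\<Gamma>\<^sub>2 / \<Gamma>\<^sub>3\<close>, which vanishes on cycles.  Conversely, a product of commutators is bounded by an
  explicit 2-chain, on which the cup products are read off the commutators; if the product lies in \<open>\<Gamma>\<^sub>3\<close>,
  it is also bounded by a chain on which all cup products vanish, and the difference of the two chains is
  the required cycle.\<close>

text \<open>The obstacle is that \<open>\<Gamma>\<^sub>2 / \<Gamma>\<^sub>3\<close> may have
  torsion, so integer valued cochains cannot decide which products of commutators vanish in it. The
  remainder \<open>\<beta>\<close> is therefore a cochain with coefficients in that group itself,
  and the integral cup products enter as exponents. Ordering the generators leaves exactly the pairs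
  \<open>j < i\<close>, which also index a basis of the degree 2 part of the free Lie algebra; so
  the exponents found by collection are at once the coordinates of the dual of the cup product.
  Knowing the image of this dual as a full kernel, not merely as a part of it, describes the
  holonomy ideal by \<open>G\<close> alone: it is generated by the degree 2 elements that vanish in
  \<open>gr G\<close>. Naturality is then formal, since a homomorphism induces compatible maps on
  \<open>H\<^sub>1\<close> and on \<open>gr\<close> and so preserves these generators. Geometry
  enters chiefly through one fact: the edges of a singular triangle, closed up by chosen paths,
  multiply in \<open>G\<close>. A separate burden is the grading: the free Lie algebra is given by
  terms, and that it is the direct sum of its degrees, as are its quotients, has to be
  proved.\<close>

declare One_nat_def [simp del]

section \<open>Homomorphisms on generated subgroups\<close>

lemma hom_generate_closed:
  assumes "group L" "group M" "f \<in> hom L M" "S \<subseteq> carrier L" "subgroup J M"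
    and "\<And>s. s \<in> S \<Longrightarrow> f s \<in> J" and "x \<in> generate L S"
  shows "f x \<in> J"
proof -
  interpret group_hom L M f
    using assms by (simp add: group_hom_def group_hom_axioms_def)
  interpret J: subgroup J M by fact
  show ?thesis
    using assms(7)
  proof (induction rule: generate.induct)
    case (inv h)
    then show ?case using assms(4,6) by (auto simp: subset_iff)
  next
    case (eng h1 h2)
    then show ?case using G.generate_in_carrier[OF assms(4)] by simp
  qed (use assms in auto)
qed

lemma hom_generate_eq:
  assumes "group L" "group M" "f \<in> hom L M" "g \<in> hom L M" "S \<subseteq> carrier L"
    and "\<And>s. s \<in> S \<Longrightarrow> f s = g s" and "x \<in> generate L S"
  shows "f x = g x"
proof -
  interpret f: group_hom L M f
    using assms by (simp add: group_hom_def group_hom_axioms_def)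
  interpret g: group_hom L M g
    using assms by (simp add: group_hom_def group_hom_axioms_def)
  show ?thesis
    using assms(7)
  proof (induction rule: generate.induct)
    case (inv h)
    then show ?case using assms(5,6) by (auto simp: subset_iff)
  next
    case (eng h1 h2)
    then show ?case using f.G.generate_in_carrier[OF assms(5)] by simp
  qed (use assms in auto)
qed

lemma (in comm_group) hom_finprod:
  assumes "comm_group M" "f \<in> hom G M" "u \<in> F \<rightarrow> carrier G"
  shows "f (finprod G u F) = finprod M (\<lambda>i. f (u i)) F"
proof -
  interpret M: comm_group M by fact
  interpret group_hom G M f
    using assms M.group_axioms by (simp add: group_hom_def group_hom_axioms_def is_group)
  show ?thesis
    using assms(3)
    by (induction F rule: infinite_finite_induct) (auto simp: Pi_iff)
qed

lemma (in comm_group) hom_pointwise_mult: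
  assumes "group K" "f \<in> hom K G" "g \<in> hom K G"
  shows "(\<lambda>x. f x \<otimes> g x) \<in> hom K G"
  using assms by (auto simp: hom_def Pi_iff m_ac)

lemma hom_comp: "\<lbrakk>f \<in> hom G H; g \<in> hom H K\<rbrakk> \<Longrightarrow> (\<lambda>x. g (f x)) \<in> hom G K"
  by (auto simp: hom_def Pi_iff)

section \<open>Lie rings\<close>

text \<open>The axioms apart from the grading. The free Lie algebra and the quotients are Lie rings
  by construction, whereas the directness of their gradings is proved afterwards, with this
  structure already in use.\<close>

locale lie_ring = comm_group L for L :: "('a, 'm) graded_lie_scheme" (structure) +
  assumes lb_closed [simp, intro]:
      "\<lbrakk>x \<in> carrier L; y \<in> carrier L\<rbrakk> \<Longrightarrow> lbracket L x y \<in> carrier L"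
    and lb_add_left:
      "\<lbrakk>x \<in> carrier L; y \<in> carrier L; z \<in> carrier L\<rbrakk>
        \<Longrightarrow> lbracket L (x \<otimes> y) z = lbracket L x z \<otimes> lbracket L y z"
    and lb_add_right:
      "\<lbrakk>x \<in> carrier L; y \<in> carrier L; z \<in> carrier L\<rbrakk>
        \<Longrightarrow> lbracket L x (y \<otimes> z) = lbracket L x y \<otimes> lbracket L x z"
    and lb_self [simp]: "x \<in> carrier L \<Longrightarrow> lbracket L x x = \<one>"
    and lb_jacobi:
      "\<lbrakk>x \<in> carrier L; y \<in> carrier L; z \<in> carrier L\<rbrakk>
        \<Longrightarrow> lbracket L x (lbracket L y z) \<otimes> lbracket L y (lbracket L z x)
              \<otimes> lbracket L z (lbracket L x y) = \<one>"
begin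

lemma lb_hom_left: "y \<in> carrier L \<Longrightarrow> (\<lambda>x. lbracket L x y) \<in> hom L L"
  by (auto simp: hom_def lb_add_left)

lemma lb_hom_right: "x \<in> carrier L \<Longrightarrow> lbracket L x \<in> hom L L"
  by (auto simp: hom_def lb_add_right)

lemma lb_one_left [simp]: "y \<in> carrier L \<Longrightarrow> lbracket L \<one> y = \<one>"
  using hom_one[OF lb_hom_left is_group is_group] by simp

lemma lb_one_right [simp]: "x \<in> carrier L \<Longrightarrow> lbracket L x \<one> = \<one>"
  using hom_one[OF lb_hom_right is_group is_group] by simp

text \<open>Polarization of \<open>[x, x] = 0\<close> at the product of \<open>x\<close> and
  \<open>y\<close>.\<close>

lemma lb_antisym:
  assumes "x \<in> carrier L" "y \<in> carrier L"
  shows "lbracket L x y \<otimes> lbracket L y x = \<one>"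
  using assms lb_self[of "x \<otimes> y"] lb_self[of x] lb_self[of y]
  by (simp add: lb_add_left lb_add_right m_comm[of "lbracket L y x"] del: lb_self)

lemma lb_swap:
  assumes "x \<in> carrier L" "y \<in> carrier L"
  shows "lbracket L x y = inv (lbracket L y x)"
  using assms lb_antisym[OF assms] by (intro inv_equality[symmetric]) auto

end

lemma (in graded_lie_algebra) lie_ring: "lie_ring L"
  by unfold_locales (use lbracket_closed lbracket_add_left lbracket_add_right lbracket_self jacobi in auto)

sublocale graded_lie_algebra \<subseteq> lie_ring
  by (rule lie_ring)

text \<open>All the axioms are multilinear, apart from \<open>[x, x] = 0\<close>, which is so modulo antisymmetry.\<close>

lemma lie_ringI_generate:
  fixes G :: "('a, 'm) graded_lie_scheme" (structure)
  assumes "comm_group G"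
    and closed: "\<And>x y. \<lbrakk>x \<in> carrier G; y \<in> carrier G\<rbrakk> \<Longrightarrow> lbracket G x y \<in> carrier G"
    and left: "\<And>x y z. \<lbrakk>x \<in> carrier G; y \<in> carrier G; z \<in> carrier G\<rbrakk>
        \<Longrightarrow> lbracket G (x \<otimes> y) z = lbracket G x z \<otimes> lbracket G y z"
    and right: "\<And>x y z. \<lbrakk>x \<in> carrier G; y \<in> carrier G; z \<in> carrier G\<rbrakk>
        \<Longrightarrow> lbracket G x (y \<otimes> z) = lbracket G x y \<otimes> lbracket G x z"
    and S: "S \<subseteq> carrier G" "carrier G \<subseteq> generate G S"
    and self: "\<And>x. x \<in> S \<Longrightarrow> lbracket G x x = \<one>"
    and anti: "\<And>x y. \<lbrakk>x \<in> S; y \<in> S\<rbrakk> \<Longrightarrow> lbracket G x y \<otimes> lbracket G y x = \<one>"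
    and jac: "\<And>x y z. \<lbrakk>x \<in> S; y \<in> S; z \<in> S\<rbrakk>
        \<Longrightarrow> lbracket G x (lbracket G y z) \<otimes> lbracket G y (lbracket G z x)
              \<otimes> lbracket G z (lbracket G x y) = \<one>"
  shows "lie_ring G"
proof -
  interpret comm_group G by fact
  have hl: "(\<lambda>x. lbracket G x y) \<in> hom G G" if "y \<in> carrier G" for y
    using that closed left by (auto simp: hom_def)
  have hr: "lbracket G x \<in> hom G G" if "x \<in> carrier G" for x
    using that closed right by (auto simp: hom_def)
  have const: "(\<lambda>x. \<one>) \<in> hom G G" by (auto simp: hom_def)
  have ext: "f x = \<one>" if "f \<in> hom G G" "\<And>s. s \<in> S \<Longrightarrow> f s = \<one>" "x \<in> carrier G" for f x
    using hom_generate_eq[OF is_group is_group that(1) const S(1)] that S(2) by blast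
  have anti1: "lbracket G x y \<otimes> lbracket G y x = \<one>" if "x \<in> S" "y \<in> carrier G" for x y
    by (rule ext[of "\<lambda>y. lbracket G x y \<otimes> lbracket G y x"])
       (use that anti S in \<open>auto intro!: hom_pointwise_mult is_group hl hr simp: subset_iff\<close>)
  have anti2: "lbracket G x y \<otimes> lbracket G y x = \<one>" if "x \<in> carrier G" "y \<in> carrier G" for x y
    by (rule ext[of "\<lambda>x. lbracket G x y \<otimes> lbracket G y x"])
       (use that anti1 S in \<open>auto intro!: hom_pointwise_mult is_group hl hr simp: subset_iff\<close>)
  have self': "lbracket G x x = \<one>" if "x \<in> carrier G" for x
  proof -
    have "x \<in> generate G S" using that S by auto
    then show ?thesis
    proof (induction rule: generate.induct)
      case one
      then show ?case using hom_one[OF hl is_group is_group] by simp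
    next
      case (incl h)
      then show ?case using self by simp
    next
      case (inv h)
      then have h: "h \<in> carrier G" using S by auto
      interpret a: group_hom G G "\<lambda>x. lbracket G x h"
        using hl[OF h] is_group by (simp add: group_hom_def group_hom_axioms_def)
      interpret b: group_hom G G "lbracket G (inv h)"
        using hr[of "inv h"] h is_group by (simp add: group_hom_def group_hom_axioms_def)
      show ?case using a.hom_inv[OF h] b.hom_inv[OF h] self[OF inv] by simp
    next
      case (eng x y)
      have xy: "x \<in> carrier G" "y \<in> carrier G" using eng generate_in_carrier[OF S(1)] by auto
      have "lbracket G (x \<otimes> y) (x \<otimes> y) =
          (lbracket G x x \<otimes> lbracket G y y) \<otimes> (lbracket G x y \<otimes> lbracket G y x)"
        using xy by (simp add: left right closed m_ac)
      then show ?case using eng anti2[OF xy] by simp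
    qed
  qed
  define J where "J x y z = lbracket G x (lbracket G y z) \<otimes> lbracket G y (lbracket G z x)
      \<otimes> lbracket G z (lbracket G x y)" for x y z
  have J_hom: "(\<lambda>x. J x y z) \<in> hom G G" if "y \<in> carrier G" "z \<in> carrier G" for y z
  proof -
    have 1: "(\<lambda>x. lbracket G y (lbracket G z x)) \<in> hom G G"
      using hom_comp[OF hr[of z] hr[of y]] that by simp
    have 2: "(\<lambda>x. lbracket G z (lbracket G x y)) \<in> hom G G"
      using hom_comp[OF hl[of y] hr[of z]] that by simp
    show ?thesis unfolding J_def using that
      by (intro hom_pointwise_mult is_group 1 2 hl closed)
  qed
  \<comment> \<open>\<open>J\<close> is invariant under rotation, so additivity in the first place
    suffices: the variables leave \<open>S\<close> one after another, each extended from the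
    generators while it stands in front.\<close>
  have J_cyc: "J x y z = J y z x" if "x \<in> carrier G" "y \<in> carrier G" "z \<in> carrier G" for x y z
    using that by (simp add: J_def closed m_ac)
  have J1: "J x y z = \<one>" if "x \<in> carrier G" "y \<in> S" "z \<in> S" for x y z
    by (rule ext[of "\<lambda>x. J x y z"], rule J_hom) (use that jac S in \<open>auto simp: J_def\<close>)
  have J2: "J x y z = \<one>" if "x \<in> carrier G" "y \<in> carrier G" "z \<in> S" for x y z
    by (rule ext[of "\<lambda>x. J x y z"], rule J_hom)
       (use that J1 S J_cyc[of _ y z] in \<open>auto simp: subset_iff\<close>)
  have J3: "J x y z = \<one>" if "x \<in> carrier G" "y \<in> carrier G" "z \<in> carrier G" for x y z
    by (rule ext[of "\<lambda>x. J x y z"], rule J_hom)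
       (use that J2 S J_cyc[of _ y z] in \<open>auto simp: subset_iff\<close>)
  show ?thesis
    by unfold_locales (use closed left right self' J3 in \<open>auto simp: J_def\<close>)
qed

definition lie_hom ::
    "('a, 'm) graded_lie_scheme \<Rightarrow> ('b, 'n) graded_lie_scheme \<Rightarrow> ('a \<Rightarrow> 'b) set" where
  "lie_hom L M = {f \<in> hom L M.
     \<forall>x\<in>carrier L. \<forall>y\<in>carrier L. f (lbracket L x y) = lbracket M (f x) (f y)}"

lemma graded_lie_hom_imp_lie_hom: "f \<in> graded_lie_hom L M \<Longrightarrow> f \<in> lie_hom L M"
  by (simp add: graded_lie_hom_def lie_hom_def)

lemma lie_homD:
  assumes "f \<in> lie_hom L M"
  shows "f \<in> hom L M"
    and "\<lbrakk>x \<in> carrier L; y \<in> carrier L\<rbrakk> \<Longrightarrow> f (lbracket L x y) = lbracket M (f x) (f y)"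
    and "\<lbrakk>x \<in> carrier L\<rbrakk> \<Longrightarrow> f x \<in> carrier M"
  using assms by (auto simp: lie_hom_def hom_def)

lemma graded_lie_hom_compose:
  assumes "f \<in> graded_lie_hom L M" "g \<in> graded_lie_hom M N"
  shows "(\<lambda>x. g (f x)) \<in> graded_lie_hom L N"
proof -
  have "f \<in> hom L M" "g \<in> hom M N" using assms by (auto simp: graded_lie_hom_def)
  then have "(\<lambda>x. g (f x)) \<in> hom L N" and f: "\<And>x. x \<in> carrier L \<Longrightarrow> f x \<in> carrier M"
    by (auto simp: hom_comp hom_in_carrier)
  moreover have "g (f (lbracket L x y)) = lbracket N (g (f x)) (g (f y))"
    if "x \<in> carrier L" "y \<in> carrier L" for x y
    using assms f that by (simp add: graded_lie_hom_def)
  moreover have "g (f x) \<in> grade N k" if "1 \<le> k" "x \<in> grade L k" for k x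
    using assms that unfolding graded_lie_hom_def by blast
  ultimately show ?thesis by (auto simp: graded_lie_hom_def)
qed

lemma lie_ideal_subgroup: "lie_ideal I L \<Longrightarrow> subgroup I L"
  by (simp add: lie_ideal_def)

lemma (in lie_ring) lie_idealI:
  assumes "subgroup I L" "\<And>x a. x \<in> carrier L \<Longrightarrow> a \<in> I \<Longrightarrow> lbracket L x a \<in> I"
  shows "lie_ideal I L"
  unfolding lie_ideal_def
proof (intro conjI ballI)
  interpret I: subgroup I L by fact
  fix x a assume xa: "x \<in> carrier L" "a \<in> I"
  then show "lbracket L x a \<in> I" using assms by simp
  then show "lbracket L a x \<in> I" using xa lb_swap[of a x] by simp
qed (rule assms)

text \<open>Brackets are additive in each argument, so absorption may be tested with generators in
  both places.\<close>

lemma (in lie_ring) lie_ideal_generateI: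
  assumes "S \<subseteq> carrier L" "T \<subseteq> carrier L" "carrier L \<subseteq> generate L T"
    and "\<And>x a. x \<in> T \<Longrightarrow> a \<in> S \<Longrightarrow> lbracket L x a \<in> generate L S"
  shows "lie_ideal (generate L S) L"
proof (rule lie_idealI)
  have sg: "subgroup (generate L S) L" by (rule generate_is_subgroup[OF assms(1)])
  then show "subgroup (generate L S) L" .
  have 1: "lbracket L x a \<in> generate L S" if "x \<in> T" "a \<in> generate L S" for x a
    by (rule hom_generate_closed[OF is_group is_group lb_hom_right assms(1) sg _ that(2)])
       (use that assms in auto)
  show "lbracket L x a \<in> generate L S" if "x \<in> carrier L" "a \<in> generate L S" for x a
    by (rule hom_generate_closed[OF is_group is_group lb_hom_left assms(2) sg])
       (use that 1 assms generate_in_carrier[OF assms(1)] in auto)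
qed

text \<open>To map one generated Lie ideal into another it is enough that this preimage contains the
  generators; the case of the zero ideal treats kernels.\<close>

lemma (in lie_ring) lie_ideal_vimage:
  assumes "lie_ring M" "f \<in> lie_hom L M" "lie_ideal I M"
  shows "lie_ideal {x \<in> carrier L. f x \<in> I} L"
proof (rule lie_idealI)
  interpret M: lie_ring M by fact
  interpret I: subgroup I M using assms(3) by (rule lie_ideal_subgroup)
  interpret group_hom L M f
    using lie_homD(1)[OF assms(2)] is_group M.is_group
    by (simp add: group_hom_def group_hom_axioms_def)
  show "subgroup {x \<in> carrier L. f x \<in> I} L"
    by unfold_locales auto
  show "lbracket L x a \<in> {x \<in> carrier L. f x \<in> I}"
    if "x \<in> carrier L" "a \<in> {x \<in> carrier L. f x \<in> I}" for x a
    using that assms(3) lie_homD(2)[OF assms(2)] by (auto simp: lie_ideal_def)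
qed

lemma (in lie_ring) lie_ideal_gen:
  assumes "S \<subseteq> carrier L"
  shows "lie_ideal (lie_ideal_gen L S) L" "S \<subseteq> lie_ideal_gen L S"
    and "\<lbrakk>lie_ideal I L; S \<subseteq> I\<rbrakk> \<Longrightarrow> lie_ideal_gen L S \<subseteq> I"
proof -
  have "lie_ideal (carrier L) L" by (rule lie_idealI) (auto simp: subgroup_self)
  then have "subgroup (lie_ideal_gen L S) L"
    unfolding lie_ideal_gen_def using assms
    by (intro subgroups_Inter) (auto simp: lie_ideal_subgroup)
  then show "lie_ideal (lie_ideal_gen L S) L"
    by (rule lie_idealI) (auto simp: lie_ideal_gen_def lie_ideal_def)
qed (auto simp: lie_ideal_gen_def)

section \<open>Gradings\<close>

abbreviation homogeneous_elements :: "('a, 'm) graded_lie_scheme \<Rightarrow> 'a set" where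
  "homogeneous_elements L \<equiv> (\<Union>k\<in>{1..}. grade L k)"

text \<open>A family of projections witnesses the directness of the sum.\<close>

lemma graded_lie_algebraI:
  fixes L (structure)
  assumes "lie_ring L"
    and sub: "\<And>k. 1 \<le> k \<Longrightarrow> subgroup (grade L k) L"
    and br: "\<And>j k x y. \<lbrakk>1 \<le> j; 1 \<le> k; x \<in> grade L j; y \<in> grade L k\<rbrakk>
      \<Longrightarrow> lbracket L x y \<in> grade L (j + k)"
    and gen: "carrier L \<subseteq> generate L (homogeneous_elements L)"
    and p_hom: "\<And>k. 1 \<le> k \<Longrightarrow> p k \<in> hom L L"
    and p_same: "\<And>k x. \<lbrakk>1 \<le> k; x \<in> grade L k\<rbrakk> \<Longrightarrow> p k x = x"
    and p_other: "\<And>j k x. \<lbrakk>1 \<le> j; 1 \<le> k; j \<noteq> k; x \<in> grade L j\<rbrakk> \<Longrightarrow> p k x = \<one>"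
  shows "graded_lie_algebra L"
proof -
  interpret lie_ring L by fact
  have hc: "homogeneous_elements L \<subseteq> carrier L"
    using subgroup.subset[OF sub] by blast
  have p: "group_hom L L (p k)" if "1 \<le> k" for k
    using p_hom[OF that] is_group by (simp add: group_hom_def group_hom_axioms_def)
  have p_in: "p k x \<in> grade L k" if "1 \<le> k" "x \<in> carrier L" for k x
  proof (rule hom_generate_closed[OF is_group is_group p_hom[OF that(1)] hc sub[OF that(1)]])
    fix s assume "s \<in> homogeneous_elements L"
    then obtain j where "1 \<le> j" "s \<in> grade L j" by auto
    then show "p k s \<in> grade L k"
      using p_same[OF that(1)] p_other[of j k s] that(1) subgroup.one_closed[OF sub[OF that(1)]]
      by (cases "j = k") auto
  qed (use that gen in auto)
  \<comment> \<open>A homogeneous generator occupies one degree; for a product the two finite sets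
    of degrees are united, which is harmless because the projections vanish outside of them.\<close>
  have fin: "\<exists>F. finite F \<and> F \<subseteq> {1..} \<and> (\<forall>k\<ge>1. k \<notin> F \<longrightarrow> p k x = \<one>) \<and> x = finprod L (\<lambda>k. p k x) F"
    if "x \<in> carrier L" for x
  proof -
    have "x \<in> generate L (homogeneous_elements L)" using that gen by auto
    then show ?thesis
    proof (induction rule: generate.induct)
      case one
      have "p k \<one> = \<one>" if "k \<ge> 1" for k using p[OF that] by (rule group_hom.hom_one)
      then show ?case by (intro exI[of _ "{}"]) auto
    next
      case (incl h)
      then obtain k where k: "k \<ge> 1" "h \<in> grade L k" by auto
      show ?case
        by (rule exI[of _ "{k}"]) (use k p_same p_other hc in auto)
    next
      case (inv h)
      then obtain k where k: "k \<ge> 1" "h \<in> grade L k" by auto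
      then have "inv h \<in> grade L k" by (simp add: sub subgroup.m_inv_closed)
      moreover have "inv h \<in> carrier L" using inv hc by auto
      ultimately show ?case
        by (intro exI[of _ "{k}"]) (use k p_same p_other in auto)
    next
      case (eng x y)
      have xy: "x \<in> carrier L" "y \<in> carrier L" using eng generate_in_carrier[OF hc] by auto
      obtain F where F: "finite F" "F \<subseteq> {1..}" "\<And>k. k \<ge> 1 \<Longrightarrow> k \<notin> F \<Longrightarrow> p k x = \<one>"
          "x = finprod L (\<lambda>k. p k x) F" using eng by auto
      obtain F' where F': "finite F'" "F' \<subseteq> {1..}" "\<And>k. k \<ge> 1 \<Longrightarrow> k \<notin> F' \<Longrightarrow> p k y = \<one>"
          "y = finprod L (\<lambda>k. p k y) F'" using eng by auto
      have pc: "p k x \<in> carrier L" "p k y \<in> carrier L" if "k \<ge> 1" for k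
        using group_hom.hom_closed[OF p[OF that]] xy by auto
      have ge: "k \<ge> 1" if "k \<in> F \<union> F'" for k using that F(2) F'(2) by auto
      have "finprod L (\<lambda>k. p k x) F = finprod L (\<lambda>k. p k x) (F \<union> F')"
        by (rule finprod_mono_neutral_cong_left) (use F F' pc ge in auto)
      moreover have "finprod L (\<lambda>k. p k y) F' = finprod L (\<lambda>k. p k y) (F \<union> F')"
        by (rule finprod_mono_neutral_cong_left) (use F F' pc ge in auto)
      ultimately have "x \<otimes> y = finprod L (\<lambda>k. p k x) (F \<union> F') \<otimes> finprod L (\<lambda>k. p k y) (F \<union> F')"
        using F(4) F'(4) by simp
      also have "\<dots> = finprod L (\<lambda>k. p k x \<otimes> p k y) (F \<union> F')"
        using pc ge by (subst finprod_multf) auto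
      also have "\<dots> = finprod L (\<lambda>k. p k (x \<otimes> y)) (F \<union> F')"
        using pc ge xy group_hom.hom_mult[OF p] by (intro finprod_cong) (auto simp: simp_implies_def)
      finally have "x \<otimes> y = finprod L (\<lambda>k. p k (x \<otimes> y)) (F \<union> F')" .
      moreover have "p k (x \<otimes> y) = \<one>" if "k \<ge> 1" "k \<notin> F \<union> F'" for k
        using that F(3) F'(3) xy group_hom.hom_mult[OF p[OF that(1)]] by auto
      ultimately show ?case using F(1,2) F'(1,2) by (intro exI[of _ "F \<union> F'"]) auto
    qed
  qed
  show ?thesis
  proof unfold_locales
    fix x assume x: "x \<in> carrier L"
    let ?P = "\<lambda>u. u \<in> (\<Pi>\<^sub>E k\<in>{1..}. grade L k) \<and> finite {k \<in> {1..}. u k \<noteq> \<one>}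
             \<and> x = finprod L u {k \<in> {1..}. u k \<noteq> \<one>}"
    show "\<exists>!u. ?P u"
    proof (rule ex1I)
      obtain F where F: "finite F" "F \<subseteq> {1..}" "\<And>k. k \<ge> 1 \<Longrightarrow> k \<notin> F \<Longrightarrow> p k x = \<one>"
          "x = finprod L (\<lambda>k. p k x) F" using fin[OF x] by auto
      let ?u = "\<lambda>k\<in>{1..}. p k x"
      have s: "{k \<in> {1..}. ?u k \<noteq> \<one>} \<subseteq> F" using F(3) by auto
      have "finprod L ?u {k \<in> {1..}. ?u k \<noteq> \<one>} = finprod L (\<lambda>k. p k x) F"
        by (rule finprod_mono_neutral_cong_left)
           (use F s x group_hom.hom_closed[OF p] in auto)
      then show "?P ?u" using F s finite_subset[OF s] p_in x by auto
    next
      fix u assume u: "?P u"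
      let ?S = "{k \<in> {1..}. u k \<noteq> \<one>}"
      have ug: "u k \<in> grade L k" if "k \<ge> 1" for k using u that by auto
      have uc: "u k \<in> carrier L" if "k \<ge> 1" for k using ug[OF that] that hc by auto
      \<comment> \<open>Uniqueness: applied to any decomposition, \<open>p k\<close> keeps the
        summand of degree \<open>k\<close> and kills the others.\<close>
      have "u k = p k x" if k: "k \<ge> 1" for k
      proof -
        have "p k x = p k (finprod L u ?S)" using u by simp
        also have "\<dots> = finprod L (\<lambda>j. p k (u j)) ?S"
          by (rule hom_finprod[OF comm_group_axioms p_hom[OF k]]) (use uc in auto)
        also have "\<dots> = finprod L (\<lambda>j. if j = k then u k else \<one>) ?S"
          using k uc p_same[OF k] p_other[OF _ k] ug
          by (intro finprod_cong') auto
        also have "\<dots> = u k"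
        proof (cases "u k = \<one>")
          case True
          then show ?thesis by (intro HOL.trans[OF finprod_one_eqI]) auto
        next
          case False
          then show ?thesis
            using finprod_singleton_swap[of k ?S "\<lambda>j. u k"] u k uc by auto
        qed
        finally show ?thesis ..
      qed
      then show "u = (\<lambda>k\<in>{1..}. p k x)" using u by (auto simp: PiE_iff extensional_def fun_eq_iff)
    qed
  qed (use sub br lb_add_left lb_add_right lb_jacobi in \<open>simp_all add: subgroup_def\<close>)
qed

section \<open>Homogeneous components\<close>

context graded_lie_algebra
begin

definition component :: "'a \<Rightarrow> nat \<Rightarrow> 'a" where
  "component x = (THE u. u \<in> (\<Pi>\<^sub>E k\<in>{1..}. grade L k) \<and> finite {k \<in> {1..}. u k \<noteq> \<one>}
             \<and> x = finprod L u {k \<in> {1..}. u k \<noteq> \<one>})"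

lemma grade_carrier: "\<lbrakk>1 \<le> k; x \<in> grade L k\<rbrakk> \<Longrightarrow> x \<in> carrier L"
  using subgroup.subset[OF grade_subgroup] by auto

lemma homogeneous_elements_carrier: "homogeneous_elements L \<subseteq> carrier L"
  using grade_carrier by auto

lemma component:
  assumes "x \<in> carrier L"
  shows "component x \<in> (\<Pi>\<^sub>E k\<in>{1..}. grade L k)" "finite {k \<in> {1..}. component x k \<noteq> \<one>}"
    "x = finprod L (component x) {k \<in> {1..}. component x k \<noteq> \<one>}"
  using theI'[OF grade_direct_sum[OF assms]] by (simp_all add: component_def)

lemma component_grade: "\<lbrakk>x \<in> carrier L; 1 \<le> k\<rbrakk> \<Longrightarrow> component x k \<in> grade L k"
  using component(1) by auto

lemma component_carrier: "\<lbrakk>x \<in> carrier L; 1 \<le> k\<rbrakk> \<Longrightarrow> component x k \<in> carrier L"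
  using component_grade grade_carrier by auto

lemma component_eqI:
  assumes "finite F" "F \<subseteq> {1..}" "\<And>k. 1 \<le> k \<Longrightarrow> u k \<in> grade L k"
    and "\<And>k. \<lbrakk>1 \<le> k; k \<notin> F\<rbrakk> \<Longrightarrow> u k = \<one>" and "x = finprod L u F" and "1 \<le> k"
  shows "component x k = u k"
proof -
  let ?u = "restrict u {1..}"
  have uc: "u k \<in> carrier L" if "1 \<le> k" for k using assms(3)[OF that] grade_carrier that by auto
  have s: "{k \<in> {1..}. ?u k \<noteq> \<one>} \<subseteq> F" using assms(4) by auto
  have "x \<in> carrier L" using assms(2,5) uc by (auto intro!: finprod_closed)
  moreover have "finprod L ?u {k \<in> {1..}. ?u k \<noteq> \<one>} = finprod L u F"
    by (rule finprod_mono_neutral_cong_left) (use assms s uc in auto)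
  ultimately have "x \<in> carrier L" "?u \<in> (\<Pi>\<^sub>E k\<in>{1..}. grade L k)"
      "finite {k \<in> {1..}. ?u k \<noteq> \<one>}" "x = finprod L ?u {k \<in> {1..}. ?u k \<noteq> \<one>}"
    using assms(3,5) finite_subset[OF s assms(1)] by auto
  then have "component x = ?u"
    unfolding component_def by (intro the1_equality[OF grade_direct_sum]) auto
  then show ?thesis using assms(6) by simp
qed

lemma component_finprod:
  assumes "x \<in> carrier L"
  obtains F where "finite F" "F \<subseteq> {1..}" "\<And>k. \<lbrakk>1 \<le> k; k \<notin> F\<rbrakk> \<Longrightarrow> component x k = \<one>"
    "x = finprod L (component x) F"
  by (rule that[OF component(2)[OF assms] _ _ component(3)[OF assms]]) auto

lemma component_homogeneous:
  assumes "1 \<le> j" "1 \<le> k" "x \<in> grade L j"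
  shows "component x k = (if k = j then x else \<one>)"
  by (rule component_eqI[of "{j}"])
     (use assms grade_carrier subgroup.one_closed[OF grade_subgroup] in auto)

lemma component_hom: assumes k: "1 \<le> k" shows "(\<lambda>x. component x k) \<in> hom L L"
proof (rule homI)
  fix x y assume xy: "x \<in> carrier L" "y \<in> carrier L"
  obtain F where F: "finite F" "F \<subseteq> {1..}" "\<And>k. \<lbrakk>1 \<le> k; k \<notin> F\<rbrakk> \<Longrightarrow> component x k = \<one>"
    "x = finprod L (component x) F" by (rule component_finprod[OF xy(1)]) blast
  obtain F' where F': "finite F'" "F' \<subseteq> {1..}" "\<And>k. \<lbrakk>1 \<le> k; k \<notin> F'\<rbrakk> \<Longrightarrow> component y k = \<one>"
    "y = finprod L (component y) F'" by (rule component_finprod[OF xy(2)]) blast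
  have ge: "k \<ge> 1" if "k \<in> F \<union> F'" for k using that F(2) F'(2) by auto
  have "finprod L (component x) F = finprod L (component x) (F \<union> F')"
    by (rule finprod_mono_neutral_cong_left) (use F F' component_carrier ge xy in auto)
  moreover have "finprod L (component y) F' = finprod L (component y) (F \<union> F')"
    by (rule finprod_mono_neutral_cong_left) (use F F' component_carrier ge xy in auto)
  ultimately have eq: "x \<otimes> y = finprod L (\<lambda>k. component x k \<otimes> component y k) (F \<union> F')"
    using F(4) F'(4) component_carrier ge xy by (subst finprod_multf) auto
  show "component (x \<otimes> y) k = component x k \<otimes> component y k"
    by (rule component_eqI[OF _ _ _ _ eq])
       (use F F' component_grade xy k subgroup.m_closed[OF grade_subgroup] in auto)
qed (rule component_carrier[OF _ k])

lemma carrier_generate_homogeneous: "carrier L \<subseteq> generate L (homogeneous_elements L)"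
proof
  fix x assume x: "x \<in> carrier L"
  interpret g: subgroup "generate L (homogeneous_elements L)" L
    by (rule generate_is_subgroup[OF homogeneous_elements_carrier])
  obtain F where F: "finite F" "F \<subseteq> {1..}" "x = finprod L (component x) F"
    using component_finprod[OF x] by metis
  have "finprod L (component x) F \<in> generate L (homogeneous_elements L)"
    using F(1,2)
  proof (induction F rule: finite_induct)
    case (insert k F)
    then have "component x k \<in> generate L (homogeneous_elements L)"
      using component_grade[OF x, of k] by (intro generate.incl) auto
    moreover have "component x k \<in> carrier L" "component x \<in> F \<rightarrow> carrier L"
      using insert component_carrier[OF x] by auto
    ultimately show ?case using insert by (subst finprod_insert) auto
  qed auto
  then show "x \<in> generate L (homogeneous_elements L)" using F by simp
qed

end

text \<open>Formulated by homogeneous generators, because generated and derived ideals provide these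
  directly; closure under components then follows by applying the projections to the
  generators.\<close>

definition graded_ideal :: "'a set \<Rightarrow> ('a, 'm) graded_lie_scheme \<Rightarrow> bool" where
  "graded_ideal I L \<longleftrightarrow> lie_ideal I L \<and> I \<subseteq> generate L (I \<inter> homogeneous_elements L)"

context graded_lie_algebra
begin

lemma graded_ideal_component:
  assumes "graded_ideal I L" "x \<in> I" "1 \<le> k"
  shows "component x k \<in> I"
proof -
  have I: "subgroup I L" using assms by (simp add: graded_ideal_def lie_ideal_subgroup)
  have c: "I \<inter> homogeneous_elements L \<subseteq> carrier L" using homogeneous_elements_carrier by auto
  show ?thesis
  proof (rule hom_generate_closed[OF is_group is_group component_hom[OF assms(3)] c I])
    fix s assume s: "s \<in> I \<inter> homogeneous_elements L"
    then obtain j where "1 \<le> j" "s \<in> grade L j" by auto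
    then show "component s k \<in> I"
      using s component_homogeneous[OF _ assms(3)] subgroup.one_closed[OF I] by auto
  next
    show "x \<in> generate L (I \<inter> homogeneous_elements L)" using assms by (auto simp: graded_ideal_def)
  qed
qed

text \<open>The subgroup generated by the homogeneous members of the ideal is itself an ideal, since
  homogeneous multipliers suffice; it contains \<open>S\<close>, so by minimality it is the whole
  ideal.\<close>

lemma graded_ideal_gen:
  assumes "S \<subseteq> homogeneous_elements L"
  shows "graded_ideal (lie_ideal_gen L S) L"
proof -
  let ?I = "lie_ideal_gen L S"
  have S: "S \<subseteq> carrier L" using assms homogeneous_elements_carrier by auto
  note I = lie_ideal_gen[OF S]
  let ?J = "generate L (?I \<inter> homogeneous_elements L)"
  have "lie_ideal ?J L"
  proof (rule lie_ideal_generateI[OF _ homogeneous_elements_carrier carrier_generate_homogeneous])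
    fix x a assume "x \<in> homogeneous_elements L" "a \<in> ?I \<inter> homogeneous_elements L"
    then obtain j k where "1 \<le> j" "1 \<le> k" "x \<in> grade L j" "a \<in> grade L k" "a \<in> ?I"
      by auto
    then have "lbracket L x a \<in> grade L (j + k)" "lbracket L x a \<in> ?I" "1 \<le> j + k"
      using grade_lbracket I(1) grade_carrier by (auto simp: lie_ideal_def)
    then show "lbracket L x a \<in> ?J" by (auto intro!: generate.incl)
  qed (use homogeneous_elements_carrier in auto)
  moreover have "S \<subseteq> ?J" using I(2) assms by (auto intro!: generate.incl)
  ultimately show ?thesis unfolding graded_ideal_def using I by auto
qed

text \<open>The bracket of a graded ideal with itself is again one: the Jacobi identity gives
  absorption, and additivity in each argument reduces all brackets to those of homogeneous members,
  which are homogeneous.\<close>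

lemma graded_ideal_derived: "graded_ideal (lie_derived L i) L"
proof (induction i)
  case 0
  have "lie_ideal (carrier L) L" by (rule lie_idealI) (auto simp: subgroup_self)
  then show ?case
    using carrier_generate_homogeneous homogeneous_elements_carrier
    by (auto simp: graded_ideal_def Int_absorb1)
next
  case (Suc i)
  let ?D = "lie_derived L i" and ?H = "homogeneous_elements L"
  let ?B = "{lbracket L x y | x y. x \<in> ?D \<and> y \<in> ?D}"
  have D: "lie_ideal ?D L" and Dg: "?D \<subseteq> generate L (?D \<inter> ?H)"
    using Suc by (auto simp: graded_ideal_def)
  have Dc: "?D \<subseteq> carrier L" using D lie_ideal_subgroup subgroup.subset by blast
  have Bc: "?B \<subseteq> carrier L" using Dc by auto
  have sg: "subgroup (generate L ?B) L" by (rule generate_is_subgroup[OF Bc])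
  have id: "lie_ideal (generate L ?B) L"
  proof (rule lie_ideal_generateI[OF Bc subset_refl])
    fix z a assume z: "z \<in> carrier L" and "a \<in> ?B"
    then obtain x y where a: "a = lbracket L x y" and x: "x \<in> ?D" and y: "y \<in> ?D" by auto
    have xc: "x \<in> carrier L" and yc: "y \<in> carrier L" using x y Dc by auto
    have 1: "lbracket L x (lbracket L y z) \<in> generate L ?B"
      using D x y z by (intro generate.incl) (auto simp: lie_ideal_def)
    have 2: "lbracket L y (lbracket L z x) \<in> generate L ?B"
      using D x y z by (intro generate.incl) (auto simp: lie_ideal_def)
    \<comment> \<open>The Jacobi identity moves \<open>z\<close> inside: \<open>[y, z]\<close> and
      \<open>[z, x]\<close> stay in the ideal of the induction hypothesis, so both terms are
      generators again.\<close>
    have "lbracket L z a = inv (lbracket L x (lbracket L y z) \<otimes> lbracket L y (lbracket L z x))"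
      using lb_jacobi[OF xc yc z] xc yc z unfolding a
      by (metis inv_equality lb_closed m_closed m_comm)
    then show "lbracket L z a \<in> generate L ?B"
      using 1 2 subgroup.m_closed[OF sg] subgroup.m_inv_closed[OF sg] by auto
  qed (auto intro: generate.incl)
  let ?J = "generate L (generate L ?B \<inter> ?H)"
  have Hc: "?D \<inter> ?H \<subseteq> carrier L" using Dc by auto
  have sJ: "subgroup ?J L" using generate_in_carrier[OF Bc] by (intro generate_is_subgroup) auto
  have 1: "lbracket L x y \<in> ?J" if x: "x \<in> ?D \<inter> ?H" and y: "y \<in> ?D \<inter> ?H" for x y
  proof -
    obtain j where j: "1 \<le> j" "x \<in> grade L j" using x by auto
    obtain k where k: "1 \<le> k" "y \<in> grade L k" using y by auto
    have "lbracket L x y \<in> ?H"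
      using grade_lbracket[of j k x y] j k by (auto intro!: bexI[of _ "j + k"])
    moreover have "lbracket L x y \<in> generate L ?B" using x y by (intro generate.incl) auto
    ultimately show ?thesis by (intro generate.incl) auto
  qed
  have 2: "lbracket L x y \<in> ?J" if "x \<in> ?D" "y \<in> ?D \<inter> ?H" for x y
    by (rule hom_generate_closed[OF is_group is_group lb_hom_left Hc sJ])
       (use that 1 Dg Dc in auto)
  have 3: "lbracket L x y \<in> ?J" if "x \<in> ?D" "y \<in> ?D" for x y
    by (rule hom_generate_closed[OF is_group is_group lb_hom_right Hc sJ])
       (use that 2 Dg Dc in auto)
  have "generate L ?B \<subseteq> ?J"
    by (rule generate_subgroup_incl[OF _ sJ]) (use 3 in auto)
  then show ?case using id by (simp add: graded_ideal_def)
qed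

end

lemma lie_hom_derived:
  assumes "lie_ring L" "lie_ring M" "f \<in> lie_hom L M" "x \<in> lie_derived L i"
  shows "x \<in> carrier L \<and> f x \<in> lie_derived M i"
  using assms(4)
proof (induction i arbitrary: x)
  case 0
  then show ?case using lie_homD[OF assms(3)] by auto
next
  case (Suc i)
  interpret L: lie_ring L by fact
  interpret M: lie_ring M by fact
  let ?B = "{lbracket L x y | x y. x \<in> lie_derived L i \<and> y \<in> lie_derived L i}"
  have dM: "lie_derived M i \<subseteq> carrier M"
  proof (induction i)
    case (Suc i)
    then have "{lbracket M x y | x y. x \<in> lie_derived M i \<and> y \<in> lie_derived M i} \<subseteq> carrier M"
      by auto
    then show ?case using M.generate_in_carrier by auto
  qed simp
  have Bc: "?B \<subseteq> carrier L" using Suc by auto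
  have "subgroup (lie_derived M (Suc i)) M"
    using dM by (auto intro!: M.generate_is_subgroup)
  then have "f x \<in> lie_derived M (Suc i)"
    by (rule hom_generate_closed[OF L.is_group M.is_group lie_homD(1)[OF assms(3)] Bc])
       (use Suc lie_homD[OF assms(3)] in \<open>auto intro!: generate.incl, metis\<close>)
  then show ?case using Suc L.generate_in_carrier[OF Bc] by auto
qed

section \<open>Quotients\<close>

lemma induced_map_eq:
  assumes "x \<in> C" "\<And>y. y \<in> C \<Longrightarrow> f y = f x"
  shows "induced_map f C = f x"
proof -
  have "f ` C = (\<lambda>_. f x) ` C" by (rule image_cong[OF HOL.refl assms(2)])
  also have "\<dots> = {f x}" by (rule image_constant[OF assms(1)])
  finally have "f ` C = {f x}" .
  then show ?thesis by (simp add: induced_map_def)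
qed

lemma (in group_hom) induced_map_coset:
  assumes "subgroup I G" "\<And>a. a \<in> I \<Longrightarrow> h a = \<one>\<^bsub>H\<^esub>" "x \<in> carrier G"
  shows "induced_map h (I #>\<^bsub>G\<^esub> x) = h x"
proof (rule induced_map_eq)
  show "x \<in> I #>\<^bsub>G\<^esub> x" using assms by (simp add: G.rcos_self)
  fix y assume "y \<in> I #>\<^bsub>G\<^esub> x"
  then obtain a where "a \<in> I" "y = a \<otimes> x" by (auto simp: r_coset_def)
  then show "h y = h x" using assms subgroup.subset[OF assms(1)] by auto
qed

lemma carrier_lie_quot: "carrier (lie_quot L I) = (\<lambda>x. I #>\<^bsub>L\<^esub> x) ` carrier L"
  by (simp add: lie_quot_def carrier_FactGroup)

lemma grade_lie_quot: "grade (lie_quot L I) k = (\<lambda>x. I #>\<^bsub>L\<^esub> x) ` grade L k"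
  by (simp add: lie_quot_def)

lemma one_lie_quot: "\<one>\<^bsub>lie_quot L I\<^esub> = I"
  by (simp add: lie_quot_def)

lemma (in lie_ring) mult_lie_quot:
  assumes "lie_ideal I L" "x \<in> carrier L" "y \<in> carrier L"
  shows "(I #> x) \<otimes>\<^bsub>lie_quot L I\<^esub> (I #> y) = I #> (x \<otimes> y)"
proof -
  interpret normal I L using assms(1) by (intro subgroup_imp_normal lie_ideal_subgroup)
  show ?thesis using assms by (simp add: lie_quot_def rcos_sum)
qed

lemma (in lie_ring) lbracket_lie_quot:
  assumes "lie_ideal I L" "x \<in> carrier L" "y \<in> carrier L"
  shows "lbracket (lie_quot L I) (I #> x) (I #> y) = I #> lbracket L x y"
proof -
  interpret normal I L using assms(1) by (intro subgroup_imp_normal lie_ideal_subgroup)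
  have sg: "subgroup I L" by unfold_locales
  let ?B = "{lbracket L a b | a b. a \<in> I #> x \<and> b \<in> I #> y}"
  have 1: "\<exists>c\<in>I. t = c \<otimes> lbracket L x y" if tB: "t \<in> ?B" for t
  proof -
    obtain a b where ab: "t = lbracket L a b" "a \<in> I #> x" "b \<in> I #> y" using tB by blast
    then obtain m n where mn: "m \<in> I" "n \<in> I" "a = m \<otimes> x" "b = n \<otimes> y"
      by (auto simp: r_coset_def)
    have c: "m \<in> carrier L" "n \<in> carrier L" using mn subset by auto
    \<comment> \<open>Each of the three extra terms has \<open>m\<close> or \<open>n\<close> as an
      entry and so lies in the ideal; hence the brackets of all representatives lie in one
      coset.\<close>
    have "t = (lbracket L m n \<otimes> lbracket L m y \<otimes> lbracket L x n) \<otimes> lbracket L x y"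
      using ab mn c assms by (simp add: lb_add_left lb_add_right m_ac)
    moreover have "lbracket L m n \<otimes> lbracket L m y \<otimes> lbracket L x n \<in> I"
      using assms mn c by (auto simp: lie_ideal_def)
    ultimately show ?thesis by blast
  qed
  have 2: "lbracket L x y \<in> ?B" using assms rcos_self[OF _ sg] by blast
  have "I <#> ?B = I #> lbracket L x y"
  proof
    show "I <#> ?B \<subseteq> I #> lbracket L x y"
    proof
      fix s assume "s \<in> I <#> ?B"
      then obtain a t where a: "a \<in> I" "t \<in> ?B" "s = a \<otimes> t" by (auto simp: set_mult_def)
      then obtain c where "c \<in> I" "t = c \<otimes> lbracket L x y" using 1 by blast
      then have "s = (a \<otimes> c) \<otimes> lbracket L x y" "a \<otimes> c \<in> I"
        using a subset assms by (auto simp: m_assoc subset_iff)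
      then show "s \<in> I #> lbracket L x y" by (auto simp: r_coset_def)
    qed
    show "I #> lbracket L x y \<subseteq> I <#> ?B"
    proof
      fix s assume "s \<in> I #> lbracket L x y"
      then obtain a where "a \<in> I" "s = a \<otimes> lbracket L x y" by (auto simp: r_coset_def)
      with 2 show "s \<in> I <#> ?B" unfolding set_mult_def by (intro UN_I) simp_all
    qed
  qed
  then show ?thesis by (simp add: lie_quot_def)
qed

lemma (in lie_ring) lie_ring_quot:
  assumes "lie_ideal I L"
  shows "lie_ring (lie_quot L I)"
proof -
  let ?Q = "lie_quot L I"
  interpret normal I L using assms(1) by (intro subgroup_imp_normal lie_ideal_subgroup)
  have sg: "subgroup I L" by unfold_locales
  note q = mult_lie_quot[OF assms] lbracket_lie_quot[OF assms]
  have one: "\<one>\<^bsub>?Q\<^esub> = I #> \<one>" using subset by (simp add: one_lie_quot)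
  have "comm_group ?Q"
  proof (rule comm_groupI)
    fix x assume "x \<in> carrier ?Q"
    then obtain a where a: "a \<in> carrier L" "x = I #> a" by (auto simp: carrier_lie_quot)
    then show "\<exists>y\<in>carrier ?Q. y \<otimes>\<^bsub>?Q\<^esub> x = \<one>\<^bsub>?Q\<^esub>"
      by (intro bexI[of _ "I #> inv a"]) (auto simp: q one carrier_lie_quot)
  qed (auto simp: q one carrier_lie_quot m_ac)
  then interpret Q: comm_group ?Q .
  show ?thesis
  proof unfold_locales
    fix x assume "x \<in> carrier ?Q"
    then show "lbracket ?Q x x = \<one>\<^bsub>?Q\<^esub>" by (auto simp: q one carrier_lie_quot)
  qed (auto simp: q one carrier_lie_quot lb_add_left lb_add_right lb_jacobi)
qed

lemma (in lie_ring) lie_quot_hom: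
  assumes "lie_ideal I L"
  shows "(\<lambda>x. I #> x) \<in> graded_lie_hom L (lie_quot L I)"
  unfolding graded_lie_hom_def
  by (intro CollectI conjI ballI allI impI homI)
    (simp_all add: carrier_lie_quot grade_lie_quot mult_lie_quot[OF assms] lbracket_lie_quot[OF assms])

text \<open>The universal property of the quotient. That \<open>grade L k\<close> lies in the
  carrier is what allows the induced map to be evaluated on the graded parts.\<close>

lemma lie_quot_induced:
  assumes "lie_ring L" "lie_ring M" "f \<in> graded_lie_hom L M" "lie_ideal I L"
    and I: "\<And>a. a \<in> I \<Longrightarrow> f a = \<one>\<^bsub>M\<^esub>"
    and gr: "\<And>k. 1 \<le> k \<Longrightarrow> grade L k \<subseteq> carrier L"
  shows "\<And>x. x \<in> carrier L \<Longrightarrow> induced_map f (I #>\<^bsub>L\<^esub> x) = f x"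
    and "induced_map f \<in> graded_lie_hom (lie_quot L I) M"
    and "induced_map f ` carrier (lie_quot L I) = f ` carrier L"
proof -
  interpret L: lie_ring L by fact
  interpret M: lie_ring M by fact
  interpret group_hom L M f
    using assms(3) L.is_group M.is_group
    by (simp add: group_hom_def group_hom_axioms_def graded_lie_hom_def)
  show eq: "induced_map f (I #>\<^bsub>L\<^esub> x) = f x" if "x \<in> carrier L" for x
    by (rule induced_map_coset[OF lie_ideal_subgroup[OF assms(4)] I that])
  show "induced_map f \<in> graded_lie_hom (lie_quot L I) M"
    unfolding graded_lie_hom_def
  proof (intro CollectI conjI ballI allI impI homI)
    fix x assume "x \<in> carrier (lie_quot L I)"
    then obtain a where a: "a \<in> carrier L" "x = I #>\<^bsub>L\<^esub> a" by (auto simp: carrier_lie_quot)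
    then show "induced_map f x \<in> carrier M" by (simp add: eq)
    fix y assume "y \<in> carrier (lie_quot L I)"
    then obtain b where b: "b \<in> carrier L" "y = I #>\<^bsub>L\<^esub> b" by (auto simp: carrier_lie_quot)
    show "induced_map f (x \<otimes>\<^bsub>lie_quot L I\<^esub> y) = induced_map f x \<otimes>\<^bsub>M\<^esub> induced_map f y"
      using a b by (simp add: eq L.mult_lie_quot[OF assms(4)])
    show "induced_map f (lbracket (lie_quot L I) x y) = lbracket M (induced_map f x) (induced_map f y)"
      using a b assms(3) by (simp add: eq L.lbracket_lie_quot[OF assms(4)] graded_lie_hom_def)
  next
    fix k :: nat assume k: "1 \<le> k"
    then show "induced_map f ` grade (lie_quot L I) k \<subseteq> grade M k"
      using gr[OF k] eq assms(3) unfolding grade_lie_quot graded_lie_hom_def image_image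
      by (fastforce simp: subset_iff)
  qed
  show "induced_map f ` carrier (lie_quot L I) = f ` carrier L"
    using eq by (auto simp: carrier_lie_quot image_image)
qed

text \<open>The projections to components preserve a graded ideal, so they descend to the quotient
  and witness the directness of its grading.\<close>

lemma (in graded_lie_algebra) graded_lie_algebra_quot:
  assumes "graded_ideal I L"
  shows "graded_lie_algebra (lie_quot L I)"
proof -
  let ?Q = "lie_quot L I"
  have id: "lie_ideal I L" using assms by (simp add: graded_ideal_def)
  interpret Q: lie_ring ?Q by (rule lie_ring_quot[OF id])
  interpret I: normal I L using id by (intro subgroup_imp_normal lie_ideal_subgroup)
  have sI: "subgroup I L" by unfold_locales
  let ?q = "\<lambda>x. I #> x"
  have qh: "?q \<in> hom L ?Q" using lie_quot_hom[OF id] by (simp add: graded_lie_hom_def)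
  have q: "group_hom L ?Q ?q"
    using qh is_group Q.is_group by (simp add: group_hom_def group_hom_axioms_def)
  define p where "p k = induced_map (\<lambda>x. I #> component x k)" for k
  have ph: "(\<lambda>x. I #> component x k) \<in> hom L ?Q" if "1 \<le> k" for k
    by (rule hom_comp[OF component_hom[OF that] qh])
  have p_eq: "p k (I #> x) = I #> component x k" if "1 \<le> k" "x \<in> carrier L" for k x
  proof -
    interpret r: group_hom L ?Q "\<lambda>x. I #> component x k"
      using ph[OF that(1)] is_group Q.is_group by (simp add: group_hom_def group_hom_axioms_def)
    show ?thesis unfolding p_def
      by (rule r.induced_map_coset[OF sI _ that(2)])
         (use I.rcos_const[OF is_group] graded_ideal_component[OF assms _ that(1)] in \<open>simp only: one_lie_quot\<close>)
  qed
  show ?thesis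
  proof (rule graded_lie_algebraI[OF Q.lie_ring_axioms])
    fix k :: nat assume k: "1 \<le> k"
    show "subgroup (grade ?Q k) ?Q"
      using group_hom.subgroup_img_is_subgroup[OF q grade_subgroup[OF k]] by (simp add: grade_lie_quot)
    show "p k \<in> hom ?Q ?Q"
    proof (rule homI)
      fix x assume "x \<in> carrier ?Q"
      then obtain a where a: "a \<in> carrier L" "x = I #> a" by (auto simp: carrier_lie_quot)
      then show "p k x \<in> carrier ?Q"
        using component_carrier[OF _ k] k by (simp add: carrier_lie_quot p_eq)
      fix y assume "y \<in> carrier ?Q"
      then obtain c where c: "c \<in> carrier L" "y = I #> c" by (auto simp: carrier_lie_quot)
      show "p k (x \<otimes>\<^bsub>?Q\<^esub> y) = p k x \<otimes>\<^bsub>?Q\<^esub> p k y"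
        using a c k Group.hom_mult[OF component_hom[OF k] a(1) c(1)] component_carrier[OF _ k]
        by (simp add: p_eq mult_lie_quot[OF id])
    qed
    fix x assume "x \<in> grade ?Q k"
    then show "p k x = x"
      using k by (auto simp: grade_lie_quot p_eq grade_carrier component_homogeneous)
  next
    fix j k :: nat and x y assume "1 \<le> j" "1 \<le> k" "x \<in> grade ?Q j" "y \<in> grade ?Q k"
    then show "lbracket ?Q x y \<in> grade ?Q (j + k)"
      using grade_lbracket by (auto simp: grade_lie_quot lbracket_lie_quot[OF id] grade_carrier)
  next
    fix j k :: nat and x assume "1 \<le> j" "1 \<le> k" "j \<noteq> k" "x \<in> grade ?Q j"
    then show "p k x = \<one>\<^bsub>?Q\<^esub>"
      using I.subset by (auto simp: grade_lie_quot p_eq grade_carrier component_homogeneous one_lie_quot)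
  next
    have "?q ` generate L (homogeneous_elements L) = generate ?Q (?q ` homogeneous_elements L)"
      by (rule group_hom.generate_img[OF q homogeneous_elements_carrier, symmetric])
    then show "carrier ?Q \<subseteq> generate ?Q (homogeneous_elements ?Q)"
      using carrier_generate_homogeneous
      by (auto simp: carrier_lie_quot grade_lie_quot image_UN)
  qed
qed

section \<open>Direct sums with convolution bracket\<close>

text \<open>The construction of \<open>gr\<close> for arbitrary pieces and brackets. It serves
  twice: for the quotients of the lower central series, and for the homogeneous parts of a free Lie
  algebra, whose sum is not yet known to be direct.\<close>

definition sum_lie :: "(nat \<Rightarrow> 'a monoid) \<Rightarrow> (nat \<Rightarrow> nat \<Rightarrow> 'a \<Rightarrow> 'a \<Rightarrow> 'a) \<Rightarrow> (nat \<Rightarrow> 'a) graded_lie" where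
  "sum_lie P b = (let S = sum_group {1..} P in
    \<lparr>carrier = carrier S, monoid.mult = monoid.mult S, one = one S,
     lbracket = (\<lambda>u v. \<lambda>k\<in>{1..}. finprod (P k) (\<lambda>i. b i (k - i) (u i) (v (k - i))) {1..<k}),
     grade = (\<lambda>k. {u \<in> carrier S. \<forall>j\<in>{1..}. j \<noteq> k \<longrightarrow> u j = \<one>\<^bsub>P j\<^esub>})\<rparr>)"

definition single :: "(nat \<Rightarrow> 'a monoid) \<Rightarrow> nat \<Rightarrow> 'a \<Rightarrow> nat \<Rightarrow> 'a" where
  "single P k x = (\<lambda>j\<in>{1..}. if j = k then x else \<one>\<^bsub>P j\<^esub>)"

text \<open>Antisymmetry is an axiom beside \<open>b_self\<close>, because the latter concerns a
  single degree and cannot be polarized across different ones.\<close>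

locale graded_pieces =
  fixes P :: "nat \<Rightarrow> 'a monoid" and b :: "nat \<Rightarrow> nat \<Rightarrow> 'a \<Rightarrow> 'a \<Rightarrow> 'a"
  assumes comm_group: "1 \<le> k \<Longrightarrow> comm_group (P k)"
    and b_closed: "\<lbrakk>1 \<le> i; 1 \<le> j; x \<in> carrier (P i); y \<in> carrier (P j)\<rbrakk>
      \<Longrightarrow> b i j x y \<in> carrier (P (i + j))"
    and b_left: "\<lbrakk>1 \<le> i; 1 \<le> j; x \<in> carrier (P i); x' \<in> carrier (P i); y \<in> carrier (P j)\<rbrakk>
      \<Longrightarrow> b i j (x \<otimes>\<^bsub>P i\<^esub> x') y = b i j x y \<otimes>\<^bsub>P (i + j)\<^esub> b i j x' y"
    and b_right: "\<lbrakk>1 \<le> i; 1 \<le> j; x \<in> carrier (P i); y \<in> carrier (P j); y' \<in> carrier (P j)\<rbrakk>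
      \<Longrightarrow> b i j x (y \<otimes>\<^bsub>P j\<^esub> y') = b i j x y \<otimes>\<^bsub>P (i + j)\<^esub> b i j x y'"
    and b_self: "\<lbrakk>1 \<le> i; x \<in> carrier (P i)\<rbrakk> \<Longrightarrow> b i i x x = \<one>\<^bsub>P (i + i)\<^esub>"
    and b_antisym: "\<lbrakk>1 \<le> i; 1 \<le> j; x \<in> carrier (P i); y \<in> carrier (P j)\<rbrakk>
      \<Longrightarrow> b i j x y \<otimes>\<^bsub>P (i + j)\<^esub> b j i y x = \<one>\<^bsub>P (i + j)\<^esub>"
    and b_jacobi: "\<lbrakk>1 \<le> i; 1 \<le> j; 1 \<le> k; x \<in> carrier (P i); y \<in> carrier (P j); z \<in> carrier (P k)\<rbrakk>
      \<Longrightarrow> b i (j + k) x (b j k y z) \<otimes>\<^bsub>P (i + j + k)\<^esub> b j (k + i) y (b k i z x)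
           \<otimes>\<^bsub>P (i + j + k)\<^esub> b k (i + j) z (b i j x y) = \<one>\<^bsub>P (i + j + k)\<^esub>"
begin

abbreviation "L \<equiv> sum_lie P b"

lemma group_P: "1 \<le> k \<Longrightarrow> group (P k)"
  using comm_group by (simp add: comm_group_def)

lemma carrier_sum_lie:
  "carrier L = {u \<in> \<Pi>\<^sub>E i\<in>{1..}. carrier (P i). finite {i \<in> {1..}. u i \<noteq> \<one>\<^bsub>P i\<^esub>}}"
  using carrier_sum_group[of "{1..}" P] group_P by (simp add: sum_lie_def Let_def)

lemma sum_lie_simps:
  "monoid.mult L = (\<lambda>u v. \<lambda>i\<in>{1..}. u i \<otimes>\<^bsub>P i\<^esub> v i)"
  "\<one>\<^bsub>L\<^esub> = (\<lambda>i\<in>{1..}. \<one>\<^bsub>P i\<^esub>)"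
  "lbracket L u v = (\<lambda>k\<in>{1..}. finprod (P k) (\<lambda>i. b i (k - i) (u i) (v (k - i))) {1..<k})"
  "grade L k = {u \<in> carrier L. \<forall>j\<in>{1..}. j \<noteq> k \<longrightarrow> u j = \<one>\<^bsub>P j\<^esub>}"
  by (simp_all add: sum_lie_def Let_def)

lemma sum_lie_coord: "\<lbrakk>u \<in> carrier L; 1 \<le> k\<rbrakk> \<Longrightarrow> u k \<in> carrier (P k)"
  by (auto simp: carrier_sum_lie)

lemma sum_lie_eqI:
  assumes "u \<in> carrier L" "v \<in> carrier L" "\<And>k. 1 \<le> k \<Longrightarrow> u k = v k"
  shows "u = v"
  using assms PiE_ext[of u "{1..}" "\<lambda>i. carrier (P i)" v] by (auto simp: carrier_sum_lie)


lemma comm_group_sum_lie: "comm_group L"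
proof (rule comm_groupI)
  interpret S: group "sum_group {1..} P" by (rule sum_group) (simp add: group_P)
  have eq: "carrier (sum_group {1..} P) = carrier L" "monoid.mult (sum_group {1..} P) = monoid.mult L"
    "\<one>\<^bsub>sum_group {1..} P\<^esub> = \<one>\<^bsub>L\<^esub>" by (simp_all add: sum_lie_def Let_def del: mult_sum_group one_sum_group)
  note S = S.m_assoc S.m_closed S.l_one S.one_closed S.l_inv_ex
  note S = S[unfolded eq]
  show "x \<otimes>\<^bsub>L\<^esub> y \<otimes>\<^bsub>L\<^esub> z = x \<otimes>\<^bsub>L\<^esub> (y \<otimes>\<^bsub>L\<^esub> z)"
    if "x \<in> carrier L" "y \<in> carrier L" "z \<in> carrier L" for x y z using S(1) that .
  show "x \<otimes>\<^bsub>L\<^esub> y \<in> carrier L" if "x \<in> carrier L" "y \<in> carrier L" for x y using S(2) that .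
  show "\<one>\<^bsub>L\<^esub> \<otimes>\<^bsub>L\<^esub> x = x" if "x \<in> carrier L" for x using S(3) that .
  show "\<one>\<^bsub>L\<^esub> \<in> carrier L" by (rule S(4))
  show "\<exists>y\<in>carrier L. y \<otimes>\<^bsub>L\<^esub> x = \<one>\<^bsub>L\<^esub>" if "x \<in> carrier L" for x using S(5) that .
  show "x \<otimes>\<^bsub>L\<^esub> y = y \<otimes>\<^bsub>L\<^esub> x" if "x \<in> carrier L" "y \<in> carrier L" for x y
    using that comm_group
    by (auto simp: sum_lie_simps sum_lie_coord comm_group_def comm_monoid.m_comm intro!: restrict_ext)
qed


lemma b_one_left: "\<lbrakk>1 \<le> i; 1 \<le> j; y \<in> carrier (P j)\<rbrakk> \<Longrightarrow> b i j \<one>\<^bsub>P i\<^esub> y = \<one>\<^bsub>P (i + j)\<^esub>"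
proof -
  assume a: "1 \<le> i" "1 \<le> j" "y \<in> carrier (P j)"
  interpret A: group "P i" by (rule group_P[OF a(1)])
  interpret C: group "P (i + j)" using a by (intro group_P) simp
  have "(\<lambda>x. b i j x y) \<in> hom (P i) (P (i + j))"
    using a by (auto simp: hom_def b_closed b_left)
  then show ?thesis by (rule hom_one[OF _ A.is_group C.is_group])
qed

lemma b_one_right: "\<lbrakk>1 \<le> i; 1 \<le> j; x \<in> carrier (P i)\<rbrakk> \<Longrightarrow> b i j x \<one>\<^bsub>P j\<^esub> = \<one>\<^bsub>P (i + j)\<^esub>"
proof -
  assume a: "1 \<le> i" "1 \<le> j" "x \<in> carrier (P i)"
  interpret A: group "P j" by (rule group_P[OF a(2)])
  interpret C: group "P (i + j)" using a by (intro group_P) simp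
  have "(\<lambda>y. b i j x y) \<in> hom (P j) (P (i + j))"
    using a by (auto simp: hom_def b_closed b_right)
  then show ?thesis by (rule hom_one[OF _ A.is_group C.is_group])
qed

lemma one_P: "1 \<le> k \<Longrightarrow> \<one>\<^bsub>P k\<^esub> \<in> carrier (P k)"
  using group_P[of k] by (simp add: group.is_monoid monoid.one_closed)

lemma coord_hom: "1 \<le> k \<Longrightarrow> (\<lambda>u. u k) \<in> hom L (P k)"
  by (rule homI) (simp_all add: sum_lie_coord sum_lie_simps)

lemma single_apply: "1 \<le> j \<Longrightarrow> single P k x j = (if j = k then x else \<one>\<^bsub>P j\<^esub>)"
  by (simp add: single_def)

lemma single_closed: "\<lbrakk>1 \<le> k; x \<in> carrier (P k)\<rbrakk> \<Longrightarrow> single P k x \<in> carrier L"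
  by (auto simp: carrier_sum_lie single_def one_P intro!: finite_subset[of _ "{k}"])

lemma grade_eq: assumes "1 \<le> k" shows "grade L k = single P k ` carrier (P k)"
proof
  show "grade L k \<subseteq> single P k ` carrier (P k)"
  proof
    fix u assume u: "u \<in> grade L k"
    then have uc: "u \<in> carrier L" by (simp add: sum_lie_simps)
    have "u = single P k (u k)"
      by (rule sum_lie_eqI[OF uc single_closed])
         (use u assms uc sum_lie_coord[of u k] in \<open>auto simp: single_apply sum_lie_simps\<close>)
    then show "u \<in> single P k ` carrier (P k)" using sum_lie_coord[OF uc assms] by blast
  qed
  show "single P k ` carrier (P k) \<subseteq> grade L k"
    using assms by (auto simp: sum_lie_simps single_closed single_apply)
qed

lemma single_hom: assumes "1 \<le> k" shows "single P k \<in> hom (P k) L"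
proof (rule homI)
  fix x y assume "x \<in> carrier (P k)" "y \<in> carrier (P k)"
  moreover have "group (P j)" if "1 \<le> j" for j by (rule group_P[OF that])
  ultimately show "single P k (x \<otimes>\<^bsub>P k\<^esub> y) = single P k x \<otimes>\<^bsub>L\<^esub> single P k y"
    by (auto simp: sum_lie_simps single_def group.is_monoid monoid.l_one one_P intro!: restrict_ext)
qed (rule single_closed[OF assms])

lemma single_one: "single P k \<one>\<^bsub>P k\<^esub> = \<one>\<^bsub>L\<^esub>"
  by (auto simp: sum_lie_simps single_def intro!: restrict_ext)

lemma lbracket_summand:
  assumes "u \<in> carrier L" "v \<in> carrier L" "i \<in> {1..<k}"
  shows "b i (k - i) (u i) (v (k - i)) \<in> carrier (P k)"
  using assms b_closed[of i "k - i" "u i" "v (k - i)"] sum_lie_coord[OF assms(1), of i]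
    sum_lie_coord[OF assms(2), of "k - i"] by auto

lemma lbracket_single:
  assumes "1 \<le> i" "1 \<le> j" "x \<in> carrier (P i)" "y \<in> carrier (P j)"
  shows "lbracket L (single P i x) (single P j y) = single P (i + j) (b i j x y)"
proof -
  have "finprod (P k) (\<lambda>l. b l (k - l) (single P i x l) (single P j y (k - l))) {1..<k} =
      (if k = i + j then b i j x y else \<one>\<^bsub>P k\<^esub>)" if k: "1 \<le> k" for k
  proof -
    interpret comm_group "P k" by (rule comm_group[OF k])
    \<comment> \<open>In degree \<open>k\<close> only the index \<open>l = i\<close> can contribute,
      and only if \<open>k - l\<close> is \<open>j\<close>; every other summand has a trivial
      entry.\<close>
    have eq: "b l (k - l) (single P i x l) (single P j y (k - l)) =
        (if l = i then if k = i + j then b i j x y else \<one>\<^bsub>P k\<^esub> else \<one>\<^bsub>P k\<^esub>)"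
      if "l \<in> {1..<k}" for l
      using that assms b_one_left[of l "k - l" "single P j y (k - l)"]
        b_one_right[of l "k - l" "single P i x l"] one_P[of l] one_P[of "k - l"]
      by (auto simp: single_apply)
    have c: "k = i + j \<Longrightarrow> b i j x y \<in> carrier (P k)" using assms b_closed by simp
    have "finprod (P k) (\<lambda>l. b l (k - l) (single P i x l) (single P j y (k - l))) {1..<k} =
        finprod (P k) (\<lambda>l. if l = i then if k = i + j then b i j x y else \<one>\<^bsub>P k\<^esub> else \<one>\<^bsub>P k\<^esub>) {1..<k}"
      by (rule finprod_cong') (use eq c in auto)
    also have "\<dots> = (if k = i + j then b i j x y else \<one>\<^bsub>P k\<^esub>)"
    proof (cases "k = i + j")
      case True
      then show ?thesis
        using finprod_singleton_swap[of i "{1..<k}" "\<lambda>l. b i j x y"] assms(1,2) c by auto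
    next
      case False
      then show ?thesis by (auto intro: finprod_one_eqI)
    qed
    finally show ?thesis .
  qed
  then show ?thesis by (auto simp: sum_lie_simps single_def intro!: restrict_ext)
qed

lemma lbracket_coord:
  "1 \<le> k \<Longrightarrow> lbracket L u v k = finprod (P k) (\<lambda>i. b i (k - i) (u i) (v (k - i))) {1..<k}"
  by (simp add: sum_lie_simps)

lemma lbracket_sum_lie_closed:
  assumes "u \<in> carrier L" "v \<in> carrier L"
  shows "lbracket L u v \<in> carrier L"
proof -
  let ?A = "{i \<in> {1..}. u i \<noteq> \<one>\<^bsub>P i\<^esub>}" and ?B = "{i \<in> {1..}. v i \<noteq> \<one>\<^bsub>P i\<^esub>}"
  have fin: "finite ?A" "finite ?B" using assms by (auto simp: carrier_sum_lie)
  have c: "lbracket L u v k \<in> carrier (P k)" if k: "1 \<le> k" for k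
  proof -
    interpret comm_group "P k" by (rule comm_group[OF k])
    show ?thesis unfolding lbracket_coord[OF k]
      by (rule finprod_closed) (use lbracket_summand[OF assms] in auto)
  qed
  \<comment> \<open>A nontrivial coordinate has a nontrivial summand, whose two entries are then
    nontrivial; so the bracket is supported on sums of degrees from the two finite supports.\<close>
  have "{k \<in> {1..}. lbracket L u v k \<noteq> \<one>\<^bsub>P k\<^esub>} \<subseteq> (\<lambda>(i, j). i + j) ` (?A \<times> ?B)"
  proof
    fix k assume k: "k \<in> {k \<in> {1..}. lbracket L u v k \<noteq> \<one>\<^bsub>P k\<^esub>}"
    then have k1: "1 \<le> k" by simp
    interpret comm_group "P k" by (rule comm_group[OF k1])
    obtain i where i: "i \<in> {1..<k}" "b i (k - i) (u i) (v (k - i)) \<noteq> \<one>\<^bsub>P k\<^esub>"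
      using k finprod_one_eqI[of "{1..<k}" "\<lambda>i. b i (k - i) (u i) (v (k - i))"]
      by (auto simp: lbracket_coord[OF k1])
    then have "u i \<noteq> \<one>\<^bsub>P i\<^esub>" "v (k - i) \<noteq> \<one>\<^bsub>P (k - i)\<^esub>"
      using b_one_left[of i "k - i" "v (k - i)"] b_one_right[of i "k - i" "u i"]
        sum_lie_coord[OF assms(1), of i] sum_lie_coord[OF assms(2), of "k - i"] by auto
    then show "k \<in> (\<lambda>(i, j). i + j) ` (?A \<times> ?B)"
      using i by (intro image_eqI[of _ _ "(i, k - i)"]) auto
  qed
  then have "finite {k \<in> {1..}. lbracket L u v k \<noteq> \<one>\<^bsub>P k\<^esub>}"
    by (rule finite_subset) (use fin in auto)
  moreover have "lbracket L u v \<in> extensional {1..}" by (simp add: sum_lie_simps)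
  ultimately show ?thesis using c by (auto simp: carrier_sum_lie PiE_iff)
qed

lemma sum_lie_generate: "carrier L \<subseteq> generate L (homogeneous_elements L)"
proof
  fix u assume "u \<in> carrier L"
  interpret comm_group L by (rule comm_group_sum_lie)
  have "u \<in> generate L (homogeneous_elements L)"
    if "finite F" "F \<subseteq> {1..}" "u \<in> carrier L" "\<forall>k\<ge>1. k \<notin> F \<longrightarrow> u k = \<one>\<^bsub>P k\<^esub>" for F u
    using that
  proof (induction F arbitrary: u rule: finite_induct)
    case empty
    then have "u = \<one>\<^bsub>L\<^esub>"
      by (intro sum_lie_eqI[OF _ one_closed]) (auto simp: sum_lie_simps(2))
    then show ?case by (auto intro: generate.one)
  next
    case (insert k F)
    have k: "1 \<le> k" using insert by auto
    let ?s = "single P k (u k)"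
    have s: "?s \<in> grade L k" using sum_lie_coord[OF insert.prems(2) k] k by (simp add: grade_eq)
    then have sc: "?s \<in> carrier L" by (simp add: sum_lie_simps)
    \<comment> \<open>Dividing by the coordinate of degree \<open>k\<close> shrinks the support to
      \<open>F\<close>.\<close>
    let ?v = "inv\<^bsub>L\<^esub> ?s \<otimes>\<^bsub>L\<^esub> u"
    have vc: "?v \<in> carrier L" using sc insert by simp
    have "?v j = \<one>\<^bsub>P j\<^esub>" if j: "1 \<le> j" "j \<notin> F" for j
    proof -
      interpret Pj: group "P j" by (rule group_P[OF j(1)])
      interpret c: group_hom L "P j" "\<lambda>u. u j"
        using coord_hom[OF j(1)] is_group Pj.is_group
        by (simp add: group_hom_def group_hom_axioms_def)
      have "?v j = inv\<^bsub>P j\<^esub> (?s j) \<otimes>\<^bsub>P j\<^esub> u j" using sc insert by simp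
      then show ?thesis using insert j group.l_inv[OF group_P[OF k] sum_lie_coord[OF insert.prems(2) k]] by (auto simp: single_apply)
    qed
    then have "?v \<in> generate L (homogeneous_elements L)" using insert vc by auto
    moreover have "?s \<in> generate L (homogeneous_elements L)" using s k by (intro generate.incl) auto
    ultimately have "?s \<otimes>\<^bsub>L\<^esub> ?v \<in> generate L (homogeneous_elements L)" by (rule generate.eng[rotated])
    then show ?case using sc insert by (simp add: m_assoc[symmetric])
  qed
  then show "u \<in> generate L (homogeneous_elements L)"
    using \<open>u \<in> carrier L\<close> by (auto simp: carrier_sum_lie intro!: exI[of _ "{i \<in> {1..}. u i \<noteq> \<one>\<^bsub>P i\<^esub>}"]) 
qed

text \<open>Additivity of the bracket is checked in coordinates. The other identities are reduced by
  \<open>lie_ringI_generate\<close> to homogeneous elements, where the convolution consists of one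
  summand and the axioms on the pieces apply.\<close>

theorem graded_lie_algebra_sum_lie: "graded_lie_algebra L"
proof -
  interpret comm_group L by (rule comm_group_sum_lie)
  note br = lbracket_sum_lie_closed
  have coord_mult: "(u \<otimes>\<^bsub>L\<^esub> v) k = u k \<otimes>\<^bsub>P k\<^esub> v k" if "1 \<le> k" for u v k
    using that by (simp add: sum_lie_simps)
  have hc: "homogeneous_elements L \<subseteq> carrier L" by (auto simp: sum_lie_simps)
  have lr: "lie_ring L"
  proof (rule lie_ringI_generate[OF comm_group_sum_lie br _ _ hc sum_lie_generate])
    fix x y z assume c: "x \<in> carrier L" "y \<in> carrier L" "z \<in> carrier L"
    show "lbracket L (x \<otimes>\<^bsub>L\<^esub> y) z = lbracket L x z \<otimes>\<^bsub>L\<^esub> lbracket L y z"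
    proof (rule sum_lie_eqI)
      fix k :: nat assume k: "1 \<le> k"
      interpret Pk: comm_group "P k" by (rule comm_group[OF k])
      have "lbracket L (x \<otimes>\<^bsub>L\<^esub> y) z k = finprod (P k) (\<lambda>i. b i (k - i) (x i) (z (k - i))
          \<otimes>\<^bsub>P k\<^esub> b i (k - i) (y i) (z (k - i))) {1..<k}"
        unfolding lbracket_coord[OF k]
      proof (rule Pk.finprod_cong'[OF HOL.refl])
        fix i assume i: "i \<in> {1..<k}"
        then have "1 \<le> i" "1 \<le> k - i" "i + (k - i) = k" by auto
        then show "b i (k - i) ((x \<otimes>\<^bsub>L\<^esub> y) i) (z (k - i)) = b i (k - i) (x i) (z (k - i))
          \<otimes>\<^bsub>P k\<^esub> b i (k - i) (y i) (z (k - i))"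
          using b_left[of i "k - i" "x i" "y i" "z (k - i)"] c by (simp add: coord_mult sum_lie_coord)
      qed (use lbracket_summand c in auto)
      also have "\<dots> = lbracket L x z k \<otimes>\<^bsub>P k\<^esub> lbracket L y z k"
        unfolding lbracket_coord[OF k]
        by (rule Pk.finprod_multf) (use lbracket_summand c in auto)
      finally show "lbracket L (x \<otimes>\<^bsub>L\<^esub> y) z k = (lbracket L x z \<otimes>\<^bsub>L\<^esub> lbracket L y z) k"
        by (simp add: coord_mult[OF k])
    qed (use c br in auto)
    show "lbracket L x (y \<otimes>\<^bsub>L\<^esub> z) = lbracket L x y \<otimes>\<^bsub>L\<^esub> lbracket L x z"
    proof (rule sum_lie_eqI)
      fix k :: nat assume k: "1 \<le> k"
      interpret Pk: comm_group "P k" by (rule comm_group[OF k])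
      have "lbracket L x (y \<otimes>\<^bsub>L\<^esub> z) k = finprod (P k) (\<lambda>i. b i (k - i) (x i) (y (k - i))
          \<otimes>\<^bsub>P k\<^esub> b i (k - i) (x i) (z (k - i))) {1..<k}"
        unfolding lbracket_coord[OF k]
      proof (rule Pk.finprod_cong'[OF HOL.refl])
        fix i assume i: "i \<in> {1..<k}"
        then have "1 \<le> i" "1 \<le> k - i" "i + (k - i) = k" by auto
        then show "b i (k - i) (x i) ((y \<otimes>\<^bsub>L\<^esub> z) (k - i)) = b i (k - i) (x i) (y (k - i))
          \<otimes>\<^bsub>P k\<^esub> b i (k - i) (x i) (z (k - i))"
          using b_right[of i "k - i" "x i" "y (k - i)" "z (k - i)"] c
          by (simp add: coord_mult sum_lie_coord)
      qed (use lbracket_summand c in auto)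
      also have "\<dots> = lbracket L x y k \<otimes>\<^bsub>P k\<^esub> lbracket L x z k"
        unfolding lbracket_coord[OF k]
        by (rule Pk.finprod_multf) (use lbracket_summand c in auto)
      finally show "lbracket L x (y \<otimes>\<^bsub>L\<^esub> z) k = (lbracket L x y \<otimes>\<^bsub>L\<^esub> lbracket L x z) k"
        by (simp add: coord_mult[OF k])
    qed (use c br in auto)
  next
    fix x assume "x \<in> homogeneous_elements L"
    then obtain i a where x: "1 \<le> i" "a \<in> carrier (P i)" "x = single P i a" by (auto simp: grade_eq)
    then show "lbracket L x x = \<one>\<^bsub>L\<^esub>" by (simp add: lbracket_single b_self single_one)
    fix y assume "y \<in> homogeneous_elements L"
    then obtain j c where y: "1 \<le> j" "c \<in> carrier (P j)" "y = single P j c" by (auto simp: grade_eq)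
    have ij: "1 \<le> i + j" using x(1) by simp
    have "lbracket L x y \<otimes>\<^bsub>L\<^esub> lbracket L y x = single P (i + j) (b i j a c \<otimes>\<^bsub>P (i + j)\<^esub> b j i c a)"
      using x y b_closed[of i j a c] b_closed[of j i c a]
      by (simp add: lbracket_single Group.hom_mult[OF single_hom[OF ij]] add.commute[of j i])
    then show "lbracket L x y \<otimes>\<^bsub>L\<^esub> lbracket L y x = \<one>\<^bsub>L\<^esub>" using x y by (simp add: b_antisym single_one)
    fix z assume "z \<in> homogeneous_elements L"
    then obtain k d where z: "1 \<le> k" "d \<in> carrier (P k)" "z = single P k d" by (auto simp: grade_eq)
    have ijk: "1 \<le> i + j + k" using x(1) by simp
    let ?A = "b i (j + k) a (b j k c d)" and ?B = "b j (k + i) c (b k i d a)"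
      and ?C = "b k (i + j) d (b i j a c)"
    have s: "i + (j + k) = i + j + k" "j + (k + i) = i + j + k" "k + (i + j) = i + j + k" by auto
    have cl: "?A \<in> carrier (P (i + j + k))" "?B \<in> carrier (P (i + j + k))" "?C \<in> carrier (P (i + j + k))"
      using x y z b_closed[of i "j + k" a "b j k c d"] b_closed[of j "k + i" c "b k i d a"]
        b_closed[of k "i + j" d "b i j a c"] b_closed[of i j a c] b_closed[of j k c d] b_closed[of k i d a]
      unfolding s by auto
    have e: "lbracket L x (lbracket L y z) = single P (i + j + k) ?A"
      "lbracket L y (lbracket L z x) = single P (i + j + k) ?B"
      "lbracket L z (lbracket L x y) = single P (i + j + k) ?C"
      using x y z by (simp_all add: lbracket_single b_closed s)
    interpret Pk: comm_group "P (i + j + k)" by (rule comm_group[OF ijk])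
    have "lbracket L x (lbracket L y z) \<otimes>\<^bsub>L\<^esub> lbracket L y (lbracket L z x) \<otimes>\<^bsub>L\<^esub> lbracket L z (lbracket L x y)
        = single P (i + j + k) (?A \<otimes>\<^bsub>P (i + j + k)\<^esub> ?B \<otimes>\<^bsub>P (i + j + k)\<^esub> ?C)"
      unfolding e using cl by (simp add: Group.hom_mult[OF single_hom[OF ijk]])
    then show "lbracket L x (lbracket L y z) \<otimes>\<^bsub>L\<^esub> lbracket L y (lbracket L z x)
        \<otimes>\<^bsub>L\<^esub> lbracket L z (lbracket L x y) = \<one>\<^bsub>L\<^esub>"
      using x y z by (simp add: b_jacobi single_one)
  qed
  show ?thesis
  proof (rule graded_lie_algebraI[OF lr _ _ sum_lie_generate, where p = "\<lambda>k u. single P k (u k)"])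
    fix k :: nat assume k: "1 \<le> k"
    interpret Pk: group "P k" by (rule group_P[OF k])
    interpret s: group_hom "P k" L "single P k"
      using single_hom[OF k] is_group Pk.is_group by (simp add: group_hom_def group_hom_axioms_def)
    show "subgroup (grade L k) L" unfolding grade_eq[OF k] by (rule s.img_is_subgroup)
    show "(\<lambda>u. single P k (u k)) \<in> hom L L" by (rule hom_comp[OF coord_hom[OF k] single_hom[OF k]])
    fix x assume "x \<in> grade L k"
    then show "single P k (x k) = x" using k by (auto simp: grade_eq single_apply)
  next
    fix j k :: nat and x y assume jk: "1 \<le> j" "1 \<le> k" and xy: "x \<in> grade L j" "y \<in> grade L k"
    have "1 \<le> j + k" using jk by simp
    then show "lbracket L x y \<in> grade L (j + k)"
      using xy jk by (auto simp: grade_eq lbracket_single b_closed)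
  next
    fix j k :: nat and x assume "1 \<le> j" "1 \<le> k" "j \<noteq> k" "x \<in> grade L j"
    then show "single P k (x k) = \<one>\<^bsub>L\<^esub>" by (auto simp: grade_eq single_apply single_one)
  qed
qed

end

section \<open>The free Lie algebra\<close>

lemma lie_terms_simps [simp]:
  "Atom x \<in> lie_terms A \<longleftrightarrow> x \<in> carrier A" "Zero \<in> lie_terms A"
  "Plus s t \<in> lie_terms A \<longleftrightarrow> s \<in> lie_terms A \<and> t \<in> lie_terms A"
  "Minus s \<in> lie_terms A \<longleftrightarrow> s \<in> lie_terms A"
  "Bracket s t \<in> lie_terms A \<longleftrightarrow> s \<in> lie_terms A \<and> t \<in> lie_terms A"
  by (auto simp: lie_terms_def)

lemma lie_eq_lie_terms:
  assumes "group A" "lie_eq A s t"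
  shows "s \<in> lie_terms A \<and> t \<in> lie_terms A"
  using assms(2) by induction (use assms(1) in \<open>auto simp: group.is_monoid monoid.m_closed\<close>)

lemma (in lie_ring) lie_eval_closed:
  assumes "h \<in> carrier A \<rightarrow> carrier L" "t \<in> lie_terms A"
  shows "lie_eval L h t \<in> carrier L"
  using assms(2) by (induction t) (use assms(1) in auto)

lemma (in lie_ring) lie_eval_lie_eq:
  assumes "group A" "h \<in> hom A L" "lie_eq A s t"
  shows "lie_eval L h s = lie_eval L h t"
proof -
  have "h \<in> carrier A \<rightarrow> carrier L" using assms(2) by (simp add: hom_def)
  note c = lie_eval_closed[OF this]
  show ?thesis
    using assms(3)
  proof induction
    case (Atom_mult x y)
    then show ?case using assms(2) by (simp add: hom_mult)
  next
    case (comm s t)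
    then show ?case using c by (simp add: m_comm)
  next
    case (assoc r s t)
    then show ?case using c by (simp add: m_assoc)
  qed (use c in \<open>simp_all add: lb_add_left lb_add_right lb_jacobi\<close>)
qed

lemma lie_eval_lie_hom:
  assumes "lie_ring M" "lie_ring N" "f \<in> lie_hom M N" "h \<in> carrier A \<rightarrow> carrier M" "t \<in> lie_terms A"
  shows "f (lie_eval M h t) = lie_eval N (\<lambda>x. f (h x)) t"
proof -
  interpret M: lie_ring M by fact
  interpret N: lie_ring N by fact
  interpret group_hom M N f
    using lie_homD(1)[OF assms(3)] M.is_group N.is_group
    by (simp add: group_hom_def group_hom_axioms_def)
  note c = M.lie_eval_closed[OF assms(4)]
  show ?thesis
    using assms(5) by (induction t) (use c lie_homD(2)[OF assms(3)] in auto)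
qed

lemma lie_eval_cong:
  "(\<And>x. x \<in> carrier A \<Longrightarrow> h x = h' x) \<Longrightarrow> t \<in> lie_terms A \<Longrightarrow> lie_eval M h t = lie_eval M h' t"
  by (induction t) auto

text \<open>Terms of degree 0, such as \<open>Bracket Zero Zero\<close>, evaluate to zero.\<close>

lemma lie_eval_homogeneous:
  assumes "lie_ring M" "\<And>k. 1 \<le> k \<Longrightarrow> subgroup (grade M k) M"
    and "\<And>j k x y. \<lbrakk>1 \<le> j; 1 \<le> k; x \<in> grade M j; y \<in> grade M k\<rbrakk> \<Longrightarrow> lbracket M x y \<in> grade M (j + k)"
    and h: "h \<in> carrier A \<rightarrow> grade M 1"
    and "homogeneous k t" "t \<in> lie_terms A"
  shows "lie_eval M h t \<in> (if k = 0 then {\<one>\<^bsub>M\<^esub>} else grade M k)"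
proof -
  interpret M: lie_ring M by fact
  let ?g = "\<lambda>k. if k = 0 then {\<one>\<^bsub>M\<^esub>} else grade M k"
  have sg: "subgroup (?g k) M" for k using assms(2)[of k] M.triv_subgroup by auto
  have "?g k \<subseteq> carrier M" for k using subgroup.subset[OF sg] .
  then have gc: "x \<in> ?g k \<Longrightarrow> x \<in> carrier M" for x k by blast
  show ?thesis
    using assms(5,6)
  proof induction
    case (1 x)
    then show ?case using h by auto
  next
    case (2 k)
    then show ?case using subgroup.one_closed[OF sg[of k]] by simp
  next
    case (3 k s t)
    then show ?case using subgroup.m_closed[OF sg[of k]] by simp
  next
    case (4 k s)
    then show ?case using subgroup.m_inv_closed[OF sg[of k]] by simp
  next
    case (5 j s k t)
    then have a: "lie_eval M h s \<in> ?g j" "lie_eval M h t \<in> ?g k" by auto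
    then have c: "lie_eval M h s \<in> carrier M" "lie_eval M h t \<in> carrier M" using gc by blast+
    have "lie_eval M h (Bracket s t) \<in> ?g (j + k)"
    proof (cases "j = 0 \<or> k = 0")
      case True
      then have "lbracket M (lie_eval M h s) (lie_eval M h t) = \<one>\<^bsub>M\<^esub>" using a c by auto
      then show ?thesis using subgroup.one_closed[OF sg[of "j + k"]] by (simp only: lie_eval.simps)
    next
      case False
      then show ?thesis using a assms(3)[of j k] by simp
    qed
    then show ?case .
  qed
qed

context
  fixes A :: "('a, 'm) monoid_scheme"
  assumes A: "group A"
begin

abbreviation "FL \<equiv> free_lie A"

lemma lie_class_eq_iff:
  assumes "s \<in> lie_terms A"
  shows "lie_class A s = lie_class A t \<longleftrightarrow> lie_eq A s t"
proof
  show "lie_eq A s t" if "lie_class A s = lie_class A t"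
    using that lie_eq.refl[OF assms] lie_eq.sym by auto
  show "lie_class A s = lie_class A t" if "lie_eq A s t"
    using that lie_eq.sym lie_eq.trans by blast
qed

lemma lie_class_eqI: "lie_eq A s t \<Longrightarrow> lie_class A s = lie_class A t"
  using lie_class_eq_iff lie_eq_lie_terms[OF A] by blast

lemma carrier_free_lie: "carrier FL = lie_class A ` lie_terms A"
  by (simp add: free_lie_def)

lemma lie_class_closed [simp, intro]: "t \<in> lie_terms A \<Longrightarrow> lie_class A t \<in> carrier FL"
  by (simp add: carrier_free_lie)

lemma one_free_lie: "\<one>\<^bsub>FL\<^esub> = lie_class A Zero"
  by (simp add: free_lie_def)

lemma mult_free_lie:
  assumes "s \<in> lie_terms A" "t \<in> lie_terms A"
  shows "lie_class A s \<otimes>\<^bsub>FL\<^esub> lie_class A t = lie_class A (Plus s t)"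
proof -
  have "{r. \<exists>s'\<in>lie_class A s. \<exists>t'\<in>lie_class A t. lie_eq A (Plus s' t') r} = lie_class A (Plus s t)"
    (is "?l = ?r")
  proof
    show "?l \<subseteq> ?r" using lie_eq.Plus_cong lie_eq.trans by blast
    show "?r \<subseteq> ?l" using lie_eq.refl[OF assms(1)] lie_eq.refl[OF assms(2)] by blast
  qed
  then show ?thesis by (simp add: free_lie_def)
qed

lemma lbracket_free_lie:
  assumes "s \<in> lie_terms A" "t \<in> lie_terms A"
  shows "lbracket FL (lie_class A s) (lie_class A t) = lie_class A (Bracket s t)"
proof -
  have "{r. \<exists>s'\<in>lie_class A s. \<exists>t'\<in>lie_class A t. lie_eq A (Bracket s' t') r} = lie_class A (Bracket s t)"
    (is "?l = ?r")
  proof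
    show "?l \<subseteq> ?r" using lie_eq.Bracket_cong lie_eq.trans by blast
    show "?r \<subseteq> ?l" using lie_eq.refl[OF assms(1)] lie_eq.refl[OF assms(2)] by blast
  qed
  then show ?thesis by (simp add: free_lie_def)
qed

lemma lie_ring_free_lie: "lie_ring FL"
proof -
  note e = mult_free_lie lbracket_free_lie
  have "comm_group FL"
  proof (rule comm_groupI)
    fix x y z assume "x \<in> carrier FL" "y \<in> carrier FL" "z \<in> carrier FL"
    then obtain r s t where t: "r \<in> lie_terms A" "s \<in> lie_terms A" "t \<in> lie_terms A"
      "x = lie_class A r" "y = lie_class A s" "z = lie_class A t" by (auto simp: carrier_free_lie)
    show "x \<otimes>\<^bsub>FL\<^esub> y \<otimes>\<^bsub>FL\<^esub> z = x \<otimes>\<^bsub>FL\<^esub> (y \<otimes>\<^bsub>FL\<^esub> z)"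
      using lie_class_eqI[OF lie_eq.assoc[OF t(1-3)]] t by (simp only: e lie_terms_simps simp_thms)
  next
    fix x y assume "x \<in> carrier FL" "y \<in> carrier FL"
    then obtain s t where t: "s \<in> lie_terms A" "t \<in> lie_terms A"
      "x = lie_class A s" "y = lie_class A t" by (auto simp: carrier_free_lie)
    show "x \<otimes>\<^bsub>FL\<^esub> y = y \<otimes>\<^bsub>FL\<^esub> x"
      using lie_class_eqI[OF lie_eq.comm[OF t(1,2)]] t by (simp only: e lie_terms_simps simp_thms)
    show "x \<otimes>\<^bsub>FL\<^esub> y \<in> carrier FL" using t by (simp only: e lie_terms_simps simp_thms lie_class_closed)
  next
    fix x assume "x \<in> carrier FL"
    then obtain t where t: "t \<in> lie_terms A" "x = lie_class A t" by (auto simp: carrier_free_lie)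
    show "\<one>\<^bsub>FL\<^esub> \<otimes>\<^bsub>FL\<^esub> x = x"
      using lie_class_eqI[OF lie_eq.zero[OF t(1)]] t
      by (simp only: e lie_terms_simps simp_thms one_free_lie)
    have "lie_class A (Minus t) \<otimes>\<^bsub>FL\<^esub> x = \<one>\<^bsub>FL\<^esub>"
      using lie_class_eqI[OF lie_eq.minus[OF t(1)]] t
      by (simp only: e lie_terms_simps simp_thms one_free_lie)
    then show "\<exists>y\<in>carrier FL. y \<otimes>\<^bsub>FL\<^esub> x = \<one>\<^bsub>FL\<^esub>"
      using t by (intro bexI[of _ "lie_class A (Minus t)"]) auto
  qed (auto simp: one_free_lie)
  then interpret comm_group FL .
  show ?thesis
  proof
    fix x y z assume "x \<in> carrier FL" "y \<in> carrier FL" "z \<in> carrier FL"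
    then obtain r s t where t: "r \<in> lie_terms A" "s \<in> lie_terms A" "t \<in> lie_terms A"
      "x = lie_class A r" "y = lie_class A s" "z = lie_class A t" by (auto simp: carrier_free_lie)
    show "lbracket FL (x \<otimes>\<^bsub>FL\<^esub> y) z = lbracket FL x z \<otimes>\<^bsub>FL\<^esub> lbracket FL y z"
      using lie_class_eqI[OF lie_eq.add_left[OF t(1-3)]] t by (simp only: e lie_terms_simps simp_thms)
    show "lbracket FL x (y \<otimes>\<^bsub>FL\<^esub> z) = lbracket FL x y \<otimes>\<^bsub>FL\<^esub> lbracket FL x z"
      using lie_class_eqI[OF lie_eq.add_right[OF t(1-3)]] t by (simp only: e lie_terms_simps simp_thms)
    show "lbracket FL x (lbracket FL y z) \<otimes>\<^bsub>FL\<^esub> lbracket FL y (lbracket FL z x)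
        \<otimes>\<^bsub>FL\<^esub> lbracket FL z (lbracket FL x y) = \<one>\<^bsub>FL\<^esub>"
      using lie_class_eqI[OF lie_eq.jacobi[OF t(1-3)]] t
      by (simp only: e lie_terms_simps simp_thms one_free_lie)
  next
    fix x y assume "x \<in> carrier FL" "y \<in> carrier FL"
    then obtain s t where t: "s \<in> lie_terms A" "t \<in> lie_terms A"
      "x = lie_class A s" "y = lie_class A t" by (auto simp: carrier_free_lie)
    show "lbracket FL x y \<in> carrier FL" using t by (simp only: e lie_terms_simps simp_thms lie_class_closed)
    show "lbracket FL x x = \<one>\<^bsub>FL\<^esub>"
      using lie_class_eqI[OF lie_eq.self[OF t(1)]] t
      by (simp only: e lie_terms_simps simp_thms one_free_lie)
  qed
qed

lemma lie_class_Minus: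
  assumes "t \<in> lie_terms A"
  shows "lie_class A (Minus t) = inv\<^bsub>FL\<^esub> (lie_class A t)"
proof -
  interpret lie_ring FL by (rule lie_ring_free_lie)
  have "lie_class A (Minus t) \<otimes>\<^bsub>FL\<^esub> lie_class A t = \<one>\<^bsub>FL\<^esub>"
    using lie_class_eqI[OF lie_eq.minus[OF assms]] assms by (simp only: mult_free_lie lie_terms_simps one_free_lie)
  then show ?thesis using assms by (intro inv_equality[symmetric]) auto
qed

lemma Atom_hom: "(\<lambda>x. lie_class A (Atom x)) \<in> hom A FL"
  by (rule homI) (simp_all add: mult_free_lie lie_class_eqI[OF lie_eq.Atom_mult])

lemma lie_eval_free_lie:
  assumes "t \<in> lie_terms A"
  shows "lie_eval FL (\<lambda>x. lie_class A (Atom x)) t = lie_class A t"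
  using assms by (induction t) (simp_all add: one_free_lie mult_free_lie lie_class_Minus lbracket_free_lie)

lemma grade_free_lie: "grade FL k = lie_class A ` {t \<in> lie_terms A. homogeneous k t}"
  by (simp add: free_lie_def)

lemma subgroup_grade_free_lie: "subgroup (grade FL k) FL"
proof -
  interpret lie_ring FL by (rule lie_ring_free_lie)
  show ?thesis
  proof (rule subgroupI)
    fix x y assume "x \<in> grade FL k" "y \<in> grade FL k"
    then obtain s t where t: "s \<in> lie_terms A" "t \<in> lie_terms A" "homogeneous k s" "homogeneous k t"
      "x = lie_class A s" "y = lie_class A t" by (auto simp: grade_free_lie)
    show "inv\<^bsub>FL\<^esub> x \<in> grade FL k"
      using t by (auto simp: grade_free_lie simp flip: lie_class_Minus intro!: image_eqI[OF HOL.refl] homogeneous.intros)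
    show "x \<otimes>\<^bsub>FL\<^esub> y \<in> grade FL k"
      using t by (auto simp: grade_free_lie mult_free_lie intro!: image_eqI[OF HOL.refl] homogeneous.intros)
  next
    have "lie_class A Zero \<in> grade FL k"
      unfolding grade_free_lie by (intro imageI) (simp add: homogeneous.intros)
    then show "grade FL k \<noteq> {}" by blast
  qed (auto simp: grade_free_lie)
qed

lemma lbracket_grade_free_lie:
  assumes "x \<in> grade FL j" "y \<in> grade FL k"
  shows "lbracket FL x y \<in> grade FL (j + k)"
proof -
  obtain s t where t: "s \<in> lie_terms A" "t \<in> lie_terms A" "homogeneous j s" "homogeneous k t"
      "x = lie_class A s" "y = lie_class A t" using assms by (auto simp: grade_free_lie)
  then show ?thesis
    by (auto simp: grade_free_lie lbracket_free_lie intro!: image_eqI[OF HOL.refl] homogeneous.intros)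
qed

text \<open>Induction on terms. For brackets the generated subgroup has to be closed under the
  bracket, which by additivity in each argument is a matter of homogeneous elements.\<close>

lemma free_lie_generate: "carrier FL \<subseteq> generate FL (homogeneous_elements FL)"
proof
  interpret lie_ring FL by (rule lie_ring_free_lie)
  let ?H = "homogeneous_elements FL"
  have gc: "grade FL k \<subseteq> carrier FL" for k by (rule subgroup.subset[OF subgroup_grade_free_lie])
  then have hc: "?H \<subseteq> carrier FL" by blast
  note sg = generate_is_subgroup[OF hc]
  have 1: "lbracket FL x y \<in> generate FL ?H" if x: "x \<in> ?H" and y: "y \<in> ?H" for x y
  proof -
    obtain j where j: "1 \<le> j" "x \<in> grade FL j" using x by auto
    obtain k where k: "1 \<le> k" "y \<in> grade FL k" using y by auto
    have "lbracket FL x y \<in> ?H"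
      using lbracket_grade_free_lie[OF j(2) k(2)] j by (auto intro!: bexI[of _ "j + k"])
    then show ?thesis by (rule generate.incl)
  qed
  have 2: "lbracket FL x y \<in> generate FL ?H" if "x \<in> generate FL ?H" "y \<in> ?H" for x y
    by (rule hom_generate_closed[OF is_group is_group lb_hom_left hc sg _ that(1)])
       (use 1 that hc in auto)
  have 3: "lbracket FL x y \<in> generate FL ?H" if "x \<in> generate FL ?H" "y \<in> generate FL ?H" for x y
    by (rule hom_generate_closed[OF is_group is_group lb_hom_right hc sg _ that(2)])
       (use 2 that generate_in_carrier[OF hc] in auto)
  fix x assume "x \<in> carrier FL"
  then obtain t where t: "t \<in> lie_terms A" "x = lie_class A t" by (auto simp: carrier_free_lie)
  have "lie_class A t \<in> generate FL ?H" using t(1)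
  proof (induction t)
    case (Atom x)
    then have "lie_class A (Atom x) \<in> grade FL 1"
      unfolding grade_free_lie by (intro imageI) (simp add: homogeneous.intros)
    then show ?case by (intro generate.incl) auto
  next
    case Zero
    then show ?case using generate.one[of FL] by (simp add: one_free_lie)
  next
    case (Plus s t)
    then show ?case using generate.eng[of _ FL ?H] by (simp flip: mult_free_lie)
  next
    case (Minus t)
    then show ?case using generate_m_inv_closed[OF hc] by (simp add: lie_class_Minus)
  next
    case (Bracket s t)
    then show ?case using 3 by (simp flip: lbracket_free_lie)
  qed
  then show "x \<in> generate FL ?H" using t by simp
qed

text \<open>The projections onto the homogeneous parts come from evaluating terms in the direct sum
  of the homogeneous parts, which is graded by construction.\<close>

theorem graded_lie_algebra_free_lie: "graded_lie_algebra FL"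
proof -
  interpret lie_ring FL by (rule lie_ring_free_lie)
  define P where "P k = \<lparr>carrier = grade FL k, monoid.mult = (\<otimes>\<^bsub>FL\<^esub>), one = \<one>\<^bsub>FL\<^esub>\<rparr>" for k
  have Ps: "carrier (P k) = grade FL k" "monoid.mult (P k) = (\<otimes>\<^bsub>FL\<^esub>)" "\<one>\<^bsub>P k\<^esub> = \<one>\<^bsub>FL\<^esub>" for k
    by (simp_all add: P_def)
  have gc: "grade FL k \<subseteq> carrier FL" for k by (rule subgroup.subset[OF subgroup_grade_free_lie])
  have gcD: "x \<in> carrier FL" if "x \<in> grade FL k" for x k using that gc by blast
  have Pg: "comm_group (P k)" for k
  proof (rule comm_groupI)
    interpret subgroup "grade FL k" FL by (rule subgroup_grade_free_lie)
    fix x assume "x \<in> carrier (P k)"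
    then show "\<exists>y\<in>carrier (P k). y \<otimes>\<^bsub>P k\<^esub> x = \<one>\<^bsub>P k\<^esub>"
      by (intro bexI[of _ "inv\<^bsub>FL\<^esub> x"]) (auto simp: Ps)
    fix y assume "y \<in> carrier (P k)"
    then show "x \<otimes>\<^bsub>P k\<^esub> y = y \<otimes>\<^bsub>P k\<^esub> x" using \<open>x \<in> carrier (P k)\<close> by (simp add: Ps m_comm gcD)
  qed (use subgroup_grade_free_lie[of k] in \<open>auto simp: Ps m_assoc gcD subgroup.m_closed subgroup.one_closed\<close>)
  interpret D: graded_pieces P "\<lambda>_ _. lbracket FL"
  proof (rule graded_pieces.intro)
    fix i j k :: nat and x y z
    assume "x \<in> carrier (P i)" "y \<in> carrier (P j)" "z \<in> carrier (P k)"
    then show "lbracket FL x (lbracket FL y z) \<otimes>\<^bsub>P (i + j + k)\<^esub> lbracket FL y (lbracket FL z x)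
           \<otimes>\<^bsub>P (i + j + k)\<^esub> lbracket FL z (lbracket FL x y) = \<one>\<^bsub>P (i + j + k)\<^esub>"
      by (auto simp: Ps lb_jacobi dest!: gcD)
  qed (simp_all add: Pg, simp_all add: Ps lbracket_grade_free_lie lb_add_left lb_add_right lb_antisym gcD)
  interpret DG: graded_lie_algebra D.L by (rule D.graded_lie_algebra_sum_lie)
  define h where "h x = single P 1 (lie_class A (Atom x))" for x
  have at: "lie_class A (Atom x) \<in> grade FL 1" if "x \<in> carrier A" for x
    unfolding grade_free_lie using that by (intro imageI) (simp add: homogeneous.intros)
  have "(\<lambda>x. lie_class A (Atom x)) \<in> hom A (P 1)"
    using Atom_hom at by (simp add: hom_def Ps Pi_iff)
  then have hh: "h \<in> hom A D.L" unfolding h_def by (rule hom_comp) (rule D.single_hom, simp)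
  then have hc: "h \<in> carrier A \<rightarrow> carrier D.L" by (simp add: hom_def)
  note ev = DG.lie_eval_lie_eq[OF A hh] and ev_closed = DG.lie_eval_closed[OF hc]
  have coord: "x k \<in> grade FL k" if "x \<in> carrier D.L" "1 \<le> k" for x k
    using D.sum_lie_coord[OF that] by (simp add: Ps)
  \<comment> \<open>The direct sum is a Lie ring, so evaluation in it respects \<open>lie_eq\<close>
    and its coordinates are well defined on classes.\<close>
  define p where "p k = induced_map (\<lambda>t. lie_eval D.L h t k)" for k
  have p: "p k (lie_class A t) = lie_eval D.L h t k" if "t \<in> lie_terms A" for k t
    unfolding p_def by (rule induced_map_eq) (use that ev lie_eq.refl[OF that] in auto)
  \<comment> \<open>The direct sum has no summand of degree 0, yet terms of degree 0 occur inside
    brackets of positive degree; they vanish on both sides.\<close>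
  have hom: "lie_class A t = \<one>\<^bsub>FL\<^esub> \<and> lie_eval D.L h t = \<one>\<^bsub>D.L\<^esub>" if "k = 0" "homogeneous k t" "t \<in> lie_terms A" for k t
  proof -
    have "lie_eval FL (\<lambda>x. lie_class A (Atom x)) t \<in> {\<one>\<^bsub>FL\<^esub>}"
      using lie_eval_homogeneous[OF lie_ring_free_lie subgroup_grade_free_lie lbracket_grade_free_lie _ that(2,3)] at that by auto
    moreover have "lie_eval D.L h t \<in> {\<one>\<^bsub>D.L\<^esub>}"
    proof -
      have "h \<in> carrier A \<rightarrow> grade D.L 1" using at by (auto simp: h_def D.grade_eq Ps)
      from lie_eval_homogeneous[OF DG.lie_ring DG.grade_subgroup DG.grade_lbracket this that(2,3)]
      show ?thesis using that(1) by auto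
    qed
    ultimately show ?thesis using lie_eval_free_lie[OF that(3)] by auto
  qed
  \<comment> \<open>Evaluation puts the class of a homogeneous term into its own degree; this is
    exactly what the projections have to satisfy.\<close>
  have single: "lie_eval D.L h t = single P k (lie_class A t)" if "homogeneous k t" "t \<in> lie_terms A" "1 \<le> k" for k t
    using that
  proof induction
    case (1 x)
    then show ?case by (simp add: h_def)
  next
    case (2 k)
    then show ?case using D.single_one[of k] by (simp add: Ps one_free_lie)
  next
    case (3 k s t)
    then have "lie_class A s \<in> carrier (P k)" "lie_class A t \<in> carrier (P k)"
      by (auto simp: Ps grade_free_lie)
    then show ?case
      using 3 hom_mult[OF D.single_hom[of k], of "lie_class A s" "lie_class A t"] mult_free_lie[of s t]
      by (simp add: Ps)
  next
    case (4 k s)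
    interpret Pk: comm_group "P k" by (rule Pg)
    interpret s: group_hom "P k" D.L "single P k"
      using D.single_hom[of k] 4 Pk.is_group DG.is_group by (simp add: group_hom_def group_hom_axioms_def)
    have c: "lie_class A s \<in> carrier (P k)" using 4 by (auto simp: Ps grade_free_lie)
    have "inv\<^bsub>P k\<^esub> (lie_class A s) = inv\<^bsub>FL\<^esub> (lie_class A s)"
      by (rule Pk.inv_equality)
         (use c subgroup.m_inv_closed[OF subgroup_grade_free_lie[of k]] gcD in \<open>auto simp: Ps\<close>)
    then show ?case using 4 s.hom_inv[OF c] by (simp add: lie_class_Minus)
  next
    case (5 j s k t)
    have cs: "lie_class A s \<in> grade FL j" "lie_class A t \<in> grade FL k"
      using 5 by (auto simp: grade_free_lie)
    show ?case
    proof (cases "j = 0 \<or> k = 0")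
      case True
      then have "lie_class A (Bracket s t) = \<one>\<^bsub>FL\<^esub>" "lie_eval D.L h (Bracket s t) = \<one>\<^bsub>D.L\<^esub>"
        using hom[of j s] hom[of k t] 5 cs gcD ev_closed[of s] ev_closed[of t]
        by (auto simp flip: lbracket_free_lie)
      then show ?thesis using D.single_one[of "j + k"] by (simp add: Ps)
    next
      case False
      then show ?thesis using 5 cs D.lbracket_single[of j k] by (simp add: Ps lbracket_free_lie)
    qed
  qed
  show ?thesis
  proof (rule graded_lie_algebraI[OF lie_ring_free_lie subgroup_grade_free_lie
        lbracket_grade_free_lie free_lie_generate, where p = p])
    fix k :: nat assume k: "1 \<le> k"
    show "p k \<in> hom FL FL"
    proof (rule homI)
      fix x y assume "x \<in> carrier FL" "y \<in> carrier FL"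
      then obtain s t where t: "s \<in> lie_terms A" "t \<in> lie_terms A"
        "x = lie_class A s" "y = lie_class A t" by (auto simp: carrier_free_lie)
      show "p k x \<in> carrier FL" using t k gcD[OF coord[OF ev_closed[OF t(1)] k]] by (simp add: p)
      show "p k (x \<otimes>\<^bsub>FL\<^esub> y) = p k x \<otimes>\<^bsub>FL\<^esub> p k y"
        using t k by (simp add: p mult_free_lie D.sum_lie_simps Ps)
    qed
    fix x assume "x \<in> grade FL k"
    then obtain t where "t \<in> lie_terms A" "homogeneous k t" "x = lie_class A t" by (auto simp: grade_free_lie)
    then show "p k x = x" using k by (simp add: p single D.single_apply)
  next
    fix j k :: nat and x assume jk: "1 \<le> j" "1 \<le> k" "j \<noteq> k" and "x \<in> grade FL j"
    then obtain t where "t \<in> lie_terms A" "homogeneous j t" "x = lie_class A t" by (auto simp: grade_free_lie)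
    then show "p k x = \<one>\<^bsub>FL\<^esub>" using jk by (simp add: p single D.single_apply Ps)
  qed
qed

lemma lie_extend_class:
  assumes "lie_ring M" "h \<in> hom A M" "t \<in> lie_terms A"
  shows "lie_extend M h (lie_class A t) = lie_eval M h t"
  unfolding lie_extend_def
  by (rule induced_map_eq)
     (use assms lie_ring.lie_eval_lie_eq[OF assms(1) A assms(2)] lie_eq.refl[OF assms(3)] in auto)

lemma lie_extend_hom:
  assumes "graded_lie_algebra M" "h \<in> hom A M" "h \<in> carrier A \<rightarrow> grade M 1"
  shows "lie_extend M h \<in> graded_lie_hom FL M"
proof -
  interpret M: graded_lie_algebra M by fact
  have hc: "h \<in> carrier A \<rightarrow> carrier M" using assms(2) by (simp add: hom_def)
  note ex = lie_extend_class[OF M.lie_ring assms(2)]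
  show ?thesis
    unfolding graded_lie_hom_def
  proof (intro CollectI conjI ballI allI impI homI)
    fix x y assume "x \<in> carrier FL" "y \<in> carrier FL"
    then obtain s t where t: "s \<in> lie_terms A" "t \<in> lie_terms A"
        "x = lie_class A s" "y = lie_class A t" by (auto simp: carrier_free_lie)
    show "lie_extend M h x \<in> carrier M" using t M.lie_eval_closed[OF hc] by (simp add: ex)
    show "lie_extend M h (x \<otimes>\<^bsub>FL\<^esub> y) = lie_extend M h x \<otimes>\<^bsub>M\<^esub> lie_extend M h y"
      using t by (simp add: ex mult_free_lie)
    show "lie_extend M h (lbracket FL x y) = lbracket M (lie_extend M h x) (lie_extend M h y)"
      using t by (simp add: ex lbracket_free_lie)
  next
    fix k :: nat assume "1 \<le> k"
    then show "lie_extend M h ` grade FL k \<subseteq> grade M k"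
      using lie_eval_homogeneous[OF M.lie_ring M.grade_subgroup M.grade_lbracket assms(3)]
      by (force simp: grade_free_lie ex)
  qed
qed

end

section \<open>The lower central series\<close>

context group
begin

lemma cancel_simps:
  assumes "x \<in> carrier G" "y \<in> carrier G"
  shows "inv x \<otimes> (x \<otimes> y) = y" "x \<otimes> (inv x \<otimes> y) = y"
  using assms by (simp_all flip: m_assoc)

text \<open>Bracketing to the right, distributing inverses and cancelling neighbours: rewriting that
  proves identities of words valid in every group.\<close>

lemmas word_simps = m_assoc inv_mult_group cancel_simps

lemma commutator_closed: "\<lbrakk>x \<in> carrier G; y \<in> carrier G\<rbrakk> \<Longrightarrow> commutator G x y \<in> carrier G"
  by simp

lemma conj_commutator:
  assumes "g \<in> carrier G" "x \<in> carrier G" "y \<in> carrier G"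
  shows "g \<otimes> commutator G x y \<otimes> inv g = commutator G (g \<otimes> x \<otimes> inv g) (g \<otimes> y \<otimes> inv g)"
  using assms by (simp add: word_simps)

lemma inv_commutator:
  assumes "x \<in> carrier G" "y \<in> carrier G"
  shows "inv (commutator G x y) = commutator G y x"
  using assms by (simp add: word_simps)

lemma commutator_mult_left:
  assumes "x \<in> carrier G" "x' \<in> carrier G" "y \<in> carrier G"
  shows "commutator G (x \<otimes> x') y = x \<otimes> commutator G x' y \<otimes> inv x \<otimes> commutator G x y"
  using assms by (simp add: word_simps)

lemma commutator_mult_right:
  assumes "x \<in> carrier G" "y \<in> carrier G" "y' \<in> carrier G"
  shows "commutator G x (y \<otimes> y') = commutator G x y \<otimes> (y \<otimes> commutator G x y' \<otimes> inv y)"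
  using assms by (simp add: word_simps)

lemma commutator_inv_right:
  assumes "x \<in> carrier G" "y \<in> carrier G"
  shows "commutator G x (inv y) = inv y \<otimes> inv (commutator G x y) \<otimes> inv (inv y)"
  using assms by (simp add: word_simps)

text \<open>The conjugations are confined to the outer entries. Modulo the next term of the lower
  central series they disappear, and the Jacobi identity is left.\<close>

lemma Hall_Witt:
  assumes "x \<in> carrier G" "y \<in> carrier G" "z \<in> carrier G"
  shows "commutator G (commutator G x y) (y \<otimes> z \<otimes> inv y)
      \<otimes> commutator G (commutator G y z) (z \<otimes> x \<otimes> inv z)
      \<otimes> commutator G (commutator G z x) (x \<otimes> y \<otimes> inv x) = \<one>"
  using assms by (simp add: word_simps)

text \<open>Being a subgroup, this set contains a generated group as soon as it contains the
  generators; so commutators with \<open>X\<close> need to be tested on generators only.\<close>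

lemma subgroup_commutator_in_normal:
  assumes "N \<lhd> G" "X \<subseteq> carrier G"
  shows "subgroup {z \<in> carrier G. \<forall>x\<in>X. commutator G x z \<in> N} G"
proof -
  interpret N: normal N G by fact
  show ?thesis
  proof (rule subgroupI)
    have "commutator G x \<one> = \<one>" if "x \<in> X" for x using that assms(2) by auto
    then show "{z \<in> carrier G. \<forall>x\<in>X. commutator G x z \<in> N} \<noteq> {}"
      using N.one_closed by (auto intro!: exI[of _ \<one>])
    show "inv z \<in> {z \<in> carrier G. \<forall>x\<in>X. commutator G x z \<in> N}"
      if z: "z \<in> {z \<in> carrier G. \<forall>x\<in>X. commutator G x z \<in> N}" for z
    proof -
      have zc: "z \<in> carrier G" using z by simp
      have "commutator G x (inv z) \<in> N" if "x \<in> X" for x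
        unfolding commutator_inv_right[OF subsetD[OF assms(2) that] zc]
        using z that by (intro N.inv_op_closed2 N.m_inv_closed) auto
      then show ?thesis using zc by simp
    qed
    show "z \<otimes> w \<in> {z \<in> carrier G. \<forall>x\<in>X. commutator G x z \<in> N}"
      if z: "z \<in> {z \<in> carrier G. \<forall>x\<in>X. commutator G x z \<in> N}"
        and w: "w \<in> {z \<in> carrier G. \<forall>x\<in>X. commutator G x z \<in> N}" for z w
    proof -
      have zc: "z \<in> carrier G" "w \<in> carrier G" using z w by simp_all
      have "commutator G x (z \<otimes> w) \<in> N" if "x \<in> X" for x
        unfolding commutator_mult_right[OF subsetD[OF assms(2) that] zc]
        using z w that by (intro N.m_closed[of "commutator G x z"] N.inv_op_closed2) auto
      then show ?thesis using zc by simp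
    qed
  qed auto
qed

lemma lower_central_1 [simp]: "lower_central G 1 = carrier G"
  using lower_central.simps(2)[of G 0] by (simp add: One_nat_def)

lemma lower_central_Suc:
  "1 \<le> k \<Longrightarrow> lower_central G (Suc k) =
    generate G {commutator G x y | x y. x \<in> lower_central G k \<and> y \<in> carrier G}"
  by simp

declare lower_central.simps(2) [simp del]

lemma lower_central_normal: "lower_central G k \<lhd> G"
proof (induction k)
  case 0
  then show ?case by (simp add: normal_self)
next
  case (Suc k)
  show ?case
  proof (cases "k = 0")
    case True
    then show ?thesis by (simp add: normal_self lower_central.simps(2))
  next
    case False
    interpret normal "lower_central G k" G by (rule Suc)
    have "lower_central G (Suc k) = generate G {commutator G x y | x y. x \<in> lower_central G k \<and> y \<in> carrier G}"
      using False by (simp add: lower_central.simps(2))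
    also have "\<dots> \<lhd> G"
    proof (rule normal_generateI)
      fix h g assume "h \<in> {commutator G x y | x y. x \<in> lower_central G k \<and> y \<in> carrier G}" and g: "g \<in> carrier G"
      then obtain x y where h: "h = commutator G x y" and xy: "x \<in> lower_central G k" "y \<in> carrier G"
        by blast
      have "x \<in> carrier G" using xy subset by blast
      then have "g \<otimes> h \<otimes> inv g = commutator G (g \<otimes> x \<otimes> inv g) (g \<otimes> y \<otimes> inv g)"
        unfolding h using conj_commutator g xy by blast
      moreover have "g \<otimes> x \<otimes> inv g \<in> lower_central G k" by (rule inv_op_closed2[OF g xy(1)])
      moreover have "g \<otimes> y \<otimes> inv g \<in> carrier G" using g xy by simp
      ultimately show "g \<otimes> h \<otimes> inv g \<in> {commutator G x y | x y. x \<in> lower_central G k \<and> y \<in> carrier G}"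
        by blast
    qed (use subset in auto)
    finally show ?thesis .
  qed
qed

lemma lower_central_subgroup: "subgroup (lower_central G k) G"
  by (rule normal_imp_subgroup[OF lower_central_normal])

lemma lower_central_carrier: "x \<in> lower_central G k \<Longrightarrow> x \<in> carrier G"
  using subgroup.subset[OF lower_central_subgroup] by blast

lemma lower_central_conj:
  "\<lbrakk>g \<in> carrier G; x \<in> lower_central G k\<rbrakk> \<Longrightarrow> g \<otimes> x \<otimes> inv g \<in> lower_central G k"
  by (rule normal.inv_op_closed2[OF lower_central_normal])

lemma lower_central_closed:
  "\<lbrakk>x \<in> lower_central G k; y \<in> lower_central G k\<rbrakk> \<Longrightarrow> x \<otimes> y \<in> lower_central G k"
  "x \<in> lower_central G k \<Longrightarrow> inv x \<in> lower_central G k"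
  "\<one> \<in> lower_central G k"
  using lower_central_subgroup[of k]
  by (simp_all add: subgroup.m_closed subgroup.m_inv_closed subgroup.one_closed)

lemma commutator_lower_central_Suc:
  assumes "1 \<le> k" "x \<in> lower_central G k" "y \<in> carrier G"
  shows "commutator G x y \<in> lower_central G (Suc k)"
  unfolding lower_central_Suc[OF assms(1)] using assms by (intro generate.incl) blast

text \<open>The three subgroups argument. \<open>\<Gamma>\<^sub>j\<^sub>+\<^sub>1\<close> is
  generated by commutators of \<open>y\<close> in \<open>\<Gamma>\<^sub>j\<close> with
  \<open>g\<close> in the group, and the Hall-Witt identity expresses the commutator of such an
  element with \<open>x\<close> by two others, to which the induction hypothesis applies at
  \<open>i\<close> and at \<open>i + 1\<close>. Hence the induction on \<open>j\<close> for all
  \<open>i\<close>.\<close>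

lemma commutator_lower_central:
  assumes "1 \<le> i" "1 \<le> j" "x \<in> lower_central G i" "y \<in> lower_central G j"
  shows "commutator G x y \<in> lower_central G (i + j)"
  using assms(2,1,3,4)
proof (induction j arbitrary: i x y rule: nat_induct_at_least)
  case base
  then show ?case
    using commutator_lower_central_Suc[of i x y] lower_central_carrier[of y 1] by (simp flip: Suc_eq_plus1)
next
  case (Suc j)
  let ?N = "lower_central G (i + Suc j)"
  note N = lower_central_normal[of "i + Suc j"]
  let ?Z = "{z \<in> carrier G. \<forall>x\<in>lower_central G i. commutator G x z \<in> ?N}"
  have X: "lower_central G i \<subseteq> carrier G" using lower_central_carrier by blast
  have "lower_central G (Suc j) \<subseteq> ?Z"
    unfolding lower_central_Suc[OF Suc.hyps]
  proof (rule generate_subgroup_incl[OF _ subgroup_commutator_in_normal[OF N X]])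
    show "{commutator G x y | x y. x \<in> lower_central G j \<and> y \<in> carrier G} \<subseteq> ?Z"
    proof
      fix z assume "z \<in> {commutator G x y | x y. x \<in> lower_central G j \<and> y \<in> carrier G}"
      then obtain y g where z: "z = commutator G y g" and y: "y \<in> lower_central G j" and g: "g \<in> carrier G"
        by blast
      have yc: "y \<in> carrier G" using y by (rule lower_central_carrier)
      have "commutator G x z \<in> ?N" if x: "x \<in> lower_central G i" for x
      proof -
        have xc: "x \<in> carrier G" using x by (rule lower_central_carrier)
        \<comment> \<open>Chosen so that the outer entry of the middle factor in
          \<open>Hall_Witt\<close>, which is \<open>w\<close> conjugated by \<open>g\<close>,
          becomes \<open>x\<close>.\<close>
        define w where "w = inv g \<otimes> x \<otimes> g"
        have w: "w \<in> lower_central G i"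
          using lower_central_conj[of "inv g" x i] g x by (simp add: w_def)
        have wc: "w \<in> carrier G" using w by (rule lower_central_carrier)
        have gw: "g \<otimes> w \<otimes> inv g = x" using g xc by (simp add: w_def word_simps)
        let ?a = "commutator G (commutator G w y) (y \<otimes> g \<otimes> inv y)"
          and ?b = "commutator G z x"
          and ?c = "commutator G (commutator G g w) (w \<otimes> y \<otimes> inv w)"
        have a: "?a \<in> ?N"
          using commutator_lower_central_Suc[of "i + j" "commutator G w y" "y \<otimes> g \<otimes> inv y"]
            Suc.IH[OF Suc.prems(1) w y] Suc.hyps yc g by simp
        have "commutator G w g \<in> lower_central G (Suc i)"
          by (rule commutator_lower_central_Suc[OF Suc.prems(1) w g])
        then have "commutator G g w \<in> lower_central G (Suc i)"
          using lower_central_closed(2) inv_commutator[OF wc g] by metis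
        then have c: "?c \<in> ?N"
          using Suc.IH[OF _ _ lower_central_conj[OF wc y], of "Suc i" "commutator G g w"] by simp
        have cl: "?a \<in> carrier G" "?b \<in> carrier G" "?c \<in> carrier G"
          using wc yc g xc by (simp_all add: z)
        have "?a \<otimes> ?b \<otimes> ?c = \<one>"
          using Hall_Witt[OF wc yc g] by (simp only: z gw)
        then have "?a \<otimes> ?b = inv ?c" using cl by (intro inv_equality[symmetric]) auto
        then have "?b = inv ?a \<otimes> inv ?c" using cl by (metis inv_solve_left inv_closed m_closed)
        then have "?b \<in> ?N" using a c lower_central_closed by simp
        moreover have "commutator G x z = inv ?b"
          using inv_commutator[of z x] xc yc g by (simp add: z)
        ultimately show ?thesis using lower_central_closed(2) by simp
      qed
      then show "z \<in> ?Z" using yc g z by simp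
    qed
  qed
  then show ?case using Suc.prems by blast
qed

lemma lower_central_Suc_subset: "lower_central G (Suc k) \<subseteq> lower_central G k"
proof (cases "k = 0")
  case False
  show ?thesis
  proof -
    have "{commutator G x y | x y. x \<in> lower_central G k \<and> y \<in> carrier G} \<subseteq> lower_central G k"
    proof clarify
      fix x y assume x: "x \<in> lower_central G k" and y: "y \<in> carrier G"
      have "commutator G x y = x \<otimes> (y \<otimes> inv x \<otimes> inv y)"
        using lower_central_carrier[OF x] y by (simp add: m_assoc)
      then show "commutator G x y \<in> lower_central G k"
        using lower_central_closed lower_central_conj x y by simp
    qed
    then show ?thesis using False lower_central_subgroup
      by (simp add: lower_central.simps(2) generate_subgroup_incl)
  qed
qed (auto simp: lower_central_carrier)

text \<open>The index is the degree, so the modulus lies one step deeper. Outside of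
  \<open>\<Gamma>\<^sub>k\<close> the same notation stands for an element of the quotient group by
  \<open>\<Gamma>\<^sub>k\<^sub>+\<^sub>1\<close>.\<close>

abbreviation cls :: "nat \<Rightarrow> 'a \<Rightarrow> 'a set" where
  "cls k x \<equiv> lower_central G (Suc k) #> x"

lemma cls_mult:
  "\<lbrakk>x \<in> carrier G; y \<in> carrier G\<rbrakk> \<Longrightarrow> cls k x <#> cls k y = cls k (x \<otimes> y)"
  by (rule normal.rcos_sum[OF lower_central_normal])

lemma cls_one: "cls k \<one> = lower_central G (Suc k)"
  using coset_mult_one lower_central_carrier by blast

lemma cls_eq_one: "x \<in> lower_central G (Suc k) \<Longrightarrow> cls k x = lower_central G (Suc k)"
  by (rule subgroup.rcos_const[OF lower_central_subgroup is_group])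

lemma cls_eq_oneD: "\<lbrakk>cls k x = lower_central G (Suc k); x \<in> carrier G\<rbrakk> \<Longrightarrow> x \<in> lower_central G (Suc k)"
  using rcos_self[OF _ lower_central_subgroup] by blast

lemma gr_part_simps:
  "carrier (gr_part G k) = cls k ` lower_central G k"
  "monoid.mult (gr_part G k) = (<#>)"
  "\<one>\<^bsub>gr_part G k\<^esub> = lower_central G (Suc k)"
  by (simp_all add: gr_part_def carrier_FactGroup fun_eq_iff)

lemma one_gr_part: "\<one>\<^bsub>gr_part G k\<^esub> = cls k \<one>"
  by (simp add: gr_part_simps cls_one)

text \<open>\<open>\<Gamma>\<^sub>k\<close> is central modulo
  \<open>\<Gamma>\<^sub>k\<^sub>+\<^sub>1\<close>.\<close>

lemma cls_commute:
  assumes "1 \<le> k" "x \<in> lower_central G k" "y \<in> carrier G"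
  shows "cls k (x \<otimes> y) = cls k (y \<otimes> x)"
proof -
  have c: "x \<in> carrier G" using assms lower_central_carrier by blast
  have "commutator G x y \<in> lower_central G (Suc k)"
    using commutator_lower_central_Suc[OF assms] .
  then have "cls k (commutator G x y) = cls k \<one>" by (simp add: cls_eq_one cls_one)
  then have "cls k (commutator G x y) <#> cls k (y \<otimes> x) = cls k \<one> <#> cls k (y \<otimes> x)" by simp
  then have "cls k (commutator G x y \<otimes> (y \<otimes> x)) = cls k (y \<otimes> x)"
    using c assms(3) by (simp add: cls_mult)
  then show ?thesis using c assms(3) by (simp add: word_simps)
qed

lemma cls_conj:
  assumes "1 \<le> k" "x \<in> lower_central G k" "y \<in> carrier G"
  shows "cls k (y \<otimes> x \<otimes> inv y) = cls k x"
proof -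
  have c: "x \<in> carrier G" using assms lower_central_carrier by blast
  have "cls k (y \<otimes> x \<otimes> inv y) = cls k (y \<otimes> x) <#> cls k (inv y)" using c assms(3) by (simp add: cls_mult)
  also have "\<dots> = cls k (x \<otimes> y) <#> cls k (inv y)" using cls_commute[OF assms] by simp
  also have "\<dots> = cls k x" using c assms(3) by (simp add: cls_mult word_simps)
  finally show ?thesis .
qed

lemma comm_group_gr_part:
  assumes "1 \<le> k"
  shows "comm_group (gr_part G k)"
proof (rule comm_groupI)
  fix X Y assume "X \<in> carrier (gr_part G k)" "Y \<in> carrier (gr_part G k)"
  then obtain x y where x: "x \<in> lower_central G k" "X = cls k x" and y: "y \<in> lower_central G k" "Y = cls k y"
    by (auto simp: gr_part_simps)
  have c: "x \<in> carrier G" "y \<in> carrier G" using x y lower_central_carrier by auto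
  show "X \<otimes>\<^bsub>gr_part G k\<^esub> Y \<in> carrier (gr_part G k)"
    using x y c lower_central_closed by (auto simp: gr_part_simps cls_mult)
  show "X \<otimes>\<^bsub>gr_part G k\<^esub> Y = Y \<otimes>\<^bsub>gr_part G k\<^esub> X"
    using x y c cls_commute[OF assms x(1) c(2)] by (simp add: gr_part_simps cls_mult)
  fix Z assume "Z \<in> carrier (gr_part G k)"
  then obtain z where z: "z \<in> lower_central G k" "Z = cls k z" by (auto simp: gr_part_simps)
  have "z \<in> carrier G" by (rule lower_central_carrier[OF z(1)])
  then show "X \<otimes>\<^bsub>gr_part G k\<^esub> Y \<otimes>\<^bsub>gr_part G k\<^esub> Z = X \<otimes>\<^bsub>gr_part G k\<^esub> (Y \<otimes>\<^bsub>gr_part G k\<^esub> Z)"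
    using x y z c by (simp add: gr_part_simps cls_mult m_assoc)
next
  show "\<one>\<^bsub>gr_part G k\<^esub> \<in> carrier (gr_part G k)"
    using lower_central_closed by (auto simp: gr_part_simps(1) one_gr_part)
  fix X assume "X \<in> carrier (gr_part G k)"
  then obtain x where x: "x \<in> lower_central G k" "X = cls k x" by (auto simp: gr_part_simps)
  have c: "x \<in> carrier G" using x lower_central_carrier by auto
  show "\<one>\<^bsub>gr_part G k\<^esub> \<otimes>\<^bsub>gr_part G k\<^esub> X = X"
    using x c by (simp add: gr_part_simps(2) one_gr_part cls_mult)
  show "\<exists>Y\<in>carrier (gr_part G k). Y \<otimes>\<^bsub>gr_part G k\<^esub> X = \<one>\<^bsub>gr_part G k\<^esub>"
    using x c lower_central_closed
    by (intro bexI[of _ "cls k (inv x)"]) (auto simp: gr_part_simps(1,2) one_gr_part cls_mult)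
qed

lemma cls_hom: "cls k \<in> hom (G\<lparr>carrier := lower_central G k\<rparr>) (gr_part G k)"
  by (rule homI) (auto simp: gr_part_simps cls_mult lower_central_carrier)

text \<open>Commutators of products obey a law twisted by conjugation. By \<open>cls_conj\<close>
  the twist is invisible in degree \<open>i + j\<close>, which leaves additivity.\<close>

lemma cls_commutator_left:
  assumes "1 \<le> i" "1 \<le> j" "x \<in> lower_central G i" "x' \<in> lower_central G i" "y \<in> lower_central G j"
  shows "cls (i + j) (commutator G (x \<otimes> x') y) =
    cls (i + j) (commutator G x y) <#> cls (i + j) (commutator G x' y)"
proof -
  note c = assms(3-5)[THEN lower_central_carrier]
  have ij: "1 \<le> i + j" using assms by simp
  note k = commutator_lower_central[OF assms(1,2)]
  have k1: "commutator G x y \<in> lower_central G (i + j)" "commutator G x' y \<in> lower_central G (i + j)"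
    using k assms by blast+
  have "cls (i + j) (commutator G (x \<otimes> x') y) =
      cls (i + j) (x \<otimes> commutator G x' y \<otimes> inv x) <#> cls (i + j) (commutator G x y)"
    unfolding commutator_mult_left[OF c] using c by (intro cls_mult[symmetric]) auto
  also have "\<dots> = cls (i + j) (commutator G x' y) <#> cls (i + j) (commutator G x y)"
    unfolding cls_conj[OF ij k1(2) c(1)] ..
  also have "\<dots> = cls (i + j) (commutator G x y) <#> cls (i + j) (commutator G x' y)"
    using cls_commute[OF ij k1(1) commutator_closed[OF c(2,3)]] c by (simp add: cls_mult del: m_assoc)
  finally show ?thesis .
qed

lemma cls_commutator_right:
  assumes "1 \<le> i" "1 \<le> j" "x \<in> lower_central G i" "y \<in> lower_central G j" "y' \<in> lower_central G j"
  shows "cls (i + j) (commutator G x (y \<otimes> y')) =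
    cls (i + j) (commutator G x y) <#> cls (i + j) (commutator G x y')"
proof -
  note c = assms(3-5)[THEN lower_central_carrier]
  have ij: "1 \<le> i + j" using assms by simp
  have k1: "commutator G x y' \<in> lower_central G (i + j)"
    by (rule commutator_lower_central) (use assms in auto)
  have "cls (i + j) (commutator G x (y \<otimes> y')) =
      cls (i + j) (commutator G x y) <#> cls (i + j) (y \<otimes> commutator G x y' \<otimes> inv y)"
    unfolding commutator_mult_right[OF c] using c by (intro cls_mult[symmetric]) auto
  also have "\<dots> = cls (i + j) (commutator G x y) <#> cls (i + j) (commutator G x y')"
    unfolding cls_conj[OF ij k1 c(2)] ..
  finally show ?thesis .
qed

lemma gr_commutator_cls:
  assumes "1 \<le> i" "1 \<le> j" "x \<in> lower_central G i" "y \<in> lower_central G j"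
  shows "gr_commutator G i j (cls i x) (cls j y) = cls (i + j) (commutator G x y)"
proof -
  let ?N = "lower_central G (Suc (i + j))"
  let ?B = "{commutator G a b | a b. a \<in> cls i x \<and> b \<in> cls j y}"
  have sg: "subgroup ?N G" by (rule lower_central_subgroup)
  have "cls (i + j) t = cls (i + j) (commutator G x y)" and tc: "t \<in> carrier G" if "t \<in> ?B" for t
  proof -
    obtain a b where t: "t = commutator G a b" and "a \<in> cls i x" "b \<in> cls j y" using \<open>t \<in> ?B\<close> by blast
    then obtain m n where mn: "m \<in> lower_central G (Suc i)" "a = m \<otimes> x" "n \<in> lower_central G (Suc j)" "b = n \<otimes> y"
      by (auto simp: r_coset_def)
    have m: "m \<in> lower_central G i" and n: "n \<in> lower_central G j"
      using mn lower_central_Suc_subset by blast+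
    have b: "b \<in> lower_central G j" using mn n assms lower_central_closed by simp
    have a: "a \<in> lower_central G i" using mn m assms lower_central_closed by simp
    show "t \<in> carrier G" using t lower_central_carrier[OF a] lower_central_carrier[OF b] by simp
    \<comment> \<open>\<open>m\<close> lies one step deeper than \<open>x\<close>, so its commutator
      with \<open>b\<close> already lies in the modulus; the same holds for \<open>n\<close>
      below.\<close>
    have "commutator G m b \<in> ?N" using commutator_lower_central[of "Suc i" j m b] mn b assms by simp
    then have 1: "cls (i + j) (commutator G m b) = cls (i + j) \<one>" by (simp add: cls_eq_one cls_one)
    have "commutator G x n \<in> ?N" using commutator_lower_central[of i "Suc j" x n] mn assms by simp
    then have 2: "cls (i + j) (commutator G x n) = cls (i + j) \<one>" by (simp add: cls_eq_one cls_one)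
    have c: "x \<in> carrier G" "y \<in> carrier G" "b \<in> carrier G" using assms b lower_central_carrier by blast+
    have "cls (i + j) t = cls (i + j) \<one> <#> cls (i + j) (commutator G x b)"
      unfolding t mn(2) cls_commutator_left[OF assms(1,2) m assms(3) b] 1 ..
    also have "\<dots> = cls (i + j) (commutator G x b)" using c by (simp add: cls_mult)
    also have "\<dots> = cls (i + j) \<one> <#> cls (i + j) (commutator G x y)"
      unfolding mn(4) cls_commutator_right[OF assms(1,2,3) n assms(4)] 2 ..
    also have "\<dots> = cls (i + j) (commutator G x y)" using c by (simp add: cls_mult)
    finally show "cls (i + j) t = cls (i + j) (commutator G x y)" .
  qed
  moreover have "commutator G x y \<in> ?B"
    using rcos_self[OF _ lower_central_subgroup] assms lower_central_carrier by blast
  ultimately have "(\<Union>t\<in>?B. cls (i + j) t) = cls (i + j) (commutator G x y)" by blast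
  moreover have "?N <#> ?B = (\<Union>t\<in>?B. cls (i + j) t)"
    unfolding set_mult_def r_coset_def by blast
  ultimately show ?thesis by (simp add: gr_commutator_def)
qed

lemma graded_pieces_gr: "graded_pieces (gr_part G) (gr_commutator G)"
proof (rule graded_pieces.intro)
  fix i j :: nat and x y assume ij: "1 \<le> i" "1 \<le> j"
    and x: "x \<in> carrier (gr_part G i)" and y: "y \<in> carrier (gr_part G j)"
  obtain a where a: "a \<in> lower_central G i" "x = cls i a" using x by (auto simp: gr_part_simps)
  obtain b where b: "b \<in> lower_central G j" "y = cls j b" using y by (auto simp: gr_part_simps)
  note ac = lower_central_carrier[OF a(1)] and bc = lower_central_carrier[OF b(1)]
  have ij1: "1 \<le> i + j" using ij by simp
  show "gr_commutator G i j x y \<in> carrier (gr_part G (i + j))"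
    using ij a b by (simp add: gr_commutator_cls gr_part_simps commutator_lower_central)
  have "commutator G a b \<otimes> commutator G b a = \<one>"
    using inv_commutator[OF bc ac] r_inv[of "commutator G a b"] inv_commutator[OF ac bc] ac bc by simp
  then show "gr_commutator G i j x y \<otimes>\<^bsub>gr_part G (i + j)\<^esub> gr_commutator G j i y x = \<one>\<^bsub>gr_part G (i + j)\<^esub>"
    using ij a b ac bc cls_one[of "i + j"]
    by (simp add: gr_commutator_cls gr_part_simps add.commute[of j i] cls_mult)
  {
    fix x' assume "x' \<in> carrier (gr_part G i)"
    then obtain a' where a': "a' \<in> lower_central G i" "x' = cls i a'" by (auto simp: gr_part_simps)
    have "x \<otimes>\<^bsub>gr_part G i\<^esub> x' = cls i (a \<otimes> a')"
      using a a' lower_central_carrier by (simp add: gr_part_simps cls_mult)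
    then show "gr_commutator G i j (x \<otimes>\<^bsub>gr_part G i\<^esub> x') y =
        gr_commutator G i j x y \<otimes>\<^bsub>gr_part G (i + j)\<^esub> gr_commutator G i j x' y"
      using ij a a' b lower_central_closed cls_commutator_left[OF ij a(1) a'(1) b(1)]
      by (simp add: gr_commutator_cls gr_part_simps)
  }
  {
    fix y' assume "y' \<in> carrier (gr_part G j)"
    then obtain b' where b': "b' \<in> lower_central G j" "y' = cls j b'" by (auto simp: gr_part_simps)
    have "y \<otimes>\<^bsub>gr_part G j\<^esub> y' = cls j (b \<otimes> b')"
      using b b' lower_central_carrier by (simp add: gr_part_simps cls_mult)
    then show "gr_commutator G i j x (y \<otimes>\<^bsub>gr_part G j\<^esub> y') =
        gr_commutator G i j x y \<otimes>\<^bsub>gr_part G (i + j)\<^esub> gr_commutator G i j x y'"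
      using ij a b' b lower_central_closed cls_commutator_right[OF ij a(1) b(1) b'(1)]
      by (simp add: gr_commutator_cls gr_part_simps)
  }
  fix k :: nat and z assume k: "1 \<le> k" and z: "z \<in> carrier (gr_part G k)"
  obtain c where c: "c \<in> lower_central G k" "z = cls k c" using z by (auto simp: gr_part_simps)
  note cc = lower_central_carrier[OF c(1)]
  let ?N = "i + j + k"
  have N1: "1 \<le> ?N" using ij by simp
  \<comment> \<open>The conjugated outer entry of \<open>Hall_Witt\<close> has the same class as the
    plain one, and the class of a commutator depends on the classes of its entries.\<close>
  have t: "cls (p + q + r) (commutator G (commutator G u v) (v \<otimes> w \<otimes> inv v)) =
      cls (p + q + r) (commutator G (commutator G u v) w)"
    if "1 \<le> p" "1 \<le> q" "1 \<le> r" "u \<in> lower_central G p" "v \<in> lower_central G q" "w \<in> lower_central G r" for p q r u v w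
  proof -
    have pq: "1 \<le> p + q" using that by simp
    have vc: "v \<in> carrier G" using that lower_central_carrier by blast
    have uv: "commutator G u v \<in> lower_central G (p + q)" using that commutator_lower_central by blast
    show ?thesis
      using gr_commutator_cls[OF pq that(3) uv lower_central_conj[OF vc that(6)]]
        gr_commutator_cls[OF pq that(3) uv that(6)] cls_conj[OF that(3,6) vc] by simp
  qed
  \<comment> \<open>\<open>Hall_Witt\<close> has the inner commutator on the left, the Jacobi
    identity on the right; exchanging the entries inverts each of the three factors.\<close>
  have inv3: "commutator G w (commutator G u v) = inv (commutator G (commutator G u v) w)"
    if "u \<in> carrier G" "v \<in> carrier G" "w \<in> carrier G" for u v w
    using inv_commutator[of "commutator G u v" w] that by simp
  define A B C where "A = commutator G (commutator G b c) a" "B = commutator G (commutator G c a) b"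
    "C = commutator G (commutator G a b) c"
  have cl: "A \<in> carrier G" "B \<in> carrier G" "C \<in> carrier G" using ac bc cc by (simp_all add: A_B_C_def)
  have lc: "A \<in> lower_central G ?N" "B \<in> lower_central G ?N" "C \<in> lower_central G ?N"
    using commutator_lower_central[OF _ ij(1) commutator_lower_central[OF ij(2) k b(1) c(1)] a(1)]
      commutator_lower_central[OF _ ij(2) commutator_lower_central[OF k ij(1) c(1) a(1)] b(1)]
      commutator_lower_central[OF _ k commutator_lower_central[OF ij a(1) b(1)] c(1)] ij k
    by (simp_all add: A_B_C_def ac_simps)
  have "cls ?N (commutator G (commutator G a b) (b \<otimes> c \<otimes> inv b)
      \<otimes> commutator G (commutator G b c) (c \<otimes> a \<otimes> inv c)
      \<otimes> commutator G (commutator G c a) (a \<otimes> b \<otimes> inv a)) = cls ?N \<one>"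
    unfolding Hall_Witt[OF ac bc cc] ..
  then have "cls ?N C <#> cls ?N A <#> cls ?N B = cls ?N \<one>"
    using t[OF ij k a(1) b(1) c(1)] t[OF ij(2) k ij(1) b(1) c(1) a(1)] t[OF k ij c(1) a(1) b(1)] ac bc cc
    by (simp add: A_B_C_def ac_simps flip: cls_mult)
  then have "cls ?N (C \<otimes> A \<otimes> B) = cls ?N \<one>" using cl by (simp add: cls_mult)
  then have CAB: "C \<otimes> A \<otimes> B \<in> lower_central G (Suc ?N)" using cls_eq_oneD cl cls_one by simp
  \<comment> \<open>Inversion reverses the order and so asks for \<open>C\<close>, \<open>B\<close>,
    \<open>A\<close>, whereas \<open>Hall_Witt\<close> supplies \<open>C\<close>, \<open>A\<close>,
    \<open>B\<close>; the factors commute modulo the next term.\<close>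
  have "inv A \<otimes> inv B \<otimes> inv C = inv (C \<otimes> B \<otimes> A)" using cl by (simp add: word_simps)
  have "cls ?N (C \<otimes> B \<otimes> A) = cls ?N C <#> cls ?N (B \<otimes> A)" using cl by (simp add: cls_mult m_assoc)
  also have "\<dots> = cls ?N C <#> cls ?N (A \<otimes> B)" using cls_commute[OF N1 lc(2) cl(1)] by simp
  also have "\<dots> = cls ?N \<one>" using cl \<open>cls ?N (C \<otimes> A \<otimes> B) = cls ?N \<one>\<close> by (simp add: cls_mult m_assoc)
  finally have "C \<otimes> B \<otimes> A \<in> lower_central G (Suc ?N)" using cls_eq_oneD cl cls_one by simp
  then have "inv A \<otimes> inv B \<otimes> inv C \<in> lower_central G (Suc ?N)"
    using lower_central_closed(2) \<open>inv A \<otimes> inv B \<otimes> inv C = inv (C \<otimes> B \<otimes> A)\<close> by simp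
  then have fin: "cls ?N (inv A) <#> cls ?N (inv B) <#> cls ?N (inv C) = lower_central G (Suc ?N)"
    using cl by (simp add: cls_mult cls_eq_one)
  have e: "gr_commutator G i (j + k) x (gr_commutator G j k y z) = cls ?N (inv A)"
    "gr_commutator G j (k + i) y (gr_commutator G k i z x) = cls ?N (inv B)"
    "gr_commutator G k (i + j) z (gr_commutator G i j x y) = cls ?N (inv C)"
    using ij k a b c ac bc cc commutator_lower_central[OF ij(2) k b(1) c(1)]
      commutator_lower_central[OF k ij(1) c(1) a(1)] commutator_lower_central[OF ij a(1) b(1)]
      inv3[OF bc cc ac] inv3[OF cc ac bc] inv3[OF ac bc cc]
    by (simp_all add: gr_commutator_cls A_B_C_def ac_simps)
  show "gr_commutator G i (j + k) x (gr_commutator G j k y z) \<otimes>\<^bsub>gr_part G ?N\<^esub>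
      gr_commutator G j (k + i) y (gr_commutator G k i z x) \<otimes>\<^bsub>gr_part G ?N\<^esub>
      gr_commutator G k (i + j) z (gr_commutator G i j x y) = \<one>\<^bsub>gr_part G ?N\<^esub>"
    unfolding e using fin by (simp add: gr_part_simps)
next
  fix i :: nat and x assume i: "1 \<le> i" and "x \<in> carrier (gr_part G i)"
  then obtain a where a: "a \<in> lower_central G i" "x = cls i a" by (auto simp: gr_part_simps)
  then show "gr_commutator G i i x x = \<one>\<^bsub>gr_part G (i + i)\<^esub>"
    using i lower_central_carrier[OF a(1)] cls_one[of "i + i"]
    by (simp add: gr_commutator_cls gr_part_simps word_simps)
qed (rule comm_group_gr_part)

lemma gr_eq_sum_lie: "gr G = sum_lie (gr_part G) (gr_commutator G)"
  by (simp add: gr_def sum_lie_def)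

theorem graded_lie_algebra_gr: "graded_lie_algebra (gr G)"
  unfolding gr_eq_sum_lie by (rule graded_pieces.graded_lie_algebra_sum_lie[OF graded_pieces_gr])

end

section \<open>Homogeneous elements of the associated graded Lie algebra and its generation in
  degree one\<close>

context group
begin

lemma single_gr_grade:
  assumes "1 \<le> k" "x \<in> lower_central G k"
  shows "single (gr_part G) k (cls k x) \<in> grade (gr G) k"
  using graded_pieces.grade_eq[OF graded_pieces_gr assms(1)] assms(2)
  by (simp add: gr_eq_sum_lie gr_part_simps)

lemma grade_gr: "1 \<le> k \<Longrightarrow> grade (gr G) k = (\<lambda>x. single (gr_part G) k (cls k x)) ` lower_central G k"
  using graded_pieces.grade_eq[OF graded_pieces_gr, of k] by (simp add: gr_eq_sum_lie gr_part_simps image_image)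

lemma gr_coord:
  assumes "u \<in> carrier (gr G)" "1 \<le> k"
  obtains x where "x \<in> lower_central G k" "u k = cls k x"
  using graded_pieces.sum_lie_coord[OF graded_pieces_gr, of u k] assms
  by (auto simp: gr_eq_sum_lie gr_part_simps)

lemma gr_eqI:
  assumes "u \<in> carrier (gr G)" "v \<in> carrier (gr G)" "\<And>k. 1 \<le> k \<Longrightarrow> u k = v k"
  shows "u = v"
  using graded_pieces.sum_lie_eqI[OF graded_pieces_gr, of u v] assms by (simp add: gr_eq_sum_lie)

lemma lbracket_single_gr:
  assumes "1 \<le> i" "1 \<le> j" "x \<in> lower_central G i" "y \<in> lower_central G j"
  shows "lbracket (gr G) (single (gr_part G) i (cls i x)) (single (gr_part G) j (cls j y)) =
    single (gr_part G) (i + j) (cls (i + j) (commutator G x y))"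
  using graded_pieces.lbracket_single[OF graded_pieces_gr assms(1,2), of "cls i x" "cls j y"] assms
  by (simp add: gr_eq_sum_lie gr_part_simps gr_commutator_cls)

lemma single_gr_mult:
  assumes "1 \<le> k" "x \<in> lower_central G k" "y \<in> lower_central G k"
  shows "single (gr_part G) k (cls k (x \<otimes> y)) =
    single (gr_part G) k (cls k x) \<otimes>\<^bsub>gr G\<^esub> single (gr_part G) k (cls k y)"
  using hom_mult[OF graded_pieces.single_hom[OF graded_pieces_gr assms(1)], of "cls k x" "cls k y"] assms
    lower_central_carrier[OF assms(2)] lower_central_carrier[OF assms(3)]
  by (simp add: gr_eq_sum_lie gr_part_simps cls_mult)

lemma single_gr_one: "single (gr_part G) k (cls k \<one>) = \<one>\<^bsub>gr G\<^esub>"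
  using graded_pieces.single_one[OF graded_pieces_gr, of k] by (simp add: gr_eq_sum_lie one_gr_part)

lemma single_gr_inv:
  assumes "1 \<le> k" "x \<in> lower_central G k"
  shows "single (gr_part G) k (cls k (inv x)) = inv\<^bsub>gr G\<^esub> (single (gr_part G) k (cls k x))"
proof -
  interpret L: graded_lie_algebra "gr G" by (rule graded_lie_algebra_gr)
  have "single (gr_part G) k (cls k (inv x)) \<otimes>\<^bsub>gr G\<^esub> single (gr_part G) k (cls k x) = \<one>\<^bsub>gr G\<^esub>"
    using assms lower_central_closed(2)[OF assms(2)] lower_central_carrier[OF assms(2)] single_gr_one
    by (simp flip: single_gr_mult)
  then show ?thesis
    using L.grade_carrier[OF assms(1)] single_gr_grade[OF assms(1)] assms lower_central_closed(2)
    by (intro L.inv_equality[symmetric]) auto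
qed

text \<open>The generators of \<open>\<Gamma>\<^sub>k\<^sub>+\<^sub>1\<close> are commutators with
  elements of the group, so their classes are brackets of degree \<open>k\<close> with degree 1. All
  surjectivity onto \<open>gr\<close> rests on this.\<close>

lemma gr_generated_by_degree_one:
  assumes J: "subgroup J (gr G)"
    and br: "\<And>u v. \<lbrakk>u \<in> J; v \<in> J\<rbrakk> \<Longrightarrow> lbracket (gr G) u v \<in> J"
    and one: "\<And>x. x \<in> carrier G \<Longrightarrow> single (gr_part G) 1 (cls 1 x) \<in> J"
  shows "carrier (gr G) \<subseteq> J"
proof -
  interpret L: graded_lie_algebra "gr G" by (rule graded_lie_algebra_gr)
  have "single (gr_part G) k (cls k x) \<in> J" if "1 \<le> k" "x \<in> lower_central G k" for k x
    using that
  proof (induction k arbitrary: x rule: nat_induct_at_least)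
    case base
    then show ?case using one by simp
  next
    case (Suc k)
    let ?S = "{commutator G x y | x y. x \<in> lower_central G k \<and> y \<in> carrier G}"
    have k: "1 \<le> Suc k" by simp
    have S: "?S \<subseteq> lower_central G (Suc k)"
      using commutator_lower_central_Suc[OF Suc.hyps] by blast
    have Sc: "?S \<subseteq> carrier G" using S lower_central_carrier by blast
    have gS: "z \<in> lower_central G (Suc k)" if "z \<in> generate G ?S" for z
      using that lower_central_Suc[OF Suc.hyps] by simp
    have sS: "single (gr_part G) (Suc k) (cls (Suc k) z) \<in> J" if zS: "z \<in> ?S" for z
    proof -
      obtain a b where z: "z = commutator G a b" "a \<in> lower_central G k" "b \<in> carrier G"
        using zS by blast
      have "lbracket (gr G) (single (gr_part G) k (cls k a)) (single (gr_part G) 1 (cls 1 b)) \<in> J"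
        using br Suc.IH[OF z(2)] one[OF z(3)] by blast
      then show ?thesis using lbracket_single_gr[of k 1 a b] Suc.hyps z by (simp flip: Suc_eq_plus1)
    qed
    have "x \<in> generate G ?S" using Suc.prems lower_central_Suc[OF Suc.hyps] by simp
    then show ?case
    proof (induction rule: generate.induct)
      case one
      then show ?case using subgroup.one_closed[OF J] by (simp add: single_gr_one)
    next
      case (incl h)
      then show ?case by (rule sS)
    next
      case (inv h)
      then show ?case
        using subgroup.m_inv_closed[OF J sS[OF inv]] single_gr_inv[OF k subsetD[OF S inv]] by simp
    next
      case (eng a b)
      then show ?case
        using subgroup.m_closed[OF J eng.IH] single_gr_mult[OF k gS gS] by simp
    qed
  qed
  then have "homogeneous_elements (gr G) \<subseteq> J" by (auto simp: grade_gr)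
  then have "generate (gr G) (homogeneous_elements (gr G)) \<subseteq> J"
    by (rule L.generate_subgroup_incl[OF _ J])
  then show ?thesis using L.carrier_generate_homogeneous by blast
qed

lemma lie_hom_onto_gr:
  assumes "lie_ring L" "f \<in> lie_hom L (gr G)"
    and "\<And>x. x \<in> carrier G \<Longrightarrow> single (gr_part G) 1 (cls 1 x) \<in> f ` carrier L"
  shows "f ` carrier L = carrier (gr G)"
proof
  interpret L: lie_ring L by fact
  interpret M: graded_lie_algebra "gr G" by (rule graded_lie_algebra_gr)
  have gh: "group_hom L (gr G) f"
    using lie_homD(1)[OF assms(2)] L.is_group M.is_group by (simp add: group_hom_def group_hom_axioms_def)
  show "carrier (gr G) \<subseteq> f ` carrier L"
  proof (rule gr_generated_by_degree_one[OF group_hom.img_is_subgroup[OF gh] _ assms(3)])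
    fix u v assume "u \<in> f ` carrier L" "v \<in> f ` carrier L"
    then obtain x y where xy: "x \<in> carrier L" "y \<in> carrier L" "u = f x" "v = f y" by blast
    then have "lbracket (gr G) u v = f (lbracket L x y)" using lie_homD(2)[OF assms(2)] by simp
    then show "lbracket (gr G) u v \<in> f ` carrier L" using xy by blast
  qed
  show "f ` carrier L \<subseteq> carrier (gr G)" using lie_homD(3)[OF assms(2)] by blast
qed

lemma gr_one_eq_single: "gr_one G = single (gr_part G) 1"
  by (simp add: gr_one_def single_def fun_eq_iff)

end

section \<open>Functoriality of the associated graded Lie algebra\<close>

context group_hom
begin

lemma hom_commutator:
  "\<lbrakk>x \<in> carrier G; y \<in> carrier G\<rbrakk> \<Longrightarrow> h (commutator G x y) = commutator H (h x) (h y)"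
  by simp

lemma hom_lower_central: "x \<in> lower_central G k \<Longrightarrow> h x \<in> lower_central H k"
proof (induction k arbitrary: x)
  case 0
  then show ?case by simp
next
  case (Suc k)
  show ?case
  proof (cases "k = 0")
    case True
    then show ?thesis using Suc.prems by (simp add: lower_central.simps(2))
  next
    case False
    then have k: "1 \<le> k" by simp
    let ?S = "{commutator G x y | x y. x \<in> lower_central G k \<and> y \<in> carrier G}"
    have S: "?S \<subseteq> carrier G" using G.lower_central_carrier by auto
    have xS: "x \<in> generate G ?S" using Suc.prems G.lower_central_Suc[OF k] by simp
    show ?thesis
    proof (rule hom_generate_closed[OF G.is_group H.is_group homh S H.lower_central_subgroup _ xS])
      fix s assume "s \<in> ?S"
      then obtain a b where s: "s = commutator G a b" "a \<in> lower_central G k" "b \<in> carrier G" by blast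
      then show "h s \<in> lower_central H (Suc k)"
        using H.commutator_lower_central_Suc[OF k Suc.IH[OF s(2)] hom_closed[OF s(3)]]
          G.lower_central_carrier[OF s(2)] by simp
    qed
  qed
qed

abbreviation "gmap \<equiv> gr_map H h"

text \<open>The image of a coset may be a proper part of a coset; the factor
  \<open>lower_central H (Suc k)\<close> in \<open>gr_map\<close> fills it up.\<close>

lemma gr_map_coord:
  assumes "1 \<le> k" "x \<in> lower_central G k" "u k = G.cls k x"
  shows "gmap u k = H.cls k (h x)"
proof -
  have xc: "x \<in> carrier G" using assms by (simp add: G.lower_central_carrier)
  have "h ` (G.cls k x) \<subseteq> H.cls k (h x)"
  proof
    fix y assume "y \<in> h ` (G.cls k x)"
    then obtain n where n: "n \<in> lower_central G (Suc k)" "y = h (n \<otimes> x)" by (auto simp: r_coset_def)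
    then have "y = h n \<otimes>\<^bsub>H\<^esub> h x" using xc G.lower_central_carrier[OF n(1)] by simp
    then show "y \<in> H.cls k (h x)" using hom_lower_central[OF n(1)] by (auto simp: r_coset_def)
  qed
  moreover have "h x \<in> h ` (G.cls k x)"
    using G.rcos_self[OF xc G.lower_central_subgroup] by blast
  moreover have "lower_central H (Suc k) <#>\<^bsub>H\<^esub> B = H.cls k y"
    if "B \<subseteq> H.cls k y" "y \<in> B" "y \<in> carrier H" for B y
  proof
    have "lower_central H (Suc k) <#>\<^bsub>H\<^esub> B \<subseteq> lower_central H (Suc k) <#>\<^bsub>H\<^esub> H.cls k y"
      using that by (intro mono_set_mult) auto
    also have "\<dots> = H.cls k \<one>\<^bsub>H\<^esub> <#>\<^bsub>H\<^esub> H.cls k y" by (simp add: H.cls_one)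
    also have "\<dots> = H.cls k y" using that H.cls_mult[of "\<one>\<^bsub>H\<^esub>" y k] by simp
    finally show "lower_central H (Suc k) <#>\<^bsub>H\<^esub> B \<subseteq> H.cls k y" .
    show "H.cls k y \<subseteq> lower_central H (Suc k) <#>\<^bsub>H\<^esub> B"
    proof
      fix s assume "s \<in> H.cls k y"
      then obtain a where "a \<in> lower_central H (Suc k)" "s = a \<otimes>\<^bsub>H\<^esub> y" by (auto simp: r_coset_def)
      then show "s \<in> lower_central H (Suc k) <#>\<^bsub>H\<^esub> B" using that(2) unfolding set_mult_def by (intro UN_I) simp_all
    qed
  qed
  ultimately have "lower_central H (Suc k) <#>\<^bsub>H\<^esub> h ` (G.cls k x) = H.cls k (h x)" using xc by simp
  then show ?thesis using assms by (simp add: gr_map_def)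
qed

lemma gr_map_carrier:
  assumes "u \<in> carrier (gr G)"
  shows "gmap u \<in> carrier (gr H)"
proof -
  have u: "finite {k \<in> {1..}. u k \<noteq> \<one>\<^bsub>gr_part G k\<^esub>}"
    using assms by (simp add: G.gr_eq_sum_lie graded_pieces.carrier_sum_lie[OF G.graded_pieces_gr])
  have one: "gmap u k = \<one>\<^bsub>gr_part H k\<^esub>" if "1 \<le> k" "u k = \<one>\<^bsub>gr_part G k\<^esub>" for k
    using gr_map_coord[of k "\<one>" u] that G.lower_central_closed(3)
    by (simp add: H.one_gr_part G.one_gr_part)
  have "{k \<in> {1..}. gmap u k \<noteq> \<one>\<^bsub>gr_part H k\<^esub>} \<subseteq> {k \<in> {1..}. u k \<noteq> \<one>\<^bsub>gr_part G k\<^esub>}"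
    using one by auto
  then have "finite {k \<in> {1..}. gmap u k \<noteq> \<one>\<^bsub>gr_part H k\<^esub>}" using u by (rule finite_subset)
  moreover have "gmap u k \<in> carrier (gr_part H k)" if k: "1 \<le> k" for k
  proof -
    obtain x where "x \<in> lower_central G k" "u k = G.cls k x" using G.gr_coord[OF assms k] .
    then show ?thesis using gr_map_coord[OF k] hom_lower_central by (simp add: H.gr_part_simps)
  qed
  moreover have "gmap u \<in> extensional {1..}" by (simp add: gr_map_def)
  ultimately show ?thesis
    by (auto simp: H.gr_eq_sum_lie graded_pieces.carrier_sum_lie[OF H.graded_pieces_gr] PiE_iff)
qed

lemma gr_map_single:
  assumes "1 \<le> k" "x \<in> lower_central G k"
  shows "gmap (single (gr_part G) k (G.cls k x)) = single (gr_part H) k (H.cls k (h x))"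
proof (rule H.gr_eqI)
  interpret GL: graded_lie_algebra "gr G" by (rule G.graded_lie_algebra_gr)
  interpret HL: graded_lie_algebra "gr H" by (rule H.graded_lie_algebra_gr)
  show "gmap (single (gr_part G) k (G.cls k x)) \<in> carrier (gr H)"
    by (rule gr_map_carrier[OF GL.grade_carrier[OF assms(1) G.single_gr_grade[OF assms]]])
  show "single (gr_part H) k (H.cls k (h x)) \<in> carrier (gr H)"
    by (rule HL.grade_carrier[OF assms(1) H.single_gr_grade[OF assms(1) hom_lower_central[OF assms(2)]]])
  fix j :: nat assume j: "1 \<le> j"
  show "gmap (single (gr_part G) k (G.cls k x)) j = single (gr_part H) k (H.cls k (h x)) j"
  proof (cases "j = k")
    case True
    then show ?thesis using gr_map_coord[OF assms] j by (simp add: single_def)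
  next
    case False
    then show ?thesis
      using gr_map_coord[OF j G.lower_central_closed(3)] j by (simp add: single_def G.one_gr_part H.one_gr_part)
  qed
qed

lemma gr_map_mult:
  assumes "u \<in> carrier (gr G)" "v \<in> carrier (gr G)"
  shows "gmap (u \<otimes>\<^bsub>gr G\<^esub> v) = gmap u \<otimes>\<^bsub>gr H\<^esub> gmap v"
proof (rule H.gr_eqI)
  interpret GL: graded_lie_algebra "gr G" by (rule G.graded_lie_algebra_gr)
  interpret HL: graded_lie_algebra "gr H" by (rule H.graded_lie_algebra_gr)
  show "gmap (u \<otimes>\<^bsub>gr G\<^esub> v) \<in> carrier (gr H)" by (rule gr_map_carrier[OF GL.m_closed[OF assms]])
  show "gmap u \<otimes>\<^bsub>gr H\<^esub> gmap v \<in> carrier (gr H)"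
    by (rule HL.m_closed[OF gr_map_carrier[OF assms(1)] gr_map_carrier[OF assms(2)]])
  fix k :: nat assume k: "1 \<le> k"
  obtain x where x: "x \<in> lower_central G k" "u k = G.cls k x" using G.gr_coord[OF assms(1) k] .
  obtain y where y: "y \<in> lower_central G k" "v k = G.cls k y" using G.gr_coord[OF assms(2) k] .
  note c = x(1)[THEN G.lower_central_carrier] y(1)[THEN G.lower_central_carrier]
  have "(u \<otimes>\<^bsub>gr G\<^esub> v) k = G.cls k (x \<otimes> y)"
    using k x y c
    by (simp add: G.gr_eq_sum_lie graded_pieces.sum_lie_simps[OF G.graded_pieces_gr] G.gr_part_simps G.cls_mult)
  then have "gmap (u \<otimes>\<^bsub>gr G\<^esub> v) k = H.cls k (h (x \<otimes> y))"
    by (rule gr_map_coord[OF k G.lower_central_closed(1)[OF x(1) y(1)]])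
  also have "\<dots> = (gmap u \<otimes>\<^bsub>gr H\<^esub> gmap v) k"
    using k c gr_map_coord[OF k x(1), of u] gr_map_coord[OF k y(1), of v] x y H.cls_mult[of "h x" "h y" k]
    by (simp add: H.gr_eq_sum_lie graded_pieces.sum_lie_simps[OF H.graded_pieces_gr] H.gr_part_simps)
  finally show "gmap (u \<otimes>\<^bsub>gr G\<^esub> v) k = (gmap u \<otimes>\<^bsub>gr H\<^esub> gmap v) k" .
qed

lemma gr_map_hom: "gmap \<in> hom (gr G) (gr H)"
  by (rule homI) (simp_all add: gr_map_carrier gr_map_mult)

theorem gr_map_graded_lie_hom: "gmap \<in> graded_lie_hom (gr G) (gr H)"
proof -
  interpret GL: graded_lie_algebra "gr G" by (rule G.graded_lie_algebra_gr)
  interpret HL: graded_lie_algebra "gr H" by (rule H.graded_lie_algebra_gr)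
  let ?S = "homogeneous_elements (gr G)"
  note Sc = GL.homogeneous_elements_carrier
  have 1: "gmap (lbracket (gr G) u v) = lbracket (gr H) (gmap u) (gmap v)" if u: "u \<in> ?S" and v: "v \<in> ?S" for u v
  proof -
    obtain i x where i: "1 \<le> i" "x \<in> lower_central G i" "u = single (gr_part G) i (G.cls i x)"
      using u by (auto simp: G.grade_gr)
    obtain j y where j: "1 \<le> j" "y \<in> lower_central G j" "v = single (gr_part G) j (G.cls j y)"
      using v by (auto simp: G.grade_gr)
    have "1 \<le> i + j" using i by simp
    then show ?thesis
      using i j G.lower_central_carrier[OF i(2)] G.lower_central_carrier[OF j(2)]
      by (simp add: G.lbracket_single_gr H.lbracket_single_gr gr_map_single hom_lower_central
          G.commutator_lower_central)
  qed
  have 2: "gmap (lbracket (gr G) u v) = lbracket (gr H) (gmap u) (gmap v)"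
    if u: "u \<in> carrier (gr G)" and v: "v \<in> ?S" for u v
    by (rule hom_generate_eq[OF GL.is_group HL.is_group hom_comp[OF GL.lb_hom_left gr_map_hom]
          hom_comp[OF gr_map_hom HL.lb_hom_left] Sc])
       (use u v 1 Sc GL.carrier_generate_homogeneous gr_map_carrier in blast)+
  have 3: "gmap (lbracket (gr G) u v) = lbracket (gr H) (gmap u) (gmap v)"
    if u: "u \<in> carrier (gr G)" and v: "v \<in> carrier (gr G)" for u v
    by (rule hom_generate_eq[OF GL.is_group HL.is_group hom_comp[OF GL.lb_hom_right gr_map_hom]
          hom_comp[OF gr_map_hom HL.lb_hom_right] Sc])
       (use u v 2 Sc GL.carrier_generate_homogeneous gr_map_carrier in blast)+
  have "gmap ` grade (gr G) k \<subseteq> grade (gr H) k" if "1 \<le> k" for k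
    using that by (auto simp: G.grade_gr gr_map_single H.single_gr_grade hom_lower_central)
  then show ?thesis using gr_map_hom 3 by (auto simp: graded_lie_hom_def)
qed

end

lemma gr_map_compose:
  assumes "group_hom G H f" "group_hom H K g" "u \<in> carrier (gr G)"
  shows "gr_map K g (gr_map H f u) = gr_map K (\<lambda>x. g (f x)) u"
proof -
  interpret f: group_hom G H f by fact
  interpret g: group_hom H K g by fact
  interpret c: group_hom G K "\<lambda>x. g (f x)"
    using hom_comp[OF f.homh g.homh] f.G.is_group g.H.is_group by (simp add: group_hom_def group_hom_axioms_def)
  show ?thesis
  proof (rule g.H.gr_eqI)
    show "gr_map K g (gr_map H f u) \<in> carrier (gr K)"
      by (rule g.gr_map_carrier[OF f.gr_map_carrier[OF assms(3)]])
    show "gr_map K (\<lambda>x. g (f x)) u \<in> carrier (gr K)" by (rule c.gr_map_carrier[OF assms(3)])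
    fix k :: nat assume k: "1 \<le> k"
    obtain x where x: "x \<in> lower_central G k" "u k = f.G.cls k x" using f.G.gr_coord[OF assms(3) k] .
    show "gr_map K g (gr_map H f u) k = gr_map K (\<lambda>x. g (f x)) u k"
      using g.gr_map_coord[where u="gr_map H f u", OF k f.hom_lower_central[OF x(1)] f.gr_map_coord[where u=u, OF k x]]
        c.gr_map_coord[where u=u, OF k x] by simp
  qed
qed

lemma gr_map_cong:
  assumes "group_hom G H f" "\<And>x. x \<in> carrier G \<Longrightarrow> f x = g x" "u \<in> carrier (gr G)"
  shows "gr_map H f u = gr_map H g u"
proof -
  interpret f: group_hom G H f by fact
  have "f ` u k = g ` u k" if k: "1 \<le> k" for k
  proof -
    obtain x where x: "x \<in> lower_central G k" "u k = f.G.cls k x" using f.G.gr_coord[OF assms(3) k] .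
    have "u k \<subseteq> carrier G"
      unfolding x(2) using x(1) f.G.lower_central_carrier by (intro f.G.r_coset_subset_G) auto
    then show ?thesis using assms(2) by (intro image_cong) auto
  qed
  then show ?thesis by (auto simp: gr_map_def intro!: restrict_ext)
qed

section \<open>The derived series\<close>

context group
begin

lemma derived_series_normal: "derived_series G i \<lhd> G"
proof (induction i)
  case (Suc i)
  then show ?case using derived_is_normal by (simp add: derived_series_def)
qed (simp add: derived_series_def normal_self)

lemma commutator_derived_series:
  "\<lbrakk>x \<in> derived_series G i; y \<in> derived_series G i\<rbrakk> \<Longrightarrow> commutator G x y \<in> derived_series G (Suc i)"
  unfolding derived_series_def by (auto simp: derived_def intro!: generate.incl)

text \<open>Each coordinate of a bracket is a product of commutators of coordinates. If these have
  representatives in the \<open>i\<close>-th derived subgroup, the commutators lie in the next one.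
  The classes in degree \<open>k\<close> with a representative in both subgroups at once are the
  image of a subgroup, hence closed under the products that the convolution and the generated
  subgroup introduce.\<close>

lemma lie_derived_gr:
  assumes "u \<in> lie_derived (gr G) i" "1 \<le> k"
  shows "\<exists>x \<in> derived_series G i \<inter> lower_central G k. u k = cls k x"
proof -
  interpret L: graded_lie_algebra "gr G" by (rule graded_lie_algebra_gr)
  let ?D = "\<lambda>i k. cls k ` (derived_series G i \<inter> lower_central G k)"
  have sD: "subgroup (?D i k) (gr_part G k)" if k: "1 \<le> k" for i k
  proof -
    interpret P: comm_group "gr_part G k" by (rule comm_group_gr_part[OF k])
    have s: "subgroup (derived_series G i \<inter> lower_central G k) G"
      by (rule subgroups_Inter_pair[OF normal_imp_subgroup[OF derived_series_normal] lower_central_subgroup])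
    then have "subgroup (derived_series G i \<inter> lower_central G k) (G\<lparr>carrier := lower_central G k\<rparr>)"
      by (rule subgroup_incl[OF _ lower_central_subgroup]) simp
    moreover have "group_hom (G\<lparr>carrier := lower_central G k\<rparr>) (gr_part G k) (cls k)"
      using cls_hom subgroup.subgroup_is_group[OF lower_central_subgroup is_group] P.is_group
      by (simp add: group_hom_def group_hom_axioms_def)
    ultimately show ?thesis by (rule group_hom.subgroup_img_is_subgroup[rotated])
  qed
  let ?T = "\<lambda>i. {u \<in> carrier (gr G). \<forall>k\<ge>1. u k \<in> ?D i k}"
  have sT: "subgroup (?T i) (gr G)" for i
  proof (rule L.subgroupI)
    have one: "\<one>\<^bsub>gr G\<^esub> k = \<one>\<^bsub>gr_part G k\<^esub>" if "1 \<le> k" for k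
      using that by (simp add: gr_eq_sum_lie graded_pieces.sum_lie_simps[OF graded_pieces_gr])
    then have "\<one>\<^bsub>gr G\<^esub> \<in> ?T i" using subgroup.one_closed[OF sD] by simp
    then show "?T i \<noteq> {}" by blast
    have ch: "group_hom (gr G) (gr_part G k) (\<lambda>u. u k)" if "1 \<le> k" for k
      using graded_pieces.coord_hom[OF graded_pieces_gr that] L.is_group comm_group_gr_part[OF that]
      by (simp add: group_hom_def group_hom_axioms_def gr_eq_sum_lie comm_group_def)
    show "inv\<^bsub>gr G\<^esub> u \<in> ?T i" if "u \<in> ?T i" for u
      using that subgroup.m_inv_closed[OF sD] group_hom.hom_inv[OF ch] by simp
    show "u \<otimes>\<^bsub>gr G\<^esub> v \<in> ?T i" if "u \<in> ?T i" "v \<in> ?T i" for u v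
      using that subgroup.m_closed[OF sD] group_hom.hom_mult[OF ch] by simp
  qed auto
  have br: "lbracket (gr G) u v \<in> ?T (Suc i)" if u: "u \<in> ?T i" and v: "v \<in> ?T i" for u v i
  proof -
    have "lbracket (gr G) u v k \<in> ?D (Suc i) k" if k: "1 \<le> k" for k
    proof -
      interpret P: comm_group "gr_part G k" by (rule comm_group_gr_part[OF k])
      have t: "gr_commutator G j (k - j) (u j) (v (k - j)) \<in> ?D (Suc i) k" if j: "j \<in> {1..<k}" for j
      proof -
        have jk: "1 \<le> j" "1 \<le> k - j" "j + (k - j) = k" using j by auto
        obtain x where x: "x \<in> derived_series G i" "x \<in> lower_central G j" "u j = cls j x"
          using u jk(1) by auto
        obtain y where y: "y \<in> derived_series G i" "y \<in> lower_central G (k - j)" "v (k - j) = cls (k - j) y"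
          using v jk(2) by auto
        have "commutator G x y \<in> lower_central G k"
          using commutator_lower_central[OF jk(1,2) x(2) y(2)] jk(3) by simp
        moreover have "commutator G x y \<in> derived_series G (Suc i)" by (rule commutator_derived_series[OF x(1) y(1)])
        ultimately show ?thesis
          using gr_commutator_cls[OF jk(1,2) x(2) y(2)] unfolding x(3) y(3) jk(3) by auto
      qed
      have "finprod (gr_part G k) (\<lambda>j. gr_commutator G j (k - j) (u j) (v (k - j))) F \<in> ?D (Suc i) k"
        if "finite F" "F \<subseteq> {1..<k}" for F
        using that
      proof (induction F rule: finite_induct)
        case empty
        then show ?case using subgroup.one_closed[OF sD[OF k]] by simp
      next
        case (insert j F)
        have "?D (Suc i) k \<subseteq> carrier (gr_part G k)" by (rule subgroup.subset[OF sD[OF k]])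
        then have "(\<lambda>j. gr_commutator G j (k - j) (u j) (v (k - j))) \<in> {1..<k} \<rightarrow> carrier (gr_part G k)"
          using t by blast
        then show ?case using insert t subgroup.m_closed[OF sD[OF k]]
          by (subst P.finprod_insert) auto
      qed
      then show ?thesis
        using k by (simp add: gr_eq_sum_lie graded_pieces.sum_lie_simps[OF graded_pieces_gr])
    qed
    then show ?thesis using u v by auto
  qed
  have "lie_derived (gr G) i \<subseteq> ?T i"
  proof (induction i)
    case 0
    have "u k \<in> ?D 0 k" if u: "u \<in> carrier (gr G)" and k: "1 \<le> k" for u k
    proof -
      obtain x where "x \<in> lower_central G k" "u k = cls k x" using gr_coord[OF u k] .
      then show ?thesis using lower_central_carrier by (auto simp: derived_series_def)
    qed
    then show ?case by auto
  next
    case (Suc i)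
    have "{lbracket (gr G) x y | x y. x \<in> lie_derived (gr G) i \<and> y \<in> lie_derived (gr G) i} \<subseteq> ?T (Suc i)"
      using br Suc by blast
    then show ?case unfolding lie_derived.simps by (rule L.generate_subgroup_incl[OF _ sT])
  qed
  then show ?thesis using assms by blast
qed

text \<open>All representatives supplied by \<open>lie_derived_gr\<close> are the identity here. The
  lemma is meant for the quotient of a group by its \<open>i\<close>-th derived subgroup.\<close>

lemma lie_derived_gr_trivial:
  assumes "derived_series G i = {\<one>}" "u \<in> lie_derived (gr G) i"
  shows "u = \<one>\<^bsub>gr G\<^esub>"
proof (rule gr_eqI)
  interpret L: graded_lie_algebra "gr G" by (rule graded_lie_algebra_gr)
  show "u \<in> carrier (gr G)"
    using assms(2) L.graded_ideal_derived[of i] subgroup.subset[OF lie_ideal_subgroup]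
    by (auto simp: graded_ideal_def)
  show "u k = \<one>\<^bsub>gr G\<^esub> k" if "1 \<le> k" for k
    using lie_derived_gr[OF assms(2) that] assms(1) that
    by (auto simp: gr_eq_sum_lie graded_pieces.sum_lie_simps[OF graded_pieces_gr] one_gr_part)
qed (simp add: graded_lie_algebra_gr[THEN graded_lie_algebra.lie_ring] lie_ring.axioms(1) comm_group.axioms group.is_monoid)

lemma solv_quot_group_hom: "group_hom G (G Mod derived_series G i) (\<lambda>g. derived_series G i #> g)"
proof -
  interpret N: normal "derived_series G i" G by (rule derived_series_normal)
  show ?thesis
    using N.r_coset_hom_Mod N.factorgroup_is_group is_group by (simp add: group_hom_def group_hom_axioms_def)
qed

lemma derived_series_solv_quot:
  "derived_series (G Mod derived_series G i) i = {\<one>\<^bsub>G Mod derived_series G i\<^esub>}"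
proof -
  let ?N = "derived_series G i"
  interpret q: group_hom G "G Mod ?N" "\<lambda>g. ?N #> g" by (rule solv_quot_group_hom)
  interpret N: normal ?N G by (rule derived_series_normal)
  have "derived_series (G Mod ?N) i = (\<lambda>g. ?N #> g) ` ?N"
    using q.exp_of_derived_img[of "carrier G" i]
    by (simp add: derived_series_def carrier_FactGroup)
  also have "\<dots> = (\<lambda>g. ?N) ` ?N" by (rule image_cong) (simp_all add: N.rcos_const[OF is_group])
  also have "\<dots> = {?N}" by (rule image_constant[OF N.one_closed])
  finally show ?thesis by simp
qed

end

section \<open>Dual bases of finitely generated torsion-free abelian groups\<close>

context comm_group
begin

abbreviation comb :: "'i set \<Rightarrow> ('i \<Rightarrow> 'a) \<Rightarrow> ('i \<Rightarrow> int) \<Rightarrow> 'a" where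
  "comb I e c \<equiv> finprod G (\<lambda>k. e k [^] c k) I"

text \<open>An indexed family and not a set, since an exchange step alters one member and may
  produce repetitions, which a set would lose.\<close>

definition spanning :: "'i set \<Rightarrow> ('i \<Rightarrow> 'a) \<Rightarrow> bool" where
  "spanning I e \<longleftrightarrow> finite I \<and> e \<in> I \<rightarrow> carrier G \<and> (\<forall>x\<in>carrier G. \<exists>c. x = comb I e c)"

lemma comb_closed: "e \<in> I \<rightarrow> carrier G \<Longrightarrow> comb I e c \<in> carrier G"
  by (rule finprod_closed) auto

lemma comb_add:
  assumes "e \<in> I \<rightarrow> carrier G"
  shows "comb I e c \<otimes> comb I e d = comb I e (\<lambda>k. c k + d k)"
proof -
  have "comb I e c \<otimes> comb I e d = finprod G (\<lambda>k. e k [^] c k \<otimes> e k [^] d k) I"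
    by (rule finprod_multf[symmetric]) (use assms in auto)
  also have "\<dots> = comb I e (\<lambda>k. c k + d k)"
    by (rule finprod_cong') (use assms in \<open>auto simp: int_pow_mult Pi_iff\<close>)
  finally show ?thesis .
qed

lemma comb_zero: "comb I e (\<lambda>_. 0) = \<one>"
  by (rule finprod_one_eqI) simp

lemma comb_inv:
  assumes "e \<in> I \<rightarrow> carrier G"
  shows "inv (comb I e c) = comb I e (\<lambda>k. - c k)"
proof (rule inv_equality)
  show "comb I e (\<lambda>k. - c k) \<otimes> comb I e c = \<one>"
    using comb_add[OF assms, of "\<lambda>k. - c k" c] comb_zero[of e I] by simp
qed (rule comb_closed[OF assms])+

text \<open>An elementary operation on the generators, compensated by the inverse operation on the
  exponents.\<close>

lemma comb_exchange:
  assumes "finite I" "e \<in> I \<rightarrow> carrier G" "i \<in> I" "j \<in> I" "i \<noteq> j"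
  shows "comb I (e(j := e j \<otimes> e i [^] s)) (d(i := d i - s * d j)) = comb I e d"
proof -
  define K where "K = I - {i, j}"
  have I: "I = insert i (insert j K)" "finite K" "i \<notin> K" "j \<notin> K" "i \<notin> insert j K" "finite (insert j K)"
    using assms by (auto simp: K_def)
  have c: "e i \<in> carrier G" "e j \<in> carrier G" "\<And>k. k \<in> K \<Longrightarrow> e k \<in> carrier G"
    using assms by (auto simp: K_def)
  have e: "comb I f d = f i [^] d i \<otimes> (f j [^] d j \<otimes> comb K f d)"
    if "\<And>k. k \<in> I \<Longrightarrow> f k \<in> carrier G" for f d
  proof -
    have "f i \<in> carrier G" "f j \<in> carrier G" "\<And>k. k \<in> K \<Longrightarrow> f k \<in> carrier G" using that I(1) by auto
    then show ?thesis
      unfolding I(1) by (subst finprod_insert[OF I(6,5)]; (subst finprod_insert[OF I(2,4)])?) auto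
  qed
  let ?e = "e(j := e j \<otimes> e i [^] s)" and ?d = "d(i := d i - s * d j)"
  have K: "comb K ?e ?d = comb K e d"
    by (rule finprod_cong') (use c I in auto)
  have cc: "comb K e d \<in> carrier G" by (rule comb_closed) (use c in auto)
  have "comb I ?e ?d = ?e i [^] ?d i \<otimes> (?e j [^] ?d j \<otimes> comb K ?e ?d)"
    by (rule e) (use assms in auto)
  also have "\<dots> = e i [^] (d i - s * d j) \<otimes> ((e j [^] d j \<otimes> e i [^] (s * d j)) \<otimes> comb K e d)"
    unfolding K using assms(5) c by (simp add: int_pow_distrib int_pow_pow)
  also have "\<dots> = (e i [^] (d i - s * d j) \<otimes> e i [^] (s * d j)) \<otimes> (e j [^] d j \<otimes> comb K e d)"
    using c cc by (simp add: m_ac)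
  also have "\<dots> = e i [^] d i \<otimes> (e j [^] d j \<otimes> comb K e d)"
    using c by (simp flip: int_pow_mult)
  also have "\<dots> = comb I e d"
    by (rule e[symmetric]) (use assms in auto)
  finally show ?thesis .
qed

lemma spanning_exchange:
  fixes s :: int
  assumes "spanning I e" "i \<in> I" "j \<in> I" "i \<noteq> j"
  shows "spanning I (e(j := e j \<otimes> e i [^] s))"
  unfolding spanning_def
proof (intro conjI ballI)
  have e: "e \<in> I \<rightarrow> carrier G" "finite I" using assms by (auto simp: spanning_def)
  show "finite I" by (rule e)
  show "e(j := e j \<otimes> e i [^] s) \<in> I \<rightarrow> carrier G" 
  proof
    fix k assume "k \<in> I"
    then have "e i \<in> carrier G" "e j \<in> carrier G" "e k \<in> carrier G" using e(1) assms(2,3) by blast+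
    then show "(e(j := e j \<otimes> e i [^] s)) k \<in> carrier G" by simp
  qed
  fix x assume "x \<in> carrier G"
  then obtain d where "x = comb I e d" using assms by (auto simp: spanning_def)
  then show "\<exists>c. x = comb I (e(j := e j \<otimes> e i [^] s)) c"
    using comb_exchange[OF e(2,1) assms(2-4), of s d] by metis
qed

lemma spanning_remove:
  assumes "spanning I e" "i \<in> I" "e i = \<one>"
  shows "spanning (I - {i}) e"
  unfolding spanning_def
proof (intro conjI ballI)
  have e: "e \<in> I \<rightarrow> carrier G" "finite I" using assms by (auto simp: spanning_def)
  show "finite (I - {i})" "e \<in> I - {i} \<rightarrow> carrier G" using e by auto
  fix x assume "x \<in> carrier G"
  then obtain d where d: "x = comb I e d" using assms by (auto simp: spanning_def)
  have I: "I = insert i (I - {i})" using assms by auto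
  have "comb I e d = e i [^] d i \<otimes> comb (I - {i}) e d"
    by (subst I, subst finprod_insert) (use e assms in auto)
  also have "\<dots> = comb (I - {i}) e d"
    using assms comb_closed[of e "I - {i}"] e by (simp add: Pi_iff int_pow_one)
  finally show "\<exists>c. x = comb (I - {i}) e c" using d by blast
qed

text \<open>In a spanning family of least size, a nontrivial relation of least weight would involve a
  single generator, by a Euclidean exchange step.\<close>

lemma spanning_minimal_independent:
  assumes tf: "torsion_free G" and span: "spanning (I :: 'i set) e"
    and min: "\<And>J f. spanning (J :: 'i set) f \<Longrightarrow> card I \<le> card J"
    and rel: "comb I e c = \<one>" and "i \<in> I"
  shows "c i = 0"
proof (rule ccontr)
  assume "c i \<noteq> 0"
  \<comment> \<open>The family varies together with the relation, because an exchange step changes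
    both; the index set, and with it the size that is minimal, stays fixed.\<close>
  have "False" if "spanning I e" "comb I e c = \<one>" "i \<in> I" "c i \<noteq> 0" for e c i
    using that
  proof (induction "nat (\<Sum>k\<in>I. \<bar>c k\<bar>)" arbitrary: e c i rule: less_induct)
    case less
    have e: "e \<in> I \<rightarrow> carrier G" "finite I" using less.prems by (auto simp: spanning_def)
    show False
    proof (cases "\<exists>j\<in>I. j \<noteq> i \<and> c j \<noteq> 0")
      \<comment> \<open>The relation involves \<open>e i\<close> alone, so torsion-freeness makes
        \<open>e i\<close> trivial, and dropping it contradicts the minimal size.\<close>
      case False
      have I: "I = insert i (I - {i})" using less.prems by auto
      have ei: "e i \<in> carrier G" using e less.prems by auto
      have "comb I e c = e i [^] c i \<otimes> comb (I - {i}) e c"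
        by (subst I, subst finprod_insert) (use e less.prems in auto)
      also have "comb (I - {i}) e c = \<one>" using False by (intro finprod_one_eqI) auto
      finally have "e i [^] c i = \<one>" using less.prems ei by simp
      then have "e i [^] \<bar>c i\<bar> = \<one>" using ei by (auto simp: abs_if int_pow_neg)
      then have "e i [^] nat \<bar>c i\<bar> = \<one>" using int_pow_int[of G "e i" "nat \<bar>c i\<bar>"] by simp
      then have "e i = \<one>" 
        using tf[unfolded torsion_free_def, rule_format, OF ei, of "nat \<bar>c i\<bar>"] less.prems(4) by simp
      then have "spanning (I - {i}) e" by (rule spanning_remove[OF less.prems(1,3)])
      from min[OF this] show False using card_Diff1_less[OF e(2) less.prems(3)] by linarith
    next
      case True
      then obtain j where j: "j \<in> I" "j \<noteq> i" "c j \<noteq> 0" by blast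
      have step: False if pq: "p \<in> I" "q \<in> I" "p \<noteq> q" "c q \<noteq> 0" "\<bar>c q\<bar> \<le> \<bar>c p\<bar>" for p q
      proof -
        \<comment> \<open>The sign for which \<open>s * c q\<close> has the sign of
          \<open>c p\<close>; as \<open>\<bar>c q\<bar>\<close> is positive and at most
          \<open>\<bar>c p\<bar>\<close>, subtracting it strictly lowers the weight, while
          \<open>c q\<close> survives.\<close>
        define s where "s = sgn (c p) * sgn (c q)"
        define c' where "c' = c(p := c p - s * c q)"
        have "s * c q = sgn (c p) * \<bar>c q\<bar>" by (simp add: s_def abs_sgn mult.assoc mult.commute[of "sgn (c q)"])
        then have "\<bar>c p - s * c q\<bar> < \<bar>c p\<bar>" using pq by (auto simp: sgn_if abs_if split: if_splits)
        then have "\<bar>c' p\<bar> < \<bar>c p\<bar>" by (simp add: c'_def)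
        then have "(\<Sum>k\<in>I. \<bar>c' k\<bar>) < (\<Sum>k\<in>I. \<bar>c k\<bar>)"
          using pq e(2) by (intro sum_strict_mono_ex1) (auto simp: c'_def)
        moreover have "0 \<le> (\<Sum>k\<in>I. \<bar>c' k\<bar>)" by (rule sum_nonneg) simp
        ultimately have lt: "nat (\<Sum>k\<in>I. \<bar>c' k\<bar>) < nat (\<Sum>k\<in>I. \<bar>c k\<bar>)" by linarith
        have "comb I (e(q := e q \<otimes> e p [^] s)) c' = \<one>"
          unfolding c'_def using comb_exchange[OF e(2,1) pq(1,2,3)] less.prems(2) by simp
        moreover have "c' q \<noteq> 0" using pq by (simp add: c'_def)
        ultimately show False
          using less.hyps[OF lt spanning_exchange[OF less.prems(1) pq(1,2,3)]] pq(2) by blast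
      qed
      show False
      proof (cases "\<bar>c j\<bar> \<le> \<bar>c i\<bar>")
        case True
        then show False using step[of i j] j less.prems by auto
      next
        case False
        then show False using step[of j i] j less.prems by auto
      qed
    qed
  qed
  then show False using span rel \<open>i \<in> I\<close> \<open>c i \<noteq> 0\<close> by blast
qed

lemma generated_imp_spanning:
  assumes "finite S" "S \<subseteq> carrier G" "carrier G \<subseteq> generate G S"
  shows "spanning S (\<lambda>s. s)"
  unfolding spanning_def
proof (intro conjI ballI)
  let ?e = "\<lambda>s::'a. s"
  show "?e \<in> S \<rightarrow> carrier G" using assms by auto
  note e = this
  fix x assume "x \<in> carrier G"
  then have "x \<in> generate G S" using assms by blast
  then show "\<exists>c. x = comb S ?e c"
  proof (induction rule: generate.induct)
    case one
    show ?case using comb_zero[of ?e S] by (intro exI[of _ "\<lambda>_. 0"]) simp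
  next
    case (incl h)
    have I: "S = insert h (S - {h})" using incl by auto
    have hc: "h \<in> carrier G" using incl assms by blast
    have "comb S ?e (\<lambda>k. if k = h then 1 else 0) = h"
    proof -
      have "comb (S - {h}) ?e (\<lambda>k. if k = h then 1 else 0) = \<one>" by (rule finprod_one_eqI) auto
      moreover have "comb S ?e (\<lambda>k. if k = h then 1 else 0) = h [^] (1::int) \<otimes> comb (S - {h}) ?e (\<lambda>k. if k = h then 1 else 0)"
        by (subst I, subst finprod_insert) (use assms incl in auto)
      ultimately show ?thesis using hc by simp
    qed
    then show ?case by (intro exI[of _ "\<lambda>k. if k = h then 1 else 0"]) (rule HOL.sym)
  next
    case (inv h)
    have I: "S = insert h (S - {h})" using inv by auto
    have hc: "h \<in> carrier G" using inv assms by blast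
    have "comb S ?e (\<lambda>k. if k = h then -1 else 0) = inv h"
    proof -
      have "comb (S - {h}) ?e (\<lambda>k. if k = h then -1 else 0) = \<one>" by (rule finprod_one_eqI) auto
      moreover have "comb S ?e (\<lambda>k. if k = h then -1 else 0) = h [^] (-1::int) \<otimes> comb (S - {h}) ?e (\<lambda>k. if k = h then -1 else 0)"
        by (subst I, subst finprod_insert) (use assms inv in auto)
      ultimately show ?thesis using hc by (simp add: int_pow_neg)
    qed
    then show ?case by (intro exI[of _ "\<lambda>k. if k = h then -1 else 0"]) (rule HOL.sym)
  next
    case (eng a b)
    then obtain c d where "a = comb S ?e c" "b = comb S ?e d" by blast
    then have "a \<otimes> b = comb S ?e (\<lambda>k. c k + d k)" using comb_add[OF e] by simp
    then show ?case by (intro exI[of _ "\<lambda>k. c k + d k"])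
  qed
qed (rule assms)

text \<open>A spanning family of least size is independent, so exponents are unique; uniqueness
  makes them additive, and as functions of the element they are the dual basis.\<close>

theorem dual_basis:
  assumes "torsion_free G" "finite S" "S \<subseteq> carrier G" "carrier G \<subseteq> generate G S"
  obtains n e a where "\<And>i. i < n \<Longrightarrow> e i \<in> carrier G" "\<And>i. i < n \<Longrightarrow> a i \<in> hom G integer_group"
    "\<And>i j. \<lbrakk>i < n; j < n\<rbrakk> \<Longrightarrow> a i (e j) = (if i = j then 1 else 0 :: int)"
    "\<And>x. x \<in> carrier G \<Longrightarrow> x = finprod G (\<lambda>i. e i [^] (a i x :: int)) {..<n::nat}"
proof -
  have "\<exists>I e. spanning (I :: 'a set) e" using generated_imp_spanning[OF assms(2-4)] by blast
  then have "\<exists>n I e. spanning (I :: 'a set) e \<and> card I = n" by blast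
  then obtain n where n: "\<exists>I e. spanning (I :: 'a set) e \<and> card I = n"
      and nmin: "\<And>m. m < n \<Longrightarrow> \<not> (\<exists>I e. spanning (I :: 'a set) e \<and> card I = m)"
    using exists_least_iff[of "\<lambda>n. \<exists>I e. spanning (I :: 'a set) e \<and> card I = n"] by blast
  obtain I e where Ie: "spanning (I :: 'a set) e" "card I = n" using n by blast
  have min: "card I \<le> card J" if "spanning (J :: 'a set) f" for J f
    using nmin[of "card J"] that Ie(2) by (metis linorder_not_less)
  have indep: "c i = 0" if "comb I e c = \<one>" "i \<in> I" for c i
    by (rule spanning_minimal_independent[OF assms(1) Ie(1) _ that]) (rule min)
  have e: "e \<in> I \<rightarrow> carrier G" "finite I" using Ie by (auto simp: spanning_def)
  have uniq: "c i = d i" if "comb I e c = comb I e d" "i \<in> I" for c d i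
  proof -
    have "comb I e (\<lambda>k. c k + - d k) = comb I e c \<otimes> inv (comb I e d)"
      unfolding comb_inv[OF e(1)] by (rule comb_add[OF e(1), symmetric])
    also have "\<dots> = \<one>" using that comb_closed[OF e(1)] by simp
    finally have "c i + - d i = 0" by (rule indep[OF _ that(2)])
    then show ?thesis by simp
  qed
  \<comment> \<open>Values outside of \<open>I\<close> are arbitrary; \<open>uniq\<close> determines
    those on \<open>I\<close>.\<close>
  define A where "A x = (SOME c. x = comb I e c)" for x
  have A: "x = comb I e (A x)" if "x \<in> carrier G" for x
  proof -
    have "\<exists>c. x = comb I e c" using Ie that by (simp add: spanning_def)
    then show ?thesis unfolding A_def by (rule someI_ex)
  qed
  have A_add: "A (x \<otimes> y) i = A x i + A y i" if "x \<in> carrier G" "y \<in> carrier G" "i \<in> I" for x y i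
  proof -
    have "comb I e (A (x \<otimes> y)) = comb I e (\<lambda>k. A x k + A y k)"
      using A[of x] A[of y] A[of "x \<otimes> y"] that comb_add[OF e(1), of "A x" "A y"] by simp
    then show ?thesis by (rule uniq[OF _ that(3)])
  qed
  have A_e: "A (e j) i = (if i = j then 1 else 0)" if "i \<in> I" "j \<in> I" for i j
  proof -
    have I: "I = insert j (I - {j})" using that by auto
    have ej: "e j \<in> carrier G" using e that by auto
    let ?c = "\<lambda>i. if i = j then 1 else 0 :: int"
    have "comb (I - {j}) e ?c = \<one>" by (rule finprod_one_eqI) auto
    moreover have "comb I e ?c = e j [^] (1::int) \<otimes> comb (I - {j}) e ?c"
      by (subst I, subst finprod_insert) (use e that in auto)
    ultimately have "comb I e (A (e j)) = comb I e ?c" using ej A[OF ej] by simp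
    then show ?thesis by (rule uniq[OF _ that(1)])
  qed
  \<comment> \<open>The members are numbered because the collection process needs them in an
    order.\<close>
  obtain h where h: "bij_betw h {0..<card I} I" using ex_bij_betw_nat_finite[OF e(2)] by blast
  then have hI: "h i \<in> I" if "i < n" for i using that Ie(2) by (auto simp: bij_betw_def)
  show ?thesis
  proof (rule that[of n "\<lambda>i. e (h i)" "\<lambda>i x. A x (h i)"])
    show "e (h i) \<in> carrier G" if "i < n" for i using e hI[OF that] by auto
    show "(\<lambda>x. A x (h i)) \<in> hom G integer_group" if "i < n" for i
      by (rule homI) (simp_all add: A_add hI[OF that])
    show "A (e (h j)) (h i) = (if i = j then 1 else 0)" if "i < n" "j < n" for i j
    proof -
      have "h i = h j \<longleftrightarrow> i = j" using h that Ie(2) by (auto simp: bij_betw_def inj_on_def)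
      then show ?thesis using A_e[OF hI[OF that(1)] hI[OF that(2)]] by simp
    qed
    show "x = finprod G (\<lambda>i. e (h i) [^] A x (h i)) {..<n}" if "x \<in> carrier G" for x
    proof -
      have "finprod G (\<lambda>i. e (h i) [^] A x (h i)) {..<n} = comb (h ` {..<n}) e (A x)"
        using h hI e Ie(2)
        by (intro finprod_reindex[symmetric]) (auto simp: bij_betw_def lessThan_atLeast0)
      also have "h ` {..<n} = I" using h Ie(2) by (simp add: bij_betw_def lessThan_atLeast0)
      finally show ?thesis using A[OF that] by simp
    qed
  qed
qed

end

section \<open>Collection in groups of nilpotency class two\<close>

definition center :: "('a, 'm) monoid_scheme \<Rightarrow> 'a set" where
  "center K = {z \<in> carrier K. \<forall>x\<in>carrier K. z \<otimes>\<^bsub>K\<^esub> x = x \<otimes>\<^bsub>K\<^esub> z}"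

lemma (in group) subgroup_center: "subgroup (center G) G"
proof (rule subgroupI)
  show "inv z \<in> center G" if "z \<in> center G" for z
  proof -
    have z: "z \<in> carrier G" "\<And>x. x \<in> carrier G \<Longrightarrow> z \<otimes> x = x \<otimes> z" using that by (auto simp: center_def)
    have "inv z \<otimes> x = x \<otimes> inv z" if x: "x \<in> carrier G" for x
    proof -
      have "inv z \<otimes> x = inv z \<otimes> (x \<otimes> z) \<otimes> inv z" using z(1) x by (simp add: m_assoc)
      also have "\<dots> = inv z \<otimes> (z \<otimes> x) \<otimes> inv z" using z(2)[OF x] by simp
      also have "\<dots> = x \<otimes> inv z" using z(1) x by (simp add: cancel_simps)
      finally show ?thesis .
    qed
    then show ?thesis using z(1) unfolding center_def by blast
  qed
  show "z \<otimes> w \<in> center G" if "z \<in> center G" "w \<in> center G" for z w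
  proof -
    have z: "z \<in> carrier G" "\<And>x. x \<in> carrier G \<Longrightarrow> z \<otimes> x = x \<otimes> z" using that by (auto simp: center_def)
    have w: "w \<in> carrier G" "\<And>x. x \<in> carrier G \<Longrightarrow> w \<otimes> x = x \<otimes> w" using that by (auto simp: center_def)
    have "z \<otimes> w \<otimes> x = x \<otimes> (z \<otimes> w)" if x: "x \<in> carrier G" for x
    proof -
      have "z \<otimes> w \<otimes> x = z \<otimes> (x \<otimes> w)" using z(1) w(1) w(2)[OF x] x by (simp add: m_assoc)
      also have "\<dots> = z \<otimes> x \<otimes> w" using z(1) w(1) x by (simp add: m_assoc)
      also have "\<dots> = x \<otimes> z \<otimes> w" using z(2)[OF x] by simp
      finally show ?thesis using z(1) w(1) x by (simp add: m_assoc)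
    qed
    then show ?thesis using z(1) w(1) unfolding center_def by blast
  qed
  have "\<one> \<in> center G" by (simp add: center_def)
  then show "center G \<noteq> {}" by blast
qed (auto simp: center_def)

text \<open>Iterated products by \<open>finprod\<close> ask for a commutative group, so products of
  central commutators are formed here, with the inherited operations.\<close>

abbreviation center_group :: "('a, 'm) monoid_scheme \<Rightarrow> ('a, 'm) monoid_scheme" where
  "center_group K \<equiv> K\<lparr>carrier := center K\<rparr>"

lemma (in group) comm_group_center: "comm_group (center_group G)"
proof -
  interpret Z: group "center_group G"
    by (rule subgroup.subgroup_is_group[OF subgroup_center is_group])
  show ?thesis
  proof (rule Z.group_comm_groupI)
    fix x y assume "x \<in> carrier (center_group G)" "y \<in> carrier (center_group G)"
    then have "x \<in> center G" "y \<in> carrier G" using subgroup.subset[OF subgroup_center] by auto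
    then have "x \<otimes> y = y \<otimes> x" unfolding center_def by blast
    then show "x \<otimes>\<^bsub>center_group G\<^esub> y = y \<otimes>\<^bsub>center_group G\<^esub> x" by simp
  qed
qed

lemma (in group) central_commutator_hom:
  assumes cc: "\<And>x y. \<lbrakk>x \<in> carrier G; y \<in> carrier G\<rbrakk> \<Longrightarrow> commutator G x y \<in> center G"
  shows "x \<in> carrier G \<Longrightarrow> commutator G x \<in> hom G (center_group G)"
    and "y \<in> carrier G \<Longrightarrow> (\<lambda>x. commutator G x y) \<in> hom G (center_group G)"
proof -
  have conj: "g \<otimes> z \<otimes> inv g = z" if "g \<in> carrier G" "z \<in> center G" for g z
  proof -
    have "z \<in> carrier G" "g \<otimes> z = z \<otimes> g" using that by (auto simp: center_def)
    then show ?thesis using that(1) by (simp add: m_assoc)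
  qed
  show "commutator G x \<in> hom G (center_group G)" if "x \<in> carrier G"
  proof (rule homI)
    fix y z assume yz: "y \<in> carrier G" "z \<in> carrier G"
    show "commutator G x (y \<otimes> z) = commutator G x y \<otimes>\<^bsub>center_group G\<^esub> commutator G x z"
      unfolding commutator_mult_right[OF that yz] conj[OF yz(1) cc[OF that yz(2)]] by simp
  qed (simp add: cc that)
  show "(\<lambda>x. commutator G x y) \<in> hom G (center_group G)" if "y \<in> carrier G"
  proof (rule homI)
    fix x z assume xz: "x \<in> carrier G" "z \<in> carrier G"
    have "commutator G z y \<otimes> commutator G x y = commutator G x y \<otimes> commutator G z y"
      using cc[OF xz(2) that] commutator_closed[OF xz(1) that] by (simp add: center_def)
    then show "commutator G (x \<otimes> z) y = commutator G x y \<otimes>\<^bsub>center_group G\<^esub> commutator G z y"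
      unfolding commutator_mult_left[OF xz that] conj[OF xz(1) cc[OF xz(2) that]] by simp
  qed (simp add: cc that)
qed

primrec ordered_prod :: "('k, 'm) monoid_scheme \<Rightarrow> (nat \<Rightarrow> 'k) \<Rightarrow> (nat \<Rightarrow> int) \<Rightarrow> nat \<Rightarrow> 'k" where
  "ordered_prod K e c 0 = \<one>\<^bsub>K\<^esub>"
| "ordered_prod K e c (Suc n) = ordered_prod K e c n \<otimes>\<^bsub>K\<^esub> e n [^]\<^bsub>K\<^esub> c n"

text \<open>Merging the second ordered product into the first moves the power \<open>c i\<close> of
  \<open>e i\<close> past the power \<open>d j\<close> of \<open>e j\<close> precisely for
  \<open>j < i\<close>; each such move costs the commutator to the power
  \<open>c i * d j\<close>.\<close>

definition collect_cocycle ::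
    "('k, 'm) monoid_scheme \<Rightarrow> (nat \<Rightarrow> 'k) \<Rightarrow> (nat \<Rightarrow> int) \<Rightarrow> (nat \<Rightarrow> int) \<Rightarrow> nat \<Rightarrow> 'k" where
  "collect_cocycle K e c d n = finprod (center_group K) (\<lambda>i. finprod (center_group K)
     (\<lambda>j. commutator K (e i) (e j) [^]\<^bsub>K\<^esub> (c i * d j)) {..<i}) {..<n}"

context group
begin

lemma ordered_prod_closed:
  "(\<And>i. i < n \<Longrightarrow> e i \<in> carrier G) \<Longrightarrow> ordered_prod G e c n \<in> carrier G"
  by (induction n) auto

lemma center_int_pow: "z \<in> center G \<Longrightarrow> z [^]\<^bsub>center_group G\<^esub> (k::int) = z [^] k"
  by (rule int_pow_consistent[OF subgroup_center, symmetric])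

text \<open>In the induction step only the last power of the first product has to travel, past the
  whole second product of length \<open>n\<close>. Its cost is the new row of the cocycle.\<close>

lemma collect:
  fixes e :: "nat \<Rightarrow> 'a"
  assumes cc: "\<And>x y. \<lbrakk>x \<in> carrier G; y \<in> carrier G\<rbrakk> \<Longrightarrow> commutator G x y \<in> center G"
    and "\<And>i. i < n \<Longrightarrow> e i \<in> carrier G"
  shows "ordered_prod G e c n \<otimes> ordered_prod G e d n =
    ordered_prod G e (\<lambda>i. c i + d i) n \<otimes> collect_cocycle G e c d n \<and> collect_cocycle G e c d n \<in> center G"
  using assms(2)
proof (induction n)
  case 0
  interpret Z: comm_group "center_group G" by (rule comm_group_center)
  show ?case using subgroup.one_closed[OF subgroup_center] by (simp add: collect_cocycle_def)
next
  case (Suc n)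
  interpret Z: comm_group "center_group G" by (rule comm_group_center)
  have zc: "center G \<subseteq> carrier G" by (rule subgroup.subset[OF subgroup_center])
  have zcom: "z \<otimes> x = x \<otimes> z" if "z \<in> center G" "x \<in> carrier G" for z x using that by (simp add: center_def)
  have en: "e n \<in> carrier G" and ei: "\<And>i. i < n \<Longrightarrow> e i \<in> carrier G" using Suc.prems by auto
  let ?P = "\<lambda>c. ordered_prod G e c n"
  let ?u = "e n [^] c n" and ?v = "e n [^] d n"
  let ?Q = "collect_cocycle G e c d n"
  have IH: "?P c \<otimes> ?P d = ?P (\<lambda>i. c i + d i) \<otimes> ?Q" "?Q \<in> center G" using Suc by auto
  have Pc: "?P c \<in> carrier G" for c by (rule ordered_prod_closed) (rule ei)
  \<comment> \<open>The commutator of the last power with the second product, by additivity in both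
    entries; \<open>comm\<close> and \<open>uR\<close> establish this.\<close>
  define R where "R = finprod (center_group G) (\<lambda>j. commutator G (e n) (e j) [^] (c n * d j)) {..<n}"
  have ki: "commutator G (e n) (e j) [^] (k::int) \<in> center G" if "j < n" for j k
    using cc[OF en ei[OF that]] subgroup_int_pow_closed[OF subgroup_center] by blast
  have R: "R \<in> center G" unfolding R_def using Z.finprod_closed[of "\<lambda>j. commutator G (e n) (e j) [^] (c n * d j)" "{..<n}"] ki by auto
  have comm: "commutator G x (ordered_prod G e d m) =
      finprod (center_group G) (\<lambda>j. commutator G x (e j) [^] d j) {..<m}" if "m \<le> n" "x \<in> carrier G" for m x
    using that(1)
  proof (induction m)
    case 0
    then show ?case using that(2) by simp
  next
    case (Suc m)
    have em: "e m \<in> carrier G" using Suc ei by auto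
    have k: "commutator G x (e j) [^] d j \<in> center G" if "j < Suc m" for j
      using cc[OF \<open>x \<in> carrier G\<close> ei[of j]] subgroup_int_pow_closed[OF subgroup_center] that Suc.prems by auto
    interpret h: group_hom G "center_group G" "commutator G x"
      using central_commutator_hom(1)[OF cc that(2)] is_group Z.is_group
      by (simp add: group_hom_def group_hom_axioms_def)
    have "commutator G x (ordered_prod G e d (Suc m)) =
        commutator G x (ordered_prod G e d m) \<otimes> commutator G x (e m [^] d m)"
      using h.hom_mult[of "ordered_prod G e d m" "e m [^] d m"] em ordered_prod_closed[of m e d] ei Suc.prems
      by (simp only: ordered_prod.simps) simp
    also have "commutator G x (e m [^] d m) = commutator G x (e m) [^] d m"
      using h.hom_int_pow[OF em, of "d m"] center_int_pow[OF cc[OF that(2) em]] by simp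
    also have "commutator G x (ordered_prod G e d m) =
        finprod (center_group G) (\<lambda>j. commutator G x (e j) [^] d j) {..<m}"
      using Suc by simp
    also have "finprod (center_group G) (\<lambda>j. commutator G x (e j) [^] d j) {..<m} \<otimes> commutator G x (e m) [^] d m =
        finprod (center_group G) (\<lambda>j. commutator G x (e j) [^] d j) {..<Suc m}"
    proof -
      have "(\<lambda>j. commutator G x (e j) [^] d j) \<in> {..<m} \<rightarrow> carrier (center_group G)" using k by auto
      then show ?thesis
        using Z.finprod_insert[of "{..<m}" m "\<lambda>j. commutator G x (e j) [^] d j"] k[of m]
          Z.m_comm[OF Z.finprod_closed, of "\<lambda>j. commutator G x (e j) [^] d j" "{..<m}" "commutator G x (e m) [^] d m"]
        by (simp add: lessThan_Suc)
    qed
    finally show ?case .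
  qed
  have uR: "commutator G ?u (?P d) = R"
  proof -
    have "commutator G ?u (e j) [^] d j = commutator G (e n) (e j) [^] (c n * d j)" if "j < n" for j
    proof -
      interpret h: group_hom G "center_group G" "\<lambda>x. commutator G x (e j)"
        using central_commutator_hom(2)[OF cc ei[OF that]] is_group Z.is_group
        by (simp add: group_hom_def group_hom_axioms_def)
      have "commutator G ?u (e j) = commutator G (e n) (e j) [^] c n"
        using h.hom_int_pow[OF en, of "c n"] center_int_pow[OF cc[OF en ei[OF that]]] by simp
      then show ?thesis using int_pow_pow[OF commutator_closed[OF en ei[OF that]]] by simp
    qed
    then have "finprod (center_group G) (\<lambda>j. commutator G ?u (e j) [^] d j) {..<n} = R"
      unfolding R_def by (intro Z.finprod_cong') (use ki in auto)
    then show ?thesis using comm[of n ?u] en by simp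
  qed
  have Qn: "collect_cocycle G e c d (Suc n) = R \<otimes> ?Q"
  proof -
    let ?f = "\<lambda>i. finprod (center_group G) (\<lambda>j. commutator G (e i) (e j) [^] (c i * d j)) {..<i}"
    have "?f i \<in> carrier (center_group G)" if "i < n" for i
      by (rule Z.finprod_closed)
         (use cc ei that subgroup_int_pow_closed[OF subgroup_center] in auto)
    then have "?f \<in> {..<n} \<rightarrow> carrier (center_group G)" by blast
    then show ?thesis
      using Z.finprod_insert[of "{..<n}" n ?f] R by (simp add: collect_cocycle_def lessThan_Suc R_def)
  qed
  have RQ: "R \<otimes> ?Q \<in> center G" using R IH(2) subgroup.m_closed[OF subgroup_center] by blast
  have uc: "?u \<in> carrier G" "?v \<in> carrier G" using en by auto
  have Rc: "R \<in> carrier G" "?Q \<in> carrier G" using R IH(2) zc by auto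
  have swap: "?u \<otimes> ?P d = R \<otimes> ?P d \<otimes> ?u"
    unfolding uR[symmetric] using uc Pc by (simp add: word_simps)
  have "ordered_prod G e c (Suc n) \<otimes> ordered_prod G e d (Suc n) = ?P c \<otimes> (?u \<otimes> ?P d) \<otimes> ?v"
    using uc Pc by (simp add: m_assoc)
  also have "\<dots> = R \<otimes> (?P c \<otimes> ?P d) \<otimes> (?u \<otimes> ?v)"
    unfolding swap using uc Pc[of c] Pc[of d] Rc zcom[OF R Pc[of c]]
    by (metis m_assoc m_closed)
  also have "\<dots> = R \<otimes> (?P (\<lambda>i. c i + d i) \<otimes> ?Q) \<otimes> e n [^] (c n + d n)"
    unfolding IH(1) using en by (simp add: int_pow_mult)
  also have "\<dots> = R \<otimes> (?Q \<otimes> (?P (\<lambda>i. c i + d i) \<otimes> e n [^] (c n + d n)))"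
    using zcom[OF IH(2) Pc[of "\<lambda>i. c i + d i"]] Rc Pc[of "\<lambda>i. c i + d i"] en
    by (simp add: m_assoc[symmetric])
  also have "\<dots> = (R \<otimes> ?Q) \<otimes> ordered_prod G e (\<lambda>i. c i + d i) (Suc n)"
    using Rc Pc[of "\<lambda>i. c i + d i"] en by (simp add: m_assoc)
  also have "\<dots> = ordered_prod G e (\<lambda>i. c i + d i) (Suc n) \<otimes> (R \<otimes> ?Q)"
    using en Pc[of "\<lambda>i. c i + d i"] by (intro zcom[OF RQ]) auto
  finally show ?case unfolding Qn using RQ by blast
qed

end

section \<open>Homotopies of paths\<close>

text \<open>The relation behind \<open>loop_class\<close>, with two separate endpoints, because
  edges of singular simplices need not be loops.\<close>

definition path_homotopic :: "'x topology \<Rightarrow> 'x \<Rightarrow> 'x \<Rightarrow> (real \<Rightarrow> 'x) \<Rightarrow> (real \<Rightarrow> 'x) \<Rightarrow> bool" where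
  "path_homotopic X a b p q \<longleftrightarrow> homotopic_with (\<lambda>r. r 0 = a \<and> r 1 = b) (top_of_set {0..1}) X p q"

lemma path_homotopicD:
  assumes "path_homotopic X a b p q"
  shows "pathin X p" "pathin X q" "p 0 = a" "p 1 = b" "q 0 = a" "q 1 = b"
  using homotopic_with_imp_continuous_maps[OF assms[unfolded path_homotopic_def]]
    homotopic_with_imp_property[OF assms[unfolded path_homotopic_def]]
  by (auto simp: pathin_def)

lemma path_homotopic_refl: "\<lbrakk>pathin X p; p 0 = a; p 1 = b\<rbrakk> \<Longrightarrow> path_homotopic X a b p p"
  by (simp add: path_homotopic_def pathin_def)

lemma path_homotopic_sym: "path_homotopic X a b p q \<Longrightarrow> path_homotopic X a b q p"
  unfolding path_homotopic_def by (rule homotopic_with_symD)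

lemma path_homotopic_trans:
  "\<lbrakk>path_homotopic X a b p q; path_homotopic X a b q r\<rbrakk> \<Longrightarrow> path_homotopic X a b p r"
  unfolding path_homotopic_def by (rule homotopic_with_trans)

text \<open>Paths are functions on all reals, and constructions that agree on the unit interval may
  differ elsewhere.\<close>

lemma path_homotopic_eq:
  assumes "path_homotopic X a b p q" "\<And>t. t \<in> {0..1} \<Longrightarrow> p t = p' t" "\<And>t. t \<in> {0..1} \<Longrightarrow> q t = q' t"
  shows "path_homotopic X a b p' q'"
proof -
  note d = path_homotopicD[OF assms(1)]
  have c: "pathin X p'" "pathin X q'"
    using continuous_map_eq[OF d(1)[unfolded pathin_def], of p'] continuous_map_eq[OF d(2)[unfolded pathin_def], of q']
      assms(2,3) by (simp_all add: pathin_def)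
  have "path_homotopic X a b p' p" "path_homotopic X a b q q'"
    unfolding path_homotopic_def
    by (rule homotopic_with_equal; use d c assms(2,3) in \<open>auto simp: pathin_def\<close>)+
  then show ?thesis by (rule path_homotopic_trans[OF path_homotopic_trans[OF _ assms(1)]])
qed

lemma continuous_map_compose_on:
  assumes "continuous_map (top_of_set T) X f" "continuous_on S u" "u ` S \<subseteq> T"
  shows "continuous_map (top_of_set S) X (\<lambda>x. f (u x))"
proof -
  have "continuous_map (top_of_set S) (top_of_set T) u"
    using assms(2,3) by (simp add: continuous_map_in_subtopology image_subset_iff_funcset)
  from continuous_map_compose[OF this assms(1)] show ?thesis by (simp add: o_def)
qed

text \<open>The straight line homotopy in \<open>Z\<close>, followed by \<open>F\<close>. An
  interval as \<open>Z\<close> yields reparametrizations, a triangle yields the contraction of the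
  boundary of a singular simplex.\<close>

lemma path_homotopic_convex:
  fixes F :: "'b::real_normed_vector \<Rightarrow> 'x"
  assumes F: "continuous_map (top_of_set Z) X F" and "convex Z"
    and u: "continuous_on {0..1} u" "u ` {0..1} \<subseteq> Z" and v: "continuous_on {0..1} v" "v ` {0..1} \<subseteq> Z"
    and ends: "u 0 = v 0" "u 1 = v 1"
  shows "path_homotopic X (F (u 0)) (F (u 1)) (\<lambda>t. F (u t)) (\<lambda>t. F (v t))"
proof -
  let ?k = "\<lambda>(s, t). (1 - s) *\<^sub>R u t + s *\<^sub>R v t"
  have cu: "continuous_on ({0..1} \<times> {0..1::real}) (\<lambda>x. u (snd x))"
    by (rule continuous_on_compose2[OF u(1) continuous_on_snd[OF continuous_on_id]]) auto
  have cv: "continuous_on ({0..1} \<times> {0..1::real}) (\<lambda>x. v (snd x))"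
    by (rule continuous_on_compose2[OF v(1) continuous_on_snd[OF continuous_on_id]]) auto
  have "continuous_on ({0..1} \<times> {0..1::real}) ?k"
    unfolding case_prod_beta by (intro continuous_intros cu cv)
  moreover have "?k ` ({0..1} \<times> {0..1::real}) \<subseteq> Z"
  proof clarsimp
    fix s t :: real assume st: "0 \<le> s" "s \<le> 1" "0 \<le> t" "t \<le> 1"
    then have "u t \<in> Z" "v t \<in> Z" using u v by auto
    then show "(1 - s) *\<^sub>R u t + s *\<^sub>R v t \<in> Z" using \<open>convex Z\<close> st by (simp add: convexD_alt)
  qed
  ultimately have "continuous_map (top_of_set ({0..1} \<times> {0..1::real})) (top_of_set Z) ?k"
    by (auto simp: continuous_map_in_subtopology)
  from continuous_map_compose[OF this F]
  have "continuous_map (prod_topology (top_of_set {0..1}) (top_of_set {0..1::real})) X (F \<circ> ?k)" by simp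
  then show ?thesis
    unfolding path_homotopic_def homotopic_with_def using ends
    by (intro exI[of _ "F \<circ> ?k"]) (auto simp: algebra_simps simp flip: scaleR_add_left)
qed

lemma path_homotopic_reparam:
  assumes "pathin X p" "continuous_on {0..1} u" "u ` {0..1} \<subseteq> {0..1}" "continuous_on {0..1} v" "v ` {0..1} \<subseteq> {0..1}"
    and "u 0 = v 0" "u 1 = v 1"
  shows "path_homotopic X (p (u 0)) (p (u 1)) (\<lambda>t. p (u t)) (\<lambda>t. p (v t))"
  by (rule path_homotopic_convex[of "{0..1}"]) (use assms in \<open>auto simp: pathin_def\<close>)

lemma pathin_concat_loops:
  assumes "pathin X p" "pathin X q" "p 1 = q 0"
  shows "pathin X (concat_loops p q)"
  unfolding pathin_def concat_loops_def
proof (rule continuous_map_cases_le)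
  have "continuous_map (top_of_set {0..1/2}) X (\<lambda>t. p (2 * t))"
    by (rule continuous_map_compose_on[OF assms(1)[unfolded pathin_def]]) (auto intro!: continuous_intros)
  moreover have "subtopology (top_of_set {0..1}) {x \<in> topspace (top_of_set {0..1}). x \<le> 1/2} = top_of_set {0..1/2::real}"
    by (auto simp: subtopology_subtopology intro!: arg_cong[where f="subtopology euclidean"])
  ultimately show "continuous_map (subtopology (top_of_set {0..1}) {x \<in> topspace (top_of_set {0..1}). x \<le> 1/2}) X (\<lambda>t. p (2 * t))"
    by simp
  have "continuous_map (top_of_set {1/2..1}) X (\<lambda>t. q (2 * t - 1))"
    by (rule continuous_map_compose_on[OF assms(2)[unfolded pathin_def]]) (auto intro!: continuous_intros)
  moreover have "subtopology (top_of_set {0..1}) {x \<in> topspace (top_of_set {0..1}). 1/2 \<le> x} = top_of_set {1/2..1::real}"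
    by (auto simp: subtopology_subtopology intro!: arg_cong[where f="subtopology euclidean"])
  ultimately show "continuous_map (subtopology (top_of_set {0..1}) {x \<in> topspace (top_of_set {0..1}). 1/2 \<le> x}) X (\<lambda>t. q (2 * t - 1))"
    by simp
  show "p (2 * t) = q (2 * t - 1)" if "t = 1/2" for t using assms(3) by (simp add: that)
qed (auto simp: continuous_map_from_subtopology)

lemma concat_loops_ends [simp]: "concat_loops p q 0 = p 0" "concat_loops p q 1 = q 1"
  by (simp_all add: concat_loops_def)

lemma path_homotopic_concat:
  assumes "path_homotopic X a b p p'" "path_homotopic X b c q q'"
  shows "path_homotopic X a c (concat_loops p q) (concat_loops p' q')"
proof -
  let ?I = "{0..1::real}"
  obtain h where h: "continuous_map (top_of_set (?I \<times> ?I)) X h" "\<And>x. h (0, x) = p x" "\<And>x. h (1, x) = p' x"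
    "\<And>t. t \<in> ?I \<Longrightarrow> h (t, 0) = a \<and> h (t, 1) = b"
    using assms(1) by (auto simp: path_homotopic_def homotopic_with_def)
  obtain k where k: "continuous_map (top_of_set (?I \<times> ?I)) X k" "\<And>x. k (0, x) = q x" "\<And>x. k (1, x) = q' x"
    "\<And>t. t \<in> ?I \<Longrightarrow> k (t, 0) = b \<and> k (t, 1) = c"
    using assms(2) by (auto simp: path_homotopic_def homotopic_with_def)
  define m where "m = (\<lambda>x::real \<times> real. if snd x \<le> 1/2 then h (fst x, 2 * snd x) else k (fst x, 2 * snd x - 1))"
  have "continuous_map (top_of_set (?I \<times> ?I)) X m"
    unfolding m_def
  proof (rule continuous_map_cases_le)
    show "continuous_map (top_of_set (?I \<times> ?I)) euclideanreal snd"
      by (simp add: continuous_on_snd)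
    have e: "subtopology (top_of_set (?I \<times> ?I)) {x \<in> topspace (top_of_set (?I \<times> ?I)). snd x \<le> 1/2} = top_of_set (?I \<times> {0..1/2})"
      by (auto simp: subtopology_subtopology intro!: arg_cong[where f="subtopology euclidean"])
    have "continuous_map (top_of_set (?I \<times> {0..1/2})) X (\<lambda>x. h (fst x, 2 * snd x))"
      by (rule continuous_map_compose_on[OF h(1)]) (auto intro!: continuous_intros)
    then show "continuous_map (subtopology (top_of_set (?I \<times> ?I)) {x \<in> topspace (top_of_set (?I \<times> ?I)). snd x \<le> 1/2}) X (\<lambda>x. h (fst x, 2 * snd x))"
      unfolding e .
    have e: "subtopology (top_of_set (?I \<times> ?I)) {x \<in> topspace (top_of_set (?I \<times> ?I)). 1/2 \<le> snd x} = top_of_set (?I \<times> {1/2..1})"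
      by (auto simp: subtopology_subtopology intro!: arg_cong[where f="subtopology euclidean"])
    have "continuous_map (top_of_set (?I \<times> {1/2..1})) X (\<lambda>x. k (fst x, 2 * snd x - 1))"
      by (rule continuous_map_compose_on[OF k(1)]) (auto intro!: continuous_intros)
    then show "continuous_map (subtopology (top_of_set (?I \<times> ?I)) {x \<in> topspace (top_of_set (?I \<times> ?I)). 1/2 \<le> snd x}) X (\<lambda>x. k (fst x, 2 * snd x - 1))"
      unfolding e .
    show "h (fst x, 2 * snd x) = k (fst x, 2 * snd x - 1)"
      if "x \<in> topspace (top_of_set (?I \<times> ?I))" "snd x = 1/2" for x
    proof -
      have "fst x \<in> ?I" "2 * snd x = 1" "2 * snd x - 1 = 0" using that by auto
      then show ?thesis using h(4)[of "fst x"] k(4)[of "fst x"] by simp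
    qed
  qed simp
  then show ?thesis
    unfolding path_homotopic_def homotopic_with_def
    by (intro exI[of _ m]) (use h k in \<open>auto simp: m_def concat_loops_def\<close>)
qed

lemma path_homotopic_assoc:
  assumes "pathin X p" "pathin X q" "pathin X r" "p 1 = q 0" "q 1 = r 0"
  shows "path_homotopic X (p 0) (r 1) (concat_loops (concat_loops p q) r) (concat_loops p (concat_loops q r))"
proof -
  let ?F = "concat_loops p (concat_loops q r)"
  \<comment> \<open>Maps the breakpoints \<open>1/4\<close> and \<open>1/2\<close> of the left
    bracketing to the breakpoints \<open>1/2\<close> and \<open>3/4\<close> of the right one. The
    slopes 2, 1, 1/2 decrease, so the function is the minimum of its three linear pieces.\<close>
  let ?u = "\<lambda>t::real. min (2 * t) (min (t + 1/4) (t / 2 + 1/2))"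
  have "pathin X ?F" using assms by (intro pathin_concat_loops) auto
  then have "path_homotopic X (?F (?u 0)) (?F (?u 1)) (\<lambda>t. ?F (?u t)) (\<lambda>t. ?F t)"
    by (rule path_homotopic_reparam; (intro continuous_intros)?) (auto simp: min_def)
  moreover have "?F (?u t) = concat_loops (concat_loops p q) r t" if "t \<in> {0..1}" for t
  proof -
    consider "t \<le> 1/4" | "1/4 < t" "t \<le> 1/2" | "1/2 < t" by linarith
    then show ?thesis
    proof cases
      case 1
      then have "?u t = 2 * t" by (auto simp: min_def)
      then show ?thesis using 1 by (simp add: concat_loops_def)
    next
      case 2
      then have "?u t = t + 1/4" by (auto simp: min_def)
      then show ?thesis using 2 by (simp add: concat_loops_def algebra_simps)
    next
      case 3
      then have "?u t = t / 2 + 1/2" by (auto simp: min_def)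
      then show ?thesis using 3 by (simp add: concat_loops_def algebra_simps)
    qed
  qed
  ultimately have "path_homotopic X (?F (?u 0)) (?F (?u 1)) (concat_loops (concat_loops p q) r) ?F"
    by (rule path_homotopic_eq) auto
  then show ?thesis by (simp add: min_def)
qed

lemma path_homotopic_unit_left:
  assumes "pathin X p"
  shows "path_homotopic X (p 0) (p 1) (concat_loops (\<lambda>_. p 0) p) p"
proof -
  let ?u = "\<lambda>t::real. max 0 (2 * t - 1)"
  have "path_homotopic X (p (?u 0)) (p (?u 1)) (\<lambda>t. p (?u t)) (\<lambda>t. p t)"
    by (rule path_homotopic_reparam[OF assms]; (intro continuous_intros)?) (auto simp: max_def)
  then have h: "path_homotopic X (p 0) (p 1) (\<lambda>t. p (?u t)) p" by simp
  show ?thesis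
  proof (rule path_homotopic_eq[OF h])
    show "p (?u t) = concat_loops (\<lambda>_. p 0) p t" for t
    proof (cases "t \<le> 1/2")
      case True
      then have "?u t = 0" by simp
      then show ?thesis using True by (simp add: concat_loops_def)
    next
      case False
      then have "?u t = 2 * t - 1" by simp
      then show ?thesis using False by (simp add: concat_loops_def)
    qed
  qed simp
qed

lemma path_homotopic_unit_right:
  assumes "pathin X p"
  shows "path_homotopic X (p 0) (p 1) (concat_loops p (\<lambda>_. p 1)) p"
proof -
  let ?u = "\<lambda>t::real. min 1 (2 * t)"
  have "path_homotopic X (p (?u 0)) (p (?u 1)) (\<lambda>t. p (?u t)) (\<lambda>t. p t)"
    by (rule path_homotopic_reparam[OF assms]; (intro continuous_intros)?) (auto simp: min_def)
  then have h: "path_homotopic X (p 0) (p 1) (\<lambda>t. p (?u t)) p" by simp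
  show ?thesis
  proof (rule path_homotopic_eq[OF h])
    show "p (?u t) = concat_loops p (\<lambda>_. p 1) t" for t
    proof (cases "t \<le> 1/2")
      case True
      then have "?u t = 2 * t" by simp
      then show ?thesis using True by (simp add: concat_loops_def)
    next
      case False
      then have "?u t = 1" by simp
      then show ?thesis using False by (simp add: concat_loops_def)
    qed
  qed simp
qed

abbreviation rev_path :: "(real \<Rightarrow> 'x) \<Rightarrow> real \<Rightarrow> 'x" where
  "rev_path p \<equiv> \<lambda>t. p (1 - t)"

lemma pathin_rev: "pathin X p \<Longrightarrow> pathin X (rev_path p)"
  unfolding pathin_def by (rule continuous_map_compose_on) (auto intro!: continuous_intros)

lemma path_homotopic_rev_left:
  assumes "pathin X p"
  shows "path_homotopic X (p 1) (p 1) (concat_loops (rev_path p) p) (\<lambda>_. p 1)"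
proof -
  \<comment> \<open>Runs from 1 back to 0 and forth again; in the interval it contracts to the
    constant 1.\<close>
  let ?u = "\<lambda>t::real. \<bar>2 * t - 1\<bar>"
  have "path_homotopic X (p (?u 0)) (p (?u 1)) (\<lambda>t. p (?u t)) (\<lambda>t. p ((\<lambda>_. 1) t))"
    by (rule path_homotopic_reparam[OF assms]) (auto intro!: continuous_intros)
  then have h: "path_homotopic X (p 1) (p 1) (\<lambda>t. p (?u t)) (\<lambda>_. p 1)" by simp
  show ?thesis
  proof (rule path_homotopic_eq[OF h])
    show "p (?u t) = concat_loops (rev_path p) p t" for t
    proof (cases "t \<le> 1/2")
      case True
      then have "?u t = 1 - 2 * t" by simp
      then show ?thesis using True by (simp add: concat_loops_def)
    next
      case False
      then have "?u t = 2 * t - 1" by simp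
      then show ?thesis using False by (simp add: concat_loops_def)
    qed
  qed simp
qed

section \<open>Singular simplices and paths\<close>

text \<open>Barycentric coordinates as a sequence, from the weights of the vertices 1 and 2. This
  gives singular 2-simplices a planar domain.\<close>

definition vertex_coords :: "real \<times> real \<Rightarrow> nat \<Rightarrow> real" where
  "vertex_coords z = (\<lambda>i. if i = 0 then 1 - fst z - snd z else if i = 1 then fst z else if i = 2 then snd z else 0)"

abbreviation triangle :: "(real \<times> real) set" where
  "triangle \<equiv> {z. 0 \<le> fst z \<and> 0 \<le> snd z \<and> fst z + snd z \<le> 1}"

definition edge_coords :: "real \<Rightarrow> nat \<Rightarrow> real" where
  "edge_coords t = (\<lambda>i. if i = 0 then 1 - t else if i = 1 then t else 0)"

abbreviation edge :: "((nat \<Rightarrow> real) \<Rightarrow> 'x) \<Rightarrow> real \<Rightarrow> 'x" where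
  "edge \<sigma> \<equiv> \<lambda>t. \<sigma> (edge_coords t)"

lemma sum_atMost_1: "(\<Sum>i\<le>(1::nat). f i) = f 0 + f 1" for f :: "nat \<Rightarrow> 'b::comm_monoid_add"
  by (simp add: One_nat_def)

lemma sum_atMost_2: "(\<Sum>i\<le>(2::nat). f i) = f 0 + f 1 + f 2" for f :: "nat \<Rightarrow> 'b::comm_monoid_add"
  by (simp add: numeral_2_eq_2 One_nat_def)

lemma edge_coords_simplex: "t \<in> {0..1} \<Longrightarrow> edge_coords t \<in> standard_simplex 1"
  by (auto simp: standard_simplex_def edge_coords_def sum_atMost_1)

lemma vertex_coords_simplex: "z \<in> triangle \<Longrightarrow> vertex_coords z \<in> standard_simplex 2"
  by (auto simp: standard_simplex_def vertex_coords_def sum_atMost_2)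

lemma simplex_1_eq:
  assumes "x \<in> standard_simplex 1"
  shows "x 1 \<in> {0..1} \<and> x = edge_coords (x 1)"
proof -
  have s: "x 0 + x 1 = 1" "0 \<le> x 0" "0 \<le> x 1" "\<And>i. 1 < i \<Longrightarrow> x i = 0"
    using assms by (auto simp: standard_simplex_def sum_atMost_1)
  have "x i = edge_coords (x 1) i" for i
    using s(1) s(4)[of i] by (auto simp: edge_coords_def)
  then have "x = edge_coords (x 1)" by (rule ext)
  then show ?thesis using s(1-3) by simp
qed

lemma simplex_2_eq: "x \<in> standard_simplex 2 \<Longrightarrow> (x 1, x 2) \<in> triangle \<and> x = vertex_coords (x 1, x 2)"
proof -
  assume x: "x \<in> standard_simplex 2"
  have s: "x 0 + x 1 + x 2 = 1" "\<And>i. 0 \<le> x i" "\<And>i. 2 < i \<Longrightarrow> x i = 0"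
    using x by (auto simp: standard_simplex_def sum_atMost_2)
  have "x i = vertex_coords (x 1, x 2) i" for i
    using s(1) s(3)[of i] by (auto simp: vertex_coords_def)
  then have "x = vertex_coords (x 1, x 2)" by (rule ext)
  moreover have "(x 1, x 2) \<in> triangle" using s(1) s(2)[of 0] s(2)[of 1] s(2)[of 2] by simp
  ultimately show ?thesis by (rule conjI[rotated])
qed

lemma continuous_edge_coords:
  "continuous_map (top_of_set {0..1}) (subtopology (powertop_real UNIV) (standard_simplex 1)) edge_coords"
proof -
  have "continuous_map (top_of_set {0..1}) euclideanreal (\<lambda>t. edge_coords t i)" for i
    by (cases "i = 0"; cases "i = 1") (auto simp: edge_coords_def intro!: continuous_intros)
  then show ?thesis
    using edge_coords_simplex
    by (auto simp: continuous_map_in_subtopology continuous_map_componentwise_UNIV)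
qed

lemma continuous_vertex_coords:
  "continuous_map (top_of_set triangle) (subtopology (powertop_real UNIV) (standard_simplex 2)) vertex_coords"
proof -
  have "continuous_map (top_of_set triangle) euclideanreal (\<lambda>t. vertex_coords t i)" for i
    by (cases "i = 0"; cases "i = 1"; cases "i = 2") (auto simp: vertex_coords_def intro!: continuous_intros)
  then show ?thesis
    using vertex_coords_simplex
    by (auto simp: continuous_map_in_subtopology continuous_map_componentwise_UNIV)
qed

lemma pathin_edge:
  assumes "singular_simplex 1 X \<sigma>"
  shows "pathin X (edge \<sigma>)"
  using continuous_map_compose[OF continuous_edge_coords, of X \<sigma>] assms
  by (auto simp: pathin_def singular_simplex_def o_def)

lemma singular_simplex_loop_simplex:
  assumes "pathin X p"
  shows "singular_simplex 1 X (loop_simplex p)"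
proof -
  have "continuous_map (subtopology (powertop_real UNIV) (standard_simplex 1)) (top_of_set {0..1}) (\<lambda>x. x 1)"
    unfolding continuous_map_in_subtopology
  proof
    show "continuous_map (subtopology (powertop_real UNIV) (standard_simplex 1)) euclidean (\<lambda>x. x 1)"
      by (rule continuous_map_from_subtopology) (use continuous_map_product_projection[of 1 UNIV "\<lambda>_. euclideanreal"] in simp)
    show "(\<lambda>x. x 1) \<in> topspace (subtopology (powertop_real UNIV) (standard_simplex 1)) \<rightarrow> {0..1::real}"
      using simplex_1_eq by simp
  qed
  from continuous_map_compose[OF this, of X p]
  have "continuous_map (subtopology (powertop_real UNIV) (standard_simplex 1)) X (\<lambda>x. p (x 1))"
    using assms by (simp add: pathin_def o_def)
  then have "continuous_map (subtopology (powertop_real UNIV) (standard_simplex 1)) X (loop_simplex p)"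
    by (rule continuous_map_eq) (simp add: loop_simplex_def)
  then show ?thesis by (simp add: singular_simplex_def loop_simplex_def)
qed

lemma edge_loop_simplex: "t \<in> {0..1} \<Longrightarrow> edge (loop_simplex p) t = p t"
  using edge_coords_simplex by (simp add: loop_simplex_def edge_coords_def)

lemma loop_simplex_edge: "singular_simplex 1 X \<sigma> \<Longrightarrow> loop_simplex (edge \<sigma>) = \<sigma>"
proof
  fix x assume \<sigma>: "singular_simplex 1 X \<sigma>"
  show "loop_simplex (edge \<sigma>) x = \<sigma> x"
  proof (cases "x \<in> standard_simplex 1")
    case True
    then have "edge_coords (x 1) = x" using simplex_1_eq by simp
    then show ?thesis using True by (simp add: loop_simplex_def)
  next
    case False
    then show ?thesis using \<sigma> by (simp add: loop_simplex_def singular_simplex_def extensional_def)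
  qed
qed

lemma loop_simplex_cong: "(\<And>t. t \<in> {0..1} \<Longrightarrow> p t = q t) \<Longrightarrow> loop_simplex p = loop_simplex q"
  unfolding loop_simplex_def by (rule restrict_ext) (use simplex_1_eq in simp)

definition triangle_simplex :: "(real \<times> real \<Rightarrow> 'x) \<Rightarrow> (nat \<Rightarrow> real) \<Rightarrow> 'x" where
  "triangle_simplex F = restrict (\<lambda>x. F (x 1, x 2)) (standard_simplex 2)"

lemma singular_simplex_triangle_simplex:
  assumes "continuous_map (top_of_set triangle) X F"
  shows "singular_simplex 2 X (triangle_simplex F)"
proof -
  have "continuous_map (powertop_real UNIV) (prod_topology euclideanreal euclideanreal) (\<lambda>x. (x 1, x (2::nat)))"
    by (intro continuous_map_pairedI continuous_map_product_projection) auto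
  then have "continuous_map (subtopology (powertop_real UNIV) (standard_simplex 2)) euclidean (\<lambda>x. (x 1, x (2::nat)))"
    by (simp add: continuous_map_from_subtopology flip: euclidean_product_topology)
  then have "continuous_map (subtopology (powertop_real UNIV) (standard_simplex 2)) (top_of_set triangle) (\<lambda>x. (x 1, x 2))"
    using simplex_2_eq by (auto simp: continuous_map_in_subtopology)
  from continuous_map_compose[OF this assms]
  have "continuous_map (subtopology (powertop_real UNIV) (standard_simplex 2)) X (triangle_simplex F)"
    by (rule continuous_map_eq) (simp add: triangle_simplex_def)
  then show ?thesis by (simp add: singular_simplex_def triangle_simplex_def)
qed

lemma simplical_face_edge_coords:
  "simplical_face 0 (edge_coords t) = vertex_coords (1 - t, t)"
  "simplical_face 1 (edge_coords t) = vertex_coords (0, t)"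
  "simplical_face 2 (edge_coords t) = vertex_coords (t, 0)"
  by (auto simp: simplical_face_def edge_coords_def vertex_coords_def fun_eq_iff)

lemma two_minus_Suc_0: "(2::nat) - Suc 0 = 1"
  by (simp add: numeral_2_eq_2 One_nat_def)

text \<open>The orientations: face 2 runs from vertex 0 to 1, face 0 from 1 to 2, face 1 from 0 to
  2. So face 2 followed by face 0 is parallel to face 1, and this order persists in all products
  below.\<close>

lemma edge_singular_face:
  assumes "t \<in> {0..1}"
  shows "edge (singular_face 2 0 \<tau>) t = \<tau> (vertex_coords (1 - t, t))"
    "edge (singular_face 2 1 \<tau>) t = \<tau> (vertex_coords (0, t))"
    "edge (singular_face 2 2 \<tau>) t = \<tau> (vertex_coords (t, 0))"
  using edge_coords_simplex[OF assms]
  by (simp_all add: singular_face_def simplical_face_edge_coords two_minus_Suc_0)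

lemma singular_face_2:
  assumes "singular_simplex 2 X \<tau>" "k \<le> 2"
  shows "singular_simplex 1 X (singular_face 2 k \<tau>)"
  using singular_simplex_singular_face[OF assms(1) _ assms(2)] by (simp add: two_minus_Suc_0)

lemma singular_face_triangle_simplex:
  "singular_face 2 0 (triangle_simplex F) = loop_simplex (\<lambda>t. F (1 - t, t))"
  "singular_face 2 1 (triangle_simplex F) = loop_simplex (\<lambda>t. F (0, t))"
  "singular_face 2 2 (triangle_simplex F) = loop_simplex (\<lambda>t. F (t, 0))"
proof -
  have coords: "vertex_coords z 1 = fst z" "vertex_coords z 2 = snd z" for z
    by (simp_all add: vertex_coords_def)
  have eq: "singular_face 2 k (triangle_simplex F) = loop_simplex (\<lambda>t. F (f t))"
    if k: "k \<le> 2" and f: "\<And>t. simplical_face k (edge_coords t) = vertex_coords (f t)" for k f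
  proof
    fix x
    show "singular_face 2 k (triangle_simplex F) x = loop_simplex (\<lambda>t. F (f t)) x"
    proof (cases "x \<in> standard_simplex 1")
      case True
      have "simplical_face k x \<in> standard_simplex 2"
        using simplical_face_in_standard_simplex[of 2 k x] k True by (simp add: two_minus_Suc_0)
      moreover have "simplical_face k x = vertex_coords (f (x 1))"
        using f[of "x 1"] simplex_1_eq[OF True] by simp
      ultimately show ?thesis
        using True by (simp add: singular_face_def triangle_simplex_def loop_simplex_def two_minus_Suc_0 coords)
    next
      case False
      then show ?thesis by (simp add: singular_face_def loop_simplex_def two_minus_Suc_0)
    qed
  qed
  show "singular_face 2 0 (triangle_simplex F) = loop_simplex (\<lambda>t. F (1 - t, t))"
    "singular_face 2 1 (triangle_simplex F) = loop_simplex (\<lambda>t. F (0, t))"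
    "singular_face 2 2 (triangle_simplex F) = loop_simplex (\<lambda>t. F (t, 0))"
    by (rule eq; simp add: simplical_face_edge_coords)+
qed

text \<open>The boundary of a singular 2-simplex is contractible because the simplex is convex.\<close>

lemma path_homotopic_triangle:
  assumes "singular_simplex 2 X \<tau>"
  shows "path_homotopic X (edge (singular_face 2 2 \<tau>) 0) (edge (singular_face 2 0 \<tau>) 1)
    (concat_loops (edge (singular_face 2 2 \<tau>)) (edge (singular_face 2 0 \<tau>))) (edge (singular_face 2 1 \<tau>))"
proof -
  let ?F = "\<lambda>z. \<tau> (vertex_coords z)"
  \<comment> \<open>The broken line from vertex 0 over vertex 1 to vertex 2, written as one path in
    the triangle; it is compared with the straight edge from 0 to 2.\<close>
  let ?u = "\<lambda>t::real. (min (2 * t) (2 - 2 * t), max 0 (2 * t - 1))"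
  have F: "continuous_map (top_of_set triangle) X ?F"
    using continuous_map_compose[OF continuous_vertex_coords, of X \<tau>] assms
    by (auto simp: singular_simplex_def o_def)
  have "convex triangle"
  proof -
    have "triangle = {z. inner (1, 0) z \<ge> 0} \<inter> {z. inner (0, 1) z \<ge> 0} \<inter> {z. inner (1, 1) z \<le> (1::real)}"
      by (auto simp: inner_prod_def)
    then show ?thesis by (simp only:) (intro convex_Int convex_halfspace_ge convex_halfspace_le)
  qed
  then have "path_homotopic X (?F (?u 0)) (?F (?u 1)) (\<lambda>t. ?F (?u t)) (\<lambda>t. ?F ((\<lambda>t. (0, t)) t))"
    by (intro path_homotopic_convex[OF F] continuous_intros) (auto simp: min_def max_def)
  moreover have "?F (?u t) = concat_loops (edge (singular_face 2 2 \<tau>)) (edge (singular_face 2 0 \<tau>)) t"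
    if "t \<in> {0..1}" for t
    using that edge_singular_face(3)[of "2 * t" \<tau>] edge_singular_face(1)[of "2 * t - 1" \<tau>]
    by (auto simp: concat_loops_def min_def max_def algebra_simps)
  ultimately have "path_homotopic X (?F (?u 0)) (?F (?u 1))
      (concat_loops (edge (singular_face 2 2 \<tau>)) (edge (singular_face 2 0 \<tau>))) (edge (singular_face 2 1 \<tau>))"
    by (rule path_homotopic_eq) (simp_all add: edge_singular_face)
  then show ?thesis by (simp add: edge_singular_face)
qed

lemma chain_boundary_2:
  "chain_boundary 2 (frag_of \<tau>) =
    frag_of (singular_face 2 0 \<tau>) - frag_of (singular_face 2 1 \<tau>) + frag_of (singular_face 2 2 \<tau>)"
  by (simp add: chain_boundary_of sum_atMost_2)

lemma chain_boundary_1: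
  "chain_boundary 1 (frag_of \<sigma>) = frag_of (singular_face 1 0 \<sigma>) - frag_of (singular_face 1 1 \<sigma>)"
  by (simp add: chain_boundary_of sum_atMost_1)

lemma singular_face_1_vertex:
  "singular_face 1 0 \<sigma> (\<lambda>j. if j = 0 then 1 else 0) = edge \<sigma> 1"
  "singular_face 1 1 \<sigma> (\<lambda>j. if j = 0 then 1 else 0) = edge \<sigma> 0"
proof -
  have s: "(1::nat) - Suc 0 = 0" by (simp add: One_nat_def)
  have "simplical_face 0 (\<lambda>j::nat. if j = 0 then 1 else 0 :: real) = edge_coords 1"
    by (auto simp: simplical_face_def edge_coords_def fun_eq_iff)
  moreover have "simplical_face 1 (\<lambda>j::nat. if j = 0 then 1 else 0 :: real) = edge_coords 0"
    by (auto simp: simplical_face_def edge_coords_def fun_eq_iff)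
  ultimately show "singular_face 1 0 \<sigma> (\<lambda>j. if j = 0 then 1 else 0) = edge \<sigma> 1"
    "singular_face 1 1 \<sigma> (\<lambda>j. if j = 0 then 1 else 0) = edge \<sigma> 0"
    by (simp_all add: singular_face_def s standard_simplex_0)
qed

text \<open>The triangle is projected onto its edge from vertex 0 to vertex 2, with vertex 1 going
  to the midpoint, where \<open>concat_loops\<close> passes from \<open>p\<close> to
  \<open>q\<close>.\<close>

definition concat_simplex :: "(real \<Rightarrow> 'x) \<Rightarrow> (real \<Rightarrow> 'x) \<Rightarrow> (nat \<Rightarrow> real) \<Rightarrow> 'x" where
  "concat_simplex p q = triangle_simplex (\<lambda>z. concat_loops p q (fst z / 2 + snd z))"

lemma concat_simplex:
  assumes "pathin X p" "pathin X q" "p 1 = q 0"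
  shows "singular_simplex 2 X (concat_simplex p q)"
    and "singular_face 2 0 (concat_simplex p q) = loop_simplex q"
    and "singular_face 2 1 (concat_simplex p q) = loop_simplex (concat_loops p q)"
    and "singular_face 2 2 (concat_simplex p q) = loop_simplex p"
proof -
  have "continuous_map (top_of_set triangle) X (\<lambda>z. concat_loops p q (fst z / 2 + snd z))"
    using pathin_concat_loops[OF assms] unfolding pathin_def
    by (rule continuous_map_compose_on) (auto intro!: continuous_intros)
  then show "singular_simplex 2 X (concat_simplex p q)"
    unfolding concat_simplex_def by (rule singular_simplex_triangle_simplex)
  have 0: "concat_loops p q ((1 - t) / 2 + t) = q t" if "t \<in> {0..1}" for t
  proof (cases "t = 0")
    case True
    then show ?thesis using assms(3) by (simp add: concat_loops_def)
  next
    case False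
    then have "\<not> (1 - t) / 2 + t \<le> 1/2" "2 * ((1 - t) / 2 + t) - 1 = t" using that by (auto simp: field_simps)
    then show ?thesis by (simp only: concat_loops_def if_False)
  qed
  have 2: "concat_loops p q (t / 2) = p t" if "t \<in> {0..1}" for t
    using that by (simp add: concat_loops_def)
  show "singular_face 2 0 (concat_simplex p q) = loop_simplex q"
    "singular_face 2 1 (concat_simplex p q) = loop_simplex (concat_loops p q)"
    "singular_face 2 2 (concat_simplex p q) = loop_simplex p"
    unfolding concat_simplex_def singular_face_triangle_simplex
    by (rule loop_simplex_cong; simp add: 0 2)+
qed

lemma const_simplex:
  assumes "a \<in> topspace X"
  shows "singular_simplex 2 X (triangle_simplex (\<lambda>_. a))"
    and "k \<le> 2 \<Longrightarrow> singular_face 2 k (triangle_simplex (\<lambda>_. a)) = loop_simplex (\<lambda>_. a)"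
proof -
  show "singular_simplex 2 X (triangle_simplex (\<lambda>_. a))"
    using assms by (intro singular_simplex_triangle_simplex) simp
  assume "k \<le> 2"
  then have "k = 0 \<or> k = 1 \<or> k = 2" by linarith
  then show "singular_face 2 k (triangle_simplex (\<lambda>_. a)) = loop_simplex (\<lambda>_. a)"
    by (auto simp: singular_face_triangle_simplex)
qed

text \<open>The square of the homotopy is cut along the diagonal \<open>d\<close>. The two sides on
  which the homotopy is constant become one constant edge in each triangle.\<close>

lemma homotopy_simplices:
  assumes "path_homotopic X a b p q"
  obtains \<tau> \<tau>' d where "singular_simplex 2 X \<tau>" "singular_simplex 2 X \<tau>'"
    "singular_face 2 2 \<tau> = loop_simplex p" "singular_face 2 0 \<tau> = loop_simplex (\<lambda>_. b)"
    "singular_face 2 1 \<tau> = d" "singular_face 2 1 \<tau>' = d"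
    "singular_face 2 2 \<tau>' = loop_simplex (\<lambda>_. a)" "singular_face 2 0 \<tau>' = loop_simplex q"
proof -
  let ?I = "{0..1::real}"
  obtain h where h: "continuous_map (top_of_set (?I \<times> ?I)) X h" "\<And>x. h (0, x) = p x" "\<And>x. h (1, x) = q x"
    "\<And>t. t \<in> ?I \<Longrightarrow> h (t, 0) = a \<and> h (t, 1) = b"
    using assms by (auto simp: path_homotopic_def homotopic_with_def)
  let ?F = "\<lambda>z. h (snd z, fst z + snd z)" and ?F' = "\<lambda>z. h (fst z + snd z, snd z)"
  have "continuous_map (top_of_set triangle) X ?F"
    by (rule continuous_map_compose_on[OF h(1)]) (auto intro!: continuous_intros)
  moreover have "continuous_map (top_of_set triangle) X ?F'"
    by (rule continuous_map_compose_on[OF h(1)]) (auto intro!: continuous_intros)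
  ultimately have "singular_simplex 2 X (triangle_simplex ?F)" "singular_simplex 2 X (triangle_simplex ?F')"
    by (auto intro: singular_simplex_triangle_simplex)
  moreover have "singular_face 2 0 (triangle_simplex ?F) = loop_simplex (\<lambda>_. b)"
    "singular_face 2 2 (triangle_simplex ?F') = loop_simplex (\<lambda>_. a)"
    "singular_face 2 2 (triangle_simplex ?F) = loop_simplex p"
    "singular_face 2 0 (triangle_simplex ?F') = loop_simplex q"
    unfolding singular_face_triangle_simplex by (rule loop_simplex_cong; simp add: h)+
  moreover have "singular_face 2 1 (triangle_simplex ?F) = loop_simplex (\<lambda>t. h (t, t))"
    "singular_face 2 1 (triangle_simplex ?F') = loop_simplex (\<lambda>t. h (t, t))"
    by (simp_all add: singular_face_triangle_simplex)
  ultimately show ?thesis by (intro that)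
qed

section \<open>Homologous paths\<close>

abbreviation homologous :: "'x topology \<Rightarrow> 'x chain \<Rightarrow> 'x chain \<Rightarrow> bool" where
  "homologous X \<equiv> homologous_rel 1 X {}"

abbreviation path_chain :: "(real \<Rightarrow> 'x) \<Rightarrow> 'x chain" where
  "path_chain p \<equiv> frag_of (loop_simplex p)"

lemma homologousI:
  assumes "singular_chain 2 X d" "chain_boundary 2 d = a - b"
  shows "homologous X a b"
  unfolding homologous_rel_def singular_boundary using assms by (auto simp: Suc_1)

text \<open>The three faces of a constant 2-simplex coincide, and their alternating sum leaves one
  of them.\<close>

lemma homologous_const:
  assumes "a \<in> topspace X"
  shows "homologous X (path_chain (\<lambda>_. a)) 0"
proof (rule homologousI)
  show "singular_chain 2 X (frag_of (triangle_simplex (\<lambda>_. a)))"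
    using const_simplex(1)[OF assms] by (simp add: singular_chain_of)
  show "chain_boundary 2 (frag_of (triangle_simplex (\<lambda>_. a))) = path_chain (\<lambda>_. a) - 0"
    by (simp add: chain_boundary_2 const_simplex(2)[OF assms])
qed

lemma homologous_concat:
  assumes "pathin X p" "pathin X q" "p 1 = q 0"
  shows "homologous X (path_chain (concat_loops p q)) (path_chain p + path_chain q)"
proof (rule homologousI)
  note c = concat_simplex[OF assms]
  show "singular_chain 2 X (- frag_of (concat_simplex p q))"
    using c(1) by (simp add: singular_chain_of singular_chain_minus)
  show "chain_boundary 2 (- frag_of (concat_simplex p q)) =
      path_chain (concat_loops p q) - (path_chain p + path_chain q)"
    by (simp add: chain_boundary_minus chain_boundary_2 c algebra_simps)
qed

lemma homologous_add: "\<lbrakk>homologous X a a'; homologous X b b'\<rbrakk> \<Longrightarrow> homologous X (a + b) (a' + b')"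
  by (rule homologous_rel_add)

lemma homologous_trans: "\<lbrakk>homologous X a b; homologous X b c\<rbrakk> \<Longrightarrow> homologous X a c"
  by (rule homologous_rel_trans)

lemma homologous_sym: "homologous X a b \<Longrightarrow> homologous X b a"
  by (simp add: homologous_rel_sym)

lemma homologous_homotopic:
  assumes "path_homotopic X a b p q"
  shows "homologous X (path_chain p) (path_chain q)"
proof -
  have ab: "a \<in> topspace X" "b \<in> topspace X"
    using path_homotopicD[OF assms] continuous_map_image_subset_topspace[of "top_of_set {0..1}" X p]
    by (force simp: pathin_def)+
  obtain \<tau> \<tau>' d where t: "singular_simplex 2 X \<tau>" "singular_simplex 2 X \<tau>'"
    "singular_face 2 2 \<tau> = loop_simplex p" "singular_face 2 0 \<tau> = loop_simplex (\<lambda>_. b)"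
    "singular_face 2 1 \<tau> = d" "singular_face 2 1 \<tau>' = d"
    "singular_face 2 2 \<tau>' = loop_simplex (\<lambda>_. a)" "singular_face 2 0 \<tau>' = loop_simplex q"
    using homotopy_simplices[OF assms] .
  have "homologous X (path_chain p + path_chain (\<lambda>_. b)) (path_chain q + path_chain (\<lambda>_. a))"
  proof (rule homologousI)
    show "singular_chain 2 X (frag_of \<tau> - frag_of \<tau>')"
      using t(1,2) by (simp add: singular_chain_of singular_chain_diff)
    show "chain_boundary 2 (frag_of \<tau> - frag_of \<tau>') =
        path_chain p + path_chain (\<lambda>_. b) - (path_chain q + path_chain (\<lambda>_. a))"
      by (simp add: chain_boundary_diff chain_boundary_2 t(3-8) algebra_simps)
  qed
  \<comment> \<open>Both constant paths are boundaries, so one is traded for the other until the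
    same summand stands on both sides.\<close>
  from homologous_rel_diff[OF this homologous_rel_diff[OF homologous_const[OF ab(2)] homologous_const[OF ab(1)]]]
  have "homologous X (path_chain p + path_chain (\<lambda>_. a)) (path_chain q + path_chain (\<lambda>_. a))"
    by (simp add: algebra_simps)
  from homologous_rel_diff[OF this homologous_rel_refl[of 1 X "{}" "path_chain (\<lambda>_. a)"]]
  show ?thesis by simp
qed

lemma homologous_rev:
  assumes "pathin X p"
  shows "homologous X (path_chain (rev_path p)) (- path_chain p)"
proof -
  have "p 1 \<in> topspace X"
    using continuous_map_image_subset_topspace[of "top_of_set {0..1}" X p] assms by (force simp: pathin_def)
  then have "homologous X (path_chain (concat_loops (rev_path p) p)) 0"
    by (rule homologous_trans[OF homologous_homotopic[OF path_homotopic_rev_left[OF assms]] homologous_const])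
  moreover have "homologous X (path_chain (concat_loops (rev_path p) p)) (path_chain (rev_path p) + path_chain p)"
    by (rule homologous_concat) (simp_all add: assms pathin_rev)
  ultimately have "homologous X (path_chain (rev_path p) + path_chain p) 0"
    using homologous_trans homologous_sym by blast
  from homologous_rel_diff[OF this homologous_rel_refl[of 1 X "{}" "path_chain p"]]
  show ?thesis by simp
qed

lemma carrier_homology:
  "carrier (homology_group 1 X) = (homologous_rel_set 1 X {}) ` singular_relcycle_set 1 X {}"
  "carrier (homology_group 2 X) = (homologous_rel_set 2 X {}) ` singular_relcycle_set 2 X {}"
  using carrier_relative_homology_group[of 1 X "{}"] carrier_relative_homology_group[of 2 X "{}"] by simp_all

lemma mult_homology:
  "homologous_rel_set 1 X {} a \<otimes>\<^bsub>homology_group 1 X\<^esub> homologous_rel_set 1 X {} b = homologous_rel_set 1 X {} (a + b)"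
proof -
  have "homologous X (a + b) c \<longleftrightarrow> (\<exists>r s. homologous X a r \<and> homologous X b s \<and> c = r + s)" for c
  proof
    assume "homologous X (a + b) c"
    from homologous_rel_diff[OF this homologous_rel_refl[of 1 X "{}" a]]
    have "homologous X b (c - a)" by simp
    then show "\<exists>r s. homologous X a r \<and> homologous X b s \<and> c = r + s"
      by (intro exI[of _ a] exI[of _ "c - a"]) simp
  qed (auto intro: homologous_add)
  then show ?thesis using mult_relative_homology_group[of 1 X "{}"] by auto
qed

lemma relcycle_1: "singular_relcycle 1 X {} c \<longleftrightarrow> singular_chain 1 X c \<and> chain_boundary 1 c = 0"
  by (simp add: singular_cycle)

lemma relcycle_path_chain:
  assumes "pathin X p" "p 0 = p 1"
  shows "singular_relcycle 1 X {} (path_chain p)"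
proof -
  let ?\<sigma> = "loop_simplex p"
  have \<sigma>: "singular_simplex 1 X ?\<sigma>" by (rule singular_simplex_loop_simplex[OF assms(1)])
  have s: "(1::nat) - Suc 0 = 0" by (simp add: One_nat_def)
  have "singular_face 1 0 ?\<sigma> = singular_face 1 1 ?\<sigma>"
  proof
    fix x :: "nat \<Rightarrow> real"
    show "singular_face 1 0 ?\<sigma> x = singular_face 1 1 ?\<sigma> x"
    proof (cases "x \<in> standard_simplex 0")
      case True
      then show ?thesis
        using singular_face_1_vertex[of ?\<sigma>] assms(2) edge_loop_simplex[of 0 p] edge_loop_simplex[of 1 p]
        by (simp add: standard_simplex_0)
    qed (simp add: singular_face_def s)
  qed
  then show ?thesis using \<sigma> by (simp add: relcycle_1 chain_boundary_1 singular_chain_of)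
qed

section \<open>The fundamental group and the first homology group\<close>

lemma loops_iff: "p \<in> loops X x0 \<longleftrightarrow> pathin X p \<and> p 0 = x0 \<and> p 1 = x0"
  by (simp add: loops_def)

lemma loop_class_alt: "loop_class X x0 p = {q \<in> loops X x0. path_homotopic X x0 x0 p q}"
  by (simp add: loop_class_def path_homotopic_def)

lemma loop_class_eq_iff:
  assumes "p \<in> loops X x0" "q \<in> loops X x0"
  shows "loop_class X x0 p = loop_class X x0 q \<longleftrightarrow> path_homotopic X x0 x0 p q"
proof
  assume "loop_class X x0 p = loop_class X x0 q"
  moreover have "q \<in> loop_class X x0 q"
    using assms(2) path_homotopic_refl[of X q] by (simp add: loop_class_alt loops_iff)
  ultimately have "q \<in> loop_class X x0 p" by simp
  then show "path_homotopic X x0 x0 p q" by (simp add: loop_class_alt)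
next
  assume pq: "path_homotopic X x0 x0 p q"
  have "path_homotopic X x0 x0 p r \<longleftrightarrow> path_homotopic X x0 x0 q r" for r
    using path_homotopic_trans[OF pq, of r] path_homotopic_trans[OF path_homotopic_sym[OF pq], of r] by blast
  then show "loop_class X x0 p = loop_class X x0 q" by (simp add: loop_class_alt)
qed

lemma concat_loops_closed: "\<lbrakk>p \<in> loops X x0; q \<in> loops X x0\<rbrakk> \<Longrightarrow> concat_loops p q \<in> loops X x0"
  by (simp add: loops_iff pathin_concat_loops)

lemma mult_fundamental_group:
  assumes "p \<in> loops X x0" "q \<in> loops X x0"
  shows "loop_class X x0 p \<otimes>\<^bsub>fundamental_group X x0\<^esub> loop_class X x0 q = loop_class X x0 (concat_loops p q)"
proof -
  have "loop_class X x0 (concat_loops p' q') = loop_class X x0 (concat_loops p q)"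
    if "p' \<in> loop_class X x0 p" "q' \<in> loop_class X x0 q" for p' q'
  proof -
    have "path_homotopic X x0 x0 p p'" "path_homotopic X x0 x0 q q'" "p' \<in> loops X x0" "q' \<in> loops X x0"
      using that by (auto simp: loop_class_alt)
    then show ?thesis
      using loop_class_eq_iff[OF concat_loops_closed[OF assms] concat_loops_closed[of p' X x0 q']]
        path_homotopic_concat by metis
  qed
  moreover have "p \<in> loop_class X x0 p" "q \<in> loop_class X x0 q"
    using assms path_homotopic_refl[of X] by (simp_all add: loop_class_alt loops_iff)
  ultimately have "(\<Union>p'\<in>loop_class X x0 p. \<Union>q'\<in>loop_class X x0 q. loop_class X x0 (concat_loops p' q')) =
      loop_class X x0 (concat_loops p q)" by blast
  then show ?thesis by (simp add: fundamental_group_def)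
qed

locale pi1_space =
  fixes G :: "'g monoid" (structure) and X :: "'x topology" and x0 :: 'x and \<theta> :: "(real \<Rightarrow> 'x) set \<Rightarrow> 'g"
  assumes group_G: "group G" and path_connected: "path_connected_space X" and x0: "x0 \<in> topspace X"
    and theta_iso: "\<theta> \<in> iso (fundamental_group X x0) G"

sublocale pi1_space \<subseteq> group G
  by (rule group_G)

context pi1_space
begin

abbreviation Theta :: "(real \<Rightarrow> 'x) \<Rightarrow> 'g" where
  "Theta p \<equiv> \<theta> (loop_class X x0 p)"

lemma carrier_fundamental_group: "carrier (fundamental_group X x0) = loop_class X x0 ` loops X x0"
  by (simp add: fundamental_group_def)

lemma Theta_closed [simp]: "p \<in> loops X x0 \<Longrightarrow> Theta p \<in> carrier G"
  using theta_iso by (auto simp: iso_def hom_def carrier_fundamental_group)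

lemma Theta_concat: "\<lbrakk>p \<in> loops X x0; q \<in> loops X x0\<rbrakk> \<Longrightarrow> Theta (concat_loops p q) = Theta p \<otimes> Theta q"
  using theta_iso by (simp add: iso_def hom_def carrier_fundamental_group flip: mult_fundamental_group)

lemma Theta_eq_iff: "\<lbrakk>p \<in> loops X x0; q \<in> loops X x0\<rbrakk> \<Longrightarrow> Theta p = Theta q \<longleftrightarrow> path_homotopic X x0 x0 p q"
  using theta_iso loop_class_eq_iff[of p X x0 q]
  by (auto simp: iso_def bij_betw_def inj_on_def carrier_fundamental_group)

lemma Theta_surj:
  assumes "g \<in> carrier G"
  obtains p where "p \<in> loops X x0" "Theta p = g"
proof -
  have "\<theta> ` loop_class X x0 ` loops X x0 = carrier G"
    using theta_iso by (auto simp: iso_def bij_betw_def carrier_fundamental_group)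
  then have "g \<in> \<theta> ` loop_class X x0 ` loops X x0" using assms by simp
  then obtain C where C: "C \<in> loop_class X x0 ` loops X x0" "g = \<theta> C" by (rule imageE)
  from C(1) obtain p where "p \<in> loops X x0" "C = loop_class X x0 p" by blast
  then show ?thesis using that[of p] C(2) by simp
qed

lemma const_loop: "(\<lambda>_. x0) \<in> loops X x0"
  using x0 by (simp add: loops_iff pathin_def)

lemma Theta_const: "Theta (\<lambda>_. x0) = \<one>"
proof -
  have "concat_loops (\<lambda>_. x0) (\<lambda>_. x0) = (\<lambda>_. x0)" by (auto simp: concat_loops_def)
  then have "Theta (\<lambda>_. x0) \<otimes> Theta (\<lambda>_. x0) = Theta (\<lambda>_. x0)"
    using Theta_concat[OF const_loop const_loop] by simp
  then show ?thesis using Theta_closed[OF const_loop] by (metis r_cancel_one')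
qed

text \<open>The path at \<open>x0\<close> is constant, so that closing up a loop at
  \<open>x0\<close> does not change its class.\<close>

definition base :: "'x \<Rightarrow> real \<Rightarrow> 'x" where
  "base x = (if x = x0 then (\<lambda>_. x0) else (SOME p. pathin X p \<and> p 0 = x0 \<and> p 1 = x))"

lemma base:
  assumes "x \<in> topspace X"
  shows "pathin X (base x)" "base x 0 = x0" "base x 1 = x"
proof -
  have "pathin X (base x) \<and> base x 0 = x0 \<and> base x 1 = x"
  proof (cases "x = x0")
    case True
    then show ?thesis using const_loop by (simp add: base_def loops_iff)
  next
    case False
    have "\<exists>p. pathin X p \<and> p 0 = x0 \<and> p 1 = x"
      using path_connected x0 assms by (auto simp: path_connected_space_def)
    from someI_ex[OF this] show ?thesis using False by (simp add: base_def)
  qed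
  then show "pathin X (base x)" "base x 0 = x0" "base x 1 = x" by auto
qed

definition based :: "(real \<Rightarrow> 'x) \<Rightarrow> real \<Rightarrow> 'x" where
  "based P = concat_loops (base (P 0)) (concat_loops P (rev_path (base (P 1))))"

lemma pathin_topspace: "pathin X P \<Longrightarrow> t \<in> {0..1} \<Longrightarrow> P t \<in> topspace X"
  using continuous_map_image_subset_topspace[of "top_of_set {0..1}" X P] by (force simp: pathin_def)

lemma based_loop:
  assumes "pathin X P"
  shows "based P \<in> loops X x0"
proof -
  have t: "P 0 \<in> topspace X" "P 1 \<in> topspace X" using pathin_topspace[OF assms] by auto
  note b = base[OF t(1)] base[OF t(2)]
  show ?thesis
    unfolding loops_iff based_def using b assms by (simp add: pathin_concat_loops pathin_rev)
qed

text \<open>A retraction of the fundamental groupoid onto \<open>G\<close>: the chosen paths close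
  up any path to a loop.\<close>

definition gam :: "(real \<Rightarrow> 'x) \<Rightarrow> 'g" where
  "gam P = Theta (based P)"

lemma gam_closed: "pathin X P \<Longrightarrow> gam P \<in> carrier G"
  by (simp add: gam_def based_loop)

lemma gam_homotopic:
  assumes "path_homotopic X a b P Q"
  shows "gam P = gam Q"
proof -
  note d = path_homotopicD[OF assms]
  have t: "a \<in> topspace X" "b \<in> topspace X" using pathin_topspace[OF d(1), of 0] pathin_topspace[OF d(1), of 1] d by auto
  note ba = base[OF t(1)] and bb = base[OF t(2)]
  have "path_homotopic X x0 x0 (based P) (based Q)"
    unfolding based_def d(3-6)
    by (rule path_homotopic_concat[OF path_homotopic_refl path_homotopic_concat[OF assms path_homotopic_refl]])
       (use ba bb pathin_rev[OF bb(1)] in auto)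
  then show ?thesis
    unfolding gam_def using Theta_eq_iff[OF based_loop[OF d(1)] based_loop[OF d(2)]] by simp
qed

text \<open>The two chosen paths to the common point \<open>Q 0\<close> are traversed in opposite
  directions and cancel; the rest is rebracketing up to homotopy.\<close>

lemma gam_concat:
  assumes P: "pathin X P" and Q: "pathin X Q" and PQ: "P 1 = Q 0"
  shows "gam (concat_loops P Q) = gam P \<otimes> gam Q"
proof -
  have t: "P 0 \<in> topspace X" "Q 0 \<in> topspace X" "Q 1 \<in> topspace X"
    using pathin_topspace[OF P] pathin_topspace[OF Q] by auto
  define a b c where "a = base (P 0)" "b = base (Q 0)" "c = rev_path (base (Q 1))"
  note a = base[OF t(1), folded a_b_c_def] and b = base[OF t(2), folded a_b_c_def]
  have c: "pathin X c" "c 0 = Q 1" "c 1 = x0"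
    using base[OF t(3)] pathin_rev by (auto simp: a_b_c_def)
  have rb: "pathin X (rev_path b)" by (rule pathin_rev[OF b(1)])
  note [simp] = a b c rb P Q PQ pathin_concat_loops
  let ?k = concat_loops
  have 1: "path_homotopic X x0 x0 (?k (?k a (?k P (rev_path b))) (?k b (?k Q c))) (?k a (?k (?k P (rev_path b)) (?k b (?k Q c))))"
    using path_homotopic_assoc[of X a "?k P (rev_path b)" "?k b (?k Q c)"] by simp
  have 2: "path_homotopic X (P 0) x0 (?k (?k P (rev_path b)) (?k b (?k Q c))) (?k P (?k (rev_path b) (?k b (?k Q c))))"
    using path_homotopic_assoc[of X P "rev_path b" "?k b (?k Q c)"] by simp
  have 3: "path_homotopic X (Q 0) x0 (?k (rev_path b) (?k b (?k Q c))) (?k (?k (rev_path b) b) (?k Q c))"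
    by (rule path_homotopic_sym) (use path_homotopic_assoc[of X "rev_path b" b "?k Q c"] in simp)
  have 4: "path_homotopic X (Q 0) x0 (?k (?k (rev_path b) b) (?k Q c)) (?k (\<lambda>_. Q 0) (?k Q c))"
    by (rule path_homotopic_concat[OF _ path_homotopic_refl]) (use path_homotopic_rev_left[of X b] in simp_all)
  have 5: "path_homotopic X (Q 0) x0 (?k (\<lambda>_. Q 0) (?k Q c)) (?k Q c)"
    using path_homotopic_unit_left[of X "?k Q c"] by simp
  have 6: "path_homotopic X (P 0) x0 (?k P (?k (rev_path b) (?k b (?k Q c)))) (?k P (?k Q c))"
    by (rule path_homotopic_concat[OF path_homotopic_refl path_homotopic_trans[OF path_homotopic_trans[OF 3 4] 5]]) simp_all
  have 7: "path_homotopic X (P 0) x0 (?k P (?k Q c)) (?k (?k P Q) c)"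
    by (rule path_homotopic_sym) (use path_homotopic_assoc[of X P Q c] in simp)
  have "path_homotopic X x0 x0 (?k a (?k (?k P (rev_path b)) (?k b (?k Q c)))) (?k a (?k (?k P Q) c))"
    by (rule path_homotopic_concat[OF path_homotopic_refl path_homotopic_trans[OF path_homotopic_trans[OF 2 6] 7]]) simp_all
  from path_homotopic_trans[OF 1 this]
  have "path_homotopic X x0 x0 (?k (based P) (based Q)) (based (?k P Q))"
    by (simp add: based_def a_b_c_def)
  then have "Theta (?k (based P) (based Q)) = Theta (based (?k P Q))"
    using Theta_eq_iff[of "?k (based P) (based Q)" "based (?k P Q)"] by (simp add: concat_loops_closed based_loop)
  then show ?thesis by (simp add: gam_def Theta_concat based_loop)
qed

lemma gam_loop:
  assumes "p \<in> loops X x0"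
  shows "gam p = Theta p"
proof -
  have p: "pathin X p" "p 0 = x0" "p 1 = x0" using assms by (auto simp: loops_iff)
  have b: "base x0 = (\<lambda>_. x0)" by (simp add: base_def)
  have "path_homotopic X x0 x0 (concat_loops p (\<lambda>_. x0)) p"
    using path_homotopic_unit_right[OF p(1)] p by simp
  moreover have "path_homotopic X x0 x0 (concat_loops (\<lambda>_. x0) (concat_loops p (\<lambda>_. x0))) (concat_loops p (\<lambda>_. x0))"
    using path_homotopic_unit_left[of X "concat_loops p (\<lambda>_. x0)"] p const_loop
    by (simp add: pathin_concat_loops loops_iff)
  ultimately have "path_homotopic X x0 x0 (based p) p"
    unfolding based_def p b by (rule path_homotopic_trans[rotated])
  then show ?thesis
    unfolding gam_def using Theta_eq_iff[OF based_loop[OF p(1)] assms] by simp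
qed

abbreviation gam1 :: "((nat \<Rightarrow> real) \<Rightarrow> 'x) \<Rightarrow> 'g" where
  "gam1 \<sigma> \<equiv> gam (edge \<sigma>)"

lemma gam1_closed: "singular_simplex 1 X \<sigma> \<Longrightarrow> gam1 \<sigma> \<in> carrier G"
  by (simp add: gam_closed pathin_edge)

text \<open>The noncommutative cocycle condition, from which everything about \<open>H\<^sub>2\<close> is derived.\<close>

lemma gam1_triangle:
  assumes "singular_simplex 2 X \<tau>"
  shows "gam1 (singular_face 2 1 \<tau>) = gam1 (singular_face 2 2 \<tau>) \<otimes> gam1 (singular_face 2 0 \<tau>)"
proof -
  have "pathin X (edge (singular_face 2 2 \<tau>))" "pathin X (edge (singular_face 2 0 \<tau>))"
    by (rule pathin_edge[OF singular_face_2[OF assms]]; simp)+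
  moreover have "edge (singular_face 2 2 \<tau>) 1 = edge (singular_face 2 0 \<tau>) 0"
    by (simp add: edge_singular_face)
  ultimately show ?thesis
    using gam_homotopic[OF path_homotopic_triangle[OF assms]] gam_concat by metis
qed

lemma gam1_loop_simplex:
  assumes "p \<in> loops X x0"
  shows "gam1 (loop_simplex p) = Theta p"
proof -
  have p: "pathin X p" "p 0 = x0" "p 1 = x0" using assms by (auto simp: loops_iff)
  have "path_homotopic X x0 x0 p p" using p by (intro path_homotopic_refl)
  then have "path_homotopic X x0 x0 (edge (loop_simplex p)) p"
    by (rule path_homotopic_eq) (simp_all add: edge_loop_simplex)
  then show ?thesis using gam_homotopic[of x0 x0 "edge (loop_simplex p)" p] gam_loop[OF assms] by simp
qed

end

declare Suc_1 [simp del]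

lemma (in comm_group) chain_hom_exists:
  assumes "\<And>\<sigma>. singular_simplex p X \<sigma> \<Longrightarrow> f \<sigma> \<in> carrier G"
  obtains h where "h \<in> hom (chain_group p X) G" "\<And>\<sigma>. singular_simplex p X \<sigma> \<Longrightarrow> h (frag_of \<sigma>) = f \<sigma>"
proof -
  have "f ` singular_simplex_set p X \<subseteq> carrier G" using assms by auto
  from free_Abelian_group_universal[OF this] show ?thesis
    using that unfolding chain_group_def by auto
qed

lemma chain_hom_simps:
  assumes "group M" "h \<in> hom (chain_group p X) M" "singular_chain p X a" "singular_chain p X b"
  shows "h (a + b) = h a \<otimes>\<^bsub>M\<^esub> h b" "h (a - b) = h a \<otimes>\<^bsub>M\<^esub> inv\<^bsub>M\<^esub> h b" "h 0 = \<one>\<^bsub>M\<^esub>" "h a \<in> carrier M"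
proof -
  interpret group_hom "chain_group p X" M h
    using assms by (simp add: group_hom_def group_hom_axioms_def)
  show "h (a + b) = h a \<otimes>\<^bsub>M\<^esub> h b" using hom_mult[of a b] assms by simp
  have "inv\<^bsub>chain_group p X\<^esub> b = - b"
    using assms(4) by (intro m_inv_chain_group) (simp add: singular_chain_def)
  then show "h (a - b) = h a \<otimes>\<^bsub>M\<^esub> inv\<^bsub>M\<^esub> h b"
    using hom_mult[of a "- b"] hom_inv[of b] assms(3,4) by (simp add: singular_chain_minus)
  show "h 0 = \<one>\<^bsub>M\<^esub>" using hom_one by simp
  show "h a \<in> carrier M" using assms by simp
qed

lemma singular_chain_induct [consumes 1, case_names zero one diff]:
  assumes "singular_chain p X c" "P 0" "\<And>\<sigma>. singular_simplex p X \<sigma> \<Longrightarrow> P (frag_of \<sigma>)"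
    and "\<And>a b. \<lbrakk>singular_chain p X a; singular_chain p X b; P a; P b\<rbrakk> \<Longrightarrow> P (a - b)"
  shows "P c"
proof -
  have "Poly_Mapping.keys c \<subseteq> singular_simplex_set p X" using assms(1) by (simp add: singular_chain_def)
  then have "singular_chain p X c \<and> P c"
  proof (induction c rule: frag_induction)
    case (diff a b)
    then show ?case using assms(4) by (simp add: singular_chain_diff)
  qed (use assms(2,3) in \<open>auto simp: singular_chain_of\<close>)
  then show ?thesis ..
qed

lemma chain_hom_eqI:
  assumes "group M" "h \<in> hom (chain_group p X) M" "k \<in> hom (chain_group p X) M" "singular_chain p X c"
    and "\<And>\<sigma>. singular_simplex p X \<sigma> \<Longrightarrow> h (frag_of \<sigma>) = k (frag_of \<sigma>)"
  shows "h c = k c"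
  using assms(4)
proof (induction rule: singular_chain_induct)
  case zero
  then show ?case using chain_hom_simps(3)[OF assms(1,2), of 0 0] chain_hom_simps(3)[OF assms(1,3), of 0 0] by simp
next
  case (one \<sigma>)
  then show ?case by (rule assms(5))
next
  case (diff a b)
  then show ?case using chain_hom_simps(2)[OF assms(1,2)] chain_hom_simps(2)[OF assms(1,3)] by simp
qed

lemma boundary_chain_hom:
  assumes "h \<in> hom (chain_group p X) M"
  shows "(\<lambda>c. h (chain_boundary (Suc p) c)) \<in> hom (chain_group (Suc p) X) M"
proof (rule homI)
  fix a b assume "a \<in> carrier (chain_group (Suc p) X)" "b \<in> carrier (chain_group (Suc p) X)"
  then have "singular_chain p X (chain_boundary (Suc p) a)" "singular_chain p X (chain_boundary (Suc p) b)"
    by (simp_all add: singular_chain_boundary_alt)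
  then show "h (chain_boundary (Suc p) (a \<otimes>\<^bsub>chain_group (Suc p) X\<^esub> b)) =
      h (chain_boundary (Suc p) a) \<otimes>\<^bsub>M\<^esub> h (chain_boundary (Suc p) b)"
    using hom_mult[OF assms] by (simp add: chain_boundary_add)
qed (use assms in \<open>auto simp: hom_def Pi_iff singular_chain_boundary_alt\<close>)

lemma const_hom: "group M \<Longrightarrow> (\<lambda>_. \<one>\<^bsub>M\<^esub>) \<in> hom L M"
  by (simp add: hom_def group.is_monoid monoid.l_one)

section \<open>The Hurewicz isomorphism in degree one\<close>

context pi1_space
begin

lemma chain_hom_boundary_trivial:
  assumes "group M" "h \<in> hom (chain_group 1 X) M" "singular_chain 2 X d"
    and "\<And>\<tau>. singular_simplex 2 X \<tau> \<Longrightarrow> h (chain_boundary 2 (frag_of \<tau>)) = \<one>\<^bsub>M\<^esub>"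
  shows "h (chain_boundary 2 d) = \<one>\<^bsub>M\<^esub>"
  using chain_hom_eqI[OF assms(1) boundary_chain_hom[OF assms(2)] const_hom[OF assms(1)], of d] assms(3,4)
  by (simp add: Suc_1)

text \<open>In a commutative group \<open>gam1_triangle\<close> says that the alternating sum over
  the faces of a triangle vanishes.\<close>

lemma gam1_boundary_trivial:
  assumes "comm_group M" "a \<in> hom G M" "h \<in> hom (chain_group 1 X) M"
    and "\<And>\<sigma>. singular_simplex 1 X \<sigma> \<Longrightarrow> h (frag_of \<sigma>) = a (gam1 \<sigma>)" and "singular_chain 2 X d"
  shows "h (chain_boundary 2 d) = \<one>\<^bsub>M\<^esub>"
proof -
  interpret M: comm_group M by fact
  show ?thesis
  proof (rule chain_hom_boundary_trivial[OF M.is_group assms(3,5)])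
    fix \<tau> assume t: "singular_simplex 2 X \<tau>"
    have f: "singular_simplex 1 X (singular_face 2 k \<tau>)" if "k \<le> 2" for k using singular_face_2[OF t that] .
    then have fc: "singular_chain 1 X (frag_of (singular_face 2 k \<tau>))" if "k \<le> 2" for k
      using that by (simp add: singular_chain_of)
    have ac: "a (gam1 (singular_face 2 k \<tau>)) \<in> carrier M" if "k \<le> 2" for k
      using assms(2) gam1_closed[OF f[OF that]] by (auto simp: hom_def)
    have "a (gam1 (singular_face 2 1 \<tau>)) = a (gam1 (singular_face 2 2 \<tau>)) \<otimes>\<^bsub>M\<^esub> a (gam1 (singular_face 2 0 \<tau>))"
      unfolding gam1_triangle[OF t] by (rule hom_mult[OF assms(2) gam1_closed[OF f] gam1_closed[OF f]]) simp_all
    then show "h (chain_boundary 2 (frag_of \<tau>)) = \<one>\<^bsub>M\<^esub>"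
      unfolding chain_boundary_2
      using f fc ac[of 0] ac[of 1] ac[of 2]
        chain_hom_simps(1)[OF M.is_group assms(3), of "frag_of (singular_face 2 0 \<tau>) - frag_of (singular_face 2 1 \<tau>)"
          "frag_of (singular_face 2 2 \<tau>)"]
        chain_hom_simps(2)[OF M.is_group assms(3), of "frag_of (singular_face 2 0 \<tau>)" "frag_of (singular_face 2 1 \<tau>)"]
      by (simp add: assms(4) singular_chain_diff M.inv_mult M.m_ac)
  qed
qed

text \<open>The classes of \<open>gam1\<close> extend linearly to chains and vanish on boundaries.
  This makes \<open>H1_to_ab\<close> well defined.\<close>

lemma homologous_loops_cls:
  assumes "p \<in> loops X x0" "q \<in> loops X x0" "homologous X (path_chain p) (path_chain q)"
  shows "cls 1 (Theta p) = cls 1 (Theta q)"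
proof -
  let ?M = "gr_part G 1"
  interpret M: comm_group ?M by (rule comm_group_gr_part) simp
  have ch: "cls 1 \<in> hom G ?M" by (rule homI) (simp_all add: gr_part_simps cls_mult)
  obtain h where h: "h \<in> hom (chain_group 1 X) ?M" "\<And>\<sigma>. singular_simplex 1 X \<sigma> \<Longrightarrow> h (frag_of \<sigma>) = cls 1 (gam1 \<sigma>)"
    using M.chain_hom_exists[of 1 X "\<lambda>\<sigma>. cls 1 (gam1 \<sigma>)"] gam1_closed by (auto simp: gr_part_simps)
  obtain d where d: "singular_chain 2 X d" "chain_boundary 2 d = path_chain p - path_chain q"
    using assms(3) unfolding homologous_rel_def singular_boundary by (auto simp: Suc_1)
  have s: "singular_simplex 1 X (loop_simplex p)" "singular_simplex 1 X (loop_simplex q)"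
    using assms(1,2) by (auto simp: loops_iff singular_simplex_loop_simplex)
  have "h (path_chain p - path_chain q) = \<one>\<^bsub>?M\<^esub>"
    using gam1_boundary_trivial[OF M.comm_group_axioms ch h d(1)] d(2) by simp
  then have "cls 1 (Theta p) \<otimes>\<^bsub>?M\<^esub> inv\<^bsub>?M\<^esub> cls 1 (Theta q) = \<one>\<^bsub>?M\<^esub>"
    using chain_hom_simps(2)[OF M.is_group h(1), of "path_chain p" "path_chain q"] s h(2) assms
    by (simp add: singular_chain_of gam1_loop_simplex)
  moreover have "cls 1 (Theta p) \<in> carrier ?M" "cls 1 (Theta q) \<in> carrier ?M"
    using assms by (auto simp: gr_part_simps)
  ultimately show ?thesis by (metis M.inv_equality M.inv_inv M.inv_closed)
qed

text \<open>Every simplex is replaced by its closed-up loop, at the price of the chosen paths at its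
  ends, which \<open>E\<close> collects. The correction factors through the boundary, as
  \<open>E c = - B (chain_boundary 1 c)\<close>, and so vanishes on a cycle. For the induction the
  claim is stated for all chains, with the correction included.\<close>

lemma cycle_homologous_loop:
  assumes "singular_relcycle 1 X {} c"
  obtains p where "p \<in> loops X x0" "homologous X (path_chain p) c"
proof -
  define E where "E = frag_extend (\<lambda>\<sigma>. path_chain (base (edge \<sigma> 0)) - path_chain (base (edge \<sigma> 1)))"
  define B where "B = frag_extend (\<lambda>s. path_chain (base (s (\<lambda>j::nat. if j = 0 then 1 else 0 :: real))))"
  have c: "singular_chain 1 X c" "chain_boundary 1 c = 0" using assms by (auto simp: relcycle_1)
  have "E c = - B (chain_boundary 1 c)"
    using c(1)
  proof (induction rule: singular_chain_induct)
    case (one \<sigma>)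
    show ?case
      by (simp add: E_def B_def chain_boundary_1 frag_extend_diff singular_face_1_vertex)
  qed (simp_all add: E_def B_def chain_boundary_diff frag_extend_diff)
  then have E0: "E c = 0" using c(2) by (simp add: B_def)
  have "\<exists>p\<in>loops X x0. homologous X (path_chain p) (c + E c)"
    using c(1)
  proof (induction rule: singular_chain_induct)
    case zero
    then show ?case using const_loop homologous_const[OF x0] by (auto simp: E_def)
  next
    case (one \<sigma>)
    have P: "pathin X (edge \<sigma>)" by (rule pathin_edge[OF one])
    have t: "edge \<sigma> 0 \<in> topspace X" "edge \<sigma> 1 \<in> topspace X"
      using pathin_topspace[OF P, of 0] pathin_topspace[OF P, of 1] by auto
    note b = base[OF t(1)] and b' = base[OF t(2)]
    let ?r = "rev_path (base (edge \<sigma> 1))"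
    have r: "pathin X ?r" by (rule pathin_rev[OF b'(1)])
    have 1: "homologous X (path_chain (concat_loops (edge \<sigma>) ?r)) (frag_of \<sigma> + - path_chain (base (edge \<sigma> 1)))"
      using homologous_trans[OF homologous_concat[OF P r]
          homologous_add[OF homologous_rel_refl homologous_rev[OF b'(1)]]] b'(3) loop_simplex_edge[OF one] by simp
    have "homologous X (path_chain (based (edge \<sigma>)))
        (path_chain (base (edge \<sigma> 0)) + (frag_of \<sigma> + - path_chain (base (edge \<sigma> 1))))"
      unfolding based_def
      by (rule homologous_trans[OF homologous_concat homologous_add[OF homologous_rel_refl 1]])
         (simp_all add: b b' r P pathin_concat_loops)
    then have "homologous X (path_chain (based (edge \<sigma>))) (frag_of \<sigma> + E (frag_of \<sigma>))"
      by (simp add: E_def algebra_simps)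
    then show ?case using based_loop[OF P] by blast
  next
    case (diff a b)
    then obtain p q where p: "p \<in> loops X x0" "homologous X (path_chain p) (a + E a)"
      and q: "q \<in> loops X x0" "homologous X (path_chain q) (b + E b)" by blast
    have pq: "pathin X p" "pathin X q" "p 1 = x0" "q 0 = x0" "q 1 = x0" using p(1) q(1) by (auto simp: loops_iff)
    have "rev_path q \<in> loops X x0" using pq pathin_rev[OF pq(2)] by (simp add: loops_iff)
    then have "concat_loops p (rev_path q) \<in> loops X x0" by (rule concat_loops_closed[OF p(1)])
    moreover have "homologous X (path_chain (concat_loops p (rev_path q))) (path_chain p + - path_chain q)"
      by (rule homologous_trans[OF homologous_concat homologous_add[OF homologous_rel_refl homologous_rev]])
         (simp_all add: pq pathin_rev)
    then have "homologous X (path_chain (concat_loops p (rev_path q))) ((a + E a) - (b + E b))"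
      using homologous_trans homologous_rel_diff[OF p(2) q(2)] by fastforce
    moreover have "(a + E a) - (b + E b) = (a - b) + E (a - b)" by (simp add: E_def frag_extend_diff)
    ultimately show ?case by metis
  qed
  then show ?thesis using that E0 by auto
qed

abbreviation hcl :: "(real \<Rightarrow> 'x) \<Rightarrow> 'x chain set" where
  "hcl p \<equiv> homologous_rel_set 1 X {} (path_chain p)"

abbreviation H1 :: "'x chain set monoid" where
  "H1 \<equiv> homology_group 1 X"

lemma hcl_closed: "p \<in> loops X x0 \<Longrightarrow> hcl p \<in> carrier H1"
  unfolding carrier_homology by (intro imageI) (auto simp: loops_iff intro: relcycle_path_chain)

lemma H1_cases:
  assumes "z \<in> carrier H1"
  obtains p where "p \<in> loops X x0" "z = hcl p"
proof -
  obtain c where c: "singular_relcycle 1 X {} c" "z = homologous_rel_set 1 X {} c"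
    using assms by (auto simp: carrier_homology)
  obtain p where "p \<in> loops X x0" "homologous X (path_chain p) c" using cycle_homologous_loop[OF c(1)] .
  then show ?thesis using that[of p] c(2) homologous_rel_set_eq[of 1 X "{}" "path_chain p" c] by simp
qed

lemma hcl_concat:
  assumes "p \<in> loops X x0" "q \<in> loops X x0"
  shows "hcl p \<otimes>\<^bsub>H1\<^esub> hcl q = hcl (concat_loops p q)"
proof -
  have "homologous X (path_chain (concat_loops p q)) (path_chain p + path_chain q)"
    using assms by (intro homologous_concat) (auto simp: loops_iff)
  then show ?thesis
    unfolding mult_homology using homologous_rel_set_eq[of 1 X "{}"] by metis
qed

lemma hcl_eqI: "\<lbrakk>p \<in> loops X x0; q \<in> loops X x0; Theta p = Theta q\<rbrakk> \<Longrightarrow> hcl p = hcl q"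
  using Theta_eq_iff homologous_homotopic homologous_rel_set_eq[of 1 X "{}" "path_chain p" "path_chain q"] by metis

abbreviation ab :: "'x chain set \<Rightarrow> 'g set" where
  "ab \<equiv> H1_to_ab G X x0 \<theta>"

lemma ab_hcl:
  assumes "p \<in> loops X x0"
  shows "ab (hcl p) = cls 1 (Theta p)"
  unfolding H1_to_ab_def
proof (rule the_equality)
  show "\<exists>q\<in>loops X x0. hcl p = hcl q \<and> cls 1 (Theta p) = lower_central G 2 #> Theta q"
    using assms by (auto simp: Suc_1)
  fix C assume "\<exists>q\<in>loops X x0. hcl p = hcl q \<and> C = lower_central G 2 #> Theta q"
  then obtain q where q: "q \<in> loops X x0" "hcl p = hcl q" "C = cls 1 (Theta q)" by (auto simp: Suc_1)
  then show "C = cls 1 (Theta p)"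
    using homologous_loops_cls[OF q(1) assms] homologous_rel_set_eq[of 1 X "{}" "path_chain q" "path_chain p"] by simp
qed

lemma group_H1: "group H1"
  by simp

lemma comm_group_H1: "comm_group H1"
  by (rule abelian_homology_group)

lemma ab_hom: "ab \<in> hom H1 (gr_part G 1)"
proof (rule homI)
  fix z w assume "z \<in> carrier H1" "w \<in> carrier H1"
  then obtain p q where p: "p \<in> loops X x0" "z = hcl p" and q: "q \<in> loops X x0" "w = hcl q"
    using H1_cases by metis
  show "ab z \<in> carrier (gr_part G 1)" using p by (simp add: ab_hcl gr_part_simps)
  show "ab (z \<otimes>\<^bsub>H1\<^esub> w) = ab z \<otimes>\<^bsub>gr_part G 1\<^esub> ab w"
    using p q by (simp add: hcl_concat ab_hcl concat_loops_closed Theta_concat gr_part_simps cls_mult)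
qed

text \<open>The Hurewicz homomorphism from \<open>G\<close> to the first homology group, by a chosen
  loop.\<close>

definition kap :: "'g \<Rightarrow> 'x chain set" where
  "kap g = hcl (SOME p. p \<in> loops X x0 \<and> Theta p = g)"

lemma kap_Theta: "p \<in> loops X x0 \<Longrightarrow> kap (Theta p) = hcl p"
  unfolding kap_def by (rule hcl_eqI) (metis (mono_tags, lifting) someI_ex)+

lemma kap_hom: "kap \<in> hom G H1"
proof (rule homI)
  fix g h assume "g \<in> carrier G" "h \<in> carrier G"
  then obtain p q where pq: "p \<in> loops X x0" "g = Theta p" "q \<in> loops X x0" "h = Theta q"
    using Theta_surj by metis
  show "kap g \<in> carrier H1" using pq by (simp add: kap_Theta hcl_closed)
  have "kap (Theta (concat_loops p q)) = hcl p \<otimes>\<^bsub>H1\<^esub> hcl q"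
    using pq by (simp only: kap_Theta concat_loops_closed hcl_concat)
  then show "kap (g \<otimes> h) = kap g \<otimes>\<^bsub>H1\<^esub> kap h" using pq by (simp add: kap_Theta Theta_concat)
qed

lemma hom_comm_trivial_lower_central:
  assumes "comm_group M" "f \<in> hom G M" "g \<in> lower_central G 2"
  shows "f g = \<one>\<^bsub>M\<^esub>"
proof -
  interpret M: comm_group M by fact
  interpret f: group_hom G M f
    using assms M.is_group group_G by (simp add: group_hom_def group_hom_axioms_def)
  have g: "g \<in> generate G {commutator G x y | x y. x \<in> carrier G \<and> y \<in> carrier G}"
    using assms(3) lower_central_Suc[of 1] by (simp add: Suc_1)
  have "f g \<in> {\<one>\<^bsub>M\<^esub>}"
  proof (rule hom_generate_closed[OF group_G M.is_group assms(2) _ M.triv_subgroup _ g])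
    fix s assume "s \<in> {commutator G x y | x y. x \<in> carrier G \<and> y \<in> carrier G}"
    then obtain x y where "s = commutator G x y" "x \<in> carrier G" "y \<in> carrier G" by blast
    then show "f s \<in> {\<one>\<^bsub>M\<^esub>}"
      using M.m_comm[of "f x" "f y"] by (simp add: M.m_assoc M.cancel_simps)
  qed auto
  then show ?thesis by simp
qed

text \<open>\<open>kap\<close> takes values in a commutative group, so it is trivial on
  \<open>\<Gamma>\<^sub>2\<close> and undoes \<open>ab\<close>.\<close>

lemma ab_inj: "inj_on ab (carrier H1)"
proof -
  interpret A: comm_group "gr_part G 1" by (rule comm_group_gr_part) simp
  interpret a: group_hom H1 "gr_part G 1" ab
    using ab_hom A.is_group by (simp add: group_hom_def group_hom_axioms_def)
  show ?thesis
    unfolding a.inj_on_one_iff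
  proof (intro allI impI)
    fix z assume z: "z \<in> carrier H1" "ab z = \<one>\<^bsub>gr_part G 1\<^esub>"
    obtain p where p: "p \<in> loops X x0" "z = hcl p" using H1_cases[OF z(1)] .
    then have "Theta p \<in> lower_central G 2"
      using z(2) cls_eq_oneD[of 1 "Theta p"] by (simp add: ab_hcl gr_part_simps Suc_1)
    from hom_comm_trivial_lower_central[OF comm_group_H1 kap_hom this]
    show "z = \<one>\<^bsub>H1\<^esub>" using p by (simp add: kap_Theta)
  qed
qed

end

section \<open>Linear functions on chains\<close>

text \<open>The sum is that of \<open>cochain_cup\<close>. Unlike a cochain it is not cut down to
  the chains of one space, so it is additive without side conditions.\<close>

definition lin :: "('s \<Rightarrow> int) \<Rightarrow> ('s \<Rightarrow>\<^sub>0 int) \<Rightarrow> int" where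
  "lin F c = (\<Sum>\<sigma>\<in>Poly_Mapping.keys c. Poly_Mapping.lookup c \<sigma> * F \<sigma>)"

lemma lin_superset:
  "\<lbrakk>finite S; Poly_Mapping.keys c \<subseteq> S\<rbrakk> \<Longrightarrow> lin F c = (\<Sum>\<sigma>\<in>S. Poly_Mapping.lookup c \<sigma> * F \<sigma>)"
  unfolding lin_def by (rule sum.mono_neutral_left) (auto simp: in_keys_iff)

lemma lin_zero [simp]: "lin F 0 = 0"
  by (simp add: lin_def)

lemma lin_of [simp]: "lin F (frag_of \<sigma>) = F \<sigma>"
  by (simp add: lin_def)

lemma lin_add: "lin F (a + b) = lin F a + lin F b"
proof -
  let ?S = "Poly_Mapping.keys a \<union> Poly_Mapping.keys b"
  have "Poly_Mapping.keys (a + b) \<subseteq> ?S" by (rule Poly_Mapping.keys_add)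
  then show ?thesis
    using lin_superset[of ?S "a + b" F] lin_superset[of ?S a F] lin_superset[of ?S b F]
    by (simp add: lookup_add algebra_simps sum.distrib)
qed

lemma lin_minus: "lin F (- a) = - lin F a"
  using lin_add[of F a "- a"] by simp

lemma lin_diff: "lin F (a - b) = lin F a - lin F b"
  using lin_add[of F a "- b"] by (simp add: lin_minus)

lemma lin_hom: "lin F \<in> hom (chain_group p X) integer_group"
  by (rule homI) (simp_all add: lin_add)

lemma lin_cong:
  assumes "singular_chain p X c" "\<And>\<sigma>. singular_simplex p X \<sigma> \<Longrightarrow> F \<sigma> = F' \<sigma>"
  shows "lin F c = lin F' c"
  unfolding lin_def using assms by (intro sum.cong) (auto simp: singular_chain_def)

lemma lin_plus: "lin (\<lambda>\<sigma>. F \<sigma> + F' \<sigma>) c = lin F c + lin F' c"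
  by (simp add: lin_def algebra_simps sum.distrib)

lemma lin_cmult: "lin (\<lambda>\<sigma>. k * F \<sigma>) c = k * lin F c"
  by (simp add: lin_def sum_distrib_left algebra_simps)

lemma lin_sub: "lin (\<lambda>\<sigma>. F \<sigma> - F' \<sigma>) c = lin F c - lin F' c"
  by (simp add: lin_def algebra_simps sum_subtractf)

lemma lin_coboundary:
  assumes "singular_chain 2 X c"
  shows "lin (\<lambda>\<tau>. f (singular_face 2 0 \<tau>) - f (singular_face 2 1 \<tau>) + f (singular_face 2 2 \<tau>)) c =
    lin f (chain_boundary 2 c)"
  using assms
  by (induction rule: singular_chain_induct) (simp_all add: lin_diff lin_add chain_boundary_2 chain_boundary_diff)

section \<open>Cup products of one-dimensional classes\<close>

lemma hom_integer_add: "f \<in> hom K integer_group \<Longrightarrow> x \<in> carrier K \<Longrightarrow> y \<in> carrier K \<Longrightarrow> f (x \<otimes>\<^bsub>K\<^esub> y) = f x + f y"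
  by (simp add: hom_def)

lemma homologous_2D:
  assumes "homologous_rel 2 X {} c c'"
  obtains d where "singular_chain 3 X d" "chain_boundary 3 d = c - c'"
proof -
  have "Suc 2 = (3::nat)" by simp
  then show ?thesis using assms that unfolding homologous_rel_def singular_boundary by auto
qed

lemma relcycle_2: "singular_relcycle 2 X {} c \<longleftrightarrow> singular_chain 2 X c \<and> chain_boundary 2 c = 0"
  by (simp add: singular_cycle)

text \<open>The simplicial identities, reduced to equality of the coordinate maps.\<close>

lemma double_face:
  assumes "i \<le> 2" "i' \<le> 2" "k \<le> 3" "k' \<le> 3"
    and "\<And>x :: nat \<Rightarrow> real. simplical_face k (simplical_face i x) = simplical_face k' (simplical_face i' x)"
  shows "singular_face 2 i (singular_face 3 k f) = singular_face 2 i' (singular_face 3 k' f)"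
proof -
  have s: "(3::nat) - Suc 0 = 2" by simp
  have "singular_face 2 i (singular_face 3 k f) = restrict (\<lambda>x. f (simplical_face k (simplical_face i x))) (standard_simplex 1)"
    if "i \<le> 2" for i k
    unfolding singular_face_def s two_minus_Suc_0
    using simplical_face_in_standard_simplex[of 2 i] that
    by (intro restrict_ext) (simp add: two_minus_Suc_0)
  then show ?thesis using assms by simp
qed

lemma singular_face_3:
  assumes "singular_simplex 3 X f" "k \<le> 3"
  shows "singular_simplex 2 X (singular_face 3 k f)"
proof -
  have s: "(3::nat) - Suc 0 = 2" by simp
  show ?thesis using singular_simplex_singular_face[OF assms(1) _ assms(2)] by (simp add: s)
qed

lemma chain_boundary_3:
  "chain_boundary 3 (frag_of f) = frag_of (singular_face 3 0 f) - frag_of (singular_face 3 1 f)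
    + frag_of (singular_face 3 2 f) - frag_of (singular_face 3 3 f)"
proof -
  have "{..3::nat} = {0, 1, 2, 3}" by auto
  then show ?thesis by (simp add: chain_boundary_of)
qed

text \<open>The cup product of 1-cochains, evaluated on a chain: face 2 is the front edge with
  vertices 0 and 1, face 0 the back edge with vertices 1 and 2.\<close>

definition cup_chain :: "(((nat \<Rightarrow> real) \<Rightarrow> 'x) \<Rightarrow> int) \<Rightarrow> (((nat \<Rightarrow> real) \<Rightarrow> 'x) \<Rightarrow> int) \<Rightarrow> 'x chain \<Rightarrow> int" where
  "cup_chain a b = lin (\<lambda>\<tau>. a (singular_face 2 2 \<tau>) * b (singular_face 2 0 \<tau>))"

abbreviation simplex_cocycle :: "'x topology \<Rightarrow> (((nat \<Rightarrow> real) \<Rightarrow> 'x) \<Rightarrow> int) \<Rightarrow> bool" where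
  "simplex_cocycle X a \<equiv> (\<forall>\<tau>. singular_simplex 2 X \<tau> \<longrightarrow>
     a (singular_face 2 1 \<tau>) = a (singular_face 2 2 \<tau>) + a (singular_face 2 0 \<tau>))"

lemma cup_chain_boundary:
  assumes a: "simplex_cocycle X a" and b: "simplex_cocycle X b" and "singular_chain 3 X d"
  shows "cup_chain a b (chain_boundary 3 d) = 0"
  using assms(3)
proof (induction rule: singular_chain_induct)
  case (one f)
  note F = singular_face_3[OF one]
  \<comment> \<open>Every equation names one edge of the tetrahedron in two ways: in this order the
    edges 02, 23, 01, 13 and 12.\<close>
  have e: "singular_face 2 2 (singular_face 3 1 f) = singular_face 2 1 (singular_face 3 3 f)"
    "singular_face 2 0 (singular_face 3 1 f) = singular_face 2 0 (singular_face 3 0 f)"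
    "singular_face 2 2 (singular_face 3 2 f) = singular_face 2 2 (singular_face 3 3 f)"
    "singular_face 2 0 (singular_face 3 2 f) = singular_face 2 1 (singular_face 3 0 f)"
    "singular_face 2 0 (singular_face 3 3 f) = singular_face 2 2 (singular_face 3 0 f)"
    by (rule double_face; auto simp: simplical_face_def fun_eq_iff)+
  have "a (singular_face 2 1 (singular_face 3 3 f)) =
      a (singular_face 2 2 (singular_face 3 3 f)) + a (singular_face 2 2 (singular_face 3 0 f))"
    using a F[of 3] e(5) by simp
  moreover have "b (singular_face 2 1 (singular_face 3 0 f)) =
      b (singular_face 2 2 (singular_face 3 0 f)) + b (singular_face 2 0 (singular_face 3 0 f))"
    using b F[of 0] by simp
  ultimately show ?case
    by (simp add: cup_chain_def chain_boundary_3 lin_add lin_diff e algebra_simps)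
qed (simp_all add: cup_chain_def chain_boundary_diff lin_diff)

lemma cup_chain_homologous:
  assumes "simplex_cocycle X a" "simplex_cocycle X b" "homologous_rel 2 X {} c c'"
  shows "cup_chain a b c = cup_chain a b c'"
proof -
  obtain d where "singular_chain 3 X d" "chain_boundary 3 d = c - c'" using homologous_2D[OF assms(3)] .
  then have "cup_chain a b (c - c') = 0" using cup_chain_boundary[OF assms(1,2)] by metis
  then show ?thesis by (simp add: cup_chain_def lin_diff)
qed

text \<open>Here \<open>a = a' + \<delta>f\<close> and \<open>b = b' + \<delta>f'\<close>; the difference of the cup products is the
  coboundary of \<open>f b - a' f'\<close>.\<close>

lemma cup_chain_cohomologous:
  assumes a: "simplex_cocycle X a" and b: "simplex_cocycle X b"
    and a': "simplex_cocycle X a'" and b': "simplex_cocycle X b'"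
    and fa: "\<And>\<sigma>. singular_simplex 1 X \<sigma> \<Longrightarrow> a \<sigma> = a' \<sigma> - f (edge \<sigma> 0) + f (edge \<sigma> 1)"
    and fb: "\<And>\<sigma>. singular_simplex 1 X \<sigma> \<Longrightarrow> b \<sigma> = b' \<sigma> - f' (edge \<sigma> 0) + f' (edge \<sigma> 1)"
    and c: "singular_relcycle 2 X {} c"
  shows "cup_chain a b c = cup_chain a' b' c"
proof -
  have c2: "singular_chain 2 X c" "chain_boundary 2 c = 0" using c by (auto simp: relcycle_2)
  let ?g = "\<lambda>\<sigma>. f (edge \<sigma> 0) * b \<sigma> - a' \<sigma> * f' (edge \<sigma> 1)"
  have "cup_chain a b c - cup_chain a' b' c =
      lin (\<lambda>\<tau>. a (singular_face 2 2 \<tau>) * b (singular_face 2 0 \<tau>) - a' (singular_face 2 2 \<tau>) * b' (singular_face 2 0 \<tau>)) c"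
    by (simp add: cup_chain_def lin_sub)
  also have "\<dots> = lin (\<lambda>\<tau>. ?g (singular_face 2 0 \<tau>) - ?g (singular_face 2 1 \<tau>) + ?g (singular_face 2 2 \<tau>)) c"
  proof (rule lin_cong[OF c2(1)])
    fix \<tau> assume t: "singular_simplex 2 X \<tau>"
    note F = singular_face_2[OF t]
    have v: "edge (singular_face 2 1 \<tau>) 0 = edge (singular_face 2 2 \<tau>) 0"
      "edge (singular_face 2 0 \<tau>) 0 = edge (singular_face 2 2 \<tau>) 1"
      "edge (singular_face 2 1 \<tau>) 1 = edge (singular_face 2 0 \<tau>) 1"
      by (simp_all add: edge_singular_face)
    have e1: "a (singular_face 2 2 \<tau>) = a' (singular_face 2 2 \<tau>) - f (edge (singular_face 2 2 \<tau>) 0) + f (edge (singular_face 2 2 \<tau>) 1)"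
      using fa[OF F] by simp
    have e2: "b (singular_face 2 0 \<tau>) = b' (singular_face 2 0 \<tau>) - f' (edge (singular_face 2 2 \<tau>) 1) + f' (edge (singular_face 2 0 \<tau>) 1)"
      using fb[OF F[of 0]] v by simp
    have e3: "b (singular_face 2 1 \<tau>) = b (singular_face 2 2 \<tau>) + b (singular_face 2 0 \<tau>)" using b t by blast
    have e4: "a' (singular_face 2 1 \<tau>) = a' (singular_face 2 2 \<tau>) + a' (singular_face 2 0 \<tau>)" using a' t by blast
    show "a (singular_face 2 2 \<tau>) * b (singular_face 2 0 \<tau>) - a' (singular_face 2 2 \<tau>) * b' (singular_face 2 0 \<tau>) =
        ?g (singular_face 2 0 \<tau>) - ?g (singular_face 2 1 \<tau>) + ?g (singular_face 2 2 \<tau>)"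
      unfolding v e1 e3 e4 unfolding e2 by (simp add: algebra_simps)
  qed
  also have "\<dots> = 0" unfolding lin_coboundary[OF c2(1), of ?g] using c2(2) by simp
  finally show ?thesis by simp
qed

text \<open>For cocycles of degree 1 the sum of the two cup products is the coboundary of minus the
  pointwise product: on the middle face the product of the sums has exactly the two mixed terms in
  excess.\<close>

lemma cup_chain_anticommute:
  assumes a: "simplex_cocycle X a" and b: "simplex_cocycle X b" and c: "singular_relcycle 2 X {} c"
  shows "cup_chain a b c = - cup_chain b a c"
proof -
  have c2: "singular_chain 2 X c" "chain_boundary 2 c = 0" using c by (auto simp: relcycle_2)
  let ?g = "\<lambda>\<sigma>. - (a \<sigma> * b \<sigma>)"
  have "cup_chain a b c + cup_chain b a c =
      lin (\<lambda>\<tau>. a (singular_face 2 2 \<tau>) * b (singular_face 2 0 \<tau>) + b (singular_face 2 2 \<tau>) * a (singular_face 2 0 \<tau>)) c"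
    by (simp add: cup_chain_def lin_plus)
  also have "\<dots> = lin (\<lambda>\<tau>. ?g (singular_face 2 0 \<tau>) - ?g (singular_face 2 1 \<tau>) + ?g (singular_face 2 2 \<tau>)) c"
  proof (rule lin_cong[OF c2(1)])
    fix \<tau> assume "singular_simplex 2 X \<tau>"
    then have "a (singular_face 2 1 \<tau>) = a (singular_face 2 2 \<tau>) + a (singular_face 2 0 \<tau>)"
      "b (singular_face 2 1 \<tau>) = b (singular_face 2 2 \<tau>) + b (singular_face 2 0 \<tau>)" using a b by blast+
    then show "a (singular_face 2 2 \<tau>) * b (singular_face 2 0 \<tau>) + b (singular_face 2 2 \<tau>) * a (singular_face 2 0 \<tau>) =
        ?g (singular_face 2 0 \<tau>) - ?g (singular_face 2 1 \<tau>) + ?g (singular_face 2 2 \<tau>)"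
      by (simp add: algebra_simps)
  qed
  also have "\<dots> = 0" unfolding lin_coboundary[OF c2(1), of ?g] using c2(2) by simp
  finally show ?thesis by simp
qed

lemma cocycles_1_iff:
  "\<phi> \<in> cocycles 1 X \<longleftrightarrow> \<phi> \<in> hom (chain_group 1 X) integer_group \<and> \<phi> \<in> extensional (singular_chain_set 1 X) \<and>
     (\<forall>c. singular_chain 2 X c \<longrightarrow> \<phi> (chain_boundary 2 c) = 0)"
  by (auto simp: cocycles_def cochain_group_def coboundary_def restrict_def fun_eq_iff Suc_1)

lemma carrier_cohomology_1:
  "carrier (cohomology_group 1 X) = (\<lambda>\<phi>. coboundaries 1 X #>\<^bsub>cochain_group 1 X\<^esub> \<phi>) ` cocycles 1 X"
  by (simp add: cohomology_group_def carrier_FactGroup)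

lemma coboundaries_1: "coboundaries 1 X = coboundary 0 X ` carrier (cochain_group 0 X)"
  by (simp add: coboundaries_def One_nat_def)

lemma coboundaries_2: "coboundaries 2 X = coboundary 1 X ` carrier (cochain_group 1 X)"
  by (simp add: coboundaries_def numeral_2_eq_2 One_nat_def)

lemma mult_cochain_group:
  "singular_chain p X c \<Longrightarrow> (\<phi> \<otimes>\<^bsub>cochain_group p X\<^esub> \<psi>) c = \<phi> c + \<psi> c"
  by (simp add: cochain_group_def)

lemma coboundary_0_apply: "singular_chain 1 X c \<Longrightarrow> coboundary 0 X f c = f (chain_boundary 1 c)"
  by (simp add: coboundary_def One_nat_def)

lemma coboundary_1_apply: "singular_chain 2 X c \<Longrightarrow> coboundary 1 X f c = f (chain_boundary 2 c)"
  by (simp add: coboundary_def Suc_1)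

lemma cochain_zero: "f \<in> carrier (cochain_group p X) \<Longrightarrow> f 0 = 0"
  using chain_hom_simps(3)[OF group_integer_group, of f p X 0 0] by (simp add: cochain_group_def)

text \<open>Representatives differ by the coboundary of a 0-cochain, and its value on a cycle is
  that of the 0-cochain on the zero chain. So evaluation on cycles does not depend on the
  representative.\<close>

lemma cohomology_1_cases:
  assumes "a \<in> carrier (cohomology_group 1 X)"
  obtains \<phi> where "\<phi> \<in> cocycles 1 X" "\<phi> \<in> a"
    "\<And>\<psi>. \<psi> \<in> a \<Longrightarrow> \<psi> \<in> cocycles 1 X \<and> (\<forall>c. singular_relcycle 1 X {} c \<longrightarrow> \<psi> c = \<phi> c)"
proof -
  obtain \<phi> where \<phi>: "\<phi> \<in> cocycles 1 X" "a = coboundaries 1 X #>\<^bsub>cochain_group 1 X\<^esub> \<phi>"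
    using assms by (auto simp: carrier_cohomology_1)
  have h: "\<phi> \<in> hom (chain_group 1 X) integer_group" "\<phi> \<in> extensional (singular_chain_set 1 X)"
    "\<And>c. singular_chain 2 X c \<Longrightarrow> \<phi> (chain_boundary 2 c) = 0"
    using \<phi>(1) by (auto simp: cocycles_1_iff)
  show ?thesis
  proof (rule that[OF \<phi>(1)])
    let ?z = "\<lambda>c\<in>carrier (chain_group 0 X). 0 :: int"
    have z: "?z \<in> carrier (cochain_group 0 X)"
      by (auto simp: cochain_group_def hom_def singular_chain_add)
    have "coboundary 0 X ?z \<otimes>\<^bsub>cochain_group 1 X\<^esub> \<phi> = \<phi>"
    proof
      fix c show "(coboundary 0 X ?z \<otimes>\<^bsub>cochain_group 1 X\<^esub> \<phi>) c = \<phi> c"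
      proof (cases "singular_chain 1 X c")
        case True
        then have "singular_chain 0 X (chain_boundary 1 c)"
          using singular_chain_boundary[OF True] by (simp add: One_nat_def)
        then show ?thesis using True by (simp add: mult_cochain_group coboundary_0_apply)
      next
        case False
        then show ?thesis using h(2) by (simp add: cochain_group_def extensional_def)
      qed
    qed
    then show "\<phi> \<in> a" unfolding \<phi>(2) r_coset_def coboundaries_1 using z by force
    fix \<psi> assume "\<psi> \<in> a"
    then obtain f where f: "f \<in> carrier (cochain_group 0 X)" "\<psi> = coboundary 0 X f \<otimes>\<^bsub>cochain_group 1 X\<^esub> \<phi>"
      by (auto simp: \<phi>(2) r_coset_def coboundaries_1)
    have val: "\<psi> c = f (chain_boundary 1 c) + \<phi> c" if "singular_chain 1 X c" for c
      using that by (simp add: f(2) mult_cochain_group coboundary_0_apply)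
    have fh: "f \<in> hom (chain_group 0 X) integer_group" using f(1) by (simp add: cochain_group_def)
    have b1: "singular_chain 0 X (chain_boundary 1 c)" if "singular_chain 1 X c" for c
      using singular_chain_boundary[OF that] by (simp add: One_nat_def)
    have "\<psi> \<in> hom (chain_group 1 X) integer_group"
      by (rule homI)
         (use hom_integer_add[OF fh] hom_integer_add[OF h(1)] b1 in
           \<open>auto simp: val singular_chain_add chain_boundary_add\<close>)
    moreover have "\<psi> \<in> extensional (singular_chain_set 1 X)" by (simp add: f(2) cochain_group_def)
    moreover have "\<psi> (chain_boundary 2 c) = 0" if c: "singular_chain 2 X c" for c
    proof -
      have "singular_chain 1 X (chain_boundary 2 c)"
        using singular_chain_boundary[OF c] by (simp add: two_minus_Suc_0)
      moreover have "chain_boundary 1 (chain_boundary 2 c) = 0"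
        using chain_boundary_boundary[OF c] by (simp add: two_minus_Suc_0)
      ultimately show ?thesis using h(3)[OF c] cochain_zero[OF f(1)] by (simp add: val)
    qed
    ultimately have "\<psi> \<in> cocycles 1 X" by (simp add: cocycles_1_iff)
    moreover have "\<psi> c = \<phi> c" if "singular_relcycle 1 X {} c" for c
      using that cochain_zero[OF f(1)] by (simp add: relcycle_1 val)
    ultimately show "\<psi> \<in> cocycles 1 X \<and> (\<forall>c. singular_relcycle 1 X {} c \<longrightarrow> \<psi> c = \<phi> c)" by blast
  qed
qed

lemma cocycle_homologous:
  assumes "\<phi> \<in> cocycles 1 X" "homologous X c c'" "singular_chain 1 X c" "singular_chain 1 X c'"
  shows "\<phi> c = \<phi> c'"
proof -
  have h: "\<phi> \<in> hom (chain_group 1 X) integer_group" using assms(1) by (simp add: cocycles_1_iff)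
  obtain d where "singular_chain 2 X d" "chain_boundary 2 d = c - c'"
    using assms(2) unfolding homologous_rel_def singular_boundary by (auto simp: Suc_1)
  then have "\<phi> (c - c') = 0" using assms(1) unfolding cocycles_1_iff by metis
  then show ?thesis using chain_hom_simps(2)[OF group_integer_group h assms(3,4)] by simp
qed

lemma kronecker_eqI:
  assumes "\<phi> \<in> a" "c \<in> z" "\<And>\<psi> d. \<psi> \<in> a \<Longrightarrow> d \<in> z \<Longrightarrow> \<psi> d = \<phi> c"
  shows "kronecker z a = \<phi> c"
proof -
  have "{\<psi> d | \<psi> d. \<psi> \<in> a \<and> d \<in> z} = {\<phi> c}" using assms by blast
  then show ?thesis by (simp add: kronecker_def)
qed

lemma kronecker_1:
  assumes "\<phi> \<in> cocycles 1 X" "\<phi> \<in> a" "a \<in> carrier (cohomology_group 1 X)" "singular_relcycle 1 X {} c"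
  shows "kronecker (homologous_rel_set 1 X {} c) a = \<phi> c"
proof (rule kronecker_eqI[OF assms(2)])
  fix \<psi> d assume \<psi>: "\<psi> \<in> a" and d: "d \<in> homologous_rel_set 1 X {} c"
  obtain \<phi>' where \<phi>': "\<And>\<psi>. \<psi> \<in> a \<Longrightarrow> \<psi> \<in> cocycles 1 X \<and> (\<forall>c. singular_relcycle 1 X {} c \<longrightarrow> \<psi> c = \<phi>' c)"
    using cohomology_1_cases[OF assms(3)] by metis
  have "singular_relcycle 1 X {} d"
    using d assms(4) homologous_rel_singular_relcycle[of 1 X "{}" c d] by simp
  then have "singular_chain 1 X d" "\<psi> d = \<phi>' d" "\<phi> d = \<phi>' d"
    using \<phi>'[OF \<psi>] \<phi>'[OF assms(2)] by (auto simp: relcycle_1)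
  moreover have "\<phi> c = \<phi> d"
    using cocycle_homologous[OF assms(1), of c d] d assms(4) \<open>singular_chain 1 X d\<close> by (simp add: relcycle_1)
  ultimately show "\<psi> d = \<phi> c" by simp
qed simp

section \<open>First cohomology as homomorphisms from the group to the integers\<close>

context pi1_space
begin

definition class_hom :: "('x chain \<Rightarrow> int) set \<Rightarrow> 'g \<Rightarrow> int" where
  "class_hom a g = kronecker (kap g) a"

abbreviation gcup :: "('g \<Rightarrow> int) \<Rightarrow> ('g \<Rightarrow> int) \<Rightarrow> 'x chain \<Rightarrow> int" where
  "gcup \<alpha> \<beta> \<equiv> cup_chain (\<lambda>\<sigma>. \<alpha> (gam1 \<sigma>)) (\<lambda>\<sigma>. \<beta> (gam1 \<sigma>))"

lemma gam1_simplex_cocycle: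
  assumes "\<alpha> \<in> hom G integer_group"
  shows "simplex_cocycle X (\<lambda>\<sigma>. \<alpha> (gam1 \<sigma>))"
proof (intro allI impI)
  fix \<tau> assume t: "singular_simplex 2 X \<tau>"
  show "\<alpha> (gam1 (singular_face 2 1 \<tau>)) = \<alpha> (gam1 (singular_face 2 2 \<tau>)) + \<alpha> (gam1 (singular_face 2 0 \<tau>))"
    unfolding gam1_triangle[OF t]
    by (rule hom_integer_add[OF assms gam1_closed[OF singular_face_2[OF t]] gam1_closed[OF singular_face_2[OF t]]]) simp_all
qed

lemma class_hom_Theta:
  assumes "a \<in> carrier (cohomology_group 1 X)" "\<phi> \<in> a" "\<phi> \<in> cocycles 1 X" "p \<in> loops X x0"
  shows "class_hom a (Theta p) = \<phi> (path_chain p)"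
  unfolding class_hom_def kap_Theta[OF assms(4)]
  by (rule kronecker_1[OF assms(3,2,1)]) (use assms(4) in \<open>auto simp: loops_iff intro: relcycle_path_chain\<close>)

lemma class_hom:
  assumes "a \<in> carrier (cohomology_group 1 X)"
  shows "class_hom a \<in> hom G integer_group"
proof (rule homI)
  obtain \<phi> where \<phi>: "\<phi> \<in> cocycles 1 X" "\<phi> \<in> a" using cohomology_1_cases[OF assms] by metis
  have h: "\<phi> \<in> hom (chain_group 1 X) integer_group" using \<phi>(1) by (simp add: cocycles_1_iff)
  fix g h' assume "g \<in> carrier G" "h' \<in> carrier G"
  then obtain p q where pq: "p \<in> loops X x0" "g = Theta p" "q \<in> loops X x0" "h' = Theta q"
    using Theta_surj by metis
  have s: "singular_chain 1 X (path_chain p)" if "p \<in> loops X x0" for p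
    using that by (simp add: loops_iff singular_chain_of singular_simplex_loop_simplex)
  have "homologous X (path_chain (concat_loops p q)) (path_chain p + path_chain q)"
    using pq by (intro homologous_concat) (auto simp: loops_iff)
  then have "\<phi> (path_chain (concat_loops p q)) = \<phi> (path_chain p) + \<phi> (path_chain q)"
    using cocycle_homologous[OF \<phi>(1)] s pq concat_loops_closed[OF pq(1,3)] hom_integer_add[OF h]
    by (simp add: singular_chain_add)
  then show "class_hom a (g \<otimes> h') = class_hom a g \<otimes>\<^bsub>integer_group\<^esub> class_hom a h'"
    using class_hom_Theta[OF assms \<phi>(2,1)] pq by (simp add: concat_loops_closed flip: Theta_concat)
qed simp

lemma kronecker_class_hom:
  assumes "p \<in> loops X x0"
  shows "kronecker (hcl p) a = class_hom a (Theta p)"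
  using assms by (simp add: class_hom_def kap_Theta)

text \<open>Composed with \<open>gam1\<close>, the homomorphism is additive over triangles and so
  extends to a cocycle; on a loop this cocycle returns the value at its class.\<close>

lemma class_hom_surj:
  assumes "\<alpha> \<in> hom G integer_group"
  obtains a where "a \<in> carrier (cohomology_group 1 X)" "\<And>g. g \<in> carrier G \<Longrightarrow> class_hom a g = \<alpha> g"
proof -
  let ?\<phi> = "\<lambda>c\<in>singular_chain_set 1 X. lin (\<lambda>\<sigma>. \<alpha> (gam1 \<sigma>)) c"
  have "?\<phi> \<in> cocycles 1 X"
    unfolding cocycles_1_iff
  proof (intro conjI allI impI)
    show "?\<phi> \<in> hom (chain_group 1 X) integer_group"
      by (rule homI) (simp_all add: singular_chain_add lin_add)
    fix c assume c: "singular_chain 2 X c"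
    have "lin (\<lambda>\<sigma>. \<alpha> (gam1 \<sigma>)) (chain_boundary 2 c) = 0"
      using gam1_boundary_trivial[OF abelian_integer_group assms lin_hom _ c] by simp
    then show "?\<phi> (chain_boundary 2 c) = 0"
      using singular_chain_boundary[OF c] by (simp add: two_minus_Suc_0)
  qed simp
  then have a: "coboundaries 1 X #>\<^bsub>cochain_group 1 X\<^esub> ?\<phi> \<in> carrier (cohomology_group 1 X)" (is "?a \<in> _")
    by (simp add: carrier_cohomology_1)
  show ?thesis
  proof (rule that[OF a])
    fix g assume "g \<in> carrier G"
    then obtain p where p: "p \<in> loops X x0" "Theta p = g" using Theta_surj by metis
    obtain \<phi> where \<phi>: "\<phi> \<in> cocycles 1 X" "\<phi> \<in> ?a"
      "\<And>\<psi>. \<psi> \<in> ?a \<Longrightarrow> \<psi> \<in> cocycles 1 X \<and> (\<forall>c. singular_relcycle 1 X {} c \<longrightarrow> \<psi> c = \<phi> c)"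
      by (rule cohomology_1_cases[OF a]) blast
    obtain f where f: "f \<in> carrier (cochain_group 0 X)" "\<phi> = coboundary 0 X f \<otimes>\<^bsub>cochain_group 1 X\<^esub> ?\<phi>"
      using \<phi>(2) by (auto simp: r_coset_def coboundaries_1)
    have pc: "singular_relcycle 1 X {} (path_chain p)" using p(1) by (auto simp: loops_iff intro: relcycle_path_chain)
    then have "\<phi> (path_chain p) = ?\<phi> (path_chain p)"
      using cochain_zero[OF f(1)] by (simp add: f(2) mult_cochain_group coboundary_0_apply relcycle_1)
    then show "class_hom ?a g = \<alpha> g"
      using class_hom_Theta[OF a \<phi>(2,1) p(1)] p pc by (simp add: relcycle_1 gam1_loop_simplex)
  qed
qed

text \<open>A representing cocycle \<open>\<phi>\<close> differs from the standard one,
  \<open>class_hom a\<close> after \<open>gam1\<close>, by the coboundary of the function that sends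
  a point to the value of \<open>\<phi>\<close> on its chosen path. By
  \<open>cup_chain_cohomologous\<close> cup products on cycles may be computed with
  \<open>gam1\<close>.\<close>

lemma kronecker_cup:
  assumes a: "a \<in> carrier (cohomology_group 1 X)" and b: "b \<in> carrier (cohomology_group 1 X)"
    and c: "singular_relcycle 2 X {} c"
  shows "kronecker (homologous_rel_set 2 X {} c) (cup 1 1 X a b) = gcup (class_hom a) (class_hom b) c"
proof -
  have cob: "simplex_cocycle X (\<lambda>\<sigma>. \<phi> (frag_of \<sigma>))"
    and shift: "\<And>\<sigma>. singular_simplex 1 X \<sigma> \<Longrightarrow> \<phi> (frag_of \<sigma>) =
        class_hom a (gam1 \<sigma>) - \<phi> (path_chain (base (edge \<sigma> 0))) + \<phi> (path_chain (base (edge \<sigma> 1)))"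
    if \<phi>: "\<phi> \<in> a" and a: "a \<in> carrier (cohomology_group 1 X)" for \<phi> a
  proof -
    have co: "\<phi> \<in> cocycles 1 X" using cohomology_1_cases[OF a] \<phi> by metis
    then have h: "\<phi> \<in> hom (chain_group 1 X) integer_group"
      and z: "\<And>c. singular_chain 2 X c \<Longrightarrow> \<phi> (chain_boundary 2 c) = 0" by (auto simp: cocycles_1_iff)
    note hs = chain_hom_simps[OF group_integer_group h]
    show "simplex_cocycle X (\<lambda>\<sigma>. \<phi> (frag_of \<sigma>))"
    proof (intro allI impI)
      fix \<tau> assume t: "singular_simplex 2 X \<tau>"
      have f: "singular_chain 1 X (frag_of (singular_face 2 k \<tau>))" if "k \<le> 2" for k
        using singular_face_2[OF t that] by (simp add: singular_chain_of)
      have "\<phi> (chain_boundary 2 (frag_of \<tau>)) = 0" using z t by (simp add: singular_chain_of)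
      then show "\<phi> (frag_of (singular_face 2 1 \<tau>)) = \<phi> (frag_of (singular_face 2 2 \<tau>)) + \<phi> (frag_of (singular_face 2 0 \<tau>))"
        using f[of 0] f[of 1] f[of 2] by (simp add: chain_boundary_2 hs(1,2) singular_chain_diff)
    qed
    fix \<sigma> assume s: "singular_simplex 1 X \<sigma>"
    have P: "pathin X (edge \<sigma>)" by (rule pathin_edge[OF s])
    have t: "edge \<sigma> 0 \<in> topspace X" "edge \<sigma> 1 \<in> topspace X"
      using pathin_topspace[OF P, of 0] pathin_topspace[OF P, of 1] by auto
    note b = base[OF t(1)] and b' = base[OF t(2)]
    let ?r = "rev_path (base (edge \<sigma> 1))"
    have r: "pathin X ?r" by (rule pathin_rev[OF b'(1)])
    have pc: "singular_chain 1 X (path_chain q)" if "pathin X q" for q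
      using that by (simp add: singular_chain_of singular_simplex_loop_simplex)
    have cc: "\<phi> (path_chain (concat_loops q q')) = \<phi> (path_chain q) + \<phi> (path_chain q')"
      if q: "pathin X q" "pathin X q'" "q 1 = q' 0" for q q'
      using cocycle_homologous[OF co homologous_concat[OF q]] pc[OF q(1)] pc[OF q(2)] pc[OF pathin_concat_loops[OF q]]
      by (simp add: singular_chain_add hs(1))
    have rr: "\<phi> (path_chain ?r) = - \<phi> (path_chain (base (edge \<sigma> 1)))"
      using cocycle_homologous[OF co homologous_rev[OF b'(1)]] pc[OF r] pc[OF b'(1)]
        hs(2)[of 0 "path_chain (base (edge \<sigma> 1))"] hs(3)[of 0 0] by (simp add: singular_chain_minus)
    have "class_hom a (gam1 \<sigma>) = \<phi> (path_chain (based (edge \<sigma>)))"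
      unfolding gam_def by (rule class_hom_Theta[OF a \<phi> co based_loop[OF P]])
    also have "\<dots> = \<phi> (path_chain (base (edge \<sigma> 0))) + (\<phi> (path_chain (edge \<sigma>)) + \<phi> (path_chain ?r))"
      unfolding based_def using b b' r P by (simp add: cc pathin_concat_loops)
    finally show "\<phi> (frag_of \<sigma>) =
        class_hom a (gam1 \<sigma>) - \<phi> (path_chain (base (edge \<sigma> 0))) + \<phi> (path_chain (base (edge \<sigma> 1)))"
      using rr loop_simplex_edge[OF s] by simp
  qed
  note cha = class_hom[OF a] and chb = class_hom[OF b]
  have val: "\<psi> d = gcup (class_hom a) (class_hom b) c"
    if \<psi>: "\<psi> \<in> cup 1 1 X a b" and d: "d \<in> homologous_rel_set 2 X {} c" for \<psi> d
  proof -
    have dc: "singular_relcycle 2 X {} d"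
      using d c homologous_rel_singular_relcycle[of 2 X "{}" c d] by simp
    then have d2: "singular_chain 2 X d" "chain_boundary 2 d = 0" by (auto simp: relcycle_2)
    obtain f \<phi> \<phi>' where f: "f \<in> carrier (cochain_group 1 X)" and \<phi>: "\<phi> \<in> a" "\<phi>' \<in> b"
      and eq: "\<psi> = coboundary 1 X f \<otimes>\<^bsub>cochain_group 2 X\<^esub> cochain_cup 1 1 X \<phi> \<phi>'"
      using \<psi> by (auto simp: cup_def set_mult_def coboundaries_2)
    have fr: "front_face 1 \<tau> = singular_face 2 2 \<tau>" if "singular_simplex 2 X \<tau>" for \<tau>
    proof -
      have "simplical_face 2 x = x" if "x \<in> standard_simplex 1" for x :: "nat \<Rightarrow> real"
        using that by (auto simp: simplical_face_def standard_simplex_def fun_eq_iff)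
      then show ?thesis unfolding front_face_def singular_face_def two_minus_Suc_0
        by (intro restrict_ext) simp
    qed
    have bk: "back_face 1 1 \<tau> = singular_face 2 0 \<tau>" for \<tau>
    proof -
      have "(\<lambda>i. if i < 1 then 0 else x (i - 1)) = simplical_face 0 x" for x :: "nat \<Rightarrow> real"
        by (auto simp: simplical_face_def fun_eq_iff)
      then show ?thesis unfolding back_face_def singular_face_def two_minus_Suc_0
        by (intro restrict_ext) simp
    qed
    have "cochain_cup 1 1 X \<phi> \<phi>' d = lin (\<lambda>\<tau>. \<phi> (frag_of (front_face 1 \<tau>)) * \<phi>' (frag_of (back_face 1 1 \<tau>))) d"
      using d2(1) by (simp add: cochain_cup_def lin_def)
    also have "\<dots> = cup_chain (\<lambda>\<sigma>. \<phi> (frag_of \<sigma>)) (\<lambda>\<sigma>. \<phi>' (frag_of \<sigma>)) d"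
      unfolding cup_chain_def by (rule lin_cong[OF d2(1)]) (simp add: fr bk)
    also have "\<dots> = gcup (class_hom a) (class_hom b) d"
      by (rule cup_chain_cohomologous[OF cob[OF \<phi>(1) a] cob[OF \<phi>(2) b]
            gam1_simplex_cocycle[OF cha] gam1_simplex_cocycle[OF chb] shift[OF \<phi>(1) a] shift[OF \<phi>(2) b] dc])
    also have "\<dots> = gcup (class_hom a) (class_hom b) c"
      using cup_chain_homologous[OF gam1_simplex_cocycle[OF cha] gam1_simplex_cocycle[OF chb], of c d] d by simp
    finally show ?thesis
      unfolding eq using d2 cochain_zero[OF f] by (simp add: mult_cochain_group coboundary_1_apply)
  qed
  have "\<exists>\<psi>. \<psi> \<in> cup 1 1 X a b"
  proof -
    obtain \<phi> \<phi>' where "\<phi> \<in> a" "\<phi>' \<in> b" using cohomology_1_cases[OF a] cohomology_1_cases[OF b] by metis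
    moreover have "(\<lambda>c\<in>carrier (chain_group 1 X). 0) \<in> carrier (cochain_group 1 X)"
      by (auto simp: cochain_group_def hom_def singular_chain_add)
    ultimately show ?thesis unfolding cup_def set_mult_def one_add_one coboundaries_2 by blast
  qed
  then obtain \<psi> where "\<psi> \<in> cup 1 1 X a b" by blast
  moreover have "c \<in> homologous_rel_set 2 X {} c" by simp
  ultimately show ?thesis using kronecker_eqI[of \<psi> "cup 1 1 X a b" c "homologous_rel_set 2 X {} c"] val by metis
qed

end

section \<open>The second graded piece of the free Lie algebra\<close>

text \<open>The product over the pairs \<open>j < i\<close>, one for each basis element
  \<open>[e i, e j]\<close> of the degree 2 part.\<close>

definition dprod :: "('k, 'm) monoid_scheme \<Rightarrow> nat \<Rightarrow> (nat \<Rightarrow> nat \<Rightarrow> 'k) \<Rightarrow> 'k" where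
  "dprod M n f = finprod M (\<lambda>i. finprod M (f i) {..<i}) {..<n}"

context comm_group
begin

lemma finprod_hom:
  assumes "group K" "\<And>i. i \<in> I \<Longrightarrow> f i \<in> hom K G"
  shows "(\<lambda>x. finprod G (\<lambda>i. f i x) I) \<in> hom K G"
proof (rule homI)
  interpret K: group K by fact
  have c: "f i x \<in> carrier G" if "i \<in> I" "x \<in> carrier K" for i x
    using assms(2)[OF that(1)] that(2) by (auto simp: hom_def)
  show "finprod G (\<lambda>i. f i x) I \<in> carrier G" if "x \<in> carrier K" for x
    by (rule finprod_closed) (use c that in auto)
  show "finprod G (\<lambda>i. f i (x \<otimes>\<^bsub>K\<^esub> y)) I = finprod G (\<lambda>i. f i x) I \<otimes> finprod G (\<lambda>i. f i y) I"
    if xy: "x \<in> carrier K" "y \<in> carrier K" for x y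
  proof -
    have "finprod G (\<lambda>i. f i (x \<otimes>\<^bsub>K\<^esub> y)) I = finprod G (\<lambda>i. f i x \<otimes> f i y) I"
      by (rule finprod_cong') (use c xy hom_mult[OF assms(2)] in auto)
    also have "\<dots> = finprod G (\<lambda>i. f i x) I \<otimes> finprod G (\<lambda>i. f i y) I"
      by (rule finprod_multf) (use c xy in auto)
    finally show ?thesis .
  qed
qed

lemma int_pow_hom:
  assumes "x \<in> carrier G" "a \<in> hom K integer_group"
  shows "(\<lambda>y. x [^] (a y :: int)) \<in> hom K G"
  using assms by (auto simp: hom_def int_pow_mult)

lemma dprod_hom:
  assumes "group K" "\<And>i j. i < n \<Longrightarrow> j < i \<Longrightarrow> f i j \<in> hom K G"
  shows "(\<lambda>x. dprod G n (\<lambda>i j. f i j x)) \<in> hom K G"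
  unfolding dprod_def by (intro finprod_hom assms) auto

lemma dprod_closed:
  assumes "\<And>i j. i < n \<Longrightarrow> j < i \<Longrightarrow> f i j \<in> carrier G"
  shows "dprod G n f \<in> carrier G"
  unfolding dprod_def by (intro finprod_closed) (use assms in \<open>auto intro!: finprod_closed\<close>)

lemma hom_dprod:
  assumes "comm_group M" "h \<in> hom G M" "\<And>i j. i < n \<Longrightarrow> j < i \<Longrightarrow> f i j \<in> carrier G"
  shows "h (dprod G n f) = dprod M n (\<lambda>i j. h (f i j))"
proof -
  interpret M: comm_group M by fact
  have c: "finprod G (f i) {..<i} \<in> carrier G" if "i < n" for i
    by (rule finprod_closed) (use assms(3) that in auto)
  have hc: "h x \<in> carrier M" if "x \<in> carrier G" for x using assms(2) that by (auto simp: hom_def)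
  have "h (dprod G n f) = finprod M (\<lambda>i. h (finprod G (f i) {..<i})) {..<n}"
    unfolding dprod_def by (rule hom_finprod[OF assms(1,2)]) (use c in auto)
  also have "\<dots> = dprod M n (\<lambda>i j. h (f i j))"
    unfolding dprod_def
  proof (rule M.finprod_cong'[OF HOL.refl])
    show "(\<lambda>i. finprod M (\<lambda>j. h (f i j)) {..<i}) \<in> {..<n} \<rightarrow> carrier M"
      using assms(3) hc by (auto intro!: M.finprod_closed)
    show "h (finprod G (f i) {..<i}) = finprod M (\<lambda>j. h (f i j)) {..<i}" if "i \<in> {..<n}" for i
      by (rule hom_finprod[OF assms(1,2)]) (use assms(3) that in auto)
  qed
  finally show ?thesis .
qed

lemma dprod_cong:
  assumes "\<And>i j. i < n \<Longrightarrow> j < i \<Longrightarrow> f i j = g i j" "\<And>i j. i < n \<Longrightarrow> j < i \<Longrightarrow> g i j \<in> carrier G"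
  shows "dprod G n f = dprod G n g"
  unfolding dprod_def
proof (rule finprod_cong'[OF HOL.refl])
  show "(\<lambda>i. finprod G (g i) {..<i}) \<in> {..<n} \<rightarrow> carrier G"
    using assms(2) by (auto intro!: finprod_closed)
  show "finprod G (f i) {..<i} = finprod G (g i) {..<i}" if "i \<in> {..<n}" for i
    by (rule finprod_cong') (use assms that in auto)
qed

lemma dprod_single:
  assumes "l < k" "k < n" "x \<in> carrier G"
  shows "dprod G n (\<lambda>i j. if i = k \<and> j = l then x else \<one>) = x"
proof -
  have "finprod G (\<lambda>j. if i = k \<and> j = l then x else \<one>) {..<i} = (if i = k then x else \<one>)" if "i < n" for i
  proof (cases "i = k")
    case True
    then show ?thesis using finprod_singleton_swap[of l "{..<i}" "\<lambda>_. x"] assms by simp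
  next
    case False
    then show ?thesis by (simp add: finprod_one_eqI)
  qed
  then have "dprod G n (\<lambda>i j. if i = k \<and> j = l then x else \<one>) = finprod G (\<lambda>i. if i = k then x else \<one>) {..<n}"
    unfolding dprod_def by (intro finprod_cong') (use assms in auto)
  also have "\<dots> = x" using finprod_singleton_swap[of k "{..<n}" "\<lambda>_. x"] assms by simp
  finally show ?thesis .
qed

lemma dprod_one: "dprod G n (\<lambda>i j. \<one>) = \<one>"
  by (simp add: dprod_def)

end

lemma finprod_integer_group: "finprod integer_group f I = sum f I"
proof -
  interpret comm_group integer_group by (rule abelian_integer_group)
  show ?thesis by (induction I rule: infinite_finite_induct) auto
qed

lemma dprod_integer_group: "dprod integer_group n f = (\<Sum>i<n. \<Sum>j<i. f i j)"
  by (simp add: dprod_def finprod_integer_group)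

context
  fixes A :: "('a, 'm) monoid_scheme"
  assumes A: "comm_group A"
begin

interpretation A: comm_group A by (rule A)

interpretation FL: graded_lie_algebra "free_lie A"
  by (rule graded_lie_algebra_free_lie[OF A.is_group])

lemma term_lin_lie_eq:
  assumes "a \<in> hom A integer_group" "lie_eq A s t"
  shows "term_lin a s = term_lin a t"
  using assms(2) by induction (use assms(1) in \<open>auto simp: hom_integer_add\<close>)

lemma term_wedge_lie_eq:
  assumes "a \<in> hom A integer_group" "b \<in> hom A integer_group" "lie_eq A s t"
  shows "term_wedge a b s = term_wedge a b t"
  using assms(3)
proof induction
  case (Bracket_cong s s' t t')
  then show ?case
    using term_lin_lie_eq[OF assms(1)] term_lin_lie_eq[OF assms(2)] by simp
qed (simp_all add: algebra_simps)

lemma wedge_pairing_class: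
  assumes "a \<in> hom A integer_group" "b \<in> hom A integer_group" "t \<in> lie_terms A"
  shows "wedge_pairing a b (lie_class A t) = term_wedge a b t"
  unfolding wedge_pairing_def
  by (rule induced_map_eq)
     (use assms term_wedge_lie_eq[OF assms(1,2)] lie_eq.refl[OF assms(3)] in auto)

lemma wedge_pairing_hom:
  assumes "a \<in> hom A integer_group" "b \<in> hom A integer_group"
  shows "wedge_pairing a b \<in> hom (free_lie A) integer_group"
proof (rule homI)
  fix x y assume "x \<in> carrier (free_lie A)" "y \<in> carrier (free_lie A)"
  then obtain s t where "s \<in> lie_terms A" "t \<in> lie_terms A" "x = lie_class A s" "y = lie_class A t"
    by (auto simp: carrier_free_lie[OF A.is_group])
  then show "wedge_pairing a b (x \<otimes>\<^bsub>free_lie A\<^esub> y) = wedge_pairing a b x \<otimes>\<^bsub>integer_group\<^esub> wedge_pairing a b y"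
    by (simp add: mult_free_lie[OF A.is_group] wedge_pairing_class[OF assms])
qed simp

abbreviation atm :: "'a \<Rightarrow> 'a lie_term set" where
  "atm x \<equiv> lie_class A (Atom x)"

lemma atm_hom: "atm \<in> hom A (free_lie A)"
  by (rule Atom_hom[OF A.is_group])

lemma atm_closed: "x \<in> carrier A \<Longrightarrow> atm x \<in> carrier (free_lie A)"
  by (simp add: lie_class_closed[OF A.is_group])

lemma wedge_pairing_bracket:
  assumes "a \<in> hom A integer_group" "b \<in> hom A integer_group" "x \<in> carrier A" "y \<in> carrier A"
  shows "wedge_pairing a b (lbracket (free_lie A) (atm x) (atm y)) = a x * b y - a y * b x"
  using assms by (simp add: lbracket_free_lie[OF A.is_group] wedge_pairing_class)

abbreviation brackets :: "'a lie_term set set" where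
  "brackets \<equiv> {lbracket (free_lie A) (atm x) (atm y) | x y. x \<in> carrier A \<and> y \<in> carrier A}"

lemma brackets_carrier: "brackets \<subseteq> carrier (free_lie A)"
  using atm_closed by auto

text \<open>Degrees 0 and 1 are carried along because a bracket of degree 2 splits as 1 + 1, or as 0
  + 2 or 2 + 0, where the factor of degree 0 vanishes.\<close>

lemma homogeneous_low_degree:
  assumes "homogeneous k t" "t \<in> lie_terms A"
  shows "(k = 0 \<longrightarrow> lie_class A t = \<one>\<^bsub>free_lie A\<^esub>) \<and> (k = 1 \<longrightarrow> (\<exists>x\<in>carrier A. lie_class A t = atm x)) \<and>
    (k = 2 \<longrightarrow> lie_class A t \<in> generate (free_lie A) brackets)"
  using assms
proof induction
  case (1 x)
  then show ?case by auto
next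
  case (2 k)
  have "lie_class A Zero = \<one>\<^bsub>free_lie A\<^esub>" by (simp add: one_free_lie[OF A.is_group])
  moreover have "atm \<one>\<^bsub>A\<^esub> = \<one>\<^bsub>free_lie A\<^esub>" by (rule hom_one[OF atm_hom A.is_group FL.is_group])
  ultimately show ?case using A.one_closed generate.one[of "free_lie A"] by auto
next
  case (3 k s t)
  then have st: "s \<in> lie_terms A" "t \<in> lie_terms A" by auto
  have e: "lie_class A (Plus s t) = lie_class A s \<otimes>\<^bsub>free_lie A\<^esub> lie_class A t"
    by (simp add: mult_free_lie[OF A.is_group st])
  show ?case
  proof (intro conjI impI)
    assume "k = 1"
    then obtain x y where "x \<in> carrier A" "y \<in> carrier A" "lie_class A s = atm x" "lie_class A t = atm y"
      using 3 by auto
    then show "\<exists>x\<in>carrier A. lie_class A (Plus s t) = atm x"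
      unfolding e by (intro bexI[of _ "x \<otimes>\<^bsub>A\<^esub> y"]) (simp_all add: hom_mult[OF atm_hom])
  next
    assume "k = 2"
    then show "lie_class A (Plus s t) \<in> generate (free_lie A) brackets"
      unfolding e using 3 by (intro generate.eng) auto
  qed (use 3 e in auto)
next
  case (4 k s)
  then have s: "s \<in> lie_terms A" by auto
  have e: "lie_class A (Minus s) = inv\<^bsub>free_lie A\<^esub> lie_class A s"
    by (rule lie_class_Minus[OF A.is_group s])
  interpret atm: group_hom A "free_lie A" atm
    using atm_hom A.is_group FL.is_group by (simp add: group_hom_def group_hom_axioms_def)
  show ?case
  proof (intro conjI impI)
    assume "k = 1"
    then obtain x where "x \<in> carrier A" "lie_class A s = atm x" using 4 by auto
    then show "\<exists>x\<in>carrier A. lie_class A (Minus s) = atm x"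
      unfolding e by (intro bexI[of _ "inv\<^bsub>A\<^esub> x"]) (simp_all add: atm.hom_inv)
  next
    assume "k = 2"
    then show "lie_class A (Minus s) \<in> generate (free_lie A) brackets"
      unfolding e using 4 FL.generate_m_inv_closed[OF brackets_carrier] by auto
  qed (use 4 e in auto)
next
  case (5 j s k t)
  then have st: "s \<in> lie_terms A" "t \<in> lie_terms A" by auto
  then have c: "lie_class A s \<in> carrier (free_lie A)" "lie_class A t \<in> carrier (free_lie A)"
    by (simp_all add: lie_class_closed[OF A.is_group])
  have e: "lie_class A (Bracket s t) = lbracket (free_lie A) (lie_class A s) (lie_class A t)"
    by (simp add: lbracket_free_lie[OF A.is_group st])
  show ?case
  proof (cases "j = 0 \<or> k = 0")
    case True
    then have "lie_class A s = \<one>\<^bsub>free_lie A\<^esub> \<or> lie_class A t = \<one>\<^bsub>free_lie A\<^esub>"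
      using 5(3)[OF st(1)] 5(4)[OF st(2)] by blast
    then have "lie_class A (Bracket s t) = \<one>\<^bsub>free_lie A\<^esub>" unfolding e using c by (elim disjE) simp_all
    moreover have "atm \<one>\<^bsub>A\<^esub> = \<one>\<^bsub>free_lie A\<^esub>" by (rule hom_one[OF atm_hom A.is_group FL.is_group])
    ultimately show ?thesis using A.one_closed generate.one[of "free_lie A"] by auto
  next
    case False
    show ?thesis
    proof (intro conjI impI)
      assume "j + k = 2"
      then have "j = 1" "k = 1" using False by auto
      then obtain x y where "x \<in> carrier A" "y \<in> carrier A" "lie_class A s = atm x" "lie_class A t = atm y"
        using 5 by auto
      then show "lie_class A (Bracket s t) \<in> generate (free_lie A) brackets"
        unfolding e by (intro generate.incl) auto
    qed (use False in auto)
  qed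
qed

lemma grade_2_generate: "grade (free_lie A) 2 \<subseteq> generate (free_lie A) brackets"
  using homogeneous_low_degree[of 2] by (auto simp: grade_free_lie[OF A.is_group])

context
  fixes n :: nat and e :: "nat \<Rightarrow> 'a" and a :: "nat \<Rightarrow> 'a \<Rightarrow> int"
  assumes e: "\<And>i. i < n \<Longrightarrow> e i \<in> carrier A" and a: "\<And>i. i < n \<Longrightarrow> a i \<in> hom A integer_group"
    and ae: "\<And>i j. \<lbrakk>i < n; j < n\<rbrakk> \<Longrightarrow> a i (e j) = (if i = j then 1 else 0)"
    and expand: "\<And>x. x \<in> carrier A \<Longrightarrow> x = finprod A (\<lambda>i. e i [^]\<^bsub>A\<^esub> a i x) {..<n}"
begin

lemma basis_generates: "carrier A \<subseteq> generate A (e ` {..<n})"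
proof
  fix x assume x: "x \<in> carrier A"
  have ec: "e ` {..<n} \<subseteq> carrier A" using e by auto
  interpret g: subgroup "generate A (e ` {..<n})" A by (rule A.generate_is_subgroup[OF ec])
  have "finprod A (\<lambda>i. e i [^]\<^bsub>A\<^esub> a i x) {..<m} \<in> generate A (e ` {..<n})" if "m \<le> n" for m
    using that
  proof (induction m)
    case (Suc m)
    have "e m [^]\<^bsub>A\<^esub> a m x \<in> generate A (e ` {..<n})"
      using Suc.prems by (intro A.subgroup_int_pow_closed[OF g.subgroup_axioms] generate.incl) auto
    moreover have "finprod A (\<lambda>i. e i [^]\<^bsub>A\<^esub> a i x) {..<Suc m} =
        e m [^]\<^bsub>A\<^esub> a m x \<otimes>\<^bsub>A\<^esub> finprod A (\<lambda>i. e i [^]\<^bsub>A\<^esub> a i x) {..<m}"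
      unfolding lessThan_Suc by (rule A.finprod_insert) (use e Suc.prems in auto)
    ultimately show ?case using Suc by simp
  qed simp
  from this[OF order_refl] show "x \<in> generate A (e ` {..<n})" unfolding expand[OF x, symmetric] .
qed

abbreviation ebr :: "nat \<Rightarrow> nat \<Rightarrow> 'a lie_term set" where
  "ebr i j \<equiv> lbracket (free_lie A) (atm (e i)) (atm (e j))"

lemma ebr_closed: "\<lbrakk>i < n; j < n\<rbrakk> \<Longrightarrow> ebr i j \<in> carrier (free_lie A)"
  by (simp add: atm_closed e)

text \<open>Both sides are additive in \<open>x\<close> and in \<open>y\<close>, so the basis
  elements decide; there the three cases are a pair in the right order, a reversed pair with the
  sign of antisymmetry, and a repeated index.\<close>

lemma bracket_normal_form:
  assumes x: "x \<in> carrier A" and y: "y \<in> carrier A"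
  shows "lbracket (free_lie A) (atm x) (atm y) =
    dprod (free_lie A) n (\<lambda>i j. ebr i j [^]\<^bsub>free_lie A\<^esub> (a i x * a j y - a i y * a j x))"
proof -
  let ?N = "\<lambda>x y. dprod (free_lie A) n (\<lambda>i j. ebr i j [^]\<^bsub>free_lie A\<^esub> (a i x * a j y - a i y * a j x))"
  have ec: "e ` {..<n} \<subseteq> carrier A" using e by auto
  have add: "a i (u \<otimes>\<^bsub>A\<^esub> v) = a i u + a i v" if "i < n" "u \<in> carrier A" "v \<in> carrier A" for i u v
    by (rule hom_integer_add[OF a[OF that(1)] that(2,3)])
  have N1: "(\<lambda>x. ?N x y) \<in> hom A (free_lie A)" for y
    by (rule FL.dprod_hom[OF A.is_group], rule FL.int_pow_hom)
       (auto simp: ebr_closed hom_def add algebra_simps)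
  have N2: "?N x \<in> hom A (free_lie A)" for x
    by (rule FL.dprod_hom[OF A.is_group], rule FL.int_pow_hom)
       (auto simp: ebr_closed hom_def add algebra_simps)
  have basis: "ebr k l = ?N (e k) (e l)" if k: "k < n" and l: "l < n" for k l
  proof -
    have val: "?N (e k) (e l) = dprod (free_lie A) n (\<lambda>i j. ebr i j [^]\<^bsub>free_lie A\<^esub>
        ((if i = k \<and> j = l then 1 else 0) - (if i = l \<and> j = k then 1 else 0) :: int))"
      by (rule FL.dprod_cong) (use k l in \<open>auto simp: ae ebr_closed\<close>)
    consider "l < k" | "k < l" | "k = l" by linarith
    then show ?thesis
    proof cases
      case 1
      have "?N (e k) (e l) = dprod (free_lie A) n (\<lambda>i j. if i = k \<and> j = l then ebr k l else \<one>\<^bsub>free_lie A\<^esub>)"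
        unfolding val by (rule FL.dprod_cong) (use 1 k l in \<open>auto simp: ebr_closed FL.int_pow_1\<close>)
      then show ?thesis using FL.dprod_single[OF 1 k ebr_closed[OF k l]] by simp
    next
      case 2
      have "?N (e k) (e l) = dprod (free_lie A) n (\<lambda>i j. if i = l \<and> j = k then ebr k l else \<one>\<^bsub>free_lie A\<^esub>)"
        unfolding val
      proof (rule FL.dprod_cong)
        fix i j assume ij: "i < n" "j < i"
        show "ebr i j [^]\<^bsub>free_lie A\<^esub> ((if i = k \<and> j = l then 1 else 0) - (if i = l \<and> j = k then 1 else 0) :: int) =
            (if i = l \<and> j = k then ebr k l else \<one>\<^bsub>free_lie A\<^esub>)"
        proof (cases "i = l \<and> j = k")
          case True
          then show ?thesis
            using 2 FL.int_pow_neg[OF ebr_closed[OF l k], of 1] ebr_closed[OF l k]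
              FL.lb_swap[OF atm_closed[OF e[OF k]] atm_closed[OF e[OF l]]] by simp
        next
          case False
          then show ?thesis using 2 ij by auto
        qed
      qed (use ebr_closed[OF k l] in auto)
      then show ?thesis using FL.dprod_single[OF 2 l ebr_closed[OF k l]] by simp
    next
      case 3
      have "?N (e k) (e l) = dprod (free_lie A) n (\<lambda>i j. \<one>\<^bsub>free_lie A\<^esub>)"
        unfolding val by (rule FL.dprod_cong) (use 3 in auto)
      then show ?thesis using 3 FL.lb_self[OF atm_closed[OF e[OF k]]] by (simp add: FL.dprod_one)
    qed
  qed
  have 1: "lbracket (free_lie A) (atm (e k)) (atm y) = ?N (e k) y" if k: "k < n" and y: "y \<in> carrier A" for k y
    by (rule hom_generate_eq[OF A.is_group FL.is_group _ N2 ec,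
          where f = "\<lambda>y. lbracket (free_lie A) (atm (e k)) (atm y)"])
       (use basis k y basis_generates hom_comp[OF atm_hom FL.lb_hom_right[OF atm_closed[OF e[OF k]]]]
         in \<open>auto simp: o_def\<close>)
  show ?thesis
    by (rule hom_generate_eq[OF A.is_group FL.is_group _ N1 ec,
          where f = "\<lambda>x. lbracket (free_lie A) (atm x) (atm y)"])
       (use 1 x y basis_generates hom_comp[OF atm_hom FL.lb_hom_left[OF atm_closed[OF y]]]
         in \<open>auto simp: o_def\<close>)
qed

text \<open>Additivity reduces the claim to brackets of atoms. The consequence is that integral
  pairings with the dual basis determine an element of degree 2, which is the uniqueness behind
  \<open>dual_cup\<close>.\<close>

lemma grade_2_normal_form:
  assumes "w \<in> grade (free_lie A) 2"
  shows "w = dprod (free_lie A) n (\<lambda>i j. ebr i j [^]\<^bsub>free_lie A\<^esub> wedge_pairing (a i) (a j) w)"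
proof (rule hom_generate_eq[OF FL.is_group FL.is_group _ _ brackets_carrier, where f = "\<lambda>w. w"])
  show "(\<lambda>w. w) \<in> hom (free_lie A) (free_lie A)" by (simp add: hom_def)
  show "(\<lambda>w. dprod (free_lie A) n (\<lambda>i j. ebr i j [^]\<^bsub>free_lie A\<^esub> wedge_pairing (a i) (a j) w)) \<in> hom (free_lie A) (free_lie A)"
    by (rule FL.dprod_hom[OF FL.is_group], rule FL.int_pow_hom) (auto simp: ebr_closed wedge_pairing_hom a)
  show "w \<in> generate (free_lie A) brackets" using assms grade_2_generate by blast
  fix s assume "s \<in> brackets"
  then obtain x y where xy: "x \<in> carrier A" "y \<in> carrier A" "s = lbracket (free_lie A) (atm x) (atm y)" by blast
  have "s = dprod (free_lie A) n (\<lambda>i j. ebr i j [^]\<^bsub>free_lie A\<^esub> (a i x * a j y - a i y * a j x))"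
    unfolding xy(3) by (rule bracket_normal_form[OF xy(1,2)])
  also have "\<dots> = dprod (free_lie A) n (\<lambda>i j. ebr i j [^]\<^bsub>free_lie A\<^esub> wedge_pairing (a i) (a j) s)"
    by (rule FL.dprod_cong) (use xy in \<open>auto simp: ebr_closed wedge_pairing_bracket a\<close>)
  finally show "s = dprod (free_lie A) n (\<lambda>i j. ebr i j [^]\<^bsub>free_lie A\<^esub> wedge_pairing (a i) (a j) s)" .
qed

lemma ebr_grade: "\<lbrakk>i < n; j < n\<rbrakk> \<Longrightarrow> ebr i j \<in> grade (free_lie A) 2"
proof -
  assume ij: "i < n" "j < n"
  have "atm x \<in> grade (free_lie A) 1" if "x \<in> carrier A" for x
    unfolding grade_free_lie[OF A.is_group] using that by (intro imageI) (simp add: homogeneous.intros)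
  then show ?thesis using FL.grade_lbracket[of 1 1 "atm (e i)" "atm (e j)"] ij e by (simp add: one_add_one)
qed

lemma dprod_ebr_grade: "dprod (free_lie A) n (\<lambda>i j. ebr i j [^]\<^bsub>free_lie A\<^esub> (N i j :: int)) \<in> grade (free_lie A) 2"
proof -
  interpret g: subgroup "grade (free_lie A) 2" "free_lie A" by (rule FL.grade_subgroup) simp
  have fin: "finprod (free_lie A) f I \<in> grade (free_lie A) 2" if "finite I" "\<And>i. i \<in> I \<Longrightarrow> f i \<in> grade (free_lie A) 2"
    for f :: "nat \<Rightarrow> 'a lie_term set" and I
    using that
  proof (induction I rule: finite_induct)
    case (insert i I)
    then show ?case using g.subset by (subst FL.finprod_insert) auto
  qed auto
  show ?thesis unfolding dprod_def
    by (intro fin FL.subgroup_int_pow_closed[OF g.subgroup_axioms] ebr_grade) auto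
qed

lemma wedge_pairing_dprod:
  assumes "f \<in> hom A integer_group" "g \<in> hom A integer_group"
  shows "wedge_pairing f g (dprod (free_lie A) n (\<lambda>i j. ebr i j [^]\<^bsub>free_lie A\<^esub> (N i j :: int))) =
    (\<Sum>i<n. \<Sum>j<i. N i j * (f (e i) * g (e j) - f (e j) * g (e i)))"
proof -
  note h = wedge_pairing_hom[OF assms]
  interpret wp: group_hom "free_lie A" integer_group "wedge_pairing f g"
    using h FL.is_group by (simp add: group_hom_def group_hom_axioms_def)
  have "wedge_pairing f g (dprod (free_lie A) n (\<lambda>i j. ebr i j [^]\<^bsub>free_lie A\<^esub> (N i j :: int))) =
      dprod integer_group n (\<lambda>i j. wedge_pairing f g (ebr i j [^]\<^bsub>free_lie A\<^esub> (N i j :: int)))"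
    by (rule FL.hom_dprod[OF abelian_integer_group h]) (auto simp: ebr_closed)
  also have "\<dots> = (\<Sum>i<n. \<Sum>j<i. N i j * (f (e i) * g (e j) - f (e j) * g (e i)))"
    unfolding dprod_integer_group
  proof (intro sum.cong HOL.refl)
    fix i j assume "i \<in> {..<n}" "j \<in> {..<i}"
    then have ij: "i < n" "j < n" by auto
    show "wedge_pairing f g (ebr i j [^]\<^bsub>free_lie A\<^esub> (N i j :: int)) = N i j * (f (e i) * g (e j) - f (e j) * g (e i))"
      using wp.hom_int_pow[OF ebr_closed[OF ij], of "N i j"] wedge_pairing_bracket[OF assms e[OF ij(1)] e[OF ij(2)]]
      by simp
  qed
  finally show ?thesis .
qed

lemma hom_eq_basis_sum:
  assumes "f \<in> hom A integer_group" "x \<in> carrier A"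
  shows "f x = (\<Sum>i<n. f (e i) * a i x)"
proof -
  interpret f: group_hom A integer_group f
    using assms A.is_group by (simp add: group_hom_def group_hom_axioms_def)
  have "f x = f (finprod A (\<lambda>i. e i [^]\<^bsub>A\<^esub> a i x) {..<n})" using expand[OF assms(2)] by simp
  also have "\<dots> = (\<Sum>i<n. f (e i [^]\<^bsub>A\<^esub> a i x))"
    using A.hom_finprod[OF abelian_integer_group assms(1), of "\<lambda>i. e i [^]\<^bsub>A\<^esub> a i x" "{..<n}"] e
    by (simp add: finprod_integer_group Pi_iff)
  also have "\<dots> = (\<Sum>i<n. f (e i) * a i x)"
    by (rule sum.cong) (use f.hom_int_pow e in auto)
  finally show ?thesis .
qed

end

end

section \<open>The dual of the cup product and commutators\<close>

lemma (in group) ordered_prod_hom: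
  assumes "group H" "h \<in> hom G H" "\<And>i. i < n \<Longrightarrow> e i \<in> carrier G"
  shows "h (ordered_prod G e c n) = ordered_prod H (\<lambda>i. h (e i)) c n"
proof -
  interpret h: group_hom G H h
    using assms by (simp add: group_hom_def group_hom_axioms_def is_group)
  show ?thesis
    using assms(3)
  proof (induction n)
    case (Suc n)
    then show ?case
      using ordered_prod_closed[of n e c] by (simp add: h.hom_int_pow)
  qed simp
qed

lemma (in comm_group) ordered_prod_comm:
  assumes "\<And>i. i < n \<Longrightarrow> e i \<in> carrier G"
  shows "ordered_prod G e c n = comb {..<n} e c"
  using assms
proof (induction n)
  case (Suc n)
  have "comb {..<Suc n} e c = e n [^] c n \<otimes> comb {..<n} e c"
    unfolding lessThan_Suc by (rule finprod_insert) (use Suc.prems in auto)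
  moreover have "comb {..<n} e c \<in> carrier G" using Suc.prems by (auto intro!: finprod_closed)
  ultimately show ?case using Suc.IH Suc.prems by (simp add: m_comm)
qed simp

context group
begin

lemma cls_hom_quot: "cls k \<in> hom G (G Mod lower_central G (Suc k))"
  using normal.r_coset_hom_Mod[OF lower_central_normal] by simp

text \<open>Both groups consist of cosets of \<open>\<Gamma>\<^sub>3\<close>, so the inclusion of
  \<open>\<Gamma>\<^sub>2 / \<Gamma>\<^sub>3\<close> into the center of the quotient is literally
  the identity.\<close>

lemma gr_part_2_center:
  "(\<lambda>z. z) \<in> hom (gr_part G 2) (center_group (G Mod lower_central G (Suc 2)))"
proof -
  have "cls 2 x <#> cls 2 y = cls 2 y <#> cls 2 x" if "x \<in> lower_central G 2" "y \<in> carrier G" for x y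
    using that cls_commute[of 2 x y] lower_central_carrier[of x 2] cls_mult[of x y 2] cls_mult[of y x 2] by simp
  then show ?thesis
    by (auto simp: hom_def gr_part_simps center_def FactGroup_def RCOSETS_def dest: lower_central_carrier)
qed

text \<open>\<open>collect\<close> in the quotient by \<open>\<Gamma>\<^sub>3\<close>, whose
  commutators are central. The double product is formed in its center and transported back to the
  commutative group \<open>gr_part G 2\<close>.\<close>

lemma class_two_collect:
  assumes g: "\<And>i. i < n \<Longrightarrow> g i \<in> carrier G"
  shows "cls 2 (ordered_prod G g c n \<otimes> ordered_prod G g d n) =
    cls 2 (ordered_prod G g (\<lambda>i. c i + d i) n) <#>
      dprod (gr_part G 2) n (\<lambda>i j. cls 2 (commutator G (g i) (g j)) [^]\<^bsub>gr_part G 2\<^esub> (c i * d j))"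
proof -
  let ?K = "G Mod lower_central G (Suc 2)" and ?M = "gr_part G 2"
  interpret K: group ?K by (rule normal.factorgroup_is_group[OF lower_central_normal])
  interpret M: comm_group ?M by (rule comm_group_gr_part) simp
  interpret Z: comm_group "center_group ?K" by (rule K.comm_group_center)
  interpret \<iota>: group_hom ?M "center_group ?K" "\<lambda>z. z"
    using gr_part_2_center M.is_group Z.is_group by (simp add: group_hom_def group_hom_axioms_def)
  interpret \<pi>: group_hom G ?K "cls 2"
    using cls_hom_quot[of 2] K.is_group by (simp add: group_hom_def group_hom_axioms_def is_group)
  have comm2: "commutator G x y \<in> lower_central G 2" if "x \<in> carrier G" "y \<in> carrier G" for x y
    using commutator_lower_central_Suc[of 1 x y] that by (simp add: Suc_1)
  have q: "cls 2 (commutator G x y) \<in> carrier ?M" if "x \<in> carrier G" "y \<in> carrier G" for x y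
    using comm2[OF that] by (simp add: gr_part_simps)
  have qK: "commutator ?K (cls 2 x) (cls 2 y) = cls 2 (commutator G x y)" if "x \<in> carrier G" "y \<in> carrier G" for x y
    by (rule \<pi>.hom_commutator[OF that, symmetric])
  have carK: "carrier ?K = cls 2 ` carrier G" by (auto simp: FactGroup_def RCOSETS_def)
  have cc: "commutator ?K x y \<in> center ?K" if xy: "x \<in> carrier ?K" "y \<in> carrier ?K" for x y
  proof -
    obtain x' y' where "x' \<in> carrier G" "y' \<in> carrier G" "x = cls 2 x'" "y = cls 2 y'"
      using xy unfolding carK by blast
    then show ?thesis using \<iota>.hom_closed[OF q[of x' y']] qK[of x' y'] by simp
  qed
  have op: "cls 2 (ordered_prod G g c n) = ordered_prod ?K (\<lambda>i. cls 2 (g i)) c n" for c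
    by (rule ordered_prod_hom[OF K.is_group cls_hom_quot g])
  have "collect_cocycle ?K (\<lambda>i. cls 2 (g i)) c d n =
      dprod (center_group ?K) n (\<lambda>i j. cls 2 (commutator G (g i) (g j)) [^]\<^bsub>?M\<^esub> (c i * d j))"
    unfolding collect_cocycle_def dprod_def[symmetric]
  proof (rule Z.dprod_cong)
    fix i j assume "i < n" "j < i"
    then have ij: "g i \<in> carrier G" "g j \<in> carrier G" using g by auto
    show "cls 2 (commutator G (g i) (g j)) [^]\<^bsub>?M\<^esub> (c i * d j) \<in> carrier (center_group ?K)"
      by (intro \<iota>.hom_closed M.int_pow_closed q ij)
    show "commutator ?K (cls 2 (g i)) (cls 2 (g j)) [^]\<^bsub>?K\<^esub> (c i * d j) =
        cls 2 (commutator G (g i) (g j)) [^]\<^bsub>?M\<^esub> (c i * d j)"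
      unfolding qK[OF ij] \<iota>.hom_int_pow[OF q[OF ij]]
      using K.center_int_pow[of "cls 2 (commutator G (g i) (g j))"] \<iota>.hom_closed[OF q[OF ij]] by simp
  qed
  also have "\<dots> = dprod ?M n (\<lambda>i j. cls 2 (commutator G (g i) (g j)) [^]\<^bsub>?M\<^esub> (c i * d j))"
    by (rule M.hom_dprod[OF Z.comm_group_axioms gr_part_2_center, symmetric]) (intro M.int_pow_closed q g; linarith)
  finally have cyc: "collect_cocycle ?K (\<lambda>i. cls 2 (g i)) c d n =
      dprod ?M n (\<lambda>i j. cls 2 (commutator G (g i) (g j)) [^]\<^bsub>?M\<^esub> (c i * d j))" .
  have "cls 2 (ordered_prod G g c n \<otimes> ordered_prod G g d n) =
      ordered_prod ?K (\<lambda>i. cls 2 (g i)) c n \<otimes>\<^bsub>?K\<^esub> ordered_prod ?K (\<lambda>i. cls 2 (g i)) d n"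
    unfolding op[symmetric] by (intro \<pi>.hom_mult ordered_prod_closed g)
  also have "\<dots> = ordered_prod ?K (\<lambda>i. cls 2 (g i)) (\<lambda>i. c i + d i) n \<otimes>\<^bsub>?K\<^esub> collect_cocycle ?K (\<lambda>i. cls 2 (g i)) c d n"
    by (rule conjunct1[OF K.collect[OF cc]]) (assumption+, intro \<pi>.hom_closed g)
  finally show ?thesis unfolding cyc op[symmetric] mult_FactGroup .
qed

end

lemma sum_square_alternating:
  fixes f :: "nat \<Rightarrow> nat \<Rightarrow> int"
  assumes "\<And>i. i < n \<Longrightarrow> f i i = 0"
  shows "(\<Sum>i<n. \<Sum>j<n. f i j) = (\<Sum>i<n. \<Sum>j<i. f i j + f j i)"
  using assms by (induction n) (simp_all add: sum.distrib)

lemma lin_sum: "lin (\<lambda>\<tau>. \<Sum>i\<in>I. f i \<tau>) c = (\<Sum>i\<in>I. lin (f i) c)"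
  unfolding lin_def sum_distrib_left by (rule sum.swap)

lemma cup_chain_add: "cup_chain a b (c + d) = cup_chain a b c + cup_chain a b d"
  and cup_chain_diff: "cup_chain a b (c - d) = cup_chain a b c - cup_chain a b d"
  by (simp_all add: cup_chain_def lin_add lin_diff)

section \<open>Chains bounded by elements of the group, and their cup products\<close>

context pi1_space
begin

lemma kronecker_hom:
  assumes "a \<in> carrier (cohomology_group 1 X)"
  shows "(\<lambda>z. kronecker z a) \<in> hom H1 integer_group"
proof (rule homI)
  fix z w assume "z \<in> carrier H1" "w \<in> carrier H1"
  then obtain p q where pq: "p \<in> loops X x0" "z = hcl p" "q \<in> loops X x0" "w = hcl q"
    by (metis H1_cases)
  then show "kronecker (z \<otimes>\<^bsub>H1\<^esub> w) a = kronecker z a \<otimes>\<^bsub>integer_group\<^esub> kronecker w a"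
    using hom_integer_add[OF class_hom[OF assms]]
    by (simp add: hcl_concat kronecker_class_hom concat_loops_closed Theta_concat)
qed simp

definition rep :: "'g \<Rightarrow> real \<Rightarrow> 'x" where
  "rep g = (SOME p. p \<in> loops X x0 \<and> Theta p = g)"

lemma rep:
  assumes "g \<in> carrier G"
  shows "rep g \<in> loops X x0" "Theta (rep g) = g"
proof -
  obtain p where "p \<in> loops X x0 \<and> Theta p = g" using Theta_surj[OF assms] by blast
  then have "rep g \<in> loops X x0 \<and> Theta (rep g) = g"
    unfolding rep_def by (rule someI[of "\<lambda>p. p \<in> loops X x0 \<and> Theta p = g"])
  then show "rep g \<in> loops X x0" "Theta (rep g) = g" by auto
qed

lemma kap_rep: "g \<in> carrier G \<Longrightarrow> kap g = hcl (rep g)"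
  using kap_Theta[of "rep g"] rep by simp

lemma kap_surj:
  assumes "z \<in> carrier H1"
  obtains g where "g \<in> carrier G" "kap g = z"
proof -
  obtain p where p: "p \<in> loops X x0" "z = hcl p" using H1_cases[OF assms] by blast
  show thesis by (rule that[of "Theta p"]) (use p kap_Theta in auto)
qed

lemma ab_kap: "g \<in> carrier G \<Longrightarrow> ab (kap g) = cls 1 g"
  using ab_hcl[of "rep g"] rep by (simp add: kap_rep)

abbreviation homs :: "('x chain set \<Rightarrow> int) set" where
  "homs \<equiv> hom H1 integer_group"

abbreviation kcup :: "('x chain set \<Rightarrow> int) \<Rightarrow> ('x chain set \<Rightarrow> int) \<Rightarrow> 'x chain \<Rightarrow> int" where
  "kcup a b \<equiv> gcup (\<lambda>g. a (kap g)) (\<lambda>g. b (kap g))"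

lemma homs_kap: "a \<in> homs \<Longrightarrow> (\<lambda>g. a (kap g)) \<in> hom G integer_group"
  by (rule hom_comp[OF kap_hom])

lemma homs_simps:
  assumes "a \<in> homs"
  shows "\<lbrakk>x \<in> carrier G; y \<in> carrier G\<rbrakk> \<Longrightarrow> a (kap (x \<otimes> y)) = a (kap x) + a (kap y)"
    and "a (kap \<one>) = 0" and "x \<in> carrier G \<Longrightarrow> a (kap (inv x)) = - a (kap x)"
    and "x \<in> lower_central G 2 \<Longrightarrow> a (kap x) = 0"
proof -
  interpret k: group_hom G integer_group "\<lambda>g. a (kap g)"
    using homs_kap[OF assms] by (simp add: group_hom_def group_hom_axioms_def is_group)
  show "\<lbrakk>x \<in> carrier G; y \<in> carrier G\<rbrakk> \<Longrightarrow> a (kap (x \<otimes> y)) = a (kap x) + a (kap y)"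
    "a (kap \<one>) = 0" "x \<in> carrier G \<Longrightarrow> a (kap (inv x)) = - a (kap x)"
    using k.hom_mult k.hom_one k.hom_inv by auto
  show "x \<in> lower_central G 2 \<Longrightarrow> a (kap x) = 0"
    using hom_comm_trivial_lower_central[OF abelian_integer_group homs_kap[OF assms]] by simp
qed

text \<open>Two chains that bound the same \<open>z\<close> differ by a 2-cycle, whose cup products are the
  difference of the two \<open>\<omega>\<close>.\<close>

definition bounds :: "'x chain \<Rightarrow> (('x chain set \<Rightarrow> int) \<Rightarrow> ('x chain set \<Rightarrow> int) \<Rightarrow> int) \<Rightarrow> bool" where
  "bounds z \<omega> \<longleftrightarrow> (\<exists>c. singular_chain 2 X c \<and> chain_boundary 2 c = z \<and> (\<forall>a\<in>homs. \<forall>b\<in>homs. kcup a b c = \<omega> a b))"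

lemma bounds_add:
  assumes "bounds z \<omega>" "bounds z' \<omega>'"
  shows "bounds (z + z') (\<lambda>a b. \<omega> a b + \<omega>' a b)"
proof -
  obtain c c' where "singular_chain 2 X c" "chain_boundary 2 c = z" "\<forall>a\<in>homs. \<forall>b\<in>homs. kcup a b c = \<omega> a b"
      "singular_chain 2 X c'" "chain_boundary 2 c' = z'" "\<forall>a\<in>homs. \<forall>b\<in>homs. kcup a b c' = \<omega>' a b"
    using assms unfolding bounds_def by blast
  then show ?thesis
    unfolding bounds_def by (intro exI[of _ "c + c'"]) (simp add: singular_chain_add chain_boundary_add cup_chain_add)
qed

lemma bounds_diff:
  assumes "bounds z \<omega>" "bounds z' \<omega>'"
  shows "bounds (z - z') (\<lambda>a b. \<omega> a b - \<omega>' a b)"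
proof -
  obtain c c' where "singular_chain 2 X c" "chain_boundary 2 c = z" "\<forall>a\<in>homs. \<forall>b\<in>homs. kcup a b c = \<omega> a b"
      "singular_chain 2 X c'" "chain_boundary 2 c' = z'" "\<forall>a\<in>homs. \<forall>b\<in>homs. kcup a b c' = \<omega>' a b"
    using assms unfolding bounds_def by blast
  then show ?thesis
    unfolding bounds_def by (intro exI[of _ "c - c'"]) (simp add: singular_chain_diff chain_boundary_diff cup_chain_diff)
qed

lemma bounds_cong:
  assumes "bounds z \<omega>" "z = z'" "\<And>a b. \<lbrakk>a \<in> homs; b \<in> homs\<rbrakk> \<Longrightarrow> \<omega> a b = \<omega>' a b"
  shows "bounds z' \<omega>'"
  using assms unfolding bounds_def by auto

abbreviation rch :: "'g \<Rightarrow> 'x chain" where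
  "rch g \<equiv> path_chain (rep g)"

text \<open>The filling is the triangle of the concatenation with the two triangles of a homotopy to
  the chosen loop of the product. Each of the latter has its constant edge as a factor of the cup
  product, on face 0 or on face 2, so only the first triangle contributes.\<close>

lemma bounds_mult:
  assumes g: "g \<in> carrier G" and h: "h \<in> carrier G"
  shows "bounds (rch g + rch h - rch (g \<otimes> h)) (\<lambda>a b. a (kap g) * b (kap h))"
proof -
  let ?p = "rep g" and ?q = "rep h" and ?r = "rep (g \<otimes> h)"
  have l: "?p \<in> loops X x0" "?q \<in> loops X x0" "?r \<in> loops X x0" using rep g h by auto
  then have pq: "concat_loops ?p ?q \<in> loops X x0" by (simp add: concat_loops_closed)
  have pin: "pathin X ?p" "pathin X ?q" "?p 1 = ?q 0" using l by (auto simp: loops_iff)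
  note cs = concat_simplex[OF pin]
  have "path_homotopic X x0 x0 (concat_loops ?p ?q) ?r"
    using Theta_eq_iff[OF pq l(3)] rep g h l by (simp add: Theta_concat)
  from homotopy_simplices[OF this] obtain \<tau> \<tau>' d where
    \<tau>: "singular_simplex 2 X \<tau>" "singular_simplex 2 X \<tau>'"
      "singular_face 2 2 \<tau> = loop_simplex (concat_loops ?p ?q)" "singular_face 2 0 \<tau> = loop_simplex (\<lambda>_. x0)"
      "singular_face 2 1 \<tau> = d" "singular_face 2 1 \<tau>' = d"
      "singular_face 2 2 \<tau>' = loop_simplex (\<lambda>_. x0)" "singular_face 2 0 \<tau>' = loop_simplex ?r"
    by blast
  let ?c = "frag_of (concat_simplex ?p ?q) + frag_of \<tau> - frag_of \<tau>'"
  have k: "a (kap (Theta (\<lambda>_. x0))) = 0" if "a \<in> homs" for a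
    using homs_simps(2)[OF that] by (simp add: Theta_const)
  show ?thesis
    unfolding bounds_def
  proof (intro exI[of _ ?c] conjI ballI)
    show "singular_chain 2 X ?c"
      by (intro singular_chain_add singular_chain_diff) (use cs(1) \<tau> in \<open>simp_all add: singular_chain_of\<close>)
    show "chain_boundary 2 ?c = rch g + rch h - rch (g \<otimes> h)"
      by (simp add: chain_boundary_add chain_boundary_diff chain_boundary_2 cs \<tau>)
    show "kcup a b ?c = a (kap g) * b (kap h)" if "a \<in> homs" "b \<in> homs" for a b
      unfolding cup_chain_add cup_chain_diff
      using rep[OF g] rep[OF h] k[OF that(1)] k[OF that(2)]
      by (simp add: cup_chain_def cs \<tau> gam1_loop_simplex l pq const_loop)
  qed
qed

abbreviation fill :: "'g \<Rightarrow> (('x chain set \<Rightarrow> int) \<Rightarrow> ('x chain set \<Rightarrow> int) \<Rightarrow> int) \<Rightarrow> bool" where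
  "fill g \<equiv> bounds (rch g)"

lemma fill_one: "fill \<one> (\<lambda>a b. 0)"
  by (rule bounds_cong[OF bounds_mult[of \<one> \<one>]]) (auto simp: homs_simps)

lemma bounds_inv:
  assumes g: "g \<in> carrier G"
  shows "bounds (rch g + rch (inv g)) (\<lambda>a b. - (a (kap g) * b (kap g)))"
  by (rule bounds_cong[OF bounds_add[OF bounds_mult[OF g inv_closed[OF g]] fill_one]])
     (use g in \<open>auto simp: homs_simps\<close>)

text \<open>The three multiplications that build the commutator telescope, and subtracting them from
  the fillings of the inverse pairs leaves its loop. The terms with \<open>x\<close> twice or
  \<open>y\<close> twice cancel. The overall minus sign, due to this subtraction, recurs in
  \<open>lext_fill\<close>.\<close>

lemma fill_commutator:
  assumes x: "x \<in> carrier G" and y: "y \<in> carrier G"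
  shows "fill (commutator G x y) (\<lambda>a b. - (a (kap x) * b (kap y) - a (kap y) * b (kap x)))"
  by (rule bounds_cong[OF bounds_diff[OF bounds_add[OF bounds_inv[OF x] bounds_inv[OF y]]
        bounds_add[OF bounds_add[OF bounds_mult[OF x y] bounds_mult[of "x \<otimes> y" "inv x"]]
          bounds_mult[of "x \<otimes> y \<otimes> inv x" "inv y"]]]])
     (use x y in \<open>auto simp: homs_simps algebra_simps\<close>)

text \<open>Homomorphisms to the integers vanish on \<open>\<Gamma>\<^sub>2\<close>, so the product
  term of \<open>bounds_mult\<close> drops out and fillings add up.\<close>

lemma fill_mult:
  assumes "g \<in> lower_central G 2" "h \<in> lower_central G 2" "fill g \<omega>" "fill h \<omega>'"
  shows "fill (g \<otimes> h) (\<lambda>a b. \<omega> a b + \<omega>' a b)"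
  by (rule bounds_cong[OF bounds_diff[OF bounds_add[OF assms(3,4)] bounds_mult[of g h]]])
     (use assms lower_central_carrier in \<open>auto simp: homs_simps\<close>)

lemma fill_inv:
  assumes "g \<in> lower_central G 2" "fill g \<omega>"
  shows "fill (inv g) (\<lambda>a b. - \<omega> a b)"
  by (rule bounds_cong[OF bounds_diff[OF bounds_inv[of g] assms(2)]])
     (use assms lower_central_carrier in \<open>auto simp: homs_simps\<close>)

lemma commutator_lower_central_2:
  "\<lbrakk>x \<in> carrier G; y \<in> carrier G\<rbrakk> \<Longrightarrow> commutator G x y \<in> lower_central G 2"
  using commutator_lower_central_Suc[of 1 x y] by (simp add: Suc_1)

text \<open>For \<open>x\<close> in \<open>\<Gamma>\<^sub>2\<close> both terms in
  \<open>fill_commutator\<close> contain a value at \<open>x\<close>, which is zero; products and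
  inverses preserve this.\<close>

lemma fill_lower_central_3:
  assumes "g \<in> lower_central G (Suc 2)"
  shows "fill g (\<lambda>a b. 0)"
proof -
  have sub: "lower_central G (Suc 2) \<subseteq> lower_central G 2" by (rule lower_central_Suc_subset)
  have *: "fill (commutator G x y) (\<lambda>a b. 0)" if "x \<in> lower_central G 2" "y \<in> carrier G" for x y
    by (rule bounds_cong[OF fill_commutator[of x y]]) (use that lower_central_carrier in \<open>auto simp: homs_simps\<close>)
  have "g \<in> generate G {commutator G x y | x y. x \<in> lower_central G 2 \<and> y \<in> carrier G}"
    using assms lower_central_Suc[of 2] by simp
  then have "g \<in> lower_central G 2 \<and> fill g (\<lambda>a b. 0)"
  proof induction
    case one
    then show ?case using fill_one lower_central_closed(3) by blast
  next
    case (incl h)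
    then show ?case using * commutator_lower_central_2 lower_central_carrier by blast
  next
    case (inv h)
    then have h: "h \<in> lower_central G 2" "fill h (\<lambda>a b. 0)"
      using * commutator_lower_central_2 lower_central_carrier by blast+
    then show ?case using lower_central_closed(2) fill_inv[OF h] by simp
  next
    case (eng h1 h2)
    then show ?case using lower_central_closed(1)[of h1 2 h2] fill_mult[of h1 h2 "\<lambda>a b. 0" "\<lambda>a b. 0"] by simp
  qed
  then show ?thesis by blast
qed

end

lemma wedge_pairing_cong:
  assumes A: "comm_group A" and f: "f \<in> hom A integer_group" and g: "g \<in> hom A integer_group"
    and f': "f' \<in> hom A integer_group" and g': "g' \<in> hom A integer_group"
    and eq: "\<And>x. x \<in> carrier A \<Longrightarrow> f x = f' x" "\<And>x. x \<in> carrier A \<Longrightarrow> g x = g' x"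
    and w: "w \<in> carrier (free_lie A)"
  shows "wedge_pairing f g w = wedge_pairing f' g' w"
proof -
  obtain t where t: "t \<in> lie_terms A" "w = lie_class A t"
    using w by (auto simp: carrier_free_lie[OF comm_group.axioms(2)[OF A]])
  have lin: "term_lin h s = term_lin h' s" if "s \<in> lie_terms A" "\<And>x. x \<in> carrier A \<Longrightarrow> h x = h' x" for h h' s
    using that by (induction s) auto
  have "term_wedge f g t = term_wedge f' g' t"
    using t(1)
  proof (induction t)
    case (Bracket s t)
    then show ?case using lin[of s f f'] lin[of t f f'] lin[of s g g'] lin[of t g g'] eq by simp
  qed auto
  then show ?thesis using t wedge_pairing_class[OF A f g] wedge_pairing_class[OF A f' g'] by simp
qed

lemma sum_product_coefficients:
  fixes f g x y :: "nat \<Rightarrow> int"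
  shows "(\<Sum>i<n. f i * x i) * (\<Sum>i<n. g i * y i) = (\<Sum>i<n. \<Sum>j<n. (f i * g j) * (x i * y j))"
  by (simp add: sum_product mult.assoc mult.left_commute)

section \<open>Evaluation of the degree two part in the associated graded Lie algebra\<close>

context pi1_space
begin

abbreviation H1_lie :: "'x chain set lie_term set graded_lie" where
  "H1_lie \<equiv> free_lie H1"

abbreviation hatom :: "'x chain set \<Rightarrow> 'x chain set lie_term set" where
  "hatom z \<equiv> lie_class H1 (Atom z)"

abbreviation lext :: "'x chain set lie_term set \<Rightarrow> nat \<Rightarrow> 'g set" where
  "lext \<equiv> lie_extend (gr G) (\<lambda>z. gr_one G (ab z))"

lemma gr_one_ab_hom: "(\<lambda>z. gr_one G (ab z)) \<in> hom H1 (gr G)"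
  using hom_comp[OF ab_hom graded_pieces.single_hom[OF graded_pieces_gr, of 1]]
  by (simp add: gr_one_eq_single gr_eq_sum_lie)

lemma gr_one_ab_kap: "g \<in> carrier G \<Longrightarrow> gr_one G (ab (kap g)) = single (gr_part G) 1 (cls 1 g)"
  by (simp add: gr_one_eq_single ab_kap)

lemma gr_one_ab_grade: "(\<lambda>z. gr_one G (ab z)) \<in> carrier H1 \<rightarrow> grade (gr G) 1"
proof
  fix z assume "z \<in> carrier H1"
  then obtain g where "g \<in> carrier G" "kap g = z" using kap_surj by blast
  then show "gr_one G (ab z) \<in> grade (gr G) 1"
    using gr_one_ab_kap[of g] single_gr_grade[of 1 g] by simp
qed

lemma lext_hom: "lext \<in> graded_lie_hom H1_lie (gr G)"
  by (rule lie_extend_hom[OF group_H1 graded_lie_algebra_gr gr_one_ab_hom gr_one_ab_grade])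

lemma hatom_closed: "z \<in> carrier H1 \<Longrightarrow> hatom z \<in> carrier H1_lie"
  by (simp add: lie_class_closed[OF group_H1])

lemma lext_atom:
  assumes "g \<in> carrier G"
  shows "lext (hatom (kap g)) = single (gr_part G) 1 (cls 1 g)"
proof -
  have "kap g \<in> carrier H1" using kap_hom assms by (auto simp: hom_def)
  then show ?thesis
    using lie_extend_class[OF group_H1 graded_lie_algebra.lie_ring[OF graded_lie_algebra_gr] gr_one_ab_hom, of "Atom (kap g)"]
      gr_one_ab_kap[OF assms] by simp
qed

lemma lext_bracket:
  assumes "x \<in> carrier G" "y \<in> carrier G"
  shows "lext (lbracket H1_lie (hatom (kap x)) (hatom (kap y))) = single (gr_part G) 2 (cls 2 (commutator G x y))"
proof -
  have "kap x \<in> carrier H1" "kap y \<in> carrier H1" using kap_hom assms by (auto simp: hom_def)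
  then have "lext (lbracket H1_lie (hatom (kap x)) (hatom (kap y))) =
      lbracket (gr G) (single (gr_part G) 1 (cls 1 x)) (single (gr_part G) 1 (cls 1 y))"
    using lie_homD(2)[OF graded_lie_hom_imp_lie_hom[OF lext_hom] hatom_closed hatom_closed] assms
    by (simp add: lext_atom)
  also have "\<dots> = single (gr_part G) (1 + 1) (cls (1 + 1) (commutator G x y))"
    by (rule lbracket_single_gr) (use assms in auto)
  finally show ?thesis unfolding one_add_one .
qed

lemma single_2_eq_one:
  assumes "g \<in> carrier G" "single (gr_part G) 2 (cls 2 g) = \<one>\<^bsub>gr G\<^esub>"
  shows "g \<in> lower_central G (Suc 2)"
proof (rule cls_eq_oneD[OF _ assms(1)])
  have "single (gr_part G) 2 (cls 2 g) 2 = single (gr_part G) 2 (cls 2 \<one>) 2"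
    unfolding assms(2) single_gr_one ..
  then show "cls 2 g = lower_central G (Suc 2)"
    unfolding cls_one by (simp add: single_def)
qed

text \<open>For a bracket of atoms take the commutator of preimages under \<open>kap\<close>, with
  its explicit filling. The group element and the filling are carried together through products and
  inverses, so that one \<open>g\<close> serves both the class in
  \<open>\<Gamma>\<^sub>2 / \<Gamma>\<^sub>3\<close> and the cup products.\<close>

lemma lext_fill:
  assumes "w \<in> grade H1_lie 2"
  shows "\<exists>g\<in>lower_central G 2. lext w = single (gr_part G) 2 (cls 2 g) \<and> fill g (\<lambda>a b. - wedge_pairing a b w)"
proof -
  interpret FL: graded_lie_algebra H1_lie by (rule graded_lie_algebra_free_lie[OF group_H1])
  interpret gr: graded_lie_algebra "gr G" by (rule graded_lie_algebra_gr)
  interpret lx: group_hom H1_lie "gr G" lext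
    using lext_hom FL.is_group gr.is_group by (simp add: group_hom_def group_hom_axioms_def graded_lie_hom_def)
  have wp: "group_hom H1_lie integer_group (wedge_pairing a b)" if "a \<in> homs" "b \<in> homs" for a b
    using wedge_pairing_hom[OF comm_group_H1 that] FL.is_group by (simp add: group_hom_def group_hom_axioms_def)
  define R where "R w \<longleftrightarrow> w \<in> carrier H1_lie \<and> (\<exists>g\<in>lower_central G 2. lext w = single (gr_part G) 2 (cls 2 g) \<and>
    fill g (\<lambda>a b. - wedge_pairing a b w))" for w
  have R_inv: "R (inv\<^bsub>H1_lie\<^esub> w)" if Rw: "R w" for w
  proof -
    obtain g where g: "w \<in> carrier H1_lie" "g \<in> lower_central G 2" "lext w = single (gr_part G) 2 (cls 2 g)"
        "fill g (\<lambda>a b. - wedge_pairing a b w)"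
      using Rw unfolding R_def by blast
    have "fill (inv g) (\<lambda>a b. - wedge_pairing a b (inv\<^bsub>H1_lie\<^esub> w))"
      by (rule bounds_cong[OF fill_inv[OF g(2,4)] HOL.refl])
         (simp add: group_hom.hom_inv[OF wp g(1)])
    then show ?thesis
      unfolding R_def using g lower_central_closed(2)[OF g(2)] single_gr_inv[OF _ g(2)]
      by (intro conjI bexI[of _ "inv g"]) (simp_all add: lx.hom_inv)
  qed
  have R_mult: "R (w \<otimes>\<^bsub>H1_lie\<^esub> w')" if Rw: "R w" "R w'" for w w'
  proof -
    obtain g g' where g: "w \<in> carrier H1_lie" "g \<in> lower_central G 2" "lext w = single (gr_part G) 2 (cls 2 g)"
        "fill g (\<lambda>a b. - wedge_pairing a b w)"
        "w' \<in> carrier H1_lie" "g' \<in> lower_central G 2" "lext w' = single (gr_part G) 2 (cls 2 g')"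
        "fill g' (\<lambda>a b. - wedge_pairing a b w')"
      using Rw unfolding R_def by blast
    have "fill (g \<otimes> g') (\<lambda>a b. - wedge_pairing a b (w \<otimes>\<^bsub>H1_lie\<^esub> w'))"
      by (rule bounds_cong[OF fill_mult[OF g(2,6,4,8)] HOL.refl])
         (simp add: group_hom.hom_mult[OF wp g(1,5)])
    then show ?thesis
      unfolding R_def using g lower_central_closed(1)[OF g(2,6)] single_gr_mult[OF _ g(2,6)]
      by (intro conjI bexI[of _ "g \<otimes> g'"]) (simp_all add: lx.hom_mult)
  qed
  have R_bracket: "R s" if s: "s \<in> {lbracket H1_lie (hatom x) (hatom y) | x y. x \<in> carrier H1 \<and> y \<in> carrier H1}" for s
  proof -
    obtain x y where xy: "x \<in> carrier H1" "y \<in> carrier H1" "s = lbracket H1_lie (hatom x) (hatom y)" using s by blast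
    obtain g h where g: "g \<in> carrier G" "kap g = x" and h: "h \<in> carrier G" "kap h = y"
      using kap_surj xy by metis
    have "fill (commutator G g h) (\<lambda>a b. - wedge_pairing a b s)"
      by (rule bounds_cong[OF fill_commutator[OF g(1) h(1)] HOL.refl])
         (use xy in \<open>simp add: wedge_pairing_bracket[OF comm_group_H1] g h\<close>)
    then show ?thesis
      unfolding R_def using commutator_lower_central_2[OF g(1) h(1)] lext_bracket[OF g(1) h(1)] xy g h
      by (intro conjI bexI[of _ "commutator G g h"]) (simp_all add: hatom_closed)
  qed
  have "w \<in> generate H1_lie {lbracket H1_lie (hatom x) (hatom y) | x y. x \<in> carrier H1 \<and> y \<in> carrier H1}"
    using assms grade_2_generate[OF comm_group_H1] by blast
  then have "R w"
  proof induction
    case one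
    have one: "\<one>\<^bsub>H1\<^esub> \<in> carrier H1" by (rule group.is_monoid[OF group_H1, THEN monoid.one_closed])
    have "R (lbracket H1_lie (hatom \<one>\<^bsub>H1\<^esub>) (hatom \<one>\<^bsub>H1\<^esub>))" by (rule R_bracket) (use one in blast)
    then show ?case unfolding FL.lb_self[OF hatom_closed[OF one]] .
  next
    case (incl h)
    then show ?case by (rule R_bracket)
  next
    case (inv h)
    then show ?case by (intro R_inv R_bracket)
  next
    case (eng h1 h2)
    then show ?case by (intro R_mult)
  qed
  then show ?thesis unfolding R_def by blast
qed

end

section \<open>Normal forms modulo the third term, and the image of the dual of the cup
  product\<close>

locale pi1_basis = pi1_space G X x0 \<theta> for G :: "'g monoid" (structure) and X :: "'x topology" and x0 \<theta> +
  fixes n :: nat and e :: "nat \<Rightarrow> 'x chain set" and a :: "nat \<Rightarrow> 'x chain set \<Rightarrow> int"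
  assumes e: "\<And>i. i < n \<Longrightarrow> e i \<in> carrier H1" and a: "\<And>i. i < n \<Longrightarrow> a i \<in> homs"
    and ae: "\<And>i j. \<lbrakk>i < n; j < n\<rbrakk> \<Longrightarrow> a i (e j) = (if i = j then 1 else 0)"
    and expand: "\<And>x. x \<in> carrier H1 \<Longrightarrow> x = finprod H1 (\<lambda>i. e i [^]\<^bsub>H1\<^esub> a i x) {..<n}"
begin

lemmas basis = comm_group_H1 e a ae expand

definition gen :: "nat \<Rightarrow> 'g" where
  "gen i = (SOME g. g \<in> carrier G \<and> kap g = e i)"

lemma gen:
  assumes "i < n"
  shows "gen i \<in> carrier G" "kap (gen i) = e i"
proof -
  obtain g where "g \<in> carrier G" "kap g = e i" using kap_surj[OF e[OF assms]] by blast
  then have "gen i \<in> carrier G \<and> kap (gen i) = e i"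
    unfolding gen_def by (intro someI[of "\<lambda>g. g \<in> carrier G \<and> kap g = e i"] conjI)
  then show "gen i \<in> carrier G" "kap (gen i) = e i" by auto
qed

text \<open>A lift of the image of \<open>x\<close> in \<open>H\<^sub>1\<close> that depends on this
  image alone; the fixed order of the generators makes it definite.\<close>

abbreviation nf :: "'g \<Rightarrow> 'g" where
  "nf x \<equiv> ordered_prod G gen (\<lambda>i. a i (kap x)) n"

lemma nf_closed: "nf x \<in> carrier G"
  by (rule ordered_prod_closed) (rule gen)

lemma nf_remainder:
  assumes x: "x \<in> carrier G"
  shows "inv (nf x) \<otimes> x \<in> lower_central G 2"
proof -
  interpret H: comm_group H1 by (rule comm_group_H1)
  have kx: "kap x \<in> carrier H1" using kap_hom x by (auto simp: hom_def)
  have "kap (nf x) = ordered_prod H1 (\<lambda>i. kap (gen i)) (\<lambda>i. a i (kap x)) n"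
    by (rule ordered_prod_hom[OF group_H1 kap_hom gen(1)])
  also have "\<dots> = finprod H1 (\<lambda>i. kap (gen i) [^]\<^bsub>H1\<^esub> a i (kap x)) {..<n}"
    by (rule H.ordered_prod_comm) (simp add: gen e)
  also have "\<dots> = finprod H1 (\<lambda>i. e i [^]\<^bsub>H1\<^esub> a i (kap x)) {..<n}"
    by (rule H.finprod_cong') (simp_all add: gen e Pi_iff)
  also have "\<dots> = kap x" by (rule expand[OF kx, symmetric])
  finally have "cls 1 (nf x) = cls 1 x" using ab_kap[OF nf_closed[of x]] ab_kap[OF x] by simp
  then have "cls 1 (inv (nf x) \<otimes> x) = cls 1 (inv (nf x) \<otimes> nf x)"
    using cls_mult[of "inv (nf x)" x 1] cls_mult[of "inv (nf x)" "nf x" 1] nf_closed[of x] x by simp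
  also have "\<dots> = lower_central G (Suc 1)" using nf_closed[of x] cls_one[of 1] by simp
  finally show ?thesis using cls_eq_oneD[of 1 "inv (nf x) \<otimes> x"] nf_closed[of x] x by (simp add: Suc_1)
qed

abbreviation rem :: "'g \<Rightarrow> 'g set" where
  "rem x \<equiv> cls 2 (inv (nf x) \<otimes> x)"

abbreviation gcom :: "nat \<Rightarrow> nat \<Rightarrow> 'g set" where
  "gcom i j \<equiv> cls 2 (commutator G (gen i) (gen j))"

abbreviation nf_cocycle :: "'g \<Rightarrow> 'g \<Rightarrow> 'g set" where
  "nf_cocycle x y \<equiv> dprod (gr_part G 2) n (\<lambda>i j. gcom i j [^]\<^bsub>gr_part G 2\<^esub> (a i (kap x) * a j (kap y)))"

lemma cls_2_closed: "x \<in> lower_central G 2 \<Longrightarrow> cls 2 x \<in> carrier (gr_part G 2)"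
  by (simp add: gr_part_simps)

lemma gcom_closed: "\<lbrakk>i < n; j < n\<rbrakk> \<Longrightarrow> gcom i j \<in> carrier (gr_part G 2)"
  by (intro cls_2_closed commutator_lower_central_2 gen)

text \<open>The remainder fails to be additive by the cup product cocycle with values in \<open>\<Gamma>\<^sub>2 / \<Gamma>\<^sub>3\<close>.\<close>

lemma rem_mult:
  assumes x: "x \<in> carrier G" and y: "y \<in> carrier G"
  shows "rem (x \<otimes> y) = nf_cocycle x y \<otimes>\<^bsub>gr_part G 2\<^esub> (rem x \<otimes>\<^bsub>gr_part G 2\<^esub> rem y)"
proof -
  let ?K = "G Mod lower_central G (Suc 2)" and ?M = "gr_part G 2"
  interpret K: group ?K by (rule normal.factorgroup_is_group[OF lower_central_normal])
  interpret M: comm_group ?M by (rule comm_group_gr_part) simp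
  let ?u = "inv (nf x) \<otimes> x" and ?v = "inv (nf y) \<otimes> y" and ?w = "inv (nf (x \<otimes> y)) \<otimes> (x \<otimes> y)"
  note nc = nf_closed[of x] nf_closed[of y] nf_closed[of "x \<otimes> y"]
  have u: "?u \<in> lower_central G 2" "?u \<in> carrier G" and v: "?v \<in> lower_central G 2" "?v \<in> carrier G"
    and w: "?w \<in> lower_central G 2" "?w \<in> carrier G"
    using nf_remainder x y nc by auto
  have uv: "?u \<otimes> ?v \<in> lower_central G 2" by (rule lower_central_closed(1)[OF u(1) v(1)])
  have MK: "z \<in> carrier ?K" if "z \<in> carrier ?M" for z
    using hom_in_carrier[OF gr_part_2_center that] by (simp add: center_def)
  have cc: "nf_cocycle x y \<in> carrier ?M"
    by (rule M.dprod_closed) (intro M.int_pow_closed gcom_closed; linarith)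
  have ruv: "rem x <#> rem y = cls 2 (?u \<otimes> ?v)" by (rule cls_mult[OF u(2) v(2)])
  have "cls 2 (nf (x \<otimes> y)) <#> rem (x \<otimes> y) = cls 2 (nf (x \<otimes> y) \<otimes> ?w)"
    by (rule cls_mult[OF nc(3) w(2)])
  \<comment> \<open>The product of \<open>nf x\<close>, \<open>u\<close>, \<open>nf y\<close> and
    \<open>v\<close> is \<open>x \<otimes> y\<close> again. Modulo \<open>\<Gamma>\<^sub>3\<close>
    the remainder \<open>u\<close> passes \<open>nf y\<close> freely, and the two adjacent normal
    forms are then collected.\<close>
  also have "nf (x \<otimes> y) \<otimes> ?w = nf x \<otimes> ((?u \<otimes> nf y) \<otimes> ?v)"
    using nc x y by (simp add: word_simps)
  also have "cls 2 \<dots> = cls 2 (nf x) <#> (cls 2 (?u \<otimes> nf y) <#> cls 2 ?v)"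
    using cls_mult[of "nf x" "(?u \<otimes> nf y) \<otimes> ?v" 2] cls_mult[of "?u \<otimes> nf y" ?v 2] nc u v by simp
  also have "cls 2 (?u \<otimes> nf y) = cls 2 (nf y \<otimes> ?u)" by (rule cls_commute) (use u nc in auto)
  also have "cls 2 (nf x) <#> (cls 2 (nf y \<otimes> ?u) <#> cls 2 ?v) = cls 2 (nf x \<otimes> ((nf y \<otimes> ?u) \<otimes> ?v))"
    using cls_mult[of "nf x" "(nf y \<otimes> ?u) \<otimes> ?v" 2] cls_mult[of "nf y \<otimes> ?u" ?v 2] nc u v by simp
  also have "nf x \<otimes> ((nf y \<otimes> ?u) \<otimes> ?v) = (nf x \<otimes> nf y) \<otimes> (?u \<otimes> ?v)"
    using nc u(2) v(2) by (simp add: m_assoc)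
  also have "cls 2 \<dots> = cls 2 (nf x \<otimes> nf y) <#> cls 2 (?u \<otimes> ?v)"
    using cls_mult[of "nf x \<otimes> nf y" "?u \<otimes> ?v" 2] nc u v by simp
  also have "cls 2 (nf x \<otimes> nf y) = cls 2 (ordered_prod G gen (\<lambda>i. a i (kap x) + a i (kap y)) n) <#> nf_cocycle x y"
    by (rule class_two_collect) (rule gen)
  also have "ordered_prod G gen (\<lambda>i. a i (kap x) + a i (kap y)) n = nf (x \<otimes> y)"
  proof -
    have "ordered_prod G gen c m = ordered_prod G gen d m" if "m \<le> n" "\<And>i. i < n \<Longrightarrow> c i = d i" for c d m
      using that by (induction m) auto
    from this[OF order_refl, of "\<lambda>i. a i (kap x) + a i (kap y)" "\<lambda>i. a i (kap (x \<otimes> y))"] show ?thesis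
      using homs_simps(1)[OF a x y] by simp
  qed
  finally have eq: "cls 2 (nf (x \<otimes> y)) \<otimes>\<^bsub>?K\<^esub> rem (x \<otimes> y) =
      cls 2 (nf (x \<otimes> y)) \<otimes>\<^bsub>?K\<^esub> (nf_cocycle x y \<otimes>\<^bsub>?K\<^esub> (rem x \<otimes>\<^bsub>?K\<^esub> rem y))"
    unfolding mult_FactGroup ruv
    using K.m_assoc[OF hom_in_carrier[OF cls_hom_quot[of 2] nc(3)] MK[OF cc] MK[OF cls_2_closed[OF uv]]]
    unfolding mult_FactGroup by simp
  have "rem (x \<otimes> y) = nf_cocycle x y \<otimes>\<^bsub>?K\<^esub> (rem x \<otimes>\<^bsub>?K\<^esub> rem y)"
    by (rule K.Units_l_cancel[THEN iffD1, OF _ _ _ eq], unfold K.Units_eq)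
       (intro hom_in_carrier[OF cls_hom_quot] nc K.m_closed MK cls_2_closed u v w cc)+
  then show ?thesis unfolding mult_FactGroup gr_part_simps .
qed

text \<open>The remainders extend linearly to 1-chains by \<open>h\<close>. Then
  \<open>rem_mult\<close>, read over a triangle, says that the product of the cup product expression
  with \<open>h\<close> of the boundary is trivial; on a cycle the second factor is trivial by
  itself.\<close>

lemma cup_relation:
  assumes c: "singular_relcycle 2 X {} c"
  shows "dprod (gr_part G 2) n (\<lambda>i j. gcom i j [^]\<^bsub>gr_part G 2\<^esub> kcup (a i) (a j) c) = \<one>\<^bsub>gr_part G 2\<^esub>"
proof -
  let ?M = "gr_part G 2"
  interpret M: comm_group ?M by (rule comm_group_gr_part) simp
  have remc: "rem x \<in> carrier ?M" if "x \<in> carrier G" for x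
    by (rule cls_2_closed[OF nf_remainder[OF that]])
  obtain h where h: "h \<in> hom (chain_group 1 X) ?M" "\<And>\<sigma>. singular_simplex 1 X \<sigma> \<Longrightarrow> h (frag_of \<sigma>) = rem (gam1 \<sigma>)"
    by (rule M.chain_hom_exists[of 1 X "\<lambda>\<sigma>. rem (gam1 \<sigma>)"]) (blast intro: remc gam1_closed)+
  let ?k = "\<lambda>c. dprod ?M n (\<lambda>i j. gcom i j [^]\<^bsub>?M\<^esub> kcup (a i) (a j) c)"
  have k: "?k \<in> hom (chain_group 2 X) ?M"
    by (intro M.dprod_hom M.int_pow_hom gcom_closed) (auto simp: cup_chain_def lin_hom group_chain_group)
  have d: "(\<lambda>c. h (chain_boundary 2 c)) \<in> hom (chain_group 2 X) ?M"
    using boundary_chain_hom[OF h(1)] by (simp add: Suc_1)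
  \<comment> \<open>Both factors are homomorphisms on 2-chains, so single triangles suffice. There
    \<open>gam1_triangle\<close> turns the middle face into a product, to which
    \<open>rem_mult\<close> applies.\<close>
  have triv: "?k c \<otimes>\<^bsub>?M\<^esub> h (chain_boundary 2 c) = \<one>\<^bsub>?M\<^esub>"
  proof (rule chain_hom_eqI[OF M.is_group M.hom_pointwise_mult[OF _ k d] const_hom[OF M.is_group]])
    show "group (chain_group 2 X)" by (simp add: group_chain_group)
    show "singular_chain 2 X c" using c relcycle_2 by blast
    fix \<tau> assume \<tau>: "singular_simplex 2 X \<tau>"
    let ?f = "\<lambda>i. singular_face 2 i \<tau>"
    have f: "singular_simplex 1 X (?f i)" if "i \<le> 2" for i
      using singular_simplex_singular_face[of 2 X \<tau> i] \<tau> that by (simp add: two_minus_Suc_0)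
    note g = gam1_closed[OF f]
    have fc: "singular_chain 1 X (frag_of (?f i))" if "i \<le> 2" for i
      using f[OF that] by (simp add: singular_chain_of)
    have kt: "?k (frag_of \<tau>) = nf_cocycle (gam1 (?f 2)) (gam1 (?f 0))"
      by (simp add: cup_chain_def)
    have cc: "nf_cocycle (gam1 (?f 2)) (gam1 (?f 0)) \<in> carrier ?M"
      by (rule M.dprod_closed) (intro M.int_pow_closed gcom_closed; linarith)
    have "h (chain_boundary 2 (frag_of \<tau>)) = h (frag_of (?f 0)) \<otimes>\<^bsub>?M\<^esub> inv\<^bsub>?M\<^esub> h (frag_of (?f 1)) \<otimes>\<^bsub>?M\<^esub> h (frag_of (?f 2))"
      unfolding chain_boundary_2 using fc[of 0] fc[of 1] fc[of 2]
      by (simp add: chain_hom_simps[OF M.is_group h(1)] singular_chain_diff)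
    also have "\<dots> = rem (gam1 (?f 0)) \<otimes>\<^bsub>?M\<^esub> inv\<^bsub>?M\<^esub> rem (gam1 (?f 1)) \<otimes>\<^bsub>?M\<^esub> rem (gam1 (?f 2))"
      by (simp only: h(2)[OF f] le0 le_numeral_extra order_refl one_le_numeral)
    also have "rem (gam1 (?f 1)) = nf_cocycle (gam1 (?f 2)) (gam1 (?f 0)) \<otimes>\<^bsub>?M\<^esub> (rem (gam1 (?f 2)) \<otimes>\<^bsub>?M\<^esub> rem (gam1 (?f 0)))"
      unfolding gam1_triangle[OF \<tau>] by (rule rem_mult) (use g in auto)
    finally have dt: "h (chain_boundary 2 (frag_of \<tau>)) = rem (gam1 (?f 0)) \<otimes>\<^bsub>?M\<^esub>
        inv\<^bsub>?M\<^esub> (nf_cocycle (gam1 (?f 2)) (gam1 (?f 0)) \<otimes>\<^bsub>?M\<^esub> (rem (gam1 (?f 2)) \<otimes>\<^bsub>?M\<^esub> rem (gam1 (?f 0)))) \<otimes>\<^bsub>?M\<^esub> rem (gam1 (?f 2))" .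
    have cancel: "p \<otimes>\<^bsub>?M\<^esub> (q \<otimes>\<^bsub>?M\<^esub> inv\<^bsub>?M\<^esub> (p \<otimes>\<^bsub>?M\<^esub> (r \<otimes>\<^bsub>?M\<^esub> q)) \<otimes>\<^bsub>?M\<^esub> r) = \<one>\<^bsub>?M\<^esub>"
      if "p \<in> carrier ?M" "q \<in> carrier ?M" "r \<in> carrier ?M" for p q r
    proof -
      have "p \<otimes>\<^bsub>?M\<^esub> (q \<otimes>\<^bsub>?M\<^esub> s \<otimes>\<^bsub>?M\<^esub> r) = (p \<otimes>\<^bsub>?M\<^esub> (r \<otimes>\<^bsub>?M\<^esub> q)) \<otimes>\<^bsub>?M\<^esub> s" if "s \<in> carrier ?M" for s
        using that \<open>p \<in> carrier ?M\<close> \<open>q \<in> carrier ?M\<close> \<open>r \<in> carrier ?M\<close> by (simp add: M.m_ac)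
      from this[of "inv\<^bsub>?M\<^esub> (p \<otimes>\<^bsub>?M\<^esub> (r \<otimes>\<^bsub>?M\<^esub> q))"] show ?thesis using that by simp
    qed
    show "?k (frag_of \<tau>) \<otimes>\<^bsub>?M\<^esub> h (chain_boundary 2 (frag_of \<tau>)) = \<one>\<^bsub>?M\<^esub>"
      unfolding kt dt by (rule cancel[OF cc remc[OF g] remc[OF g]]) auto
  qed
  have "h (chain_boundary 2 c) = \<one>\<^bsub>?M\<^esub>"
    using c chain_hom_simps(3)[OF M.is_group h(1), of 0 0] relcycle_2[of X c] by simp
  moreover have "?k c \<in> carrier ?M"
    by (rule M.dprod_closed) (intro M.int_pow_closed gcom_closed; linarith)
  ultimately show ?thesis using triv by simp
qed

abbreviation ebr' :: "nat \<Rightarrow> nat \<Rightarrow> 'x chain set lie_term set" where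
  "ebr' i j \<equiv> lbracket H1_lie (hatom (e i)) (hatom (e j))"

abbreviation dual_element :: "'x chain \<Rightarrow> 'x chain set lie_term set" where
  "dual_element c \<equiv> dprod H1_lie n (\<lambda>i j. ebr' i j [^]\<^bsub>H1_lie\<^esub> kcup (a i) (a j) c)"

lemma dual_element_grade: "dual_element c \<in> grade H1_lie 2"
  by (rule dprod_ebr_grade[OF basis])

text \<open>Expanding \<open>f\<close> and \<open>g\<close> in the dual basis gives a sum over all
  pairs. Anticommutativity of the cup product on a cycle folds it onto \<open>j < i\<close>, and the
  diagonal terms vanish since each is its own negative.\<close>

lemma wedge_pairing_dual_element:
  assumes f: "f \<in> homs" and g: "g \<in> homs" and c: "singular_relcycle 2 X {} c"
  shows "wedge_pairing f g (dual_element c) = kcup f g c"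
proof -
  let ?c = "\<lambda>i j. kcup (a i) (a j) c"
  have sc: "singular_chain 2 X c" using c relcycle_2 by blast
  have anti: "?c i j = - ?c j i" if "i < n" "j < n" for i j
    by (rule cup_chain_anticommute[OF gam1_simplex_cocycle gam1_simplex_cocycle c]) (intro homs_kap a that)+
  have "kcup f g c = lin (\<lambda>\<tau>. \<Sum>i<n. \<Sum>j<n. (f (e i) * g (e j)) *
      (a i (kap (gam1 (singular_face 2 2 \<tau>))) * a j (kap (gam1 (singular_face 2 0 \<tau>))))) c"
    unfolding cup_chain_def
  proof (rule lin_cong[OF sc])
    fix \<tau> assume \<tau>: "singular_simplex 2 X \<tau>"
    have "singular_simplex 1 X (singular_face 2 k \<tau>)" if "k \<le> 2" for k
      using singular_simplex_singular_face[of 2 X \<tau> k] \<tau> that by (simp add: two_minus_Suc_0)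
    then have k: "kap (gam1 (singular_face 2 k \<tau>)) \<in> carrier H1" if "k \<le> 2" for k
      using that kap_hom gam1_closed by (blast intro: hom_in_carrier)
    show "f (kap (gam1 (singular_face 2 2 \<tau>))) * g (kap (gam1 (singular_face 2 0 \<tau>))) =
        (\<Sum>i<n. \<Sum>j<n. (f (e i) * g (e j)) *
          (a i (kap (gam1 (singular_face 2 2 \<tau>))) * a j (kap (gam1 (singular_face 2 0 \<tau>)))))"
      by (rule HOL.trans[OF arg_cong2[OF hom_eq_basis_sum[OF basis f k[OF order_refl]]
            hom_eq_basis_sum[OF basis g k[OF le0]], of "(*)"] sum_product_coefficients])
  qed
  also have "\<dots> = (\<Sum>i<n. \<Sum>j<n. (f (e i) * g (e j)) * ?c i j)"
    unfolding lin_sum lin_cmult cup_chain_def ..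
  also have "\<dots> = (\<Sum>i<n. \<Sum>j<i. (f (e i) * g (e j)) * ?c i j + (f (e j) * g (e i)) * ?c j i)"
  proof (rule sum_square_alternating)
    show "(f (e i) * g (e i)) * ?c i i = 0" if "i < n" for i using anti[OF that that] by simp
  qed
  also have "\<dots> = (\<Sum>i<n. \<Sum>j<i. ?c i j * (f (e i) * g (e j) - f (e j) * g (e i)))"
  proof (intro sum.cong HOL.refl)
    fix i j assume "i \<in> {..<n}" "j \<in> {..<i}"
    then show "(f (e i) * g (e j)) * ?c i j + (f (e j) * g (e i)) * ?c j i =
        ?c i j * (f (e i) * g (e j) - f (e j) * g (e i))"
      using anti[of j i] by (simp add: algebra_simps)
  qed
  also have "\<dots> = wedge_pairing f g (dual_element c)"
    by (rule wedge_pairing_dprod[OF basis f g, symmetric])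
  finally show ?thesis by simp
qed

lemma lext_dual_element:
  assumes "singular_relcycle 2 X {} c"
  shows "lext (dual_element c) = \<one>\<^bsub>gr G\<^esub>"
proof -
  let ?M = "gr_part G 2"
  interpret FL: graded_lie_algebra H1_lie by (rule graded_lie_algebra_free_lie[OF group_H1])
  interpret gr: graded_lie_algebra "gr G" by (rule graded_lie_algebra_gr)
  interpret M: comm_group ?M by (rule comm_group_gr_part) simp
  have lx: "lext \<in> hom H1_lie (gr G)" using lext_hom by (simp add: graded_lie_hom_def)
  interpret lx: group_hom H1_lie "gr G" lext
    using lx FL.is_group gr.is_group by (simp add: group_hom_def group_hom_axioms_def)
  have sg: "single (gr_part G) 2 \<in> hom ?M (gr G)"
    using graded_pieces.single_hom[OF graded_pieces_gr, of 2] by (simp add: gr_eq_sum_lie)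
  interpret sg: group_hom ?M "gr G" "single (gr_part G) 2"
    using sg M.is_group gr.is_group by (simp add: group_hom_def group_hom_axioms_def)
  have eb: "ebr' i j \<in> carrier H1_lie" if "i < n" "j < n" for i j by (rule ebr_closed[OF basis that])
  have "lext (dual_element c) = dprod (gr G) n (\<lambda>i j. lext (ebr' i j [^]\<^bsub>H1_lie\<^esub> kcup (a i) (a j) c))"
    by (rule FL.hom_dprod[OF gr.comm_group_axioms lx]) (intro FL.int_pow_closed eb; linarith)
  also have "\<dots> = dprod (gr G) n (\<lambda>i j. single (gr_part G) 2 (gcom i j [^]\<^bsub>?M\<^esub> kcup (a i) (a j) c))"
  proof (rule gr.dprod_cong)
    fix i j assume "i < n" "j < i"
    then have ij: "i < n" "j < n" by auto
    show "single (gr_part G) 2 (gcom i j [^]\<^bsub>?M\<^esub> kcup (a i) (a j) c) \<in> carrier (gr G)"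
      by (intro sg.hom_closed M.int_pow_closed gcom_closed ij)
    have "lext (ebr' i j) = single (gr_part G) 2 (gcom i j)"
      using lext_bracket[OF gen(1)[OF ij(1)] gen(1)[OF ij(2)]] by (simp add: gen ij)
    then show "lext (ebr' i j [^]\<^bsub>H1_lie\<^esub> kcup (a i) (a j) c) = single (gr_part G) 2 (gcom i j [^]\<^bsub>?M\<^esub> kcup (a i) (a j) c)"
      unfolding lx.hom_int_pow[OF eb[OF ij]] sg.hom_int_pow[OF gcom_closed[OF ij]] by simp
  qed
  also have "\<dots> = single (gr_part G) 2 (dprod ?M n (\<lambda>i j. gcom i j [^]\<^bsub>?M\<^esub> kcup (a i) (a j) c))"
    by (rule M.hom_dprod[OF gr.comm_group_axioms sg, symmetric]) (intro M.int_pow_closed gcom_closed; linarith)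
  also have "\<dots> = \<one>\<^bsub>gr G\<^esub>" unfolding cup_relation[OF assms] by (rule sg.hom_one)
  finally show ?thesis .
qed

text \<open>Uniqueness: every \<open>a i\<close> is evaluation by some cohomology class, so the
  defining property fixes all pairings with the dual basis, and these fix the element by
  \<open>grade_2_normal_form\<close>. The classes agree with \<open>a i\<close> on the carrier only,
  whence \<open>wedge_pairing_cong\<close>.\<close>

lemma dual_cup_eqI:
  assumes c: "singular_relcycle 2 X {} c" and w: "w \<in> grade H1_lie 2"
    and wp: "\<And>f g. \<lbrakk>f \<in> homs; g \<in> homs\<rbrakk> \<Longrightarrow> wedge_pairing f g w = kcup f g c"
  shows "dual_cup X (homologous_rel_set 2 X {} c) = w"
  unfolding dual_cup_def
proof (rule the_equality)
  have k: "kronecker (homologous_rel_set 2 X {} c) (cup 1 1 X f g) = kcup (\<lambda>x. kronecker x f) (\<lambda>x. kronecker x g) c"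
    if "f \<in> carrier (cohomology_group 1 X)" "g \<in> carrier (cohomology_group 1 X)" for f g
    using kronecker_cup[OF that c] by (simp add: class_hom_def[abs_def])
  show "w \<in> grade H1_lie 2 \<and> (\<forall>f\<in>carrier (cohomology_group 1 X). \<forall>g\<in>carrier (cohomology_group 1 X).
      wedge_pairing (\<lambda>x. kronecker x f) (\<lambda>x. kronecker x g) w = kronecker (homologous_rel_set 2 X {} c) (cup 1 1 X f g))"
    using w wp kronecker_hom k by simp
  fix w' assume w': "w' \<in> grade H1_lie 2 \<and> (\<forall>f\<in>carrier (cohomology_group 1 X). \<forall>g\<in>carrier (cohomology_group 1 X).
      wedge_pairing (\<lambda>x. kronecker x f) (\<lambda>x. kronecker x g) w' = kronecker (homologous_rel_set 2 X {} c) (cup 1 1 X f g))"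
  interpret FL: graded_lie_algebra H1_lie by (rule graded_lie_algebra_free_lie[OF group_H1])
  have wc: "w \<in> carrier H1_lie" "w' \<in> carrier H1_lie" using w w' FL.grade_carrier[of 2] by auto
  have dual: "\<exists>f\<in>carrier (cohomology_group 1 X). \<forall>x\<in>carrier H1. a i x = kronecker x f" if i: "i < n" for i
  proof -
    obtain f where f: "f \<in> carrier (cohomology_group 1 X)" "\<And>g. g \<in> carrier G \<Longrightarrow> class_hom f g = a i (kap g)"
      using class_hom_surj[OF homs_kap[OF a[OF i]]] by blast
    have "a i x = kronecker x f" if "x \<in> carrier H1" for x
      using kap_surj[OF that] f(2) unfolding class_hom_def by metis
    then show ?thesis using f(1) by blast
  qed
  have "wedge_pairing (a i) (a j) w' = wedge_pairing (a i) (a j) w" if ij: "i < n" "j < n" for i j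
  proof -
    obtain f g where fg: "f \<in> carrier (cohomology_group 1 X)" "g \<in> carrier (cohomology_group 1 X)"
        "\<forall>x\<in>carrier H1. a i x = kronecker x f" "\<forall>x\<in>carrier H1. a j x = kronecker x g"
      using dual ij by blast
    have "wedge_pairing (a i) (a j) v = wedge_pairing (\<lambda>x. kronecker x f) (\<lambda>x. kronecker x g) v" if "v \<in> carrier H1_lie" for v
      by (rule wedge_pairing_cong[OF comm_group_H1 a a kronecker_hom kronecker_hom]) (use fg ij that in auto)
    then show ?thesis using w' k[OF fg(1,2)] wp[OF kronecker_hom kronecker_hom] fg wc by simp
  qed
  then have "dprod H1_lie n (\<lambda>i j. ebr' i j [^]\<^bsub>H1_lie\<^esub> wedge_pairing (a i) (a j) w') =
      dprod H1_lie n (\<lambda>i j. ebr' i j [^]\<^bsub>H1_lie\<^esub> wedge_pairing (a i) (a j) w)"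
    by (intro FL.dprod_cong FL.int_pow_closed ebr_closed[OF basis]) auto
  then show "w' = w"
    using grade_2_normal_form[OF basis, of w] grade_2_normal_form[OF basis, of w'] w w' by simp
qed

theorem dual_cup_image:
  "dual_cup X ` carrier (homology_group 2 X) = {w \<in> grade H1_lie 2. lext w = \<one>\<^bsub>gr G\<^esub>}"
proof (intro equalityI subsetI)
  fix w assume "w \<in> dual_cup X ` carrier (homology_group 2 X)"
  then obtain c where c: "singular_relcycle 2 X {} c" "w = dual_cup X (homologous_rel_set 2 X {} c)"
    by (auto simp: carrier_homology)
  have "w = dual_element c"
    unfolding c(2) by (rule dual_cup_eqI[OF c(1) dual_element_grade wedge_pairing_dual_element]) (use c in auto)
  then show "w \<in> {w \<in> grade H1_lie 2. lext w = \<one>\<^bsub>gr G\<^esub>}"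
    using dual_element_grade lext_dual_element[OF c(1)] by simp
next
  fix w assume w: "w \<in> {w \<in> grade H1_lie 2. lext w = \<one>\<^bsub>gr G\<^esub>}"
  then obtain g where g: "g \<in> lower_central G 2" "lext w = single (gr_part G) 2 (cls 2 g)"
      "fill g (\<lambda>a b. - wedge_pairing a b w)"
    using lext_fill by blast
  have "g \<in> lower_central G (Suc 2)"
    by (rule single_2_eq_one[OF lower_central_carrier[OF g(1)]]) (use g w in simp)
  \<comment> \<open>The filling with vanishing cup products comes first in the difference, which
    undoes the sign carried by \<open>lext_fill\<close>.\<close>
  then have "bounds (rch g - rch g) (\<lambda>a b. 0 - (- wedge_pairing a b w))"
    by (rule bounds_diff[OF fill_lower_central_3 g(3)])
  then obtain c where c: "singular_chain 2 X c" "chain_boundary 2 c = 0"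
      "\<forall>a\<in>homs. \<forall>b\<in>homs. kcup a b c = wedge_pairing a b w"
    unfolding bounds_def by auto
  then have rc: "singular_relcycle 2 X {} c" using relcycle_2 by blast
  have "dual_cup X (homologous_rel_set 2 X {} c) = w"
    by (rule dual_cup_eqI[OF rc]) (use w c in auto)
  then show "w \<in> dual_cup X ` carrier (homology_group 2 X)"
    using rc unfolding carrier_homology by blast
qed

end

lemma (in graded_lie_algebra) grade_subset: "1 \<le> k \<Longrightarrow> grade L k \<subseteq> carrier L"
  by (auto intro: grade_carrier)

lemma graded_lie_hom_grade: "\<lbrakk>f \<in> graded_lie_hom L M; 1 \<le> k; x \<in> grade L k\<rbrakk> \<Longrightarrow> f x \<in> grade M k"
  by (simp add: graded_lie_hom_def) blast

section \<open>Finitely generated groups\<close>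

lemma word_eq_words: "\<lbrakk>word_eq n R u v; R \<subseteq> words n\<rbrakk> \<Longrightarrow> u \<in> words n \<and> v \<in> words n"
  by (induction rule: word_eq.induct) (auto simp: words_def)

lemma word_eq_append:
  assumes "word_eq n R u u'" "R \<subseteq> words n" "v \<in> words n"
  shows "word_eq n R (u @ v) (u' @ v)" "word_eq n R (v @ u) (v @ u')"
proof -
  have app: "s @ t \<in> words n" if "s \<in> words n" "t \<in> words n" for s t using that by (simp add: words_def)
  show "word_eq n R (u @ v) (u' @ v)"
    using assms
  proof induction
    case (cancel s t k e)
    then show ?case using word_eq.cancel[of s n "t @ v" k R e] app by simp
  next
    case (relator s t r)
    then show ?case using word_eq.relator[of s n "t @ v" r R] app by simp
  qed (auto intro: word_eq.intros app)
  show "word_eq n R (v @ u) (v @ u')"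
    using assms
  proof induction
    case (cancel s t k e)
    then show ?case using word_eq.cancel[of "v @ s" n t k R e] app by simp
  next
    case (relator s t r)
    then show ?case using word_eq.relator[of "v @ s" n t r R] app by simp
  qed (auto intro: word_eq.intros app)
qed

lemma mult_presented_group:
  assumes R: "R \<subseteq> words n" and u: "u \<in> words n" and v: "v \<in> words n"
  shows "Collect (word_eq n R u) \<otimes>\<^bsub>presented_group n R\<^esub> Collect (word_eq n R v) = Collect (word_eq n R (u @ v))"
proof -
  have "word_eq n R (u @ v) w" if "word_eq n R u u'" "word_eq n R v v'" "word_eq n R (u' @ v') w" for u' v' w
  proof -
    have "u' \<in> words n" using word_eq_words[OF that(1) R] by blast
    then show ?thesis
      using word_eq_append(1)[OF that(1) R v] word_eq_append(2)[OF that(2) R] that(3) by (meson word_eq.trans)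
  qed
  then show ?thesis
    unfolding presented_group_def using u v by (auto intro: word_eq.refl)
qed

text \<open>Every word is a product of letters, so the preimages of the classes of one-letter words
  generate; inverse letters are among them.\<close>

lemma finitely_presented_generated:
  assumes "finitely_presented G"
  obtains S where "finite S" "S \<subseteq> carrier G" "carrier G \<subseteq> generate G S"
proof -
  interpret group G using assms by (simp add: finitely_presented_def)
  obtain n R \<phi> where R: "R \<subseteq> words n" and \<phi>: "\<phi> \<in> iso G (presented_group n R)"
    using assms by (auto simp: finitely_presented_def is_iso_def)
  let ?c = "\<lambda>u. Collect (word_eq n R u)"
  have mult: "\<phi> (x \<otimes>\<^bsub>G\<^esub> y) = \<phi> x \<otimes>\<^bsub>presented_group n R\<^esub> \<phi> y" if "x \<in> carrier G" "y \<in> carrier G" for x y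
    using \<phi> that by (simp add: iso_def hom_def)
  have inj: "x = y" if "\<phi> x = \<phi> y" "x \<in> carrier G" "y \<in> carrier G" for x y
    using \<phi> that by (auto simp: iso_def bij_betw_def inj_on_def)
  have surj: "\<phi> ` carrier G = ?c ` words n"
    using \<phi> by (simp add: iso_def bij_betw_def presented_group_def)
  let ?l = "(\<lambda>l. inv_into (carrier G) \<phi> (?c [l])) ` ({..<n} \<times> UNIV)"
  have lw: "[l] \<in> words n" if "l \<in> {..<n} \<times> UNIV" for l using that by (simp add: words_def)
  have l: "inv_into (carrier G) \<phi> (?c [l]) \<in> carrier G" "\<phi> (inv_into (carrier G) \<phi> (?c [l])) = ?c [l]"
    if "l \<in> {..<n} \<times> UNIV" for l
  proof -
    have "?c [l] \<in> \<phi> ` carrier G" unfolding surj using lw[OF that] by blast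
    then show "inv_into (carrier G) \<phi> (?c [l]) \<in> carrier G" "\<phi> (inv_into (carrier G) \<phi> (?c [l])) = ?c [l]"
      by (rule inv_into_into, rule f_inv_into_f)
  qed
  have lc: "?l \<subseteq> carrier G" using l(1) by blast
  have gen: "\<exists>g\<in>generate G ?l. \<phi> g = ?c u" if "u \<in> words n" for u
    using that
  proof (induction u)
    case Nil
    then obtain g where g: "g \<in> carrier G" "\<phi> g = ?c []" using surj by (metis imageE imageI)
    \<comment> \<open>The class of the empty word is idempotent, and an idempotent of the group
      \<open>G\<close> is its identity; this identifies it without first proving that the words
      modulo \<open>word_eq\<close> form a group.\<close>
    then have "\<phi> (g \<otimes>\<^bsub>G\<^esub> g) = \<phi> g" using mult_presented_group[OF R Nil Nil] mult by simp
    then have "g = \<one>\<^bsub>G\<^esub>" using inj[of "g \<otimes>\<^bsub>G\<^esub> g" g] g by simp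
    then show ?case using g generate.one by metis
  next
    case (Cons a u)
    then have a: "a \<in> {..<n} \<times> UNIV" and u: "u \<in> words n" by (auto simp: words_def)
    obtain g where g: "g \<in> generate G ?l" "\<phi> g = ?c u" using Cons.IH u by blast
    let ?s = "inv_into (carrier G) \<phi> (?c [a])"
    have "\<phi> (?s \<otimes>\<^bsub>G\<^esub> g) = ?c ([a] @ u)"
      using mult[OF l(1)[OF a] generate_in_carrier[OF lc g(1)]] g(2) l(2)[OF a] mult_presented_group[OF R lw[OF a] u] by simp
    moreover have "?s \<otimes>\<^bsub>G\<^esub> g \<in> generate G ?l" by (rule generate.eng[OF generate.incl[OF imageI[OF a]] g(1)])
    ultimately show ?case by auto
  qed
  have "carrier G \<subseteq> generate G ?l"
  proof
    fix x assume x: "x \<in> carrier G"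
    then obtain u where "u \<in> words n" "\<phi> x = ?c u" using surj by blast
    then obtain g where "g \<in> generate G ?l" "\<phi> g = \<phi> x" using gen by metis
    then show "x \<in> generate G ?l" using inj[of g x] generate_in_carrier[OF lc] x by metis
  qed
  then show thesis by (intro that[OF _ lc]) auto
qed

section \<open>The holonomy Lie algebra\<close>

text \<open>Keeps the identity for the dual of the cup product free of the basis by which it was
  proved.\<close>

locale holonomy_space = pi1_space G X x0 \<theta> for G :: "'g monoid" (structure) and X :: "'x topology" and x0 \<theta> +
  assumes dual_cup_image:
    "dual_cup X ` carrier (homology_group 2 X) =
      {w \<in> grade (free_lie (homology_group 1 X)) 2. lie_extend (gr G) (\<lambda>z. gr_one G (H1_to_ab G X x0 \<theta> z)) w = \<one>\<^bsub>gr G\<^esub>}"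

context pi1_space
begin

lemma torsion_free_H1:
  assumes "torsion_free (abelianization G)"
  shows "torsion_free H1"
proof -
  interpret H: comm_group H1 by (rule comm_group_H1)
  interpret M: comm_group "gr_part G 1" by (rule comm_group_gr_part) simp
  interpret ab: group_hom H1 "gr_part G 1" ab
    using ab_hom H.is_group M.is_group by (simp add: group_hom_def group_hom_axioms_def)
  have "lower_central G (Suc 1) = derived G (carrier G)"
    unfolding lower_central_Suc[OF order_refl] derived_def by (rule arg_cong[where f = "generate G"]) auto
  then have gp: "gr_part G 1 = abelianization G" by (simp add: gr_part_def Suc_1)
  show ?thesis
    unfolding torsion_free_def
  proof (intro ballI allI impI)
    fix z and k :: nat assume z: "z \<in> carrier H1" and k: "0 < k \<and> z [^]\<^bsub>H1\<^esub> k = \<one>\<^bsub>H1\<^esub>"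
    have "ab z [^]\<^bsub>gr_part G 1\<^esub> k = \<one>\<^bsub>gr_part G 1\<^esub>" using ab.hom_nat_pow[OF z, of k] k by simp
    then have "ab z = \<one>\<^bsub>gr_part G 1\<^esub>"
      using assms k ab.hom_closed[OF z] unfolding gp torsion_free_def by blast
    then show "z = \<one>\<^bsub>H1\<^esub>" using inj_onD[OF ab_inj, of z "\<one>\<^bsub>H1\<^esub>"] z by simp
  qed
qed

lemma holonomy_space:
  assumes "finitely_presented G" "torsion_free (abelianization G)"
  shows "holonomy_space G X x0 \<theta>"
proof -
  interpret H: comm_group H1 by (rule comm_group_H1)
  obtain S where S: "finite S" "S \<subseteq> carrier G" "carrier G \<subseteq> generate G S"
    using finitely_presented_generated[OF assms(1)] by blast
  have kS: "kap ` S \<subseteq> carrier H1" using S(2) kap_hom by (auto simp: hom_def)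
  have "carrier H1 \<subseteq> generate H1 (kap ` S)"
  proof
    fix z assume "z \<in> carrier H1"
    then obtain g where g: "g \<in> carrier G" "kap g = z" using kap_surj by blast
    show "z \<in> generate H1 (kap ` S)"
      unfolding g(2)[symmetric]
      by (rule hom_generate_closed[OF is_group H.is_group kap_hom S(2) H.generate_is_subgroup[OF kS]])
         (use g S(3) in \<open>auto intro: generate.incl\<close>)
  qed
  then obtain n e a where "\<And>i. i < n \<Longrightarrow> e i \<in> carrier H1" "\<And>i. i < n \<Longrightarrow> a i \<in> hom H1 integer_group"
    "\<And>i j. \<lbrakk>i < n; j < n\<rbrakk> \<Longrightarrow> a i (e j) = (if i = j then 1 else 0 :: int)"
    "\<And>x. x \<in> carrier H1 \<Longrightarrow> x = finprod H1 (\<lambda>i. e i [^]\<^bsub>H1\<^esub> (a i x :: int)) {..<n::nat}"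
    using H.dual_basis[OF torsion_free_H1[OF assms(2)] finite_imageI[OF S(1)] kS] by blast
  then interpret pi1_basis G X x0 \<theta> n e a by unfold_locales
  show ?thesis by unfold_locales (rule dual_cup_image)
qed

end

section \<open>The epimorphism to the associated graded Lie algebra and its solvable
  quotients\<close>

context holonomy_space
begin

abbreviation relators :: "'x chain set lie_term set set" where
  "relators \<equiv> {w \<in> grade H1_lie 2. lext w = \<one>\<^bsub>gr G\<^esub>}"

text \<open>From here on the ideal is handled by its description through \<open>lext\<close>; chains
  and cup products do not occur any more.\<close>

lemma holonomy_ideal_eq: "holonomy_ideal X = lie_ideal_gen H1_lie relators"
  unfolding holonomy_ideal_def dual_cup_image ..

sublocale FL: graded_lie_algebra H1_lie
  by (rule graded_lie_algebra_free_lie[OF group_H1])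

sublocale gr: graded_lie_algebra "gr G"
  by (rule graded_lie_algebra_gr)

lemma relators_carrier: "relators \<subseteq> carrier H1_lie"
  using FL.grade_carrier[of 2] by auto

lemma graded_ideal_holonomy: "graded_ideal (holonomy_ideal X) H1_lie"
  unfolding holonomy_ideal_eq by (rule FL.graded_ideal_gen) (auto intro!: bexI[of _ 2])

lemma lie_ideal_holonomy: "lie_ideal (holonomy_ideal X) H1_lie"
  using graded_ideal_holonomy by (simp add: graded_ideal_def)

sublocale hol: graded_lie_algebra "holonomy X"
  unfolding holonomy_def by (rule FL.graded_lie_algebra_quot[OF graded_ideal_holonomy])

text \<open>The kernel of a Lie homomorphism is an ideal, and it contains the generators by their
  very description.\<close>

lemma lext_holonomy_ideal:
  assumes "w \<in> holonomy_ideal X"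
  shows "lext w = \<one>\<^bsub>gr G\<^esub>"
proof -
  have "lie_ideal {\<one>\<^bsub>gr G\<^esub>} (gr G)"
    by (rule gr.lie_idealI) (auto intro: gr.triv_subgroup)
  then have "lie_ideal {w \<in> carrier H1_lie. lext w \<in> {\<one>\<^bsub>gr G\<^esub>}} H1_lie"
    by (rule FL.lie_ideal_vimage[OF gr.lie_ring graded_lie_hom_imp_lie_hom[OF lext_hom]])
  then have "holonomy_ideal X \<subseteq> {w \<in> carrier H1_lie. lext w \<in> {\<one>\<^bsub>gr G\<^esub>}}"
    unfolding holonomy_ideal_eq by (rule FL.lie_ideal_gen(3)[OF relators_carrier]) (use relators_carrier in auto)
  then show ?thesis using assms by auto
qed

lemma Psi_coset: "w \<in> carrier H1_lie \<Longrightarrow> Psi G X x0 \<theta> (holonomy_ideal X #>\<^bsub>H1_lie\<^esub> w) = lext w"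
  unfolding Psi_def by (rule lie_quot_induced(1)[OF FL.lie_ring gr.lie_ring lext_hom lie_ideal_holonomy])
    (auto intro: lext_holonomy_ideal FL.grade_carrier)

lemma Psi_hom: "Psi G X x0 \<theta> \<in> graded_lie_hom (holonomy X) (gr G)"
  unfolding Psi_def holonomy_def by (rule lie_quot_induced(2)[OF FL.lie_ring gr.lie_ring lext_hom lie_ideal_holonomy])
    (auto intro: lext_holonomy_ideal FL.grade_carrier)

lemma holonomy_cases:
  assumes "u \<in> carrier (holonomy X)"
  obtains w where "w \<in> carrier H1_lie" "u = holonomy_ideal X #>\<^bsub>H1_lie\<^esub> w"
  using assms unfolding holonomy_def carrier_lie_quot by blast

lemma Psi_degree_one:
  assumes "g \<in> carrier G"
  shows "\<exists>u\<in>carrier (holonomy X). Psi G X x0 \<theta> u = single (gr_part G) 1 (cls 1 g)"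
proof -
  have k: "hatom (kap g) \<in> carrier H1_lie" using kap_hom assms by (auto simp: hom_def intro: hatom_closed)
  show ?thesis
    unfolding holonomy_def carrier_lie_quot
    by (intro bexI[of _ "holonomy_ideal X #>\<^bsub>H1_lie\<^esub> hatom (kap g)"] imageI k)
       (simp add: Psi_coset[OF k] lext_atom[OF assms])
qed

abbreviation solv :: "nat \<Rightarrow> 'g set monoid" where
  "solv i \<equiv> G Mod derived_series G i"

abbreviation proj :: "nat \<Rightarrow> 'g \<Rightarrow> 'g set" where
  "proj i g \<equiv> derived_series G i #> g"

abbreviation Psi_proj :: "nat \<Rightarrow> 'x chain set lie_term set set \<Rightarrow> nat \<Rightarrow> 'g set set" where
  "Psi_proj i u \<equiv> gr_map (solv i) (proj i) (Psi G X x0 \<theta> u)"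

lemma Psi_proj_hom: "Psi_proj i \<in> graded_lie_hom (holonomy X) (gr (solv i))"
  by (rule graded_lie_hom_compose[OF Psi_hom group_hom.gr_map_graded_lie_hom[OF solv_quot_group_hom]])

lemma solv_Psi_exists: "\<exists>\<psi>. solv_Psi G X x0 \<theta> i \<psi>"
proof
  interpret q: group_hom G "solv i" "proj i" by (rule solv_quot_group_hom)
  interpret grq: graded_lie_algebra "gr (solv i)" by (rule q.H.graded_lie_algebra_gr)
  let ?D = "lie_derived (holonomy X) i"
  have gD: "graded_ideal ?D (holonomy X)" by (rule hol.graded_ideal_derived)
  then have D: "lie_ideal ?D (holonomy X)" by (simp add: graded_ideal_def)
  \<comment> \<open>A Lie homomorphism maps the derived ideal into that of
    \<open>gr (solv i)\<close>, which is trivial because the group \<open>solv i\<close> has trivial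
    \<open>i\<close>-th derived subgroup.\<close>
  have kill: "Psi_proj i u = \<one>\<^bsub>gr (solv i)\<^esub>" if "u \<in> ?D" for u
    using lie_hom_derived[OF hol.lie_ring grq.lie_ring graded_lie_hom_imp_lie_hom[OF Psi_proj_hom] that]
    by (intro q.H.lie_derived_gr_trivial[OF derived_series_solv_quot]) blast
  note ind = lie_quot_induced[OF hol.lie_ring grq.lie_ring Psi_proj_hom D kill hol.grade_subset]
  \<comment> \<open>Surjectivity is a question of degree 1, where every element of the quotient
    group lifts to \<open>G\<close> and from there to an atom.\<close>
  have "Psi_proj i ` carrier (holonomy X) = carrier (gr (solv i))"
  proof (rule q.H.lie_hom_onto_gr[OF hol.lie_ring graded_lie_hom_imp_lie_hom[OF Psi_proj_hom]])
    fix x assume "x \<in> carrier (solv i)"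
    then obtain g where g: "g \<in> carrier G" "x = proj i g" by (auto simp: carrier_FactGroup)
    obtain u where u: "u \<in> carrier (holonomy X)" "Psi G X x0 \<theta> u = single (gr_part G) 1 (cls 1 g)"
      using Psi_degree_one[OF g(1)] by blast
    have "Psi_proj i u = single (gr_part (solv i)) 1 (q.H.cls 1 x)"
      unfolding u(2) g(2) by (rule q.gr_map_single) (use g in auto)
    then show "single (gr_part (solv i)) 1 (q.H.cls 1 x) \<in> Psi_proj i ` carrier (holonomy X)" using u(1) by (metis imageI)
  qed
  then have "graded_lie_epi (holonomy_solv X i) (gr (solv i)) (induced_map (Psi_proj i))"
    unfolding graded_lie_epi_def using ind hol.graded_lie_algebra_quot[OF gD] grq.graded_lie_algebra_axioms by simp
  then show "solv_Psi G X x0 \<theta> i (induced_map (Psi_proj i))"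
    unfolding solv_Psi_def using ind(1) by simp
qed

end

section \<open>Naturality\<close>

locale holonomy_spaces_hom =
  dom: holonomy_space G X x0 \<theta> + cod: holonomy_space H Y y0 \<eta> + f: group_hom G H f
  for G :: "'g monoid" and X :: "'x topology" and x0 \<theta>
    and H :: "'h monoid" and Y :: "'y topology" and y0 \<eta> and f
begin

abbreviation "h1 \<equiv> H1_map G X x0 \<theta> H Y y0 \<eta> f"

text \<open>\<open>H1_map\<close> passes through abelianizations and back by an inverse of
  \<open>ab\<close>; on Hurewicz images this amounts to applying \<open>f\<close>.\<close>

lemma h1_kap:
  assumes g: "g \<in> carrier G"
  shows "h1 (dom.kap g) = cod.kap (f g)"
proof -
  \<comment> \<open>A family with the same coset in every degree, of which the first coordinate is
    read: this reuses the computation of \<open>gr_map_coord\<close> for a bare coset.\<close>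
  have "gr_map H f (\<lambda>_. dom.cls 1 g) 1 = cod.cls 1 (f g)"
    by (rule f.gr_map_coord) (use g in auto)
  then have "lower_central H 2 <#>\<^bsub>H\<^esub> f ` dom.ab (dom.kap g) = cod.ab (cod.kap (f g))"
    using dom.ab_kap[OF g] cod.ab_kap[OF f.hom_closed[OF g]] by (simp add: gr_map_def Suc_1)
  moreover have "cod.kap (f g) \<in> carrier cod.H1" by (rule hom_in_carrier[OF cod.kap_hom f.hom_closed[OF g]])
  ultimately show ?thesis
    unfolding H1_map_def by (simp add: inv_into_f_f[OF cod.ab_inj])
qed

lemma h1_hom: "h1 \<in> hom dom.H1 cod.H1"
proof (rule homI)
  show "h1 z \<in> carrier cod.H1" if "z \<in> carrier dom.H1" for z
    using dom.kap_surj[OF that] h1_kap hom_in_carrier[OF cod.kap_hom f.hom_closed] by metis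
  show "h1 (z \<otimes>\<^bsub>dom.H1\<^esub> w) = h1 z \<otimes>\<^bsub>cod.H1\<^esub> h1 w" if zw: "z \<in> carrier dom.H1" "w \<in> carrier dom.H1" for z w
  proof -
    obtain x y where xy: "x \<in> carrier G" "dom.kap x = z" "y \<in> carrier G" "dom.kap y = w"
      using dom.kap_surj zw by metis
    then have "z \<otimes>\<^bsub>dom.H1\<^esub> w = dom.kap (x \<otimes>\<^bsub>G\<^esub> y)" using Group.hom_mult[OF dom.kap_hom] by simp
    then show ?thesis
      using xy h1_kap Group.hom_mult[OF cod.kap_hom f.hom_closed f.hom_closed] by auto
  qed
qed

abbreviation flh :: "'x chain set lie_term set \<Rightarrow> 'y chain set lie_term set" where
  "flh \<equiv> lie_extend cod.H1_lie (\<lambda>z. cod.hatom (h1 z))"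

lemma hatom_h1_hom: "(\<lambda>z. cod.hatom (h1 z)) \<in> hom dom.H1 cod.H1_lie"
  by (rule hom_comp[OF h1_hom Atom_hom[OF cod.group_H1]])

lemma flh_hom: "flh \<in> graded_lie_hom dom.H1_lie cod.H1_lie"
proof (rule lie_extend_hom[OF dom.group_H1 cod.FL.graded_lie_algebra_axioms hatom_h1_hom])
  show "(\<lambda>z. cod.hatom (h1 z)) \<in> carrier dom.H1 \<rightarrow> grade cod.H1_lie 1"
    unfolding grade_free_lie[OF cod.group_H1]
    using hom_in_carrier[OF h1_hom] by (auto intro!: imageI homogeneous.intros)
qed

text \<open>Both sides evaluate the same term in \<open>gr H\<close>, since Lie homomorphisms
  commute with evaluation; so it is enough to compare values on atoms, where \<open>h1_kap\<close>
  applies.\<close>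

lemma lext_flh:
  assumes "w \<in> carrier dom.H1_lie"
  shows "cod.lext (flh w) = gr_map H f (dom.lext w)"
proof -
  obtain t where t: "t \<in> lie_terms dom.H1" "w = lie_class dom.H1 t"
    using assms by (auto simp: carrier_free_lie[OF dom.group_H1])
  have "cod.lext (flh w) = cod.lext (lie_eval cod.H1_lie (\<lambda>z. cod.hatom (h1 z)) t)"
    unfolding t(2) lie_extend_class[OF dom.group_H1 cod.FL.lie_ring hatom_h1_hom t(1)] ..
  also have "\<dots> = lie_eval (gr H) (\<lambda>z. cod.lext (cod.hatom (h1 z))) t"
    by (rule lie_eval_lie_hom[OF cod.FL.lie_ring cod.gr.lie_ring graded_lie_hom_imp_lie_hom[OF cod.lext_hom] _ t(1)])
       (use hom_in_carrier[OF hatom_h1_hom] in auto)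
  also have "\<dots> = lie_eval (gr H) (\<lambda>z. gr_map H f (gr_one G (dom.ab z))) t"
  proof (rule lie_eval_cong[OF _ t(1)])
    fix z assume "z \<in> carrier dom.H1"
    then obtain g where g: "g \<in> carrier G" "dom.kap g = z" using dom.kap_surj by blast
    have "gr_map H f (single (gr_part G) 1 (dom.cls 1 g)) = single (gr_part H) 1 (cod.cls 1 (f g))"
      by (rule f.gr_map_single) (use g in auto)
    then show "cod.lext (cod.hatom (h1 z)) = gr_map H f (gr_one G (dom.ab z))"
      unfolding g(2)[symmetric] h1_kap[OF g(1)] cod.lext_atom[OF f.hom_closed[OF g(1)]] dom.gr_one_ab_kap[OF g(1)] by simp
  qed
  also have "\<dots> = gr_map H f (lie_eval (gr G) (\<lambda>z. gr_one G (dom.ab z)) t)"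
    by (rule lie_eval_lie_hom[OF dom.gr.lie_ring cod.gr.lie_ring graded_lie_hom_imp_lie_hom[OF f.gr_map_graded_lie_hom] _ t(1), symmetric])
       (use hom_in_carrier[OF dom.gr_one_ab_hom] in auto)
  also have "\<dots> = gr_map H f (dom.lext w)"
    unfolding t(2) lie_extend_class[OF dom.group_H1 dom.gr.lie_ring dom.gr_one_ab_hom t(1)] ..
  finally show ?thesis .
qed

text \<open>A relator has trivial image in \<open>gr G\<close>, hence its image under
  \<open>flh\<close> has trivial image in \<open>gr H\<close> and is again of degree 2: it is a
  relator for \<open>H\<close>. This makes the functoriality of the holonomy Lie algebra purely
  algebraic.\<close>

lemma flh_holonomy_ideal:
  assumes "w \<in> holonomy_ideal X"
  shows "flh w \<in> holonomy_ideal Y"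
proof -
  have "lie_ideal {w \<in> carrier dom.H1_lie. flh w \<in> holonomy_ideal Y} dom.H1_lie"
    by (rule dom.FL.lie_ideal_vimage[OF cod.FL.lie_ring graded_lie_hom_imp_lie_hom[OF flh_hom] cod.lie_ideal_holonomy])
  moreover have "dom.relators \<subseteq> {w \<in> carrier dom.H1_lie. flh w \<in> holonomy_ideal Y}"
  proof
    fix w assume w: "w \<in> dom.relators"
    then have wc: "w \<in> carrier dom.H1_lie" using dom.relators_carrier by blast
    have "gr_map H f \<one>\<^bsub>gr G\<^esub> = \<one>\<^bsub>gr H\<^esub>"
      by (rule hom_one[OF f.gr_map_hom dom.gr.is_group cod.gr.is_group])
    then have "cod.lext (flh w) = \<one>\<^bsub>gr H\<^esub>" using lext_flh[OF wc] w by simp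
    moreover have "flh w \<in> grade cod.H1_lie 2" using graded_lie_hom_grade[OF flh_hom, of 2 w] w by simp
    ultimately have "flh w \<in> cod.relators" by simp
    then show "w \<in> {w \<in> carrier dom.H1_lie. flh w \<in> holonomy_ideal Y}"
      using wc cod.FL.lie_ideal_gen(2)[OF cod.relators_carrier] unfolding cod.holonomy_ideal_eq by blast
  qed
  ultimately have "holonomy_ideal X \<subseteq> {w \<in> carrier dom.H1_lie. flh w \<in> holonomy_ideal Y}"
    unfolding dom.holonomy_ideal_eq by (rule dom.FL.lie_ideal_gen(3)[OF dom.relators_carrier])
  then show ?thesis using assms by blast
qed

abbreviation "hmap \<equiv> holonomy_map G X x0 \<theta> H Y y0 \<eta> f"

lemma hmap:
  shows "\<And>w. w \<in> carrier dom.H1_lie \<Longrightarrow>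
      hmap (holonomy_ideal X #>\<^bsub>dom.H1_lie\<^esub> w) = holonomy_ideal Y #>\<^bsub>cod.H1_lie\<^esub> flh w"
    and "hmap \<in> graded_lie_hom (holonomy X) (holonomy Y)"
proof -
  have h: "(\<lambda>w. holonomy_ideal Y #>\<^bsub>cod.H1_lie\<^esub> flh w) \<in> graded_lie_hom dom.H1_lie (holonomy Y)"
    unfolding holonomy_def
    by (rule graded_lie_hom_compose[OF flh_hom cod.FL.lie_quot_hom[OF cod.lie_ideal_holonomy]])
  have kill: "holonomy_ideal Y #>\<^bsub>cod.H1_lie\<^esub> flh w = \<one>\<^bsub>holonomy Y\<^esub>" if "w \<in> holonomy_ideal X" for w
    using subgroup.rcos_const[OF lie_ideal_subgroup[OF cod.lie_ideal_holonomy] cod.FL.is_group flh_holonomy_ideal[OF that]]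
    by (simp add: holonomy_def one_lie_quot)
  note ind = lie_quot_induced[OF dom.FL.lie_ring cod.hol.lie_ring h dom.lie_ideal_holonomy kill dom.FL.grade_subset]
  show "\<And>w. w \<in> carrier dom.H1_lie \<Longrightarrow>
      hmap (holonomy_ideal X #>\<^bsub>dom.H1_lie\<^esub> w) = holonomy_ideal Y #>\<^bsub>cod.H1_lie\<^esub> flh w"
    unfolding holonomy_map_def by (rule ind(1))
  show "hmap \<in> graded_lie_hom (holonomy X) (holonomy Y)"
    unfolding holonomy_map_def holonomy_def[of X] by (rule ind(2))
qed

lemma Psi_hmap:
  assumes "u \<in> carrier (holonomy X)"
  shows "Psi H Y y0 \<eta> (hmap u) = gr_map H f (Psi G X x0 \<theta> u)"
proof -
  obtain w where w: "w \<in> carrier dom.H1_lie" "u = holonomy_ideal X #>\<^bsub>dom.H1_lie\<^esub> w"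
    using dom.holonomy_cases[OF assms] by blast
  have "flh w \<in> carrier cod.H1_lie" by (rule lie_homD(3)[OF graded_lie_hom_imp_lie_hom[OF flh_hom] w(1)])
  then show ?thesis
    unfolding w(2) hmap(1)[OF w(1)] dom.Psi_coset[OF w(1)] using cod.Psi_coset lext_flh[OF w(1)] by simp
qed

lemma holonomy_solv_map_coset:
  assumes "u \<in> carrier (holonomy X)"
  shows "holonomy_solv_map G X x0 \<theta> H Y y0 \<eta> i f (lie_derived (holonomy X) i #>\<^bsub>holonomy X\<^esub> u) =
    lie_derived (holonomy Y) i #>\<^bsub>holonomy Y\<^esub> hmap u"
proof -
  have DX: "lie_ideal (lie_derived (holonomy X) i) (holonomy X)" and DY: "lie_ideal (lie_derived (holonomy Y) i) (holonomy Y)"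
    using dom.hol.graded_ideal_derived cod.hol.graded_ideal_derived by (simp_all add: graded_ideal_def)
  have h: "(\<lambda>u. lie_derived (holonomy Y) i #>\<^bsub>holonomy Y\<^esub> hmap u) \<in> graded_lie_hom (holonomy X) (holonomy_solv Y i)"
    by (rule graded_lie_hom_compose[OF hmap(2) cod.hol.lie_quot_hom[OF DY]])
  have kill: "lie_derived (holonomy Y) i #>\<^bsub>holonomy Y\<^esub> hmap u = \<one>\<^bsub>holonomy_solv Y i\<^esub>"
    if "u \<in> lie_derived (holonomy X) i" for u
    using subgroup.rcos_const[OF lie_ideal_subgroup[OF DY] cod.hol.is_group]
      lie_hom_derived[OF dom.hol.lie_ring cod.hol.lie_ring graded_lie_hom_imp_lie_hom[OF hmap(2)] that]
    by (simp add: one_lie_quot)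
  show ?thesis
    unfolding holonomy_solv_map_def
    by (rule lie_quot_induced(1)[OF dom.hol.lie_ring cod.hol.lie_ring_quot[OF DY] h DX kill dom.hol.grade_subset assms])
qed

lemma solv_quot_map:
  shows "\<And>x. x \<in> carrier G \<Longrightarrow> solv_quot_map H i f (dom.proj i x) = cod.proj i (f x)"
    and "group_hom (dom.solv i) (cod.solv i) (solv_quot_map H i f)"
proof -
  interpret p: group_hom G "dom.solv i" "dom.proj i" by (rule dom.solv_quot_group_hom)
  interpret q: group_hom H "cod.solv i" "cod.proj i" by (rule cod.solv_quot_group_hom)
  have qf: "(\<lambda>x. cod.proj i (f x)) \<in> hom G (cod.solv i)" by (rule hom_comp[OF f.homh q.homh])
  interpret qf: group_hom G "cod.solv i" "\<lambda>x. cod.proj i (f x)"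
    using qf dom.is_group q.H.is_group by (simp add: group_hom_def group_hom_axioms_def)
  have "f x \<in> derived_series H i" if "x \<in> derived_series G i" for x
  proof -
    have "f ` derived_series G i = (derived H ^^ i) (f ` carrier G)"
      unfolding derived_series_def by (rule f.exp_of_derived_img[symmetric]) simp
    also have "\<dots> \<subseteq> derived_series H i"
      unfolding derived_series_def by (rule cod.mono_exp_of_derived) auto
    finally show ?thesis using that by blast
  qed
  then have kill: "cod.proj i (f x) = \<one>\<^bsub>cod.solv i\<^esub>" if "x \<in> derived_series G i" for x
    using subgroup.rcos_const[OF normal.axioms(1)[OF cod.derived_series_normal] cod.is_group] that by simp
  show m: "solv_quot_map H i f (dom.proj i x) = cod.proj i (f x)" if "x \<in> carrier G" for x
    unfolding solv_quot_map_def
    by (rule qf.induced_map_coset[OF normal.axioms(1)[OF dom.derived_series_normal] kill that])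
  have "solv_quot_map H i f \<in> hom (dom.solv i) (cod.solv i)"
  proof (rule homI)
    fix x y assume "x \<in> carrier (dom.solv i)" "y \<in> carrier (dom.solv i)"
    then obtain x' y' where xy: "x' \<in> carrier G" "x = dom.proj i x'" "y' \<in> carrier G" "y = dom.proj i y'"
      by (auto simp: carrier_FactGroup)
    show "solv_quot_map H i f x \<in> carrier (cod.solv i)"
      unfolding xy(2) m[OF xy(1)] by (rule qf.hom_closed[OF xy(1)])
    show "solv_quot_map H i f (x \<otimes>\<^bsub>dom.solv i\<^esub> y) = solv_quot_map H i f x \<otimes>\<^bsub>cod.solv i\<^esub> solv_quot_map H i f y"
      unfolding xy(2,4) m[OF xy(1)] m[OF xy(3)] p.hom_mult[OF xy(1,3), symmetric] qf.hom_mult[OF xy(1,3), symmetric]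
      by (rule m) (use xy in simp)
  qed
  then show "group_hom (dom.solv i) (cod.solv i) (solv_quot_map H i f)"
    using p.H.is_group q.H.is_group by (simp add: group_hom_def group_hom_axioms_def)
qed

text \<open>On the coset of \<open>u\<close> the defining squares of \<open>\<psi>\<close> and
  \<open>\<psi>'\<close> reduce both sides to \<open>gr\<close> of a composite map from
  \<open>G\<close> to the solvable quotient of \<open>H\<close>, and the two composites agree on
  \<open>G\<close>.\<close>

lemma solv_Psi_natural:
  assumes \<psi>: "solv_Psi G X x0 \<theta> i \<psi>" and \<psi>': "solv_Psi H Y y0 \<eta> i \<psi>'" and v: "v \<in> carrier (holonomy_solv X i)"
  shows "\<psi>' (holonomy_solv_map G X x0 \<theta> H Y y0 \<eta> i f v) = gr_map (cod.solv i) (solv_quot_map H i f) (\<psi> v)"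
proof -
  obtain u where u: "u \<in> carrier (holonomy X)" "v = lie_derived (holonomy X) i #>\<^bsub>holonomy X\<^esub> u"
    using v unfolding carrier_lie_quot by blast
  have hu: "hmap u \<in> carrier (holonomy Y)" by (rule lie_homD(3)[OF graded_lie_hom_imp_lie_hom[OF hmap(2)] u(1)])
  have Pu: "Psi G X x0 \<theta> u \<in> carrier (gr G)" by (rule lie_homD(3)[OF graded_lie_hom_imp_lie_hom[OF dom.Psi_hom] u(1)])
  note p = dom.solv_quot_group_hom[of i] and q = cod.solv_quot_group_hom[of i]
  have "\<psi>' (holonomy_solv_map G X x0 \<theta> H Y y0 \<eta> i f v) = cod.Psi_proj i (hmap u)"
    unfolding u(2) holonomy_solv_map_coset[OF u(1)] using \<psi>' hu by (simp add: solv_Psi_def)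
  also have "\<dots> = gr_map (cod.solv i) (\<lambda>x. cod.proj i (f x)) (Psi G X x0 \<theta> u)"
    unfolding Psi_hmap[OF u(1)] by (rule gr_map_compose[OF f.group_hom_axioms q Pu])
  also have "\<dots> = gr_map (cod.solv i) (\<lambda>x. solv_quot_map H i f (dom.proj i x)) (Psi G X x0 \<theta> u)"
  proof (rule gr_map_cong[OF _ _ Pu])
    show "group_hom G (cod.solv i) (\<lambda>x. cod.proj i (f x))"
      using hom_comp[OF f.homh group_hom.homh[OF q]] dom.is_group q
      by (simp add: group_hom_def group_hom_axioms_def)
  qed (simp add: solv_quot_map(1))
  also have "\<dots> = gr_map (cod.solv i) (solv_quot_map H i f) (dom.Psi_proj i u)"
    by (rule gr_map_compose[OF p solv_quot_map(2) Pu, symmetric])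
  also have "dom.Psi_proj i u = \<psi> v"
    using \<psi> u by (simp add: solv_Psi_def)
  finally show ?thesis .
qed

end

lemma K_G_1_holonomy_space:
  assumes "finitely_presented G" "torsion_free (abelianization G)" "K_G_1 G X x0 \<theta>"
  shows "holonomy_space G X x0 \<theta>"
proof -
  interpret pi1_space G X x0 \<theta>
    by (rule pi1_space.intro) (use assms in \<open>auto simp: finitely_presented_def K_G_1_def\<close>)
  show ?thesis by (rule holonomy_space[OF assms(1,2)])
qed

text \<open>Since \<open>solv_Psi\<close> determines its map on the domain, naturality can be
  asserted against every \<open>\<psi>'\<close> for \<open>H\<close>, without a simultaneous choice
  for all groups.\<close>

theorem proposition5p3:
  fixes G :: "'g monoid" and X :: "'x topology" and x0 :: 'x
    and \<theta> :: "(real \<Rightarrow> 'x) set \<Rightarrow> 'g" and i :: nat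
  assumes "finitely_presented G" and "torsion_free (abelianization G)"
    and "K_G_1 G X x0 \<theta>" and "1 \<le> i"
  shows "\<exists>\<psi>. solv_Psi G X x0 \<theta> i \<psi> \<and>
    (\<forall>(H :: 'h monoid) (Y :: 'y topology) y0 \<eta> f \<psi>'.
       finitely_presented H \<and> torsion_free (abelianization H) \<and> K_G_1 H Y y0 \<eta> \<and>
       f \<in> hom G H \<and> solv_Psi H Y y0 \<eta> i \<psi>' \<longrightarrow>
       (\<forall>v\<in>carrier (holonomy_solv X i).
          \<psi>' (holonomy_solv_map G X x0 \<theta> H Y y0 \<eta> i f v) =
          gr_map (H Mod derived_series H i) (solv_quot_map H i f) (\<psi> v)))"
proof -
  interpret dom: holonomy_space G X x0 \<theta> by (rule K_G_1_holonomy_space[OF assms(1-3)])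
  obtain \<psi> where \<psi>: "solv_Psi G X x0 \<theta> i \<psi>" using dom.solv_Psi_exists by blast
  show ?thesis
  proof (intro exI[of _ \<psi>] conjI \<psi> allI impI ballI)
    fix H :: "'h monoid" and Y :: "'y topology" and y0 \<eta> f \<psi>' v
    assume A: "finitely_presented H \<and> torsion_free (abelianization H) \<and> K_G_1 H Y y0 \<eta> \<and>
       f \<in> hom G H \<and> solv_Psi H Y y0 \<eta> i \<psi>'" and v: "v \<in> carrier (holonomy_solv X i)"
    interpret cod: holonomy_space H Y y0 \<eta> by (rule K_G_1_holonomy_space) (use A in auto)
    interpret holonomy_spaces_hom G X x0 \<theta> H Y y0 \<eta> f
      using A by unfold_locales auto
    show "\<psi>' (holonomy_solv_map G X x0 \<theta> H Y y0 \<eta> i f v) =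
          gr_map (H Mod derived_series H i) (solv_quot_map H i f) (\<psi> v)"
      by (rule solv_Psi_natural[OF \<psi> _ v]) (use A in blast)
  qed
qed

end
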